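(* Let $v$ be a probability measure on $[-\tau,0]$ and assume that, for each $i\in\mathbf S$ and all $\xi,\eta\in\mathscr C$: (i) there exist $\alpha_i\in\mathbb R$ and $\beta_i\ge0$ (depending only on $i$) such that $$2\langle \xi(0)-\eta(0),b(\xi,i)-b(\eta,i)\rangle+\|\sigma(\xi,i)-\sigma(\eta,i)\|_{\rm HS}^2\le\alpha_i|\xi(0)-\eta(0)|^2+\beta_i\int_{-\tau}^0|\xi(\vartheta)-\eta(\vartheta)|^2\,v(d\vartheta);$$ (ii) there exists $L>0$ (independent of $i,\xi,\eta$) such that $$\|\sigma(\xi,i)-\sigma(\eta,i)\|_{\rm HS}^2\le L\Big(|\xi(0)-\eta(0)|^2+\int_{-\tau}^0|\xi(\vartheta)-\eta(\vartheta)|^2\,v(d\vartheta)\Big);$$ (iii) there exists $L_1>0$ (independent of $i,\xi,\eta$) such that $$|b(\xi,i)-b(\eta,i)|^2\le L_1\Big(|\xi(0)-\eta(0)|^2+\int_{-\tau}^0|\xi(\vartheta)-\eta(\vartheta)|^2\,v(d\vartheta)\Big).$$ Let $\hat\alpha:=\min_{i\in\mathbf S}\alpha_i$, $Q_3:=Q+\mathrm{diag}\big(\alpha_1+4e^{-\hat\alpha\tau}\beta_1,\dots,\alpha_N+4e^{-\hat\alpha\tau}\beta_N\big)$ and $\eta_3:=-\max_{\gamma\in\mathrm{spec}(Q_3)}\mathrm{Re}(\gamma)$, and assume $\eta_3>0$. Then there exist $\delta_0\in(0,1)$, $\alpha>0$ and $c>0$ such that for every integer $k\ge0$, every step size $\delta\in(0,\delta_0)$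 and all $\nu_1,\nu_2\in\mathcal P_0$, $$W_\rho(\nu_1P^{(\delta)}_{k\delta},\nu_2P^{(\delta)}_{k\delta})\le c\Big(1+\sum_{i\in\mathbf S}\int_{\mathscr C}\|\xi\|_\infty\,\nu_1(d\xi,i)+\sum_{i\in\mathbf S}\int_{\mathscr C}\|\eta\|_\infty\,\nu_2(d\eta,i)\Big)e^{-\alpha k\delta}.$$ Furthermore, for such $\delta$, $(Y_{k\delta}(\xi,i),\Lambda^i(k\delta))$ admits a unique invariant probability measure $\mu^{(\delta)}\in\mathcal P_0$ (i.e. $\mu^{(\delta)}P^{(\delta)}_{k\delta}=\mu^{(\delta)}$ for all $k\ge0$), and for all $(\xi,i)\in\mathscr C\times\mathbf S$ and $k\ge0$, $$W_\rho(\delta_{(\xi,i)}P^{(\delta)}_{k\delta},\mu^{(\delta)}P^{(\delta)}_{k\delta})\le c\Big(1+\|\xi\|_\infty+\sum_{j\in\mathbf S}\int_{\mathscr C}\|\eta\|_\infty\,\mu^{(\delta)}(d\eta,j)\Big)e^{-\alpha k\delta},$$ where $\delta_{(\xi,i)}$ is the Dirac measure at $(\xi,i)$.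
   Context: Fix $\tau>0$ and let $\mathscr C=C([-\tau,0];\mathbb R^n)$ with $\|f\|_\infty=\sup_{-\tau\le\vartheta\le0}|f(\vartheta)|$. Let $\mathbf S=\{1,\dots,N\}$, $2\le N<\infty$. $(\Lambda(t))_{t\ge0}$ is an irreducible right-continuous continuous-time Markov chain on $\mathbf S$ with $Q$-matrix $Q=(q_{ij})$, i.e. $\mathbb P(\Lambda(t+h)=j\mid\Lambda(t)=i)=q_{ij}h+o(h)$ for $j\ne i$ and $=1+q_{ii}h+o(h)$ for $j=i$, as $h\downarrow0$. $(W(t))$ is an $m$-dimensional Brownian motion independent of $(\Lambda(t))$. $\Lambda^i$ denotes the chain started from $i$. $\|\cdot\|_{\rm HS}$ is the Hilbert–Schmidt norm. Let $b:\mathscr C\times\mathbf S\to\mathbb R^n$ and $\sigma:\mathscr C\times\mathbf S\to\mathbb R^n\otimes\mathbb R^m$. Euler–Maruyama scheme: step sizes are always of the form $\delta=\tau/M\in(0,1)$ with $M>\tau$ an integer, and $t_\delta:=\lfloor t/\delta\rfloor\delta$. The process $Y$ is defined by $$dY(t)=b(Y_{t_\delta},\Lambda(t_\delta))\,dt+\sigma(Y_{t_\delta},\Lambda(t_\delta))\,dW(t),\quad t>0,\qquad Y(\vartheta)=\xi(\vartheta)\ (\vartheta\in[-\tau,0]),\ \Lambda(0)=i,$$ where $Y_{k\delta}$ is the $\mathscr C$-valued random variable obtained by linear interpolation of $Y((k-M)\delta),\dots,Y((k-1)\delta),Y(k\delta)$: for $\vartheta\in[l\delta,(l+1)\delta]$,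 $l=-M,\dots,-1$, $$Y_{k\delta}(\vartheta)=Y((k+l)\delta)+\frac{\vartheta-l\delta}{\delta}\{Y((k+l+1)\delta)-Y((k+l)\delta)\}.$$ To display the initial data one writes $Y_{k\delta}(\xi,i)$. $P^{(\delta)}_{k\delta}((\xi,i),\cdot)$ is the law of $(Y_{k\delta}(\xi,i),\Lambda^i(k\delta))$ and $\nu P^{(\delta)}_{k\delta}=\int P^{(\delta)}_{k\delta}(\mathbf x,\cdot)\,\nu(d\mathbf x)$. Let $\mathbf E=\mathscr C\times\mathbf S$ with distance $\rho((\xi,i),(\eta,j))=\|\xi-\eta\|_\infty+\mathbf 1_{\{i\ne j\}}$, let $\mathcal P$ be the set of probability measures on $\mathbf E$, and $\mathcal P_0=\{\nu\in\mathcal P:\sum_{i\in\mathbf S}\int_{\mathscr C}\|\xi\|_\infty\nu(d\xi,i)<\infty\}$. For $\mu,\nu\in\mathcal P_0$, $W_\rho(\mu,\nu)=\inf_{\pi}\int_{\mathbf E\times\mathbf E}\rho(\mathbf x,\mathbf y)\,\pi(d\mathbf x,d\mathbf y)$, the infimum over couplings $\pi$ of $\mu$ and $\nu$. $\mathrm{spec}(\cdot)$ is the set of (complex) eigenvalues of a matrix. *)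

theory Defs
  imports "HOL-Probability.Probability" "HOL-Library.Landau_Symbols"
begin

section \<open>The path space and the state space\<close>

text \<open>
  \<open>C([-\<tau>,0]; \<real>\<^sup>n)\<close> with the supremum metric.  Its elements are functions on the reals that are
  undefined outside \<open>[-\<tau>,0]\<close>.
\<close>

definition path_space :: "real \<Rightarrow> (real \<Rightarrow> real ^ 'n) metric" where
  "path_space \<tau> = cfunspace (top_of_set {-\<tau>..0}) euclidean_metric"

definition sup_norm :: "real \<Rightarrow> (real \<Rightarrow> real ^ 'n) \<Rightarrow> real" where
  "sup_norm \<tau> f = (SUP \<theta>\<in>{-\<tau>..0}. norm (f \<theta>))"

lemma bounded_path:
  "continuous_on {-\<tau>..0::real} f \<Longrightarrow> bounded (f ` {-\<tau>..0})"
  by (intro compact_imp_bounded compact_continuous_image compact_Icc)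

lemma mspace_path_space:
  "mspace (path_space \<tau>) = {f. f \<in> extensional {-\<tau>..0} \<and> continuous_on {-\<tau>..0} f}"
  using bounded_path unfolding path_space_def mspace_cfunspace by auto

lemma mdist_path_space:
  assumes "0 \<le> \<tau>" "f \<in> mspace (path_space \<tau>)" "g \<in> mspace (path_space \<tau>)"
  shows "mdist (path_space \<tau>) f g = sup_norm \<tau> (\<lambda>\<theta>. f \<theta> - g \<theta>)"
proof -
  have "f \<in> Met_TC.fspace {-\<tau>..0}" "g \<in> Met_TC.fspace {-\<tau>..0}"
    using assms(2,3) bounded_path unfolding mspace_path_space Met_TC.fspace_def by auto
  then show ?thesis
    using assms(1) unfolding path_space_def cfunspace_def sup_norm_def
    by (simp, simp add: Met_TC.fdist_def dist_norm)
qed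

definition path_borel :: "real \<Rightarrow> (real \<Rightarrow> real ^ 'n) measure" where
  "path_borel \<tau> = sigma (mspace (path_space \<tau>)) {U. openin (mtopology_of (path_space \<tau>)) U}"

text \<open>
  The index set of the chain is a finite type; since it is finite and discrete, the product
  sigma-algebra below is the Borel sigma-algebra of the metric \<open>rho \<tau>\<close>.
\<close>

definition state_space :: "real \<Rightarrow> ((real \<Rightarrow> real ^ 'n) \<times> 's::finite) measure" where
  "state_space \<tau> = path_borel \<tau> \<Otimes>\<^sub>M count_space UNIV"

definition rho ::
  "real \<Rightarrow> (real \<Rightarrow> real ^ 'n) \<times> 's \<Rightarrow> (real \<Rightarrow> real ^ 'n) \<times> 's \<Rightarrow> real" where
  "rho \<tau> x y = sup_norm \<tau> (\<lambda>\<theta>. fst x \<theta> - fst y \<theta>) + (if snd x \<noteq> snd y then 1 else 0)"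

section \<open>Probability measures on the state space and the Wasserstein distance\<close>

definition prob_measures :: "real \<Rightarrow> ((real \<Rightarrow> real ^ 'n) \<times> 's::finite) measure set" where
  "prob_measures \<tau> = {\<nu>. prob_space \<nu> \<and> sets \<nu> = sets (state_space \<tau>)}"

definition first_moment :: "real \<Rightarrow> ((real \<Rightarrow> real ^ 'n) \<times> 's::finite) measure \<Rightarrow> ennreal" where
  "first_moment \<tau> \<nu> =
     (\<Sum>i\<in>UNIV. \<integral>\<^sup>+x. ennreal (sup_norm \<tau> (fst x)) * indicator {i} (snd x) \<partial>\<nu>)"

definition prob_measures0 :: "real \<Rightarrow> ((real \<Rightarrow> real ^ 'n) \<times> 's::finite) measure set" where
  "prob_measures0 \<tau> = {\<nu> \<in> prob_measures \<tau>. first_moment \<tau> \<nu> < \<infinity>}"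

definition couplings :: "real \<Rightarrow> ((real \<Rightarrow> real ^ 'n) \<times> 's::finite) measure \<Rightarrow>
    ((real \<Rightarrow> real ^ 'n) \<times> 's) measure \<Rightarrow>
    (((real \<Rightarrow> real ^ 'n) \<times> 's) \<times> ((real \<Rightarrow> real ^ 'n) \<times> 's)) measure set" where
  "couplings \<tau> \<mu> \<nu> = {\<pi>. prob_space \<pi> \<and>
     sets \<pi> = sets (state_space \<tau> \<Otimes>\<^sub>M state_space \<tau>) \<and>
     distr \<pi> (state_space \<tau>) fst = \<mu> \<and> distr \<pi> (state_space \<tau>) snd = \<nu>}"

definition wasserstein :: "real \<Rightarrow> ((real \<Rightarrow> real ^ 'n) \<times> 's::finite) measure \<Rightarrow>
    ((real \<Rightarrow> real ^ 'n) \<times> 's) measure \<Rightarrow> ennreal" where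
  "wasserstein \<tau> \<mu> \<nu> = (INF \<pi>\<in>couplings \<tau> \<mu> \<nu>. \<integral>\<^sup>+z. ennreal (rho \<tau> (fst z) (snd z)) \<partial>\<pi>)"

section \<open>The driving processes\<close>

text \<open>
  A time-homogeneous right-continuous Markov chain with finite state space and the given Q-matrix.
  Conditional probabilities are only constrained when the conditioning event is not null.
\<close>

definition markov_chain :: "'w measure \<Rightarrow> real ^ 's ^ 's \<Rightarrow> (real \<Rightarrow> 'w \<Rightarrow> 's::finite) \<Rightarrow> bool" where
  "markov_chain \<Omega> Q X \<longleftrightarrow>
     (\<forall>t\<ge>0. X t \<in> measurable \<Omega> (count_space UNIV)) \<and>
     (AE \<omega> in \<Omega>. \<forall>t\<ge>0. \<forall>\<^sub>F s in at_right t. X s \<omega> = X t \<omega>) \<and>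
     (\<forall>n (t :: nat \<Rightarrow> real) x.
        0 \<le> t 0 \<longrightarrow> (\<forall>k\<le>n. t k < t (Suc k)) \<longrightarrow> \<P>(\<omega> in \<Omega>. \<forall>k\<le>n. X (t k) \<omega> = x k) > 0 \<longrightarrow>
        \<P>(\<omega> in \<Omega>. X (t (Suc n)) \<omega> = x (Suc n) \<bar> \<forall>k\<le>n. X (t k) \<omega> = x k)
          = \<P>(\<omega> in \<Omega>. X (t (Suc n)) \<omega> = x (Suc n) \<bar> X (t n) \<omega> = x n)) \<and>
     (\<forall>s\<ge>0. \<forall>t\<ge>0. \<forall>h\<ge>0. \<forall>i j.
        \<P>(\<omega> in \<Omega>. X s \<omega> = i) > 0 \<longrightarrow> \<P>(\<omega> in \<Omega>. X t \<omega> = i) > 0 \<longrightarrow>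
        \<P>(\<omega> in \<Omega>. X (s + h) \<omega> = j \<bar> X s \<omega> = i) = \<P>(\<omega> in \<Omega>. X (t + h) \<omega> = j \<bar> X t \<omega> = i)) \<and>
     (\<forall>t\<ge>0. \<forall>i j. \<P>(\<omega> in \<Omega>. X t \<omega> = i) > 0 \<longrightarrow>
        (\<lambda>h. \<P>(\<omega> in \<Omega>. X (t + h) \<omega> = j \<bar> X t \<omega> = i) - ((if i = j then 1 else 0) + Q $ i $ j * h))
          \<in> o[at_right 0](\<lambda>h. h))"

text \<open>
  \<open>\<Lambda> i\<close> is the chain started from \<open>i\<close>.  Nothing is assumed about the joint law of the chains
  with different starting points.
\<close>

definition irreducible_chain_family ::
  "'w measure \<Rightarrow> real ^ 's ^ 's \<Rightarrow> ('s::finite \<Rightarrow> real \<Rightarrow> 'w \<Rightarrow> 's) \<Rightarrow> bool" where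
  "irreducible_chain_family \<Omega> Q \<Lambda> \<longleftrightarrow>
     (\<forall>i. markov_chain \<Omega> Q (\<Lambda> i) \<and> (AE \<omega> in \<Omega>. \<Lambda> i 0 \<omega> = i)) \<and>
     (\<forall>i j. \<exists>t\<ge>0. \<P>(\<omega> in \<Omega>. \<Lambda> i t \<omega> = j) > 0)"

definition brownian_motion :: "'w measure \<Rightarrow> (real \<Rightarrow> 'w \<Rightarrow> real ^ 'm) \<Rightarrow> bool" where
  "brownian_motion \<Omega> W \<longleftrightarrow>
     (\<forall>t\<ge>0. W t \<in> borel_measurable \<Omega>) \<and>
     (AE \<omega> in \<Omega>. W 0 \<omega> = 0) \<and>
     (AE \<omega> in \<Omega>. continuous_on {0..} (\<lambda>t. W t \<omega>)) \<and>
     (\<forall>n (t :: nat \<Rightarrow> real). 0 \<le> t 0 \<longrightarrow> (\<forall>k<n. t k < t (Suc k)) \<longrightarrow>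
        prob_space.indep_vars \<Omega> (\<lambda>_. borel) (\<lambda>k \<omega>. W (t (Suc k)) \<omega> - W (t k) \<omega>) {..<n}) \<and>
     (\<forall>s\<ge>0. \<forall>t>s.
        prob_space.indep_vars \<Omega> (\<lambda>_. borel) (\<lambda>j \<omega>. (W t \<omega> - W s \<omega>) $ j) UNIV \<and>
        (\<forall>j. distributed \<Omega> lborel (\<lambda>\<omega>. (W t \<omega> - W s \<omega>) $ j) (normal_density 0 (sqrt (t - s)))))"

definition independent_processes ::
  "'w measure \<Rightarrow> (real \<Rightarrow> 'w \<Rightarrow> real ^ 'm) \<Rightarrow> (real \<Rightarrow> 'w \<Rightarrow> 's::finite) \<Rightarrow> bool" where
  "independent_processes \<Omega> W X \<longleftrightarrow> prob_space.indep_set \<Omega>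
     (sets (vimage_algebra (space \<Omega>) (\<lambda>\<omega>. \<lambda>t\<in>{0..}. W t \<omega>) (\<Pi>\<^sub>M t\<in>{0::real..}. borel)))
     (sets (vimage_algebra (space \<Omega>) (\<lambda>\<omega>. \<lambda>t\<in>{0..}. X t \<omega>) (\<Pi>\<^sub>M t\<in>{0::real..}. count_space UNIV)))"

section \<open>The Euler--Maruyama scheme\<close>

text \<open>Values in \<open>\<real>\<^sup>n \<otimes> \<real>\<^sup>m\<close> are rendered as matrices with \<open>n\<close> rows and \<open>m\<close> columns.\<close>

definition hs_norm :: "real ^ 'm ^ 'n \<Rightarrow> real" where
  "hs_norm A = sqrt (\<Sum>i\<in>UNIV. \<Sum>j\<in>UNIV. (A $ i $ j)\<^sup>2)"

text \<open>
  The segment at time \<open>k\<delta>\<close>: the linear interpolation of \<open>y ((k-M)\<delta>), \<dots>, y (k\<delta>)\<close> where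
  \<open>\<delta> = \<tau>/M\<close>.  The index of the grid interval containing \<open>\<theta>\<close> is cut off at \<open>-1\<close>, so that \<open>\<theta> = 0\<close>
  is the right end point of the last interval.  The segment at time \<open>0\<close> is
  the interpolation of the initial path, not the initial path itself.
\<close>

definition segment :: "real \<Rightarrow> real \<Rightarrow> (real \<Rightarrow> real ^ 'n) \<Rightarrow> int \<Rightarrow> (real \<Rightarrow> real ^ 'n)" where
  "segment \<tau> \<delta> y k = (\<lambda>\<theta>\<in>{-\<tau>..0}.
     let l = min (-1) \<lfloor>\<theta> / \<delta>\<rfloor> in
       y (of_int (k + l) * \<delta>) +
       ((\<theta> - of_int l * \<delta>) / \<delta>) *\<^sub>R (y (of_int (k + l + 1) * \<delta>) - y (of_int (k + l) * \<delta>)))"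

text \<open>
  The Ito integral over \<open>[0,t]\<close> of the process that equals \<open>H k\<close> on the \<open>k\<close>-th interval
  \<open>[k\<delta>, (k+1)\<delta>)\<close>, along the path \<open>w\<close>.
\<close>

definition step_ito_integral ::
  "real \<Rightarrow> (int \<Rightarrow> real ^ 'm ^ 'n) \<Rightarrow> (real \<Rightarrow> real ^ 'm) \<Rightarrow> real \<Rightarrow> real ^ 'n" where
  "step_ito_integral \<delta> H w t =
     (\<Sum>k\<in>{0..\<lfloor>t / \<delta>\<rfloor>}. H k *v (w (min t (of_int (k + 1) * \<delta>)) - w (of_int k * \<delta>)))"

definition euler_maruyama :: "'w measure \<Rightarrow> real \<Rightarrow> real \<Rightarrow>
    ((real \<Rightarrow> real ^ 'n) \<Rightarrow> 's \<Rightarrow> real ^ 'n) \<Rightarrow> ((real \<Rightarrow> real ^ 'n) \<Rightarrow> 's \<Rightarrow> real ^ 'm ^ 'n) \<Rightarrow>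
    (real \<Rightarrow> 'w \<Rightarrow> real ^ 'm) \<Rightarrow> (real \<Rightarrow> 'w \<Rightarrow> 's) \<Rightarrow> (real \<Rightarrow> real ^ 'n) \<Rightarrow>
    (real \<Rightarrow> 'w \<Rightarrow> real ^ 'n) \<Rightarrow> bool" where
  "euler_maruyama \<Omega> \<tau> \<delta> b \<sigma> W X \<xi> Y \<longleftrightarrow>
     (\<forall>t\<ge>-\<tau>. Y t \<in> borel_measurable \<Omega>) \<and>
     (AE \<omega> in \<Omega>.
        (\<forall>\<theta>\<in>{-\<tau>..0}. Y \<theta> \<omega> = \<xi> \<theta>) \<and>
        (\<forall>t\<ge>0. Y t \<omega> = \<xi> 0
           + integral {0..t} (\<lambda>s. b (segment \<tau> \<delta> (\<lambda>r. Y r \<omega>) \<lfloor>s / \<delta>\<rfloor>) (X (of_int \<lfloor>s / \<delta>\<rfloor> * \<delta>) \<omega>))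
           + step_ito_integral \<delta>
               (\<lambda>k. \<sigma> (segment \<tau> \<delta> (\<lambda>r. Y r \<omega>) k) (X (of_int k * \<delta>) \<omega>)) (\<lambda>r. W r \<omega>) t))"

definition em_kernel :: "'w measure \<Rightarrow> real \<Rightarrow> real \<Rightarrow>
    ((real \<Rightarrow> real ^ 'n) \<Rightarrow> 's \<Rightarrow> real \<Rightarrow> 'w \<Rightarrow> real ^ 'n) \<Rightarrow> ('s::finite \<Rightarrow> real \<Rightarrow> 'w \<Rightarrow> 's) \<Rightarrow>
    nat \<Rightarrow> (real \<Rightarrow> real ^ 'n) \<times> 's \<Rightarrow> ((real \<Rightarrow> real ^ 'n) \<times> 's) measure" where
  "em_kernel \<Omega> \<tau> \<delta> Y \<Lambda> k x = distr \<Omega> (state_space \<tau>)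
     (\<lambda>\<omega>. (segment \<tau> \<delta> (\<lambda>r. Y (fst x) (snd x) r \<omega>) (int k), \<Lambda> (snd x) (real k * \<delta>) \<omega>))"

definition em_invariant :: "'w measure \<Rightarrow> real \<Rightarrow> real \<Rightarrow>
    ((real \<Rightarrow> real ^ 'n) \<Rightarrow> 's \<Rightarrow> real \<Rightarrow> 'w \<Rightarrow> real ^ 'n) \<Rightarrow> ('s::finite \<Rightarrow> real \<Rightarrow> 'w \<Rightarrow> 's) \<Rightarrow>
    ((real \<Rightarrow> real ^ 'n) \<times> 's) measure \<Rightarrow> bool" where
  "em_invariant \<Omega> \<tau> \<delta> Y \<Lambda> \<mu> \<longleftrightarrow>
     \<mu> \<in> prob_measures \<tau> \<and> (\<forall>k. \<mu> \<bind> em_kernel \<Omega> \<tau> \<delta> Y \<Lambda> k = \<mu>)"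

section \<open>The spectral condition\<close>

definition spec :: "real ^ 's ^ 's \<Rightarrow> complex set" where
  "spec A = {\<gamma>. \<exists>v. v \<noteq> 0 \<and> map_matrix complex_of_real A *v v = \<gamma> *s v}"

definition Q3 :: "real \<Rightarrow> real ^ 's ^ 's \<Rightarrow> ('s::finite \<Rightarrow> real) \<Rightarrow> ('s \<Rightarrow> real) \<Rightarrow> real ^ 's ^ 's" where
  "Q3 \<tau> Q \<alpha> \<beta> = Q + (\<chi> i j. if i = j then \<alpha> i + 4 * exp (- Min (range \<alpha>) * \<tau>) * \<beta> i else 0)"

definition eta3 :: "real \<Rightarrow> real ^ 's ^ 's \<Rightarrow> ('s::finite \<Rightarrow> real) \<Rightarrow> ('s \<Rightarrow> real) \<Rightarrow> real" where
  "eta3 \<tau> Q \<alpha> \<beta> = - Max (Re ` spec (Q3 \<tau> Q \<alpha> \<beta>))"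

end

theory Submission
  imports Defs
begin

text \<open>
  The history of the scheme at time \<open>k\<delta>\<close> is the vector of its last \<open>M + 1\<close> grid values, and one step
  of the scheme is a random map of (history, state of the chain). The noise of a step is a Brownian
  increment \<open>w\<close> together with a random map \<open>f\<close> of the state set whose values \<open>f i\<close> are independent,
  \<open>f i\<close> having the one-step law of the chain from \<open>i\<close>; the step sends \<open>(z, i)\<close> to
  \<open>(em_step z i w, f i)\<close>. Feeding the same noise to two initial conditions couples two copies of the
  scheme: they are driven by the same Brownian motion, and their chains move independently until they
  meet and together from then on. Every estimate concerns this coupling.

  \<^item> \<^emph>\<open>Second moments.\<close> The off-diagonal entries of \<open>Q3\<close> are nonnegative and it has no real
    eigenvalue \<open>\<ge> 0\<close>, so some positive vector \<open>u\<close> satisfies \<open>Q3 u = -1\<close> (\<open>eta3_positive_vector\<close>).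
    In one step the second moment of the newest value is at most \<open>c1 i\<close> times that of the current value
    plus \<open>c2 i\<close> times a weighted mean of those of the delayed values, where \<open>c1 i\<close> is about
    \<open>1 + \<alpha> i * \<delta>\<close> and \<open>c2 i\<close> about \<open>\<beta> i * \<delta>\<close>. Let \<open>A\<close> be the maximum over \<open>l \<le> M\<close> of
    \<open>r ^ l\<close> times the second moment of the value \<open>l\<close> steps back, with \<open>r = 1 + \<alpha>' * \<delta>\<close> and \<open>\<alpha>'\<close> the
    minimum of \<open>\<alpha>\<close>. As \<open>r\<close> is at most \<open>c1 i + c2 i * D\<close>, a step multiplies \<open>A\<close> at most by this factor,
    provided that \<open>D * r ^ M \<ge> 1\<close>. As \<open>r ^ M\<close> is close to \<open>exp (\<alpha>' * \<tau>)\<close>, the number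
    \<open>D = 4 * exp (- \<alpha>' * \<tau>)\<close> from \<open>Q3\<close> has this property, and then \<open>u\<close> is a Lyapunov
    function for the product of these factors along the chain (\<open>weighted_moment\<close>). The estimate is used
    twice: for one copy, where it gives bounded moments, and for the difference of two copies whose
    chains agree, where it gives exponential decay.

  \<^item> \<^emph>\<open>Suprema.\<close> The squared distance from the running maximum of the norms to the current norm
    satisfies a linear recursive inequality, which bounds the second moment of the maximum over a whole history
    (\<open>top_second_moment\<close>).

  \<^item> \<^emph>\<open>Meeting.\<close> The function \<open>1 - \<lambda> ^ d\<close> of the graph distance \<open>d\<close> from one state to another has
    strictly negative drift at distinct states under two independent copies of the chain when \<open>\<lambda>\<close> is
    small
    (\<open>meeting_function\<close>), so the chains are still apart after \<open>k\<close> steps with probability exponentially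
    small in \<open>k\<delta>\<close>.

  Splitting the time interval in the middle gives the contraction of the coupling (\<open>contraction\<close>): if
  the chains have met in the first half, the difference contracts in the second; otherwise bounded
  moments are weighed against the small probability. Composing the random maps in reversed order
  turns contraction into almost sure convergence (\<open>orbit_converges\<close>); the limit does not depend on the
  starting point, and its law is the unique invariant law (\<open>invariant_limit_law\<close>, \<open>invariant_unique\<close>).

  Linear interpolation carries these results from histories to \<open>C([-\<tau>,0]; \<real>\<^sup>n)\<close>
  (\<open>wasserstein_path_kernel\<close>, \<open>path_law_invariant\<close>, \<open>path_law_unique\<close>). It remains to see that the
  scheme has this law. The chains with different starting points are unrelated processes, but their
  transition matrices are semigroups with the same generator and hence coincide
  (\<open>transition_semigroup_unique\<close>); together with the independence of the Brownian increments
  this identifies the kernel of the scheme (\<open>em_kernel_eq_path_kernel\<close>).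
\<close>

section \<open>Positive vectors of Metzler matrices\<close>

text \<open>
  The eigenvalues are the zeros of the characteristic polynomial, which is not the zero polynomial since
  it does not vanish beyond the sum of all absolute entries. Finiteness makes the maximum in \<open>eta3\<close> an
  upper bound for the real parts of the spectrum.
\<close>

lemma finite_spec:
  fixes A :: "real ^ 's::finite ^ 's"
  shows "finite (spec A)"
proof -
  define R where "R = (\<Sum>i\<in>UNIV. \<Sum>j\<in>UNIV. \<bar>A $ i $ j\<bar>)"
  \<comment> \<open>The characteristic polynomial \<open>det (A - \<gamma>)\<close>, as a determinant of polynomials in \<open>\<gamma>\<close>.\<close>
  define q where "q = det (\<chi> i j. [: complex_of_real (A $ i $ j), if i = j then -1 else 0 :])"
  have poly_q: "poly q \<gamma> = det (map_matrix complex_of_real A - mat \<gamma>)" for \<gamma>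
    unfolding q_def det_def
    by (simp add: poly_sum poly_prod mat_def map_matrix_def)
      (intro sum.cong refl arg_cong2[where f="(*)"] prod.cong, auto)
  have mat_vec: "mat \<gamma> *v v = \<gamma> *s v" for \<gamma> :: complex and v :: "complex ^ 's"
    by (simp add: vec_eq_iff matrix_vector_mult_def mat_def if_distrib[of "\<lambda>x. x * _"] cong: if_cong)
  have eig_iff: "\<gamma> \<in> spec A \<longleftrightarrow> poly q \<gamma> = 0" for \<gamma>
  proof -
    have "\<gamma> \<in> spec A \<longleftrightarrow> (\<exists>v. v \<noteq> 0 \<and> (map_matrix complex_of_real A - mat \<gamma>) *v v = 0)"
      unfolding spec_def
      by (simp add: matrix_vector_mult_diff_rdistrib mat_vec)
    also have "\<dots> \<longleftrightarrow> \<not> invertible (map_matrix complex_of_real A - mat \<gamma>)"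
      by (metis invertible_left_inverse matrix_left_invertible_ker)
    finally show ?thesis by (simp add: invertible_det_nz poly_q)
  qed
  \<comment> \<open>At an entry of maximal modulus an eigenvector bounds the modulus of the eigenvalue by \<open>R\<close>.\<close>
  have "complex_of_real (R + 1) \<notin> spec A"
  proof
    assume "complex_of_real (R + 1) \<in> spec A"
    then obtain v where v: "v \<noteq> 0"
      "map_matrix complex_of_real A *v v = complex_of_real (R + 1) *s v"
      unfolding spec_def by auto
    obtain i where i: "\<And>j. norm (v $ j) \<le> norm (v $ i)"
    proof -
      have "Max (range (\<lambda>j. norm (v $ j))) \<in> range (\<lambda>j. norm (v $ j))"
        by (intro Max_in) auto
      then obtain i where "Max (range (\<lambda>j. norm (v $ j))) = norm (v $ i)" by blast
      then have "\<And>j. norm (v $ j) \<le> norm (v $ i)"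
        by (metis Max_ge finite finite_imageI rangeI)
      then show ?thesis using that by blast
    qed
    have vi: "norm (v $ i) > 0"
    proof (rule ccontr)
      assume "\<not> norm (v $ i) > 0"
      then have "v $ j = 0" for j using i[of j] by (simp add: order.trans)
      then show False using v(1) by (simp add: vec_eq_iff)
    qed
    have "R \<ge> 0" unfolding R_def by (intro sum_nonneg) auto
    have "(R + 1) * norm (v $ i) = norm (complex_of_real (R + 1) * v $ i)"
      using \<open>R \<ge> 0\<close> by (simp add: norm_mult del: of_real_add)
    also have "complex_of_real (R + 1) * v $ i = (\<Sum>j\<in>UNIV. complex_of_real (A $ i $ j) * v $ j)"
      using arg_cong[OF v(2), of "\<lambda>x. x $ i"] by (simp add: matrix_vector_mult_def map_matrix_def distrib_right)
    also have "norm \<dots> \<le> (\<Sum>j\<in>UNIV. \<bar>A $ i $ j\<bar> * norm (v $ j))"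
      by (intro sum_norm_le) (simp add: norm_mult)
    also have "\<dots> \<le> (\<Sum>j\<in>UNIV. \<bar>A $ i $ j\<bar> * norm (v $ i))"
      by (intro sum_mono mult_left_mono i) auto
    also have "\<dots> \<le> R * norm (v $ i)"
      unfolding sum_distrib_right[symmetric] R_def
      by (intro mult_right_mono member_le_sum[where f="\<lambda>i. \<Sum>j\<in>UNIV. \<bar>A $ i $ j\<bar>"] sum_nonneg) auto
    finally show False using vi by (simp add: algebra_simps)
  qed
  then have "q \<noteq> 0" by (auto simp: eig_iff)
  then have "finite {x. poly q x = 0}" by (rule poly_roots_finite)
  then show ?thesis by (simp add: eig_iff[symmetric])
qed

lemma continuous_on_If_const:
  "continuous_on S f \<Longrightarrow> continuous_on S g \<Longrightarrow> continuous_on S (\<lambda>x. if b then f x else g x)"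
  by (cases b) auto

text \<open>
  Let \<open>U t\<close> solve \<open>(t - A) (U t) = 1\<close> for \<open>t \<ge> 0\<close>; by Cramer's rule it depends continuously on \<open>t\<close>. It
  is positive for large \<open>t\<close>, where the diagonal dominates. If \<open>U t\<close> is nonnegative, it is positive,
  because at a zero entry the left-hand side would be \<open>\<le> 0\<close>. So the set of \<open>t\<close> with positive \<open>U t\<close> is
  open, closed and nonempty in the half-line, and contains \<open>0\<close>.
\<close>

lemma metzler_positive_solution:
  fixes A :: "real ^ 's::finite ^ 's"
  assumes offdiag: "\<And>i j. i \<noteq> j \<Longrightarrow> 0 \<le> A $ i $ j"
    and no_eig: "\<And>t x. 0 \<le> t \<Longrightarrow> A *v x = t *s x \<Longrightarrow> x = 0"
  obtains u :: "real ^ 's" where "\<And>i. 0 < u $ i" "\<And>i. (A *v u) $ i = - 1"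
proof -
  define B where "B t = mat t - A" for t
  define one :: "real ^ 's" where "one = (\<chi> i. 1)"
  define U where "U t = (\<chi> k. det (\<chi> i j. if j = k then one $ i else B t $ i $ j) / det (B t))" for t
  have Bv: "B t *v x = t *s x - A *v x" for t x
    unfolding B_def
    by (simp add: matrix_vector_mult_diff_rdistrib)
      (simp add: vec_eq_iff matrix_vector_mult_def mat_def if_distrib[of "\<lambda>x. x * _"] cong: if_cong)
  have det: "det (B t) \<noteq> 0" if "t \<ge> 0" for t
  proof -
    have "\<forall>x. B t *v x = 0 \<longrightarrow> x = 0" using no_eig[OF that] by (auto simp: Bv)
    then show ?thesis
      by (metis invertible_det_nz invertible_left_inverse matrix_left_invertible_ker)
  qed
  have U_eq: "B t *v U t = one" if "t \<ge> 0" for t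
    using cramer[OF det[OF that]] unfolding U_def by simp
  have U_i: "t * U t $ i - (\<Sum>j\<in>UNIV. A $ i $ j * U t $ j) = 1" if "t \<ge> 0" for t i
  proof -
    have "(t *s U t - A *v U t) $ i = one $ i" using U_eq[OF that] unfolding Bv by simp
    then show ?thesis by (simp add: one_def matrix_vector_mult_def)
  qed
  have cont_B: "continuous_on {0..} (\<lambda>t. B t $ i $ j)" for i j
    unfolding B_def mat_def by (cases "i = j") (auto intro!: continuous_intros)
  have cont_det: "continuous_on {0..} (\<lambda>t. det (B t))"
    unfolding det_def by (intro continuous_intros continuous_on_prod cont_B)
  have cont_num: "continuous_on {0..} (\<lambda>t. det (\<chi> i j. if j = k then one $ i else B t $ i $ j))" for k
    unfolding det_def vec_lambda_beta
    by (intro continuous_intros continuous_on_prod continuous_on_If_const cont_B)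
  have cont: "continuous_on {0..} U"
    unfolding U_def
    by (intro continuous_intros cont_det cont_num) (auto simp: det)
  have pos: "U t $ i > 0" if "t \<ge> 0" "\<And>j. U t $ j \<ge> 0" for t i
  proof (rule ccontr)
    assume "\<not> U t $ i > 0"
    then have 0: "U t $ i = 0" using that(2)[of i] by linarith
    have "(\<Sum>j\<in>UNIV. A $ i $ j * U t $ j) \<ge> 0"
    proof (intro sum_nonneg)
      fix j show "0 \<le> A $ i $ j * U t $ j"
        by (cases "i = j") (use 0 that(2) offdiag[of i j] in auto)
    qed
    then show False using U_i[OF that(1), of i] 0 by simp
  qed
  define P where "P = {0..} \<inter> U -` {x. \<forall>i. 0 < x $ i}"
  have P_eq: "P = {0..} \<inter> U -` {x. \<forall>i. 0 \<le> x $ i}"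
    unfolding P_def using pos by (auto intro: less_imp_le)
  have "{x :: real ^ 's. \<forall>i. 0 < x $ i} = (\<Inter>i. {x. 0 < x $ i})"
    "{x :: real ^ 's. \<forall>i. 0 \<le> x $ i} = (\<Inter>i. {x. 0 \<le> x $ i})" by auto
  then have oc: "open {x :: real ^ 's. \<forall>i. 0 < x $ i}" "closed {x :: real ^ 's. \<forall>i. 0 \<le> x $ i}"
    by (auto intro!: open_INT closed_INT open_Collect_less closed_Collect_le continuous_intros)
  have "openin (top_of_set {0..}) P"
    unfolding P_def by (rule continuous_openin_preimage_gen[OF cont oc(1)])
  moreover have "closedin (top_of_set {0..}) P"
    unfolding P_eq by (rule continuous_closedin_preimage[OF cont oc(2)])
  moreover have "P \<noteq> {}"
  proof -
    define t where "t = 1 + (\<Sum>i\<in>UNIV. \<Sum>j\<in>UNIV. \<bar>A $ i $ j\<bar>)"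
    have t: "t \<ge> 0" unfolding t_def by (intro add_nonneg_nonneg sum_nonneg) auto
    define m where "m = Min (range (\<lambda>j. U t $ j))"
    have "m \<in> range (\<lambda>j. U t $ j)" unfolding m_def by (intro Min_in) auto
    then obtain i where i: "U t $ i = m" by auto
    have min: "U t $ i \<le> U t $ j" for j unfolding i m_def by (intro Min_le) auto
    have "U t $ i > 0"
    proof -
      have "(\<Sum>j\<in>UNIV. A $ i $ j * U t $ i) \<le> (\<Sum>j\<in>UNIV. A $ i $ j * U t $ j)"
      proof (intro sum_mono)
        fix j show "A $ i $ j * U t $ i \<le> A $ i $ j * U t $ j"
          by (cases "i = j") (auto intro!: mult_left_mono offdiag min)
      qed
      then have *: "1 \<le> (t - (\<Sum>j\<in>UNIV. A $ i $ j)) * U t $ i"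
        using U_i[OF t, of i] by (simp add: sum_distrib_right[symmetric] left_diff_distrib)
      have "(\<Sum>j\<in>UNIV. A $ i $ j) \<le> (\<Sum>j\<in>UNIV. \<bar>A $ i $ j\<bar>)" by (intro sum_mono) auto
      also have "\<dots> \<le> (\<Sum>i\<in>UNIV. \<Sum>j\<in>UNIV. \<bar>A $ i $ j\<bar>)"
        by (intro member_le_sum[where f="\<lambda>i. \<Sum>j\<in>UNIV. \<bar>A $ i $ j\<bar>"] sum_nonneg) auto
      finally have "t - (\<Sum>j\<in>UNIV. A $ i $ j) > 0" unfolding t_def by linarith
      then show ?thesis using * by (smt (verit) mult_nonneg_nonpos)
    qed
    then have "t \<in> P" using t min unfolding P_def by (auto intro: less_le_trans)
    then show ?thesis by auto
  qed
  ultimately have "P = {0..}"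
    using connected_clopen[of "{0..} :: real set"] by (auto simp: connected_Ici)
  then have "\<And>i. U 0 $ i > 0" unfolding P_def by auto
  moreover have "(A *v U 0) $ i = - 1" for i
    using U_i[of 0 i] by (simp add: matrix_vector_mult_def)
  ultimately show ?thesis using that by blast
qed

lemma eta3_positive_vector:
  fixes Q :: "real ^ 's::finite ^ 's"
  assumes "eta3 \<tau> Q \<alpha> \<beta> > 0" and offdiag: "\<And>i j. i \<noteq> j \<Longrightarrow> 0 \<le> Q $ i $ j"
  obtains u :: "'s \<Rightarrow> real" where "\<And>i. 0 < u i"
    "\<And>i. (\<Sum>j\<in>UNIV. Q $ i $ j * u j) + (\<alpha> i + 4 * exp (- Min (range \<alpha>) * \<tau>) * \<beta> i) * u i = - 1"
proof -
  let ?A = "Q3 \<tau> Q \<alpha> \<beta>"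
  have no_eig: "x = 0" if "t \<ge> 0" "?A *v x = t *s x" for t x
  proof (rule ccontr)
    assume "x \<noteq> 0"
    define v where "v = (\<chi> i. complex_of_real (x $ i))"
    have "v \<noteq> 0" using \<open>x \<noteq> 0\<close> unfolding v_def vec_eq_iff by auto
    moreover have "map_matrix complex_of_real ?A *v v = complex_of_real t *s v"
    proof -
      have "(map_matrix complex_of_real ?A *v v) $ i = complex_of_real ((?A *v x) $ i)" for i
        unfolding v_def by (simp add: matrix_vector_mult_def map_matrix_def)
      then show ?thesis unfolding that(2) by (simp add: vec_eq_iff v_def)
    qed
    ultimately have "complex_of_real t \<in> spec ?A" unfolding spec_def by auto
    then have "t \<in> Re ` spec ?A" by force
    then have "t \<le> Max (Re ` spec ?A)" by (intro Max_ge finite_imageI finite_spec)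
    then show False using assms(1) that(1) unfolding eta3_def by linarith
  qed
  obtain u :: "real ^ 's" where u: "\<And>i. 0 < u $ i" "\<And>i. (?A *v u) $ i = - 1"
  proof (rule metzler_positive_solution[of ?A])
    show "0 \<le> ?A $ i $ j" if "i \<noteq> j" for i j using offdiag[OF that] that unfolding Q3_def by simp
  qed (use no_eig in auto)
  have "(?A *v u) $ i = (\<Sum>j\<in>UNIV. Q $ i $ j * u $ j) + (\<alpha> i + 4 * exp (- Min (range \<alpha>) * \<tau>) * \<beta> i) * u $ i" for i
    unfolding Q3_def matrix_vector_mult_def
    by (simp add: distrib_right sum.distrib if_distrib[of "\<lambda>x. x * _"] cong: if_cong)
  with u show ?thesis using that[of "\<lambda>i. u $ i"] by simp
qed

section \<open>Transition matrices of a finite chain\<close>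

text \<open>
  The state at time zero enters through the expansion, which also prescribes the generator \<open>Q\<close>.
\<close>

definition transition_semigroup :: "real ^ 's ^ 's \<Rightarrow> (real \<Rightarrow> 's::finite \<Rightarrow> 's \<Rightarrow> real) \<Rightarrow> bool" where
  "transition_semigroup Q p \<longleftrightarrow>
     (\<forall>h>0. \<forall>i j. 0 \<le> p h i j) \<and> (\<forall>h>0. \<forall>i. (\<Sum>j\<in>UNIV. p h i j) = 1) \<and>
     (\<forall>s>0. \<forall>h>0. \<forall>i j. p (s + h) i j = (\<Sum>k\<in>UNIV. p s i k * p h k j)) \<and>
     (\<forall>i j. (\<lambda>h. p h i j - ((if i = j then 1 else 0) + Q $ i $ j * h)) \<in> o[at_right 0](\<lambda>h. h))"

context
  fixes Q :: "real ^ 's::finite ^ 's" and p :: "real \<Rightarrow> 's \<Rightarrow> 's \<Rightarrow> real"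
  assumes p: "transition_semigroup Q p"
begin

lemma transition_nonneg: "h > 0 \<Longrightarrow> 0 \<le> p h i j"
  and transition_sum: "h > 0 \<Longrightarrow> (\<Sum>j\<in>UNIV. p h i j) = 1"
  and transition_add: "s > 0 \<Longrightarrow> h > 0 \<Longrightarrow> p (s + h) i j = (\<Sum>k\<in>UNIV. p s i k * p h k j)"
  and transition_smallo:
    "(\<lambda>h. p h i j - ((if i = j then 1 else 0) + Q $ i $ j * h)) \<in> o[at_right 0](\<lambda>h. h)"
  using p unfolding transition_semigroup_def by auto

lemma transition_expansion:
  assumes "e > 0"
  shows "eventually (\<lambda>h. \<forall>i j. \<bar>p h i j - ((if i = j then 1 else 0) + Q $ i $ j * h)\<bar> \<le> e * h) (at_right 0)"
proof -
  have "eventually (\<lambda>h. \<bar>p h i j - ((if i = j then 1 else 0) + Q $ i $ j * h)\<bar> \<le> e * h) (at_right 0)" for i j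
  proof -
    have "eventually (\<lambda>h. norm (p h i j - ((if i = j then 1 else 0) + Q $ i $ j * h)) \<le> e * norm h) (at_right (0::real))"
      using landau_o.smallD[OF transition_smallo[of i j] assms] by simp
    moreover have "eventually (\<lambda>h::real. h > 0) (at_right 0)" by (rule eventually_at_right_less)
    ultimately show ?thesis by eventually_elim auto
  qed
  then show ?thesis by (simp add: eventually_all_finite)
qed

lemma transition_deriv: "((\<lambda>h. (p h i j - (if i = j then 1 else 0)) / h) \<longlongrightarrow> Q $ i $ j) (at_right 0)"
proof -
  have "((\<lambda>h. (p h i j - ((if i = j then 1 else 0) + Q $ i $ j * h)) / h) \<longlongrightarrow> 0) (at_right 0)"
    by (rule smalloD_tendsto[OF transition_smallo])
  then have "((\<lambda>h. (p h i j - ((if i = j then 1 else 0) + Q $ i $ j * h)) / h + Q $ i $ j) \<longlongrightarrow> 0 + Q $ i $ j) (at_right 0)"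
    by (intro tendsto_intros)
  moreover have "eventually (\<lambda>h. (p h i j - ((if i = j then 1 else 0) + Q $ i $ j * h)) / h + Q $ i $ j
      = (p h i j - (if i = j then 1 else 0)) / h) (at_right (0::real))"
    using eventually_at_right_less[of "0::real"] by eventually_elim (simp add: field_simps)
  ultimately show ?thesis by (auto simp: filterlim_cong)
qed

lemma generator_nonneg: "i \<noteq> j \<Longrightarrow> 0 \<le> Q $ i $ j"
proof -
  assume ij: "i \<noteq> j"
  show ?thesis
  proof (rule tendsto_lowerbound[OF transition_deriv[of i j]])
    show "eventually (\<lambda>h. 0 \<le> (p h i j - (if i = j then 1 else 0)) / h) (at_right 0)"
      using eventually_at_right_less[of "0::real"]
      by eventually_elim (use ij transition_nonneg in auto)
  qed simp
qed

lemma generator_sum: "(\<Sum>j\<in>UNIV. Q $ i $ j) = 0"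
proof -
  have "((\<lambda>h. \<Sum>j\<in>UNIV. (p h i j - (if i = j then 1 else 0)) / h) \<longlongrightarrow> (\<Sum>j\<in>UNIV. Q $ i $ j)) (at_right 0)"
    by (intro tendsto_sum transition_deriv)
  moreover have "eventually (\<lambda>h. (\<Sum>j\<in>UNIV. (p h i j - (if i = j then 1 else 0)) / h) = 0) (at_right (0::real))"
    using eventually_at_right_less[of "0::real"]
    by eventually_elim (simp add: sum_divide_distrib[symmetric] sum_subtractf transition_sum)
  ultimately have "((\<lambda>h::real. 0::real) \<longlongrightarrow> (\<Sum>j\<in>UNIV. Q $ i $ j)) (at_right 0)"
    by (rule Lim_transform_eventually)
  then show ?thesis by (simp add: tendsto_const_iff)
qed

lemma generator_mult_diff:
  "(\<Sum>j\<in>UNIV. Q $ i $ j * f j) = (\<Sum>j\<in>UNIV. Q $ i $ j * (f j - f i))"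
  by (simp add: right_diff_distrib sum_subtractf sum_distrib_right[symmetric] generator_sum)

text \<open>
  During a short time \<open>h\<close> the mass that leaves \<open>A\<close> is \<open>o(h)\<close>, so the total loss over \<open>t / h\<close> steps
  is \<open>o(1)\<close> as \<open>h\<close> tends to zero.
\<close>

lemma closed_set_transition:
  assumes closed: "\<And>i j. i \<in> A \<Longrightarrow> j \<notin> A \<Longrightarrow> Q $ i $ j = 0"
    and "t > 0" "i \<in> A" "j \<notin> A"
  shows "p t i j = 0"
proof -
  \<comment> \<open>The mass outside \<open>A\<close>; it is subadditive along successive time intervals.\<close>
  define e where "e h i = (\<Sum>j\<in>-A. p h i j)" for h i
  have add: "e (s + h) i \<le> a + b" if "s > 0" "h > 0" "i \<in> A" "e s i \<le> a" "\<And>i. i \<in> A \<Longrightarrow> e h i \<le> b" "b \<ge> 0" for s h i a b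
  proof -
    have le1: "e h k \<le> 1" for k
      unfolding e_def transition_sum[OF \<open>h > 0\<close>, of k, symmetric]
      using transition_nonneg[OF \<open>h > 0\<close>] by (intro sum_mono2) auto
    have "e (s + h) i = (\<Sum>k\<in>UNIV. p s i k * e h k)"
      unfolding e_def transition_add[OF that(1,2)] sum_distrib_left by (rule sum.swap)
    also have "\<dots> = (\<Sum>k\<in>A. p s i k * e h k) + (\<Sum>k\<in>-A. p s i k * e h k)"
      by (subst sum.union_disjoint[symmetric]) (auto simp: Compl_partition)
    also have "\<dots> \<le> (\<Sum>k\<in>A. p s i k * b) + (\<Sum>k\<in>-A. p s i k * 1)"
      using transition_nonneg[OF \<open>s > 0\<close>] that(5) le1
      by (intro add_mono sum_mono mult_left_mono) auto
    also have "\<dots> \<le> 1 * b + e s i"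
    proof -
      have "(\<Sum>k\<in>A. p s i k) \<le> (\<Sum>k\<in>UNIV. p s i k)"
        using transition_nonneg[OF \<open>s > 0\<close>] by (intro sum_mono2) auto
      then have "(\<Sum>k\<in>A. p s i k) * b \<le> 1 * b"
        using that(6) unfolding transition_sum[OF \<open>s > 0\<close>] by (rule mult_right_mono)
      then show ?thesis unfolding e_def by (simp add: sum_distrib_right[symmetric])
    qed
    finally show ?thesis using that(4) by simp
  qed
  have iter: "e (real (Suc n) * h) i \<le> real (Suc n) * b"
    if "h > 0" "i \<in> A" "\<And>i. i \<in> A \<Longrightarrow> e h i \<le> b" "b \<ge> 0" for n h i b
  proof (induction n)
    case (Suc n)
    have "e (real (Suc n) * h + h) i \<le> real (Suc n) * b + b"
      using that Suc by (intro add) auto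
    then show ?case by (simp add: algebra_simps)
  qed (use that in auto)
  have small: "e t i \<le> t * \<epsilon>" if "\<epsilon> > 0" for \<epsilon>
  proof -
    define c where "c = real CARD('s)"
    have "c > 0" unfolding c_def by (simp add: card_gt_0_iff)
    have "eventually (\<lambda>h. \<forall>i j. \<bar>p h i j - ((if i = j then 1 else 0) + Q $ i $ j * h)\<bar> \<le> \<epsilon> / c * h) (at_right 0)"
      using that \<open>c > 0\<close> by (intro transition_expansion) auto
    then obtain d where d: "d > 0" "\<And>h i j. 0 < h \<Longrightarrow> h < d \<Longrightarrow>
        \<bar>p h i j - ((if i = j then 1 else 0) + Q $ i $ j * h)\<bar> \<le> \<epsilon> / c * h"
      unfolding eventually_at_right_field by auto
    obtain n where n: "t / d < real (Suc n)" using reals_Archimedean2 less_trans of_nat_less_iff lessI by metis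
    define h where "h = t / real (Suc n)"
    have h: "0 < h" "h < d" using \<open>t > 0\<close> d(1) n unfolding h_def by (auto simp: field_simps)
    have "e h i \<le> \<epsilon> * h" if "i \<in> A" for i
    proof -
      have "e h i \<le> (\<Sum>j\<in>-A. \<epsilon> / c * h)"
        unfolding e_def
      proof (intro sum_mono)
        fix j assume "j \<in> - A"
        then have "i \<noteq> j" "Q $ i $ j = 0" using that closed by auto
        then show "p h i j \<le> \<epsilon> / c * h" using d(2)[OF h, of i j] by auto
      qed
      also have "\<dots> = real (card (-A)) * (\<epsilon> / c * h)" by simp
      also have "\<dots> \<le> c * (\<epsilon> / c * h)"
        using \<open>\<epsilon> > 0\<close> \<open>c > 0\<close> h unfolding c_def by (intro mult_right_mono) (auto intro!: card_mono)
      finally show ?thesis using \<open>c > 0\<close> by simp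
    qed
    then have "e (real (Suc n) * h) i \<le> real (Suc n) * (\<epsilon> * h)"
      using h \<open>\<epsilon> > 0\<close> \<open>i \<in> A\<close> by (intro iter) auto
    moreover have ht: "real (Suc n) * h = t" unfolding h_def by simp
    moreover from ht have "real (Suc n) * (\<epsilon> * h) = t * \<epsilon>" by (metis mult.assoc mult.commute)
    ultimately show ?thesis by metis
  qed
  have "e t i \<le> 0"
  proof (rule field_le_epsilon)
    fix \<epsilon> :: real assume "\<epsilon> > 0"
    then show "e t i \<le> 0 + \<epsilon>" using small[of "\<epsilon> / t"] \<open>t > 0\<close> by simp
  qed
  moreover have "p t i j \<le> e t i"
    unfolding e_def using assms transition_nonneg by (intro member_le_sum) auto
  ultimately show ?thesis using transition_nonneg[OF \<open>t > 0\<close>, of i j] by simp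
qed

end

text \<open>
  The distance of the rows is subadditive in time and \<open>o(h)\<close> over a short time \<open>h\<close>; summing over \<open>t / h\<close>
  steps leaves nothing. This is what identifies the transition matrices of chains that live on the same
  probability space without any relation to each other.
\<close>

lemma transition_semigroup_unique:
  fixes Q :: "real ^ 's::finite ^ 's"
  assumes p: "transition_semigroup Q p" and q: "transition_semigroup Q q" and "t > 0"
  shows "p t i j = q t i j"
proof -
  note pp = transition_nonneg[OF p] transition_sum[OF p] transition_add[OF p]
  note qq = transition_nonneg[OF q] transition_sum[OF q] transition_add[OF q]
  define e where "e h i = (\<Sum>j\<in>UNIV. \<bar>p h i j - q h i j\<bar>)" for h i
  have add: "e (s + h) i \<le> a + b" if "s > 0" "h > 0" "e s i \<le> a" "\<And>i. e h i \<le> b" for s h i a b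
  proof -
    have "e (s + h) i \<le> (\<Sum>j\<in>UNIV. \<Sum>k\<in>UNIV. \<bar>p s i k - q s i k\<bar> * p h k j + q s i k * \<bar>p h k j - q h k j\<bar>)"
      unfolding e_def
    proof (intro sum_mono)
      fix j
      have "p (s + h) i j - q (s + h) i j = (\<Sum>k\<in>UNIV. (p s i k - q s i k) * p h k j + q s i k * (p h k j - q h k j))"
        unfolding pp(3)[OF that(1,2)] qq(3)[OF that(1,2)] sum_subtractf[symmetric]
        by (intro sum.cong) (auto simp: algebra_simps)
      then have "\<bar>p (s + h) i j - q (s + h) i j\<bar>
          \<le> (\<Sum>k\<in>UNIV. \<bar>(p s i k - q s i k) * p h k j + q s i k * (p h k j - q h k j)\<bar>)"
        by simp
      also have "\<dots> \<le> (\<Sum>k\<in>UNIV. \<bar>p s i k - q s i k\<bar> * p h k j + q s i k * \<bar>p h k j - q h k j\<bar>)"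
      proof (rule sum_mono)
        fix k
        show "\<bar>(p s i k - q s i k) * p h k j + q s i k * (p h k j - q h k j)\<bar>
            \<le> \<bar>p s i k - q s i k\<bar> * p h k j + q s i k * \<bar>p h k j - q h k j\<bar>"
          using abs_triangle_ineq[of "(p s i k - q s i k) * p h k j" "q s i k * (p h k j - q h k j)"]
            pp(1)[OF \<open>h > 0\<close>, of k j] qq(1)[OF \<open>s > 0\<close>, of i k] by (simp add: abs_mult)
      qed
      finally show "\<bar>p (s + h) i j - q (s + h) i j\<bar>
          \<le> (\<Sum>k\<in>UNIV. \<bar>p s i k - q s i k\<bar> * p h k j + q s i k * \<bar>p h k j - q h k j\<bar>)" .
    qed
    also have "\<dots> = (\<Sum>k\<in>UNIV. \<Sum>j\<in>UNIV. \<bar>p s i k - q s i k\<bar> * p h k j + q s i k * \<bar>p h k j - q h k j\<bar>)"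
      by (rule sum.swap)
    also have "\<dots> = e s i + (\<Sum>k\<in>UNIV. q s i k * e h k)"
      using pp(2)[OF \<open>h > 0\<close>] unfolding e_def sum.distrib sum_distrib_left[symmetric] by simp
    also have "(\<Sum>k\<in>UNIV. q s i k * e h k) \<le> (\<Sum>k\<in>UNIV. q s i k * b)"
      using qq(1)[OF \<open>s > 0\<close>] that(4) by (intro sum_mono mult_left_mono) auto
    also have "\<dots> = b" using qq(2)[OF \<open>s > 0\<close>] by (simp add: sum_distrib_right[symmetric])
    finally show ?thesis using that(3) by simp
  qed
  have iter: "e (real (Suc n) * h) i \<le> real (Suc n) * b"
    if "h > 0" "\<And>i. e h i \<le> b" for n h i b
  proof (induction n)
    case (Suc n)
    have "e (real (Suc n) * h + h) i \<le> real (Suc n) * b + b"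
      using that Suc by (intro add) auto
    then show ?case by (simp add: algebra_simps)
  qed (use that in auto)
  have small: "e t i \<le> t * \<epsilon>" if "\<epsilon> > 0" for \<epsilon>
  proof -
    define c where "c = real CARD('s)"
    have "c > 0" unfolding c_def by (simp add: card_gt_0_iff)
    have "eventually (\<lambda>h. (\<forall>i j. \<bar>p h i j - ((if i = j then 1 else 0) + Q $ i $ j * h)\<bar> \<le> \<epsilon> / (2 * c) * h) \<and>
      (\<forall>i j. \<bar>q h i j - ((if i = j then 1 else 0) + Q $ i $ j * h)\<bar> \<le> \<epsilon> / (2 * c) * h)) (at_right 0)"
      using that \<open>c > 0\<close> by (intro eventually_conj transition_expansion[OF p] transition_expansion[OF q]) auto
    then obtain d where d: "d > 0"
      "\<And>h i j. 0 < h \<Longrightarrow> h < d \<Longrightarrow> \<bar>p h i j - ((if i = j then 1 else 0) + Q $ i $ j * h)\<bar> \<le> \<epsilon> / (2 * c) * h"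
      "\<And>h i j. 0 < h \<Longrightarrow> h < d \<Longrightarrow> \<bar>q h i j - ((if i = j then 1 else 0) + Q $ i $ j * h)\<bar> \<le> \<epsilon> / (2 * c) * h"
      unfolding eventually_at_right_field by auto
    obtain n where n: "t / d < real (Suc n)" using reals_Archimedean2 less_trans of_nat_less_iff lessI by metis
    define h where "h = t / real (Suc n)"
    have h: "0 < h" "h < d" using \<open>t > 0\<close> d(1) n unfolding h_def by (auto simp: field_simps)
    have "e h i \<le> \<epsilon> * h" for i
    proof -
      have "e h i \<le> (\<Sum>j\<in>(UNIV::'s set). \<epsilon> / c * h)"
        unfolding e_def
      proof (intro sum_mono)
        fix j
        have "\<epsilon> / (2 * c) * h + \<epsilon> / (2 * c) * h = \<epsilon> / c * h" by (simp add: field_simps)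
        then show "\<bar>p h i j - q h i j\<bar> \<le> \<epsilon> / c * h"
          using d(2)[OF h, of i j] d(3)[OF h, of i j] by linarith
      qed
      then show ?thesis using \<open>c > 0\<close> by (simp add: c_def)
    qed
    then have "e (real (Suc n) * h) i \<le> real (Suc n) * (\<epsilon> * h)"
      using h by (intro iter) auto
    moreover have ht: "real (Suc n) * h = t" unfolding h_def by simp
    moreover from ht have "real (Suc n) * (\<epsilon> * h) = t * \<epsilon>" by (metis mult.assoc mult.commute)
    ultimately show ?thesis by metis
  qed
  have "e t i \<le> 0"
  proof (rule field_le_epsilon)
    fix \<epsilon> :: real assume "\<epsilon> > 0"
    then show "e t i \<le> 0 + \<epsilon>" using small[of "\<epsilon> / t"] \<open>t > 0\<close> by simp
  qed
  moreover have "\<bar>p t i j - q t i j\<bar> \<le> e t i"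
    unfolding e_def by (intro member_le_sum) auto
  ultimately show ?thesis by simp
qed

section \<open>From the chain to its transition matrices\<close>

text \<open>
  Every state is visited with positive probability at some time, so that the conditional probabilities of
  the process determine a full transition matrix.
\<close>

locale chain_process = prob_space \<Omega> for \<Omega> :: "'w measure" +
  fixes Q :: "real ^ 's::finite ^ 's" and X :: "real \<Rightarrow> 'w \<Rightarrow> 's"
  assumes mc: "markov_chain \<Omega> Q X"
    and accessible: "\<And>a. \<exists>t\<ge>0. \<P>(\<omega> in \<Omega>. X t \<omega> = a) > 0"
begin

lemma X_meas [measurable]: "t \<ge> 0 \<Longrightarrow> X t \<in> measurable \<Omega> (count_space UNIV)"
  using mc[unfolded markov_chain_def, THEN conjunct1] by blast

definition visit :: "'s \<Rightarrow> real" where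
  "visit a = (SOME t. t \<ge> 0 \<and> \<P>(\<omega> in \<Omega>. X t \<omega> = a) > 0)"

definition trans :: "real \<Rightarrow> 's \<Rightarrow> 's \<Rightarrow> real" where
  "trans h a b = \<P>(\<omega> in \<Omega>. X (visit a + h) \<omega> = b \<bar> X (visit a) \<omega> = a)"

lemma visit: "visit a \<ge> 0" "\<P>(\<omega> in \<Omega>. X (visit a) \<omega> = a) > 0"
  using someI_ex[OF accessible[unfolded Bex_def]] unfolding visit_def by blast+

lemma trans_eq:
  assumes "t \<ge> 0" "h \<ge> 0" "\<P>(\<omega> in \<Omega>. X t \<omega> = a) > 0"
  shows "\<P>(\<omega> in \<Omega>. X (t + h) \<omega> = b \<bar> X t \<omega> = a) = trans h a b"
  unfolding trans_def
  using mc[unfolded markov_chain_def, THEN conjunct2, THEN conjunct2, THEN conjunct2, THEN conjunct1, rule_format,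
      of t "visit a" h a b] assms visit[of a] by blast

lemma prob_two:
  assumes "t \<ge> 0" "h \<ge> 0"
  shows "\<P>(\<omega> in \<Omega>. X (t + h) \<omega> = b \<and> X t \<omega> = a) = \<P>(\<omega> in \<Omega>. X t \<omega> = a) * trans h a b"
proof (cases "\<P>(\<omega> in \<Omega>. X t \<omega> = a) > 0")
  case True
  then show ?thesis using trans_eq[OF assms True, of b] by (simp add: cond_prob_def field_simps)
next
  case False
  then have 0: "\<P>(\<omega> in \<Omega>. X t \<omega> = a) = 0" by (simp add: zero_less_measure_iff)
  have "\<P>(\<omega> in \<Omega>. X (t + h) \<omega> = b \<and> X t \<omega> = a) \<le> \<P>(\<omega> in \<Omega>. X t \<omega> = a)"
    using assms by (intro finite_measure_mono) auto
  then show ?thesis using 0 measure_nonneg[of \<Omega>] by (simp add: order_antisym)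
qed

lemma sum_over_states:
  assumes "t \<ge> 0" "Measurable.pred \<Omega> P"
  shows "(\<Sum>b\<in>UNIV. \<P>(\<omega> in \<Omega>. X t \<omega> = b \<and> P \<omega>)) = \<P>(\<omega> in \<Omega>. P \<omega>)"
proof -
  have "\<P>(\<omega> in \<Omega>. P \<omega>) = prob (\<Union>b. {\<omega>\<in>space \<Omega>. X t \<omega> = b \<and> P \<omega>})"
    by (intro arg_cong[where f=prob]) auto
  also have "\<dots> = (\<Sum>b\<in>UNIV. \<P>(\<omega> in \<Omega>. X t \<omega> = b \<and> P \<omega>))"
    using assms by (intro finite_measure_finite_Union) (auto simp: disjoint_family_on_def)
  finally show ?thesis by simp
qed

lemma trans_nonneg: "0 \<le> trans h a b"
  unfolding trans_def cond_prob_def by auto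

lemma trans_sum: assumes "h \<ge> 0" shows "(\<Sum>b\<in>UNIV. trans h a b) = 1"
proof -
  have "(\<Sum>b\<in>UNIV. \<P>(\<omega> in \<Omega>. X (visit a) \<omega> = a) * trans h a b) = \<P>(\<omega> in \<Omega>. X (visit a) \<omega> = a)"
    unfolding prob_two[OF visit(1) assms, symmetric]
    using assms visit by (intro sum_over_states) auto
  then show ?thesis using visit(2)[of a] by (simp add: sum_distrib_left[symmetric])
qed

text \<open>
  The Markov property as a product formula, which also covers conditioning on null events.
\<close>

lemma markov_step:
  assumes "0 \<le> t 0" "\<And>k. k \<le> n \<Longrightarrow> t k < t (Suc k)"
  shows "\<P>(\<omega> in \<Omega>. X (t (Suc n)) \<omega> = x (Suc n) \<and> (\<forall>k\<le>n. X (t k) \<omega> = x k)) =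
    \<P>(\<omega> in \<Omega>. \<forall>k\<le>n. X (t k) \<omega> = x k) * trans (t (Suc n) - t n) (x n) (x (Suc n))"
proof -
  have tpos: "0 \<le> t k" if "k \<le> Suc n" for k
    using that by (induction k) (use assms in \<open>auto intro: order.trans less_imp_le\<close>)
  have [measurable]: "X (t k) \<in> measurable \<Omega> (count_space UNIV)" if "k \<le> Suc n" for k
    using tpos[OF that] by simp
  have meas: "Measurable.pred \<Omega> (\<lambda>\<omega>. \<forall>k\<le>n. X (t k) \<omega> = x k)"
  proof -
    have "{\<omega>\<in>space \<Omega>. \<forall>k\<le>n. X (t k) \<omega> = x k} = (\<Inter>k\<in>{..n}. {\<omega>\<in>space \<Omega>. X (t k) \<omega> = x k})" by auto
    also have "\<dots> \<in> sets \<Omega>" by (intro sets.finite_INT) auto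
    finally show ?thesis unfolding pred_def .
  qed
  show ?thesis
  proof (cases "\<P>(\<omega> in \<Omega>. \<forall>k\<le>n. X (t k) \<omega> = x k) > 0")
    case True
    have "\<P>(\<omega> in \<Omega>. \<forall>k\<le>n. X (t k) \<omega> = x k) \<le> \<P>(\<omega> in \<Omega>. X (t n) \<omega> = x n)"
      using tpos by (intro finite_measure_mono) auto
    with True have pos: "\<P>(\<omega> in \<Omega>. X (t n) \<omega> = x n) > 0" by linarith
    have "\<P>(\<omega> in \<Omega>. X (t (Suc n)) \<omega> = x (Suc n) \<bar> \<forall>k\<le>n. X (t k) \<omega> = x k)
          = \<P>(\<omega> in \<Omega>. X (t (Suc n)) \<omega> = x (Suc n) \<bar> X (t n) \<omega> = x n)"
      using mc[unfolded markov_chain_def, THEN conjunct2, THEN conjunct2, THEN conjunct1, rule_format, of t n x]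
        assms True by blast
    also have "\<dots> = trans (t (Suc n) - t n) (x n) (x (Suc n))"
      using trans_eq[of "t n" "t (Suc n) - t n" "x n" "x (Suc n)"] tpos[of n] assms(2)[of n] pos by simp
    finally show ?thesis using True by (simp add: cond_prob_def field_simps)
  next
    case False
    then have 0: "\<P>(\<omega> in \<Omega>. \<forall>k\<le>n. X (t k) \<omega> = x k) = 0" by (simp add: zero_less_measure_iff)
    have "\<P>(\<omega> in \<Omega>. X (t (Suc n)) \<omega> = x (Suc n) \<and> (\<forall>k\<le>n. X (t k) \<omega> = x k)) \<le> \<P>(\<omega> in \<Omega>. \<forall>k\<le>n. X (t k) \<omega> = x k)"
      using meas by (intro finite_measure_mono) auto
    then show ?thesis using 0 measure_nonneg[of \<Omega>] by (simp add: order_antisym)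
  qed
qed

lemma trans_add:
  assumes "s > 0" "h > 0"
  shows "trans (s + h) a b = (\<Sum>c\<in>UNIV. trans s a c * trans h c b)"
proof -
  define t0 where "t0 = visit a"
  have t0: "t0 \<ge> 0" "\<P>(\<omega> in \<Omega>. X t0 \<omega> = a) > 0" using visit unfolding t0_def by auto
  have m[measurable]: "X t0 \<in> measurable \<Omega> (count_space UNIV)" "X (t0 + s) \<in> measurable \<Omega> (count_space UNIV)"
    "X (t0 + s + h) \<in> measurable \<Omega> (count_space UNIV)" using t0 assms by auto
  have "\<P>(\<omega> in \<Omega>. X (t0 + s + h) \<omega> = b \<and> X (t0 + s) \<omega> = c \<and> X t0 \<omega> = a)
      = \<P>(\<omega> in \<Omega>. X t0 \<omega> = a) * (trans s a c * trans h c b)" for c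
  proof -
    define t where "t = (\<lambda>k::nat. if k = 0 then t0 else if k = 1 then t0 + s else t0 + s + h)"
    define x where "x = (\<lambda>k::nat. if k = 0 then a else if k = 1 then c else b)"
    have "\<P>(\<omega> in \<Omega>. X (t (Suc 1)) \<omega> = x (Suc 1) \<and> (\<forall>k\<le>1. X (t k) \<omega> = x k)) =
      \<P>(\<omega> in \<Omega>. \<forall>k\<le>1. X (t k) \<omega> = x k) * trans (t (Suc 1) - t 1) (x 1) (x (Suc 1))"
      using t0 assms by (intro markov_step) (auto simp: t_def)
    moreover have "(\<forall>k\<le>1. X (t k) \<omega> = x k) \<longleftrightarrow> X (t0 + s) \<omega> = c \<and> X t0 \<omega> = a" for \<omega>
      by (auto simp: t_def x_def le_Suc_eq)
    ultimately show ?thesis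
      using prob_two[of t0 s c a] t0 assms by (simp add: t_def x_def)
  qed
  note three = this
  have "\<P>(\<omega> in \<Omega>. X t0 \<omega> = a) * trans (s + h) a b = \<P>(\<omega> in \<Omega>. X (t0 + s + h) \<omega> = b \<and> X t0 \<omega> = a)"
    using prob_two[of t0 "s + h" b a] t0 assms by (simp add: add.assoc)
  also have "\<dots> = (\<Sum>c\<in>UNIV. \<P>(\<omega> in \<Omega>. X (t0 + s) \<omega> = c \<and> X (t0 + s + h) \<omega> = b \<and> X t0 \<omega> = a))"
    using t0 assms by (intro sum_over_states[symmetric]) auto
  also have "\<dots> = (\<Sum>c\<in>UNIV. \<P>(\<omega> in \<Omega>. X t0 \<omega> = a) * (trans s a c * trans h c b))"
    unfolding three[symmetric] by (intro sum.cong refl arg_cong[where f=prob]) auto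
  finally show ?thesis using t0(2) by (simp add: sum_distrib_left[symmetric])
qed

lemma transition_semigroup_trans: "transition_semigroup Q trans"
proof -
  have "(\<lambda>h. trans h i j - ((if i = j then 1 else 0) + Q $ i $ j * h)) \<in> o[at_right 0](\<lambda>h. h)" for i j
    using mc[unfolded markov_chain_def, THEN conjunct2, THEN conjunct2, THEN conjunct2, THEN conjunct2, rule_format,
      of "visit i" i j] visit[of i] unfolding trans_def by blast
  then show ?thesis
    unfolding transition_semigroup_def using trans_nonneg trans_sum trans_add by auto
qed

end

section \<open>Iterated random maps\<close>

text \<open>
  The noise at the head of the stream acts last, so lengthening the composition adds a map on the inside:
  for fixed noise, contraction makes the iterates converge, while forward iterates converge only in law.
\<close>

primrec back_iter :: "('t \<Rightarrow> 'x \<Rightarrow> 'x) \<Rightarrow> nat \<Rightarrow> 't stream \<Rightarrow> 'x \<Rightarrow> 'x" where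
  "back_iter F 0 s x = x"
| "back_iter F (Suc k) s x = F (shd s) (back_iter F k (stl s) x)"

text \<open>
  The transition operator of the Markov chain generated by the random maps; its \<open>k\<close>-th power gives
  expectations after \<open>k\<close> steps.
\<close>

definition avg :: "'t measure \<Rightarrow> ('t \<Rightarrow> 'x \<Rightarrow> 'x) \<Rightarrow> ('x \<Rightarrow> ennreal) \<Rightarrow> 'x \<Rightarrow> ennreal" where
  "avg \<Theta> F g x = (\<integral>\<^sup>+\<theta>. g (F \<theta> x) \<partial>\<Theta>)"

definition pair_map :: "('t \<Rightarrow> 'x \<Rightarrow> 'x) \<Rightarrow> 't \<Rightarrow> 'x \<times> 'x \<Rightarrow> 'x \<times> 'x" where
  "pair_map F \<theta> z = (F \<theta> (fst z), F \<theta> (snd z))"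

lemma back_pair_map: "back_iter (pair_map F) k s (x, y) = (back_iter F k s x, back_iter F k s y)"
  by (induction k arbitrary: s) (auto simp: pair_map_def)

lemma avg_pow_Suc: "(avg \<Theta> F ^^ Suc k) g x = (\<integral>\<^sup>+\<theta>. (avg \<Theta> F ^^ k) g (F \<theta> x) \<partial>\<Theta>)"
  unfolding funpow.simps o_def by (rule avg_def)

lemma avg_pow_pair_fst: "(avg \<Theta> (pair_map F) ^^ k) (\<lambda>z. g (fst z)) z = (avg \<Theta> F ^^ k) g (fst z)"
proof (induction k arbitrary: z)
  case (Suc k)
  have "(avg \<Theta> (pair_map F) ^^ k) (\<lambda>z. g (fst z)) = (\<lambda>z. (avg \<Theta> F ^^ k) g (fst z))"
    using Suc by auto
  then show ?case unfolding avg_pow_Suc by (simp add: pair_map_def)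
qed simp

lemma avg_pow_pair_snd: "(avg \<Theta> (pair_map F) ^^ k) (\<lambda>z. g (snd z)) z = (avg \<Theta> F ^^ k) g (snd z)"
proof (induction k arbitrary: z)
  case (Suc k)
  have "(avg \<Theta> (pair_map F) ^^ k) (\<lambda>z. g (snd z)) = (\<lambda>z. (avg \<Theta> F ^^ k) g (snd z))"
    using Suc by auto
  then show ?case unfolding avg_pow_Suc by (simp add: pair_map_def)
qed simp

locale random_maps = prob_space \<Theta> for \<Theta> :: "'t measure" +
  fixes X :: "'x measure" and F :: "'t \<Rightarrow> 'x \<Rightarrow> 'x"
  assumes F_measurable: "(\<lambda>z. F (fst z) (snd z)) \<in> measurable (\<Theta> \<Otimes>\<^sub>M X) X"
begin

lemma F_measurable' [measurable (raw)]:
  "f \<in> measurable A \<Theta> \<Longrightarrow> g \<in> measurable A X \<Longrightarrow> (\<lambda>x. F (f x) (g x)) \<in> measurable A X"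
  using measurable_compose[OF measurable_Pair F_measurable, of f A g] by simp

sublocale stream: prob_space "stream_space \<Theta>"
  by (rule prob_space_stream_space)

lemma back_measurable' [measurable (raw)]:
  "f \<in> measurable A (stream_space \<Theta>) \<Longrightarrow> g \<in> measurable A X \<Longrightarrow> (\<lambda>x. back_iter F k (f x) (g x)) \<in> measurable A X"
  by (induction k arbitrary: f) auto

lemma F_space: "\<theta> \<in> space \<Theta> \<Longrightarrow> x \<in> space X \<Longrightarrow> F \<theta> x \<in> space X"
  using measurable_space[OF F_measurable, of "(\<theta>, x)"] by (simp add: space_pair_measure)

lemma avg_measurable [measurable (raw)]: "g \<in> borel_measurable X \<Longrightarrow> avg \<Theta> F g \<in> borel_measurable X"
proof -
  assume [measurable]: "g \<in> borel_measurable X"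
  show ?thesis unfolding avg_def[abs_def] by measurable
qed

lemma avg_pow_measurable [measurable (raw)]: "g \<in> borel_measurable X \<Longrightarrow> (avg \<Theta> F ^^ k) g \<in> borel_measurable X"
  by (induction k) auto

text \<open>
  The maps are independent and identically distributed, so reversing their order does not change the law
  of a single iterate.
\<close>

lemma nn_integral_back:
  assumes "g \<in> borel_measurable X" "x \<in> space X"
  shows "(\<integral>\<^sup>+s. g (back_iter F k s x) \<partial>stream_space \<Theta>) = (avg \<Theta> F ^^ k) g x"
  using assms(1)
proof (induction k arbitrary: g)
  case 0
  then show ?case by (simp add: stream.emeasure_space_1)
next
  case (Suc k)
  note [measurable] = Suc(2) and x[simp] = assms(2)
  interpret p: pair_sigma_finite \<Theta> "stream_space \<Theta>" ..
  have "(\<integral>\<^sup>+s. g (back_iter F (Suc k) s x) \<partial>stream_space \<Theta>)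
      = (\<integral>\<^sup>+\<theta>. \<integral>\<^sup>+s. g (F \<theta> (back_iter F k s x)) \<partial>stream_space \<Theta> \<partial>\<Theta>)"
    by (subst nn_integral_stream_space) auto
  also have "\<dots> = (\<integral>\<^sup>+s. \<integral>\<^sup>+\<theta>. g (F \<theta> (back_iter F k s x)) \<partial>\<Theta> \<partial>stream_space \<Theta>)"
    by (rule p.Fubini'[symmetric]) simp
  also have "\<dots> = (\<integral>\<^sup>+s. avg \<Theta> F g (back_iter F k s x) \<partial>stream_space \<Theta>)"
    unfolding avg_def ..
  also have "\<dots> = (avg \<Theta> F ^^ k) (avg \<Theta> F g) x" by (rule Suc(1)) simp
  finally show ?case by (simp add: funpow_swap1)
qed

lemma avg_pow_mono:
  assumes "\<And>y. y \<in> space X \<Longrightarrow> g y \<le> h y" "x \<in> space X"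
  shows "(avg \<Theta> F ^^ k) g x \<le> (avg \<Theta> F ^^ k) h x"
  using assms(2)
proof (induction k arbitrary: x)
  case (Suc k)
  show ?case
    unfolding avg_pow_Suc
    by (intro nn_integral_mono Suc.IH F_space Suc.prems) auto
qed (use assms(1) in simp)

lemma avg_pow_add:
  assumes [measurable]: "g \<in> borel_measurable X" "h \<in> borel_measurable X" and x: "x \<in> space X"
  shows "(avg \<Theta> F ^^ k) (\<lambda>y. g y + h y) x = (avg \<Theta> F ^^ k) g x + (avg \<Theta> F ^^ k) h x"
  using x by (simp add: nn_integral_back[symmetric] nn_integral_add)

lemma avg_pow_sum:
  assumes [measurable]: "\<And>i. i \<in> I \<Longrightarrow> g i \<in> borel_measurable X" and x: "x \<in> space X"
  shows "(avg \<Theta> F ^^ k) (\<lambda>y. \<Sum>i\<in>I. g i y) x = (\<Sum>i\<in>I. (avg \<Theta> F ^^ k) (g i) x)"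
  using x by (simp add: nn_integral_back[symmetric] nn_integral_sum)

lemma avg_pow_cmult:
  assumes [measurable]: "g \<in> borel_measurable X" and x: "x \<in> space X"
  shows "(avg \<Theta> F ^^ k) (\<lambda>y. c * g y) x = c * (avg \<Theta> F ^^ k) g x"
  using x by (simp add: nn_integral_back[symmetric] nn_integral_cmult)

lemma avg_pow_const: "x \<in> space X \<Longrightarrow> (avg \<Theta> F ^^ k) (\<lambda>y. c) x = c"
  by (simp add: nn_integral_back[symmetric] stream.emeasure_space_1)

lemma random_maps_pair: "random_maps \<Theta> (X \<Otimes>\<^sub>M X) (pair_map F)"
proof
  show "(\<lambda>z. pair_map F (fst z) (snd z)) \<in> \<Theta> \<Otimes>\<^sub>M (X \<Otimes>\<^sub>M X) \<rightarrow>\<^sub>M X \<Otimes>\<^sub>M X"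
    unfolding pair_map_def by measurable
qed

text \<open>
  The iterate with one more map starts from \<open>F \<theta> x\<close> instead of \<open>x\<close>, and the remaining \<open>n\<close> maps are
  common: an increment of the backward orbit is a coupled pair after \<open>n\<close> steps.
\<close>

lemma nn_integral_back_increment:
  assumes "g \<in> borel_measurable (X \<Otimes>\<^sub>M X)" "x \<in> space X"
  shows "(\<integral>\<^sup>+s. g (back_iter F n s x, back_iter F (Suc n) s x) \<partial>stream_space \<Theta>)
    = (\<integral>\<^sup>+\<theta>. (avg \<Theta> (pair_map F) ^^ n) g (x, F \<theta> x) \<partial>\<Theta>)"
  using assms(1)
proof (induction n arbitrary: g)
  case 0
  note [measurable] = 0 and x[simp] = assms(2)
  show ?case
    by (subst nn_integral_stream_space) (auto simp: stream.emeasure_space_1)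
next
  case (Suc n)
  note [measurable] = Suc(2) and x[simp] = assms(2)
  interpret p: pair_sigma_finite \<Theta> "stream_space \<Theta>" ..
  interpret P: random_maps \<Theta> "X \<Otimes>\<^sub>M X" "pair_map F" by (rule random_maps_pair)
  have "(\<integral>\<^sup>+s. g (back_iter F (Suc n) s x, back_iter F (Suc (Suc n)) s x) \<partial>stream_space \<Theta>)
     = (\<integral>\<^sup>+\<theta>. \<integral>\<^sup>+s. g (F \<theta> (back_iter F n s x), F \<theta> (back_iter F (Suc n) s x)) \<partial>stream_space \<Theta> \<partial>\<Theta>)"
    by (subst nn_integral_stream_space) auto
  also have "\<dots> = (\<integral>\<^sup>+s. \<integral>\<^sup>+\<theta>. g (F \<theta> (back_iter F n s x), F \<theta> (back_iter F (Suc n) s x)) \<partial>\<Theta> \<partial>stream_space \<Theta>)"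
    by (rule p.Fubini'[symmetric]) measurable
  also have "\<dots> = (\<integral>\<^sup>+s. avg \<Theta> (pair_map F) g (back_iter F n s x, back_iter F (Suc n) s x) \<partial>stream_space \<Theta>)"
    by (simp add: avg_def pair_map_def)
  also have "\<dots> = (\<integral>\<^sup>+\<theta>. (avg \<Theta> (pair_map F) ^^ n) (avg \<Theta> (pair_map F) g) (x, F \<theta> x) \<partial>\<Theta>)"
    by (rule Suc(1)) simp
  finally show ?case by (simp add: funpow_swap1)
qed

end

section \<open>Random maps with an environment chain\<close>

text \<open>
  The history moves with the current state of the environment; the random map \<open>fst \<theta>\<close> then gives the next
  state. Sampling a map of the whole state set couples the environment chains from all starting points.
\<close>

definition env_step :: "('x \<Rightarrow> 's \<Rightarrow> 'w \<Rightarrow> 'x) \<Rightarrow> ('s \<Rightarrow> 's) \<times> 'w \<Rightarrow> 'x \<times> 's \<Rightarrow> 'x \<times> 's" where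
  "env_step step \<theta> x = (step (fst x) (snd x) (snd \<theta>), (fst \<theta>) (snd x))"

definition env_noise :: "('s \<Rightarrow> 's) pmf \<Rightarrow> 'w measure \<Rightarrow> (('s \<Rightarrow> 's) \<times> 'w) measure" where
  "env_noise \<Phi> N = measure_pmf \<Phi> \<Otimes>\<^sub>M N"

locale environment_maps = noise: prob_space N for N :: "'w measure" +
  fixes X :: "'x measure" and step :: "'x \<Rightarrow> 's::finite \<Rightarrow> 'w \<Rightarrow> 'x" and \<Phi> :: "('s \<Rightarrow> 's) pmf"
  assumes step_measurable: "\<And>i. (\<lambda>z. step (fst z) i (snd z)) \<in> measurable (X \<Otimes>\<^sub>M N) X"
begin

lemma step_measurable' [measurable (raw)]:
  assumes "f \<in> measurable A X" "g \<in> measurable A N"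
  shows "(\<lambda>x. step (f x) i (g x)) \<in> measurable A X"
  using measurable_compose[OF measurable_Pair[OF assms] step_measurable[of i]] by simp

sublocale random_maps "env_noise \<Phi> N" "X \<Otimes>\<^sub>M count_space UNIV" "env_step step"
proof (rule random_maps.intro)
  interpret pp: pair_prob_space "measure_pmf \<Phi>" N ..
  show "prob_space (env_noise \<Phi> N)" unfolding env_noise_def by (rule pp.prob_space_axioms)
  have 1: "(\<lambda>z. step (fst (snd z)) i (snd (fst z))) \<in> measurable ((count_space UNIV \<Otimes>\<^sub>M N) \<Otimes>\<^sub>M (X \<Otimes>\<^sub>M count_space UNIV)) X" for i
    by measurable
  have 2: "(\<lambda>z. step (fst (snd z)) (snd (snd z)) (snd (fst z))) \<in> measurable ((count_space UNIV \<Otimes>\<^sub>M N) \<Otimes>\<^sub>M (X \<Otimes>\<^sub>M count_space (UNIV::'s set))) X"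
    by (rule measurable_compose_countable[where f="\<lambda>i z. step (fst (snd z)) i (snd (fst z))" and g="\<lambda>z. snd (snd z)"]) (rule 1, measurable)
  have 3: "(\<lambda>z. (fst (fst z)) (snd (snd z))) \<in> measurable ((count_space (UNIV::('s\<Rightarrow>'s) set) \<Otimes>\<^sub>M N) \<Otimes>\<^sub>M (X \<Otimes>\<^sub>M count_space UNIV)) (count_space UNIV)"
  proof (rule measurable_compose_countable[where f="\<lambda>i z. (fst (fst z)) i" and g="\<lambda>z. snd (snd z)"])
    fix i
    show "(\<lambda>z. fst (fst z) i) \<in> measurable ((count_space (UNIV::('s\<Rightarrow>'s) set) \<Otimes>\<^sub>M N) \<Otimes>\<^sub>M (X \<Otimes>\<^sub>M count_space UNIV)) (count_space UNIV)"
      by (rule measurable_compose[where f="\<lambda>z. fst (fst z)" and g="\<lambda>f. f i" and N="count_space UNIV"]) auto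
  qed measurable
  have "sets (env_noise \<Phi> N) = sets (count_space UNIV \<Otimes>\<^sub>M N)"
    unfolding env_noise_def by (intro sets_pair_measure_cong) auto
  then show "random_maps_axioms (env_noise \<Phi> N) (X \<Otimes>\<^sub>M count_space UNIV) (env_step step)"
    unfolding random_maps_axioms_def env_step_def
    by (subst measurable_cong_sets[OF sets_pair_measure_cong[OF _ refl] refl]) (auto intro!: measurable_Pair 2 3)
qed

lemma avg_env:
  assumes [measurable]: "g \<in> borel_measurable (X \<Otimes>\<^sub>M count_space UNIV)" and x: "x \<in> space X"
  shows "avg (env_noise \<Phi> N) (env_step step) g (x, i) =
    (\<Sum>j\<in>UNIV. ennreal (pmf (map_pmf (\<lambda>f. f i) \<Phi>) j) * (\<integral>\<^sup>+w. g (step x i w, j) \<partial>N))"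
proof -
  note x[simp]
  interpret pp: pair_prob_space "measure_pmf \<Phi>" N ..
  have [measurable]: "(\<lambda>\<theta>. g (step x i (snd \<theta>), fst \<theta> i)) \<in> borel_measurable (measure_pmf \<Phi> \<Otimes>\<^sub>M N)"
  proof (subst measurable_cong_sets[OF sets_pair_measure_cong[OF sets_measure_pmf_count_space refl] refl])
    have [measurable]: "(\<lambda>\<theta>. fst \<theta> i) \<in> measurable (count_space UNIV \<Otimes>\<^sub>M N) (count_space (UNIV::'s set))"
      by (rule measurable_compose[where f="\<lambda>z. fst z" and g="\<lambda>f. f i" and N="count_space UNIV"]) auto
    show "(\<lambda>\<theta>. g (step x i (snd \<theta>), fst \<theta> i)) \<in> borel_measurable (count_space UNIV \<Otimes>\<^sub>M N)"
      by (rule measurable_compose[OF _ assms(1)]) (auto intro!: measurable_Pair)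
  qed
  have "avg (env_noise \<Phi> N) (env_step step) g (x, i) = (\<integral>\<^sup>+f. \<integral>\<^sup>+w. g (step x i w, f i) \<partial>N \<partial>measure_pmf \<Phi>)"
    unfolding avg_def env_noise_def env_step_def
    by (subst noise.nn_integral_fst[symmetric]) auto
  also have "\<dots> = (\<integral>\<^sup>+j. \<integral>\<^sup>+w. g (step x i w, j) \<partial>N \<partial>measure_pmf (map_pmf (\<lambda>f. f i) \<Phi>))"
    by simp
  also have "\<dots> = (\<Sum>j\<in>UNIV. ennreal (pmf (map_pmf (\<lambda>f. f i) \<Phi>) j) * (\<integral>\<^sup>+w. g (step x i w, j) \<partial>N))"
    by (subst nn_integral_measure_pmf_support[of UNIV]) (auto simp: mult.commute)
  finally show ?thesis .
qed

end

section \<open>Second moments of a linear delay recursion\<close>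

text \<open>
  The constant of the maximal inequality \<open>top_second_moment\<close>. It is written out to show that it is the same
  for all step sizes: \<open>T\<close> is the length of the history, which is \<open>\<tau>\<close> on every grid.
\<close>

definition moment_const :: "real \<Rightarrow> real \<Rightarrow> real \<Rightarrow> real \<Rightarrow> real \<Rightarrow> real" where
  "moment_const D C a K T = 2 * exp (2 * T) * (D + T * ((2 * K + 2) * (D * C * (1 + 1 / a)) + 1))
     + 2 * (D * C * (1 + 1 / a))"

text \<open>
  \<open>Z l x\<close> stands for a nonnegative quantity attached to the history \<open>x\<close> at the position \<open>l\<close> steps back,
  and \<open>wt\<close> for the delay weights. Two instances are used: the norm of the grid values of one solution, and
  the distance between two solutions with a common environment, where \<open>\<kappa>\<close> vanishes. The assumptions
  on \<open>r\<close> make \<open>r ^ l\<close> a weight under which older values do not hurt: \<open>r\<close> is at most every one-step factor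
  \<open>c1 i + c2 i * D\<close>, and over a whole history the weight loses at most the factor \<open>D\<close>.
\<close>

locale delay_recursion = environment_maps N X step \<Phi>
  for N :: "'w measure" and X :: "'x measure" and step :: "'x \<Rightarrow> 's::finite \<Rightarrow> 'w \<Rightarrow> 'x"
    and \<Phi> :: "('s \<Rightarrow> 's) pmf" +
  fixes Z :: "nat \<Rightarrow> 'x \<Rightarrow> real" and wt :: "nat \<Rightarrow> real" and c1 c2 u :: "'s \<Rightarrow> real"
    and M :: nat and \<delta> r a D K U um \<kappa> :: real
  assumes Z_measurable [measurable]: "\<And>l. Z l \<in> borel_measurable X"
    and Z_nonneg: "\<And>l x. x \<in> space X \<Longrightarrow> 0 \<le> Z l x"
    and Z_shift: "\<And>l x i w. l < M \<Longrightarrow> x \<in> space X \<Longrightarrow> w \<in> space N \<Longrightarrow> Z (Suc l) (step x i w) = Z l x"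
    and second_moment_step: "\<And>x i. x \<in> space X \<Longrightarrow>
      (\<integral>\<^sup>+w. ennreal ((Z 0 (step x i w))\<^sup>2) \<partial>N) \<le> ennreal (c1 i * (Z 0 x)\<^sup>2 + c2 i * (\<Sum>l\<le>M. wt l * (Z l x)\<^sup>2) + \<kappa> * \<delta>)"
    and deviation_step: "\<And>x i m. x \<in> space X \<Longrightarrow> 0 \<le> m \<Longrightarrow>
      (\<integral>\<^sup>+w. ennreal ((m - Z 0 (step x i w))\<^sup>2) \<partial>N)
        \<le> ennreal ((m - Z 0 x)\<^sup>2 + \<delta> * (m\<^sup>2 + K * ((Z 0 x)\<^sup>2 + (\<Sum>l\<le>M. wt l * (Z l x)\<^sup>2)) + \<kappa>))"
    and wt_nonneg: "\<And>l. 0 \<le> wt l" and wt_sum: "(\<Sum>l\<le>M. wt l) = 1"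
    and c1_nonneg: "\<And>i. 0 \<le> c1 i" and c2_nonneg: "\<And>i. 0 \<le> c2 i"
    and r: "0 < r" "r \<le> 1" "1 \<le> D * r ^ M" "r \<le> 1 - a * \<delta>" "\<And>i. r \<le> c1 i + c2 i * D"
    and lyapunov: "\<And>i. (c1 i + c2 i * D) * (\<Sum>j\<in>UNIV. pmf (map_pmf (\<lambda>f. f i) \<Phi>) j * u j) \<le> (1 - a * \<delta>) * u i"
    and u: "\<And>i. um \<le> u i" "\<And>i. u i \<le> U" "0 < um"
    and pos: "0 < a" "0 < \<delta>" "0 \<le> \<kappa>" "0 \<le> K"
begin

abbreviation "p i j \<equiv> pmf (map_pmf (\<lambda>f. f i) \<Phi>) j"
abbreviation "P \<equiv> avg (env_noise \<Phi> N) (env_step step)"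

lemma p_sum: "(\<Sum>j\<in>UNIV. p i j) = 1"
  by (rule sum_pmf_eq_1) auto

lemma u_pos: "0 < u i" using u(1,3) by (rule less_le_trans[rotated])

lemma U_pos: "0 < U" using u_pos[of undefined] u(2)[of undefined] by linarith

lemma D_ge_1: "1 \<le> D"
proof -
  have "0 < r ^ M" "r ^ M \<le> 1" using r by (auto simp: power_le_one)
  then show ?thesis using r(3) by (smt (verit) mult_le_cancel_left1 mult_pos_pos mult_neg_pos mult_left_le)
qed

lemma one_minus: "0 < 1 - a * \<delta>" "1 - a * \<delta> < 1" using r(1,4) pos by auto

text \<open>
  Averaging over the Brownian noise for a fixed environment turns a bound \<open>A\<close> for all the weighted moments
  into \<open>(c1 i + c2 i * D) * A + \<kappa> * \<delta>\<close>: at positions \<open>l > 0\<close> the shift costs the factor \<open>r\<close>, and at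
  position \<open>0\<close> every moment under the delay mean is at most \<open>D * A\<close>. The environment then contributes its
  average, which \<open>u\<close> controls. The induction therefore runs over all laws of the history at once, with
  the environment state kept deterministic.
\<close>

lemma weighted_moment:
  assumes "sets law = sets X" "prob_space law" "0 \<le> A"
    and "\<And>l. l \<le> M \<Longrightarrow> (\<integral>\<^sup>+x. ennreal (r ^ l * (Z l x)\<^sup>2) \<partial>law) \<le> ennreal A" and l: "l \<le> M"
  shows "(\<integral>\<^sup>+x. (P ^^ k) (\<lambda>z. ennreal (u (snd z) * (r ^ l * (Z l (fst z))\<^sup>2))) (x, i) \<partial>law)
    \<le> ennreal ((1 - a * \<delta>) ^ k * u i * A + \<kappa> * U / a * (1 - (1 - a * \<delta>) ^ k))"
  using assms(1-4)
proof (induction k arbitrary: law i A)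
  case 0
  have [measurable_cong]: "sets law = sets X" by fact
  have "(\<integral>\<^sup>+x. ennreal (u i * (r ^ l * (Z l x)\<^sup>2)) \<partial>law) = ennreal (u i) * (\<integral>\<^sup>+x. ennreal (r ^ l * (Z l x)\<^sup>2) \<partial>law)"
    using u_pos[of i] r by (subst nn_integral_cmult[symmetric]) (auto simp: ennreal_mult intro!: nn_integral_cong)
  also have "\<dots> \<le> ennreal (u i) * ennreal A" using 0 l by (intro mult_left_mono) auto
  finally show ?case using u_pos[of i] 0 by (simp add: ennreal_mult)
next
  case (Suc k)
  interpret law: prob_space law by fact
  have sets_law [measurable_cong]: "sets law = sets X" by fact
  have space_law: "space law = space X" using sets_law by (rule sets_eq_imp_space_eq)
  define g where "g = (\<lambda>z. ennreal (u (snd z) * (r ^ l * (Z l (fst z))\<^sup>2)))"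
  have [measurable]: "(\<lambda>z. u (snd z)) \<in> borel_measurable (X \<Otimes>\<^sub>M count_space UNIV)"
    by (rule measurable_compose[OF measurable_snd]) simp
  have g [measurable]: "g \<in> borel_measurable (X \<Otimes>\<^sub>M count_space UNIV)" unfolding g_def by measurable
  have [measurable]: "(P ^^ k) g \<in> borel_measurable (X \<Otimes>\<^sub>M count_space UNIV)" by (rule avg_pow_measurable[OF g])
  \<comment> \<open>The law of the history after one step in the environment state \<open>i\<close>.\<close>
  define law' where "law' = distr (law \<Otimes>\<^sub>M N) X (\<lambda>z. step (fst z) i (snd z))"
  interpret pp: pair_prob_space law N ..
  have step_m [measurable]: "(\<lambda>z. step (fst z) i (snd z)) \<in> measurable (law \<Otimes>\<^sub>M N) X" by measurable
  have law': "sets law' = sets X" "prob_space law'"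
    unfolding law'_def by (simp, rule pp.prob_space_distr, measurable)
  have int_law': "(\<integral>\<^sup>+x. f x \<partial>law') = (\<integral>\<^sup>+x. \<integral>\<^sup>+w. f (step x i w) \<partial>N \<partial>law)" if [measurable]: "f \<in> borel_measurable X" for f
    unfolding law'_def by (simp add: nn_integral_distr noise.nn_integral_fst[symmetric])
  define G where "G = c1 i + c2 i * D"
  define A' where "A' = G * A + \<kappa> * \<delta>"
  have G: "r \<le> G" "0 \<le> G" using r unfolding G_def by (auto intro: order.trans less_imp_le)
  have A': "0 \<le> A'" unfolding A'_def using G Suc.prems pos by simp
  have bound: "(\<integral>\<^sup>+x. ennreal (r ^ l * (Z l x)\<^sup>2) \<partial>law') \<le> ennreal A'" if "l \<le> M" for l
  proof (cases l)
    case (Suc l')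
    have "(\<integral>\<^sup>+x. ennreal (r ^ l * (Z l x)\<^sup>2) \<partial>law') = (\<integral>\<^sup>+x. \<integral>\<^sup>+w. ennreal (r ^ l * (Z l' x)\<^sup>2) \<partial>N \<partial>law)"
      using Z_shift Suc that by (subst int_law') (simp, intro nn_integral_cong, simp add: space_law)
    also have "\<dots> = (\<integral>\<^sup>+x. ennreal r * ennreal (r ^ l' * (Z l' x)\<^sup>2) \<partial>law)"
      using r by (auto simp: noise.emeasure_space_1 Suc ennreal_mult[symmetric] mult.assoc)
    also have "\<dots> = ennreal r * (\<integral>\<^sup>+x. ennreal (r ^ l' * (Z l' x)\<^sup>2) \<partial>law)"
      by (rule nn_integral_cmult) measurable
    also have "\<dots> \<le> ennreal r * ennreal A"
      using Suc that by (intro mult_left_mono Suc.prems) auto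
    also have "\<dots> \<le> ennreal A'"
      unfolding A'_def using Suc.prems r G pos by (simp add: ennreal_mult[symmetric] add_increasing2 mult_right_mono)
    finally show ?thesis .
  next
    case 0
    have Zl: "(\<integral>\<^sup>+x. ennreal ((Z l x)\<^sup>2) \<partial>law) \<le> ennreal (D * A)" if "l \<le> M" for l
    proof -
      have "1 \<le> D * r ^ l"
        using r D_ge_1 that by (intro order.trans[OF r(3)] mult_left_mono power_decreasing) auto
      then have "(\<integral>\<^sup>+x. ennreal ((Z l x)\<^sup>2) \<partial>law) \<le> (\<integral>\<^sup>+x. ennreal D * ennreal (r ^ l * (Z l x)\<^sup>2) \<partial>law)"
      proof (intro nn_integral_mono)
        fix x
        have "1 * (Z l x)\<^sup>2 \<le> D * r ^ l * (Z l x)\<^sup>2" using \<open>1 \<le> D * r ^ l\<close> by (intro mult_right_mono) auto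
        then show "ennreal ((Z l x)\<^sup>2) \<le> ennreal D * ennreal (r ^ l * (Z l x)\<^sup>2)"
          using r D_ge_1 by (simp add: ennreal_mult[symmetric] mult.assoc ennreal_leI)
      qed
      also have "\<dots> = ennreal D * (\<integral>\<^sup>+x. ennreal (r ^ l * (Z l x)\<^sup>2) \<partial>law)"
        by (rule nn_integral_cmult) measurable
      also have "\<dots> \<le> ennreal D * ennreal A" using that by (intro mult_left_mono Suc.prems) auto
      finally show ?thesis using D_ge_1 Suc.prems by (simp add: ennreal_mult)
    qed
    have Z0: "(\<integral>\<^sup>+x. ennreal ((Z 0 x)\<^sup>2) \<partial>law) \<le> ennreal A" using Suc.prems(4)[of 0] by simp
    have "(\<integral>\<^sup>+x. ennreal (r ^ l * (Z l x)\<^sup>2) \<partial>law') = (\<integral>\<^sup>+x. \<integral>\<^sup>+w. ennreal ((Z 0 (step x i w))\<^sup>2) \<partial>N \<partial>law)"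
      using 0 by (subst int_law') auto
    also have "\<dots> \<le> (\<integral>\<^sup>+x. ennreal (c1 i * (Z 0 x)\<^sup>2 + c2 i * (\<Sum>l\<le>M. wt l * (Z l x)\<^sup>2) + \<kappa> * \<delta>) \<partial>law)"
      by (intro nn_integral_mono second_moment_step) (simp add: space_law)
    also have "\<dots> = (\<integral>\<^sup>+x. ennreal (c1 i) * ennreal ((Z 0 x)\<^sup>2) + ennreal (c2 i) * (\<Sum>l\<le>M. ennreal (wt l) * ennreal ((Z l x)\<^sup>2)) + ennreal (\<kappa> * \<delta>) \<partial>law)"
      using c1_nonneg c2_nonneg wt_nonneg pos
      by (intro nn_integral_cong) (simp add: ennreal_plus ennreal_mult sum_nonneg sum_ennreal[symmetric] del: sum_ennreal)
    also have "\<dots> = ennreal (c1 i) * (\<integral>\<^sup>+x. ennreal ((Z 0 x)\<^sup>2) \<partial>law) + ennreal (c2 i) * (\<Sum>l\<le>M. ennreal (wt l) * (\<integral>\<^sup>+x. ennreal ((Z l x)\<^sup>2) \<partial>law)) + ennreal (\<kappa> * \<delta>)"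
      by (simp add: nn_integral_add nn_integral_cmult nn_integral_sum law.emeasure_space_1)
    also have "\<dots> \<le> ennreal (c1 i) * ennreal A + ennreal (c2 i) * (\<Sum>l\<le>M. ennreal (wt l) * ennreal (D * A)) + ennreal (\<kappa> * \<delta>)"
      by (intro add_mono mult_left_mono sum_mono Zl Z0) auto
    also have "(\<Sum>l\<le>M. ennreal (wt l) * ennreal (D * A)) = ennreal (D * A)"
      using wt_nonneg wt_sum by (simp add: sum_distrib_right[symmetric] sum_ennreal)
    also have "ennreal (c1 i) * ennreal A + ennreal (c2 i) * ennreal (D * A) + ennreal (\<kappa> * \<delta>) = ennreal A'"
      unfolding A'_def G_def using c1_nonneg[of i] c2_nonneg[of i] Suc.prems D_ge_1 pos
      by (simp add: ennreal_mult[symmetric] ennreal_plus[symmetric] algebra_simps del: ennreal_plus)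
    finally show ?thesis .
  qed
  let ?q = "1 - a * \<delta>"
  define c where "c = \<kappa> * U / a * (1 - ?q ^ k)"
  have q: "0 \<le> ?q" "?q ^ k \<le> 1" using one_minus by (auto intro: power_le_one)
  have c: "0 \<le> c" unfolding c_def using pos U_pos q by auto
  have "(\<integral>\<^sup>+x. (P ^^ Suc k) g (x, i) \<partial>law)
     = (\<integral>\<^sup>+x. (\<Sum>j\<in>UNIV. ennreal (p i j) * (\<integral>\<^sup>+w. (P ^^ k) g (step x i w, j) \<partial>N)) \<partial>law)"
    unfolding funpow.simps o_def by (intro nn_integral_cong avg_env avg_pow_measurable g) (simp add: space_law)
  also have "\<dots> = (\<Sum>j\<in>UNIV. ennreal (p i j) * (\<integral>\<^sup>+x. \<integral>\<^sup>+w. (P ^^ k) g (step x i w, j) \<partial>N \<partial>law))"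
    by (simp add: nn_integral_sum nn_integral_cmult)
  also have "\<dots> = (\<Sum>j\<in>UNIV. ennreal (p i j) * (\<integral>\<^sup>+x. (P ^^ k) g (x, j) \<partial>law'))"
    by (subst int_law') auto
  also have "\<dots> \<le> (\<Sum>j\<in>UNIV. ennreal (p i j) * ennreal (?q ^ k * u j * A' + c))"
    unfolding g_def c_def by (intro sum_mono mult_left_mono Suc.IH law' A' bound) auto
  also have "\<dots> = ennreal (\<Sum>j\<in>UNIV. p i j * (?q ^ k * u j * A' + c))"
  proof -
    have "0 \<le> ?q ^ k * u j * A' + c" for j using q A' c u_pos[of j] by (auto intro!: add_nonneg_nonneg mult_nonneg_nonneg)
    then show ?thesis by (simp add: ennreal_mult[symmetric] sum_ennreal)
  qed
  also have "(\<Sum>j\<in>UNIV. p i j * (?q ^ k * u j * A' + c)) = ?q ^ k * (A' * (\<Sum>j\<in>UNIV. p i j * u j)) + c"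
  proof -
    have "p i j * (?q ^ k * u j * A' + c) = ?q ^ k * A' * (p i j * u j) + c * p i j" for j by (simp add: algebra_simps)
    then have "(\<Sum>j\<in>UNIV. p i j * (?q ^ k * u j * A' + c)) = ?q ^ k * A' * (\<Sum>j\<in>UNIV. p i j * u j) + c * (\<Sum>j\<in>UNIV. p i j)"
      by (simp add: sum.distrib sum_distrib_left)
    then show ?thesis by (simp add: p_sum)
  qed
  also have "A' * (\<Sum>j\<in>UNIV. p i j * u j) \<le> ?q * u i * A + \<kappa> * \<delta> * U"
  proof -
    have "(\<Sum>j\<in>UNIV. p i j * u j) \<le> (\<Sum>j\<in>UNIV. p i j * U)" by (intro sum_mono mult_left_mono u) auto
    then have "(\<Sum>j\<in>UNIV. p i j * u j) \<le> U" using p_sum[of i] by (simp add: sum_distrib_right[symmetric])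
    then have "\<kappa> * \<delta> * (\<Sum>j\<in>UNIV. p i j * u j) \<le> \<kappa> * \<delta> * U" using pos by (intro mult_left_mono) auto
    moreover have "A * (G * (\<Sum>j\<in>UNIV. p i j * u j)) \<le> A * (?q * u i)"
      using lyapunov[of i] Suc.prems unfolding G_def by (intro mult_left_mono) auto
    ultimately show ?thesis unfolding A'_def by (simp add: algebra_simps)
  qed
  also have "?q ^ k * (?q * u i * A + \<kappa> * \<delta> * U) + c = ?q ^ Suc k * u i * A + \<kappa> * U / a * (1 - ?q ^ Suc k)"
    unfolding c_def using pos by (simp add: field_simps)
  finally show ?case using q unfolding g_def by (simp add: ennreal_leI mult_left_mono)
qed

definition "C0 = D * U / um"

lemma C0_pos: "0 < C0" unfolding C0_def using D_ge_1 U_pos u by simp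

lemma second_moment:
  assumes x: "x \<in> space X" and R: "0 \<le> R" "\<And>l. l \<le> M \<Longrightarrow> Z l x \<le> R" and l: "l \<le> M"
  shows "(P ^^ k) (\<lambda>z. ennreal ((Z l (fst z))\<^sup>2)) (x, i) \<le> ennreal (C0 * ((1 - a * \<delta>) ^ k * R\<^sup>2 + \<kappa> / a))"
proof -
  note x[simp]
  let ?q = "1 - a * \<delta>"
  have [measurable]: "(\<lambda>z. u (snd z)) \<in> borel_measurable (X \<Otimes>\<^sub>M count_space UNIV)"
    by (rule measurable_compose[OF measurable_snd]) simp
  have [measurable]: "(P ^^ k) (\<lambda>z. ennreal (u (snd z) * (r ^ l * (Z l (fst z))\<^sup>2))) \<in> borel_measurable (X \<Otimes>\<^sub>M count_space UNIV)"
    by (rule avg_pow_measurable) measurable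
  have "(P ^^ k) (\<lambda>z. ennreal ((Z l (fst z))\<^sup>2)) (x, i)
      \<le> (P ^^ k) (\<lambda>z. ennreal (D / um) * ennreal (u (snd z) * (r ^ l * (Z l (fst z))\<^sup>2))) (x, i)"
  proof (rule avg_pow_mono)
    fix y :: "'x \<times> 's"
    have "1 \<le> D * r ^ l"
      using r D_ge_1 l by (intro order.trans[OF r(3)] mult_left_mono power_decreasing) auto
    moreover have "1 \<le> u (snd y) / um" using u by simp
    ultimately have "1 * 1 \<le> (D * r ^ l) * (u (snd y) / um)" using r D_ge_1 by (intro mult_mono) auto
    then have "1 * (Z l (fst y))\<^sup>2 \<le> (D * r ^ l) * (u (snd y) / um) * (Z l (fst y))\<^sup>2" by (intro mult_right_mono) auto
    also have "\<dots> = D / um * (u (snd y) * (r ^ l * (Z l (fst y))\<^sup>2))" by simp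
    finally show "ennreal ((Z l (fst y))\<^sup>2) \<le> ennreal (D / um) * ennreal (u (snd y) * (r ^ l * (Z l (fst y))\<^sup>2))"
      using D_ge_1 u u_pos[of "snd y"] r by (simp add: ennreal_mult[symmetric] ennreal_leI)
  qed (simp add: space_pair_measure)
  also have "\<dots> = ennreal (D / um) * (P ^^ k) (\<lambda>z. ennreal (u (snd z) * (r ^ l * (Z l (fst z))\<^sup>2))) (x, i)"
    by (rule avg_pow_cmult) (auto simp: space_pair_measure)
  also have "(P ^^ k) (\<lambda>z. ennreal (u (snd z) * (r ^ l * (Z l (fst z))\<^sup>2))) (x, i)
     = (\<integral>\<^sup>+y. (P ^^ k) (\<lambda>z. ennreal (u (snd z) * (r ^ l * (Z l (fst z))\<^sup>2))) (y, i) \<partial>return X x)"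
    by (subst nn_integral_return) (auto simp: space_pair_measure)
  also have "\<dots> \<le> ennreal (?q ^ k * u i * R\<^sup>2 + \<kappa> * U / a * (1 - ?q ^ k))"
  proof (rule weighted_moment[OF _ _ _ _ l])
    show "(\<integral>\<^sup>+y. ennreal (r ^ l * (Z l y)\<^sup>2) \<partial>return X x) \<le> ennreal (R\<^sup>2)" if "l \<le> M" for l
    proof -
      have "r ^ l * (Z l x)\<^sup>2 \<le> 1 * R\<^sup>2"
        using r R that Z_nonneg[OF x] by (intro mult_mono power_mono power_le_one) auto
      then show ?thesis by (subst nn_integral_return) (auto intro!: ennreal_leI)
    qed
  qed (auto intro: prob_space_return)
  also have "ennreal (D / um) * \<dots> \<le> ennreal (C0 * (?q ^ k * R\<^sup>2 + \<kappa> / a))"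
  proof -
    have q: "0 \<le> ?q" "0 \<le> ?q ^ k" "?q ^ k \<le> 1" using one_minus by (auto intro: power_le_one)
    have "?q ^ k * u i * R\<^sup>2 + \<kappa> * U / a * (1 - ?q ^ k) \<le> ?q ^ k * U * R\<^sup>2 + \<kappa> * U / a * 1"
      using q u pos U_pos by (intro add_mono mult_left_mono mult_right_mono) auto
    then have "D / um * (?q ^ k * u i * R\<^sup>2 + \<kappa> * U / a * (1 - ?q ^ k)) \<le> D / um * (?q ^ k * U * R\<^sup>2 + \<kappa> * U / a * 1)"
      using D_ge_1 u by (intro mult_left_mono) auto
    also have "\<dots> = C0 * (?q ^ k * R\<^sup>2 + \<kappa> / a)" unfolding C0_def by (simp add: field_simps)
    finally show ?thesis using D_ge_1 u q pos U_pos u_pos[of i]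
      by (subst ennreal_mult[symmetric]) (auto intro!: ennreal_leI add_nonneg_nonneg mult_nonneg_nonneg divide_nonneg_nonneg)
  qed
  finally show ?thesis by (simp add: mult_left_mono)
qed

definition top :: "nat \<Rightarrow> 'x \<Rightarrow> real" where "top j x = Max ((\<lambda>l. Z l x) ` {..j})"

lemma top_measurable [measurable]: "top j \<in> borel_measurable X"
  unfolding top_def[abs_def] by measurable

lemma top_ge: "l \<le> j \<Longrightarrow> Z l x \<le> top j x"
  unfolding top_def by (intro Max_ge) auto

lemma top_le: "(\<And>l. l \<le> j \<Longrightarrow> Z l x \<le> R) \<Longrightarrow> top j x \<le> R"
  unfolding top_def by (intro Max.boundedI) auto

lemma top_step:
  assumes "j < M" "x \<in> space X" "w \<in> space N"
  shows "top (Suc j) (step x i w) = max (Z 0 (step x i w)) (top j x)"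
proof -
  have "(\<lambda>l. Z l (step x i w)) ` {..Suc j} = insert (Z 0 (step x i w)) ((\<lambda>l. Z l x) ` {..j})"
    using assms Z_shift[of _ x w i] unfolding atMost_Suc_eq_insert_0 image_insert image_image
    by (intro arg_cong2[where f=insert] image_cong) auto
  then show ?thesis unfolding top_def by (simp add: Max_insert)
qed

text \<open>
  The gap between the running maximum and the current value does not grow when a new maximum is reached:
  the gap is then zero. So only the downward movements of the current value matter, and these are
  controlled by one-step moments, in place of a martingale inequality.
\<close>

definition dev :: "nat \<Rightarrow> 'x \<Rightarrow> real" where "dev j x = (top j x - Z 0 x)\<^sup>2"

lemma dev_measurable [measurable]: "dev j \<in> borel_measurable X"
  unfolding dev_def[abs_def] by measurable

lemma dev_nonneg: "0 \<le> dev j x" unfolding dev_def by simp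

lemma dev_avg:
  assumes "j < M" and z: "z \<in> space (X \<Otimes>\<^sub>M count_space UNIV)"
  shows "P (\<lambda>z. ennreal (dev (Suc j) (fst z))) z \<le>
    ennreal ((1 + 2 * \<delta>) * dev j (fst z)
      + \<delta> * ((K + 2) * (Z 0 (fst z))\<^sup>2 + K * (\<Sum>l\<le>M. wt l * (Z l (fst z))\<^sup>2) + \<kappa>))"
proof -
  obtain x i where zxi: "z = (x, i)" by fastforce
  have x[simp]: "x \<in> space X" using z zxi by (simp add: space_pair_measure)
  have top0: "0 \<le> top j x" using top_ge[of 0 j x] Z_nonneg[OF x, of 0] by simp
  have "P (\<lambda>z. ennreal (dev (Suc j) (fst z))) (x, i) = (\<Sum>j'\<in>UNIV. ennreal (p i j') * (\<integral>\<^sup>+w. ennreal (dev (Suc j) (step x i w)) \<partial>N))"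
    by (subst avg_env) auto
  also have "\<dots> = (\<integral>\<^sup>+w. ennreal (dev (Suc j) (step x i w)) \<partial>N)"
    using p_sum[of i] by (simp add: sum_distrib_right[symmetric] sum_ennreal)
  also have "\<dots> \<le> (\<integral>\<^sup>+w. ennreal ((top j x - Z 0 (step x i w))\<^sup>2) \<partial>N)"
    using assms by (intro nn_integral_mono ennreal_leI) (auto simp: dev_def top_step max_def)
  also have "\<dots> \<le> ennreal ((top j x - Z 0 x)\<^sup>2 + \<delta> * ((top j x)\<^sup>2 + K * ((Z 0 x)\<^sup>2 + (\<Sum>l\<le>M. wt l * (Z l x)\<^sup>2)) + \<kappa>))"
    by (rule deviation_step[OF x top0])
  also have "(top j x)\<^sup>2 \<le> 2 * dev j x + 2 * (Z 0 x)\<^sup>2"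
    using sum_squares_bound[of "top j x - Z 0 x" "Z 0 x"] unfolding dev_def by (simp add: power2_eq_square algebra_simps)
  finally show ?thesis using pos zxi
    by (simp add: dev_def[symmetric] algebra_simps ennreal_leI)
qed

lemma dev_bound:
  assumes x: "x \<in> space X" and b: "0 \<le> b" "\<And>n l. l \<le> M \<Longrightarrow> (P ^^ (k + n)) (\<lambda>z. ennreal ((Z l (fst z))\<^sup>2)) (x, i) \<le> ennreal b"
    and B: "0 \<le> B" "(P ^^ k) (\<lambda>z. ennreal (dev j (fst z))) (x, i) \<le> ennreal B" and "j + n \<le> M"
  shows "(P ^^ (k + n)) (\<lambda>z. ennreal (dev (j + n) (fst z))) (x, i)
    \<le> ennreal ((1 + 2 * \<delta>) ^ n * (B + real n * \<delta> * ((2 * K + 2) * b + \<kappa>)))"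
  using \<open>j + n \<le> M\<close>
proof (induction n)
  case 0
  then show ?case using B by simp
next
  case (Suc n)
  have xi[simp]: "(x, i) \<in> space (X \<Otimes>\<^sub>M count_space UNIV)" using x by (simp add: space_pair_measure)
  let ?m = "k + n" and ?E = "(2 * K + 2) * b + \<kappa>"
  have [measurable]: "(\<lambda>z. f (fst z)) \<in> borel_measurable (X \<Otimes>\<^sub>M count_space UNIV)" if "f \<in> borel_measurable X" for f :: "'x \<Rightarrow> ennreal"
    using that by measurable
  have "(P ^^ (k + Suc n)) (\<lambda>z. ennreal (dev (j + Suc n) (fst z))) (x, i)
      = (P ^^ ?m) (P (\<lambda>z. ennreal (dev (Suc (j + n)) (fst z)))) (x, i)"
    by (simp add: funpow_swap1)
  also have "\<dots> \<le> (P ^^ ?m) (\<lambda>z. ennreal (1 + 2 * \<delta>) * ennreal (dev (j + n) (fst z))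
      + ennreal \<delta> * (ennreal (K + 2) * ennreal ((Z 0 (fst z))\<^sup>2) + ennreal K * (\<Sum>l\<le>M. ennreal (wt l) * ennreal ((Z l (fst z))\<^sup>2)) + ennreal \<kappa>)) (x, i)"
  proof (rule avg_pow_mono[OF order.trans[OF dev_avg] xi])
    fix y
    show "ennreal ((1 + 2 * \<delta>) * dev (j + n) (fst y)
      + \<delta> * ((K + 2) * (Z 0 (fst y))\<^sup>2 + K * (\<Sum>l\<le>M. wt l * (Z l (fst y))\<^sup>2) + \<kappa>))
      \<le> ennreal (1 + 2 * \<delta>) * ennreal (dev (j + n) (fst y))
      + ennreal \<delta> * (ennreal (K + 2) * ennreal ((Z 0 (fst y))\<^sup>2) + ennreal K * (\<Sum>l\<le>M. ennreal (wt l) * ennreal ((Z l (fst y))\<^sup>2)) + ennreal \<kappa>)"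
      using pos wt_nonneg dev_nonneg
      by (simp add: ennreal_mult[symmetric] sum_nonneg ennreal_plus[symmetric] del: ennreal_plus)
  qed (use Suc.prems in auto)
  also have "\<dots> = ennreal (1 + 2 * \<delta>) * (P ^^ ?m) (\<lambda>z. ennreal (dev (j + n) (fst z))) (x, i)
      + ennreal \<delta> * (ennreal (K + 2) * (P ^^ ?m) (\<lambda>z. ennreal ((Z 0 (fst z))\<^sup>2)) (x, i)
        + ennreal K * (\<Sum>l\<le>M. ennreal (wt l) * (P ^^ ?m) (\<lambda>z. ennreal ((Z l (fst z))\<^sup>2)) (x, i)) + ennreal \<kappa>)"
    by (simp add: avg_pow_add avg_pow_cmult avg_pow_sum avg_pow_const)
  also have "\<dots> \<le> ennreal (1 + 2 * \<delta>) * ennreal ((1 + 2 * \<delta>) ^ n * (B + real n * \<delta> * ?E))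
      + ennreal \<delta> * (ennreal (K + 2) * ennreal b + ennreal K * (\<Sum>l\<le>M. ennreal (wt l) * ennreal b) + ennreal \<kappa>)"
    using Suc by (intro add_mono mult_left_mono sum_mono b) auto
  also have "(\<Sum>l\<le>M. ennreal (wt l) * ennreal b) = ennreal b"
    using wt_nonneg wt_sum by (simp add: sum_distrib_right[symmetric] sum_ennreal)
  also have "ennreal (1 + 2 * \<delta>) * ennreal ((1 + 2 * \<delta>) ^ n * (B + real n * \<delta> * ?E))
      + ennreal \<delta> * (ennreal (K + 2) * ennreal b + ennreal K * ennreal b + ennreal \<kappa>)
     = ennreal ((1 + 2 * \<delta>) ^ Suc n * (B + real n * \<delta> * ?E) + \<delta> * ?E)"
  proof -
    have 1: "0 \<le> (1 + 2 * \<delta>) ^ n * (B + real n * \<delta> * ?E)" using pos B b by (intro mult_nonneg_nonneg add_nonneg_nonneg) auto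
    have 2: "ennreal (1 + 2 * \<delta>) * ennreal ((1 + 2 * \<delta>) ^ n * (B + real n * \<delta> * ?E)) = ennreal ((1 + 2 * \<delta>) ^ Suc n * (B + real n * \<delta> * ?E))"
      using pos 1 by (subst ennreal_mult[symmetric]) (auto simp: mult.assoc)
    have 3: "ennreal \<delta> * (ennreal (K + 2) * ennreal b + ennreal K * ennreal b + ennreal \<kappa>) = ennreal (\<delta> * ?E)"
      using pos b by (simp add: ennreal_mult[symmetric] ennreal_plus[symmetric] algebra_simps del: ennreal_plus)
    have 4: "0 \<le> (1 + 2 * \<delta>) ^ Suc n * (B + real n * \<delta> * ?E)" "0 \<le> \<delta> * ?E"
      using pos B b by (auto intro!: mult_nonneg_nonneg add_nonneg_nonneg)
    show ?thesis unfolding 2 3 using 4 by (simp add: ennreal_plus[symmetric] del: ennreal_plus power_Suc)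
  qed
  also have "\<dots> \<le> ennreal ((1 + 2 * \<delta>) ^ Suc n * (B + real (Suc n) * \<delta> * ?E))"
  proof (rule ennreal_leI)
    have "1 \<le> (1 + 2 * \<delta>) ^ Suc n" using pos by (intro one_le_power) auto
    then have "1 * (\<delta> * ?E) \<le> (1 + 2 * \<delta>) ^ Suc n * (\<delta> * ?E)" using pos b by (intro mult_right_mono) auto
    then show "(1 + 2 * \<delta>) ^ Suc n * (B + real n * \<delta> * ?E) + \<delta> * ?E \<le> (1 + 2 * \<delta>) ^ Suc n * (B + real (Suc n) * \<delta> * ?E)"
      by (simp add: distrib_left distrib_right del: power_Suc)
  qed
  finally show ?case .
qed

text \<open>
  The recursion for \<open>dev\<close> is started \<open>M\<close> steps before the end, with the trivial maximum over one value,
  or, if fewer than \<open>M\<close> steps have been made, at time zero with the part of the initial history that is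
  still visible. Over \<open>M\<close> steps the factor \<open>1 + 2 * \<delta>\<close> accumulates to at most \<open>exp (2 * T)\<close>.
\<close>

lemma top_second_moment:
  assumes x: "x \<in> space X" and R: "0 \<le> R" "\<And>l. l \<le> M \<Longrightarrow> Z l x \<le> R"
    and T: "real M * \<delta> = T"
  shows "(P ^^ k) (\<lambda>z. ennreal ((top M (fst z))\<^sup>2)) (x, i)
    \<le> ennreal (moment_const D C0 a K T * ((1 - a * \<delta>) ^ k * R\<^sup>2 + \<kappa>))"
proof -
  have xi[simp]: "(x, i) \<in> space (X \<Otimes>\<^sub>M count_space UNIV)" using x by (simp add: space_pair_measure)
  let ?q = "1 - a * \<delta>"
  have q: "0 < ?q" "?q \<le> 1" "\<And>n. ?q ^ n \<le> 1" "\<And>n. 0 \<le> ?q ^ n" using one_minus by (auto intro: power_le_one)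
  have qM: "1 \<le> D * ?q ^ M"
  proof -
    have "D * r ^ M \<le> D * ?q ^ M" using r D_ge_1 by (intro mult_left_mono power_mono) auto
    then show ?thesis using r(3) by linarith
  qed
  define S where "S = ?q ^ k * R\<^sup>2 + \<kappa>"
  define dd where "dd = D * C0 * (1 + 1 / a)"
  define b where "b = dd * S"
  define E where "E = (2 * K + 2) * b + \<kappa>"
  have S0: "0 \<le> S" "\<kappa> \<le> S" unfolding S_def using q pos by auto
  have DC: "0 \<le> dd" unfolding dd_def using D_ge_1 C0_pos pos by auto
  have b0: "0 \<le> b" unfolding b_def using DC S0(1) by (rule mult_nonneg_nonneg)
  have T0: "0 \<le> T" using T pos by auto
  have bb: "C0 * (s * R\<^sup>2 + \<kappa> / a) \<le> b" if "s \<le> D * ?q ^ k" for s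
  proof -
    have "s * R\<^sup>2 + \<kappa> / a \<le> D * ?q ^ k * R\<^sup>2 + D * (\<kappa> / a)"
      using that D_ge_1 pos mult_right_mono[of 1 D "\<kappa> / a"] by (intro add_mono mult_right_mono) auto
    also have "\<dots> \<le> D * ?q ^ k * R\<^sup>2 + D * (\<kappa> / a) + (D * (?q ^ k * R\<^sup>2) / a + D * \<kappa>)"
      using D_ge_1 q pos by simp
    also have "\<dots> = D * (1 + 1 / a) * S" unfolding S_def by (simp add: field_simps)
    finally have "C0 * (s * R\<^sup>2 + \<kappa> / a) \<le> C0 * (D * (1 + 1 / a) * S)" using C0_pos by (intro mult_left_mono) auto
    then show ?thesis unfolding b_def dd_def by (simp add: mult_ac)
  qed
  have pow_le: "?q ^ m \<le> D * ?q ^ k" if "k \<le> m + M" for m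
  proof -
    have "?q ^ m * 1 \<le> ?q ^ m * (D * ?q ^ M)" using qM q by (intro mult_left_mono) auto
    also have "\<dots> = D * ?q ^ (m + M)" by (simp add: power_add)
    also have "\<dots> \<le> D * ?q ^ k" using D_ge_1 q that by (intro mult_left_mono power_decreasing) auto
    finally show ?thesis by simp
  qed
  have Zb: "(P ^^ m) (\<lambda>z. ennreal ((Z l (fst z))\<^sup>2)) (x, i) \<le> ennreal b" if "k \<le> m + M" "l \<le> M" for m l
    using second_moment[OF x R that(2), of m i] bb[OF pow_le[OF that(1)]] by (meson ennreal_leI order.trans)
  have exp_le: "(1 + 2 * \<delta>) ^ n \<le> exp (2 * T)" if "n \<le> M" for n
  proof -
    have "(1 + 2 * \<delta>) ^ n \<le> exp (2 * \<delta>) ^ n" using exp_ge_add_one_self[of "2 * \<delta>"] pos by (intro power_mono) auto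
    also have "\<dots> = exp (real n * (2 * \<delta>))" by (simp add: exp_of_nat_mult)
    also have "real n * (2 * \<delta>) \<le> real M * (2 * \<delta>)" using that pos by (intro mult_right_mono) auto
    also have "real M * (2 * \<delta>) = 2 * T" using T by simp
    finally show ?thesis by simp
  qed
  have devM: "(P ^^ k) (\<lambda>z. ennreal (dev M (fst z))) (x, i) \<le> ennreal (exp (2 * T) * (D * S + T * E))"
  proof -
    have key: "(1 + 2 * \<delta>) ^ n * (B + real n * \<delta> * E) \<le> exp (2 * T) * (D * S + T * E)"
      if "n \<le> M" "0 \<le> B" "B \<le> D * S" for n B
    proof -
      have E0: "0 \<le> E" unfolding E_def using pos b0 by auto
      have "real n * \<delta> \<le> T" unfolding T[symmetric] using that pos by (intro mult_right_mono) auto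
      then have "B + real n * \<delta> * E \<le> D * S + T * E" using that E0 by (intro add_mono mult_right_mono) auto
      then show ?thesis using exp_le[OF that(1)] pos that E0 by (intro mult_mono) auto
    qed
    show ?thesis
    proof (cases "M \<le> k")
      case True
      have "(P ^^ (k - M + M)) (\<lambda>z. ennreal (dev (0 + M) (fst z))) (x, i)
         \<le> ennreal ((1 + 2 * \<delta>) ^ M * (0 + real M * \<delta> * ((2 * K + 2) * b + \<kappa>)))"
      proof (rule dev_bound[OF x b0])
        show "(P ^^ (k - M)) (\<lambda>z. ennreal (dev 0 (fst z))) (x, i) \<le> ennreal 0"
          by (simp add: dev_def top_def avg_pow_const)
      qed (auto intro!: Zb)
      also have "\<dots> \<le> ennreal (exp (2 * T) * (D * S + T * E))"
        unfolding E_def[symmetric] using D_ge_1 S0 by (intro ennreal_leI key) auto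
      finally show ?thesis using True by simp
    next
      case False
      have "(P ^^ (0 + k)) (\<lambda>z. ennreal (dev (M - k + k) (fst z))) (x, i)
         \<le> ennreal ((1 + 2 * \<delta>) ^ k * (R\<^sup>2 + real k * \<delta> * ((2 * K + 2) * b + \<kappa>)))"
      proof (rule dev_bound[OF x b0])
        have "0 \<le> top (M - k) x - Z 0 x" "top (M - k) x - Z 0 x \<le> R"
          using top_ge[of 0 "M - k" x] top_le[of "M - k" x R] R Z_nonneg[OF x, of 0] by auto
        then have "dev (M - k) x \<le> R\<^sup>2" unfolding dev_def by (intro power_mono)
        then show "(P ^^ 0) (\<lambda>z. ennreal (dev (M - k) (fst z))) (x, i) \<le> ennreal (R\<^sup>2)"
          by (simp add: ennreal_leI)
      qed (use False in \<open>auto intro!: Zb\<close>)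
      also have "\<dots> \<le> ennreal (exp (2 * T) * (D * S + T * E))"
      proof -
        have "1 * R\<^sup>2 \<le> D * ?q ^ k * R\<^sup>2" using pow_le[of 0] False by (intro mult_right_mono) auto
        also have "\<dots> \<le> D * S" unfolding S_def using D_ge_1 pos by (simp add: distrib_left)
        finally show ?thesis unfolding E_def[symmetric] using False by (intro ennreal_leI key) auto
      qed
      finally show ?thesis using False by simp
    qed
  qed
  have "(P ^^ k) (\<lambda>z. ennreal ((top M (fst z))\<^sup>2)) (x, i)
     \<le> (P ^^ k) (\<lambda>z. 2 * ennreal (dev M (fst z)) + 2 * ennreal ((Z 0 (fst z))\<^sup>2)) (x, i)"
  proof (rule avg_pow_mono[OF _ xi])
    fix y :: "'x \<times> 's"
    have "(top M (fst y))\<^sup>2 \<le> 2 * dev M (fst y) + 2 * (Z 0 (fst y))\<^sup>2"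
      using sum_squares_bound[of "top M (fst y) - Z 0 (fst y)" "Z 0 (fst y)"] unfolding dev_def by (simp add: power2_eq_square algebra_simps)
    then have "ennreal ((top M (fst y))\<^sup>2) \<le> ennreal (2 * dev M (fst y) + 2 * (Z 0 (fst y))\<^sup>2)" by (rule ennreal_leI)
    then show "ennreal ((top M (fst y))\<^sup>2) \<le> 2 * ennreal (dev M (fst y)) + 2 * ennreal ((Z 0 (fst y))\<^sup>2)"
      using dev_nonneg[of M "fst y"] by (simp add: ennreal_plus ennreal_mult)
  qed
  also have "\<dots> = 2 * (P ^^ k) (\<lambda>z. ennreal (dev M (fst z))) (x, i) + 2 * (P ^^ k) (\<lambda>z. ennreal ((Z 0 (fst z))\<^sup>2)) (x, i)"
    by (simp add: avg_pow_add avg_pow_cmult)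
  also have "\<dots> \<le> 2 * ennreal (exp (2 * T) * (D * S + T * E)) + 2 * ennreal b"
    by (intro add_mono mult_left_mono devM Zb) auto
  also have "\<dots> = ennreal (2 * (exp (2 * T) * (D * S + T * E)) + 2 * b)"
  proof -
    have "0 \<le> exp (2 * T) * (D * S + T * E)" using D_ge_1 S0 T0 pos b0 unfolding E_def by auto
    then show ?thesis using b0 by (simp add: ennreal_plus ennreal_mult)
  qed
  also have "\<dots> \<le> ennreal (moment_const D C0 a K T * S)"
  proof (rule ennreal_leI)
    have "E \<le> ((2 * K + 2) * dd + 1) * S"
      unfolding E_def b_def using S0 by (simp add: algebra_simps)
    then have "exp (2 * T) * (D * S + T * E) \<le> exp (2 * T) * (D * S + T * (((2 * K + 2) * dd + 1) * S))"
      using T0 D_ge_1 by (intro mult_left_mono add_mono) auto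
    moreover have "moment_const D C0 a K T * S = 2 * (exp (2 * T) * (D * S + T * (((2 * K + 2) * dd + 1) * S))) + 2 * (dd * S)"
      unfolding moment_const_def dd_def[symmetric] by (simp add: algebra_simps)
    ultimately show "2 * (exp (2 * T) * (D * S + T * E)) + 2 * b \<le> moment_const D C0 a K T * S"
      unfolding b_def by linarith
  qed
  finally show ?thesis unfolding S_def .
qed

end

section \<open>The Euler--Maruyama step on histories\<close>

lemma hs_norm_eq_norm: "hs_norm A = norm A"
  unfolding hs_norm_def norm_vec_def L2_set_def by (simp add: sum_nonneg)

lemma norm_vec_power2: fixes x :: "real ^ 'n::finite" shows "(norm x)\<^sup>2 = (\<Sum>a\<in>UNIV. (x $ a)\<^sup>2)"
  unfolding norm_vec_def L2_set_def by (simp add: sum_nonneg)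

lemma continuous_matrix_vector_mult:
  "continuous_on UNIV (\<lambda>z :: (real ^ 'm::finite ^ 'n::finite) \<times> (real ^ 'm). fst z *v snd z)"
  unfolding matrix_vector_mult_def by (intro continuous_intros)

text \<open>
  The moment estimates use a Brownian increment through its mean and covariance.
\<close>

locale gaussian_increment = prob_space N for N :: "(real ^ 'm::finite) measure" +
  fixes \<delta> :: real
  assumes sets_N [measurable_cong, simp]: "sets N = sets borel"
    and mean_N: "\<And>i. has_bochner_integral N (\<lambda>w. w $ i) 0"
    and cov_N: "\<And>i j. has_bochner_integral N (\<lambda>w. w $ i * w $ j) (if i = j then \<delta> else 0)"
begin

lemma space_N [simp]: "space N = UNIV" using sets_eq_imp_space_eq[OF sets_N] by simp

lemma has_bochner_integral_affine_square:
  fixes p :: "real ^ 'n::finite" and B :: "real ^ 'm ^ 'n"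
  shows "has_bochner_integral N (\<lambda>w. c + q \<bullet> w + (norm (p + B *v w))\<^sup>2) (c + (norm p)\<^sup>2 + \<delta> * (norm B)\<^sup>2)"
proof -
  have c: "has_bochner_integral N (\<lambda>w. d) d" for d :: real
    using prob_space by (simp add: has_bochner_integral_iff)
  have eq: "c + q \<bullet> w + (norm (p + B *v w))\<^sup>2 = c + (\<Sum>i\<in>UNIV. q $ i * w $ i) +
     (\<Sum>a\<in>UNIV. (p $ a)\<^sup>2 + (\<Sum>i\<in>UNIV. 2 * p $ a * B $ a $ i * w $ i)
        + (\<Sum>i\<in>UNIV. \<Sum>j\<in>UNIV. B $ a $ i * B $ a $ j * (w $ i * w $ j)))" for w
    unfolding norm_vec_power2 inner_vec_def
    by (simp add: matrix_vector_mult_def power2_sum sum_distrib_left power2_eq_square sum_product algebra_simps)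
  have "has_bochner_integral N (\<lambda>w. c + q \<bullet> w + (norm (p + B *v w))\<^sup>2)
     (c + (\<Sum>i\<in>UNIV. q $ i * 0) +
     (\<Sum>a\<in>UNIV. (p $ a)\<^sup>2 + (\<Sum>i\<in>UNIV. 2 * p $ a * B $ a $ i * 0)
        + (\<Sum>i\<in>UNIV. \<Sum>j\<in>UNIV. B $ a $ i * B $ a $ j * (if i = j then \<delta> else 0))))"
    unfolding eq
    by (intro has_bochner_integral_add has_bochner_integral_sum has_bochner_integral_mult_right mean_N cov_N c)
  also have "(c + (\<Sum>i\<in>UNIV. q $ i * 0) +
     (\<Sum>a\<in>UNIV. (p $ a)\<^sup>2 + (\<Sum>i\<in>UNIV. 2 * p $ a * B $ a $ i * 0)
        + (\<Sum>i\<in>UNIV. \<Sum>j\<in>UNIV. B $ a $ i * B $ a $ j * (if i = j then \<delta> else 0))))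
     = c + (norm p)\<^sup>2 + \<delta> * (norm B)\<^sup>2"
  proof -
    have "(norm B)\<^sup>2 = (\<Sum>a\<in>UNIV. \<Sum>i\<in>UNIV. (B $ a $ i)\<^sup>2)"
      unfolding norm_vec_def[of B] L2_set_def by (simp add: sum_nonneg norm_vec_power2)
    moreover have "(\<Sum>j\<in>UNIV. B $ a $ i * B $ a $ j * (if i = j then \<delta> else 0)) = \<delta> * (B $ a $ i)\<^sup>2" for a i
      by (subst sum.remove[of _ i]) (auto simp: power2_eq_square)
    ultimately show ?thesis by (simp add: norm_vec_power2 sum.distrib sum_distrib_left)
  qed
  finally show ?thesis .
qed

lemma nn_integral_le_affine_square:
  fixes p :: "real ^ 'n::finite" and B :: "real ^ 'm ^ 'n"
  assumes "\<And>w. 0 \<le> f w" "\<And>w. f w \<le> c + q \<bullet> w + (norm (p + B *v w))\<^sup>2"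
  shows "(\<integral>\<^sup>+w. ennreal (f w) \<partial>N) \<le> ennreal (c + (norm p)\<^sup>2 + \<delta> * (norm B)\<^sup>2)"
proof -
  note * = has_bochner_integral_affine_square[of c q p B]
  have "(\<integral>\<^sup>+w. ennreal (f w) \<partial>N) \<le> (\<integral>\<^sup>+w. ennreal (c + q \<bullet> w + (norm (p + B *v w))\<^sup>2) \<partial>N)"
    by (intro nn_integral_mono ennreal_leI assms)
  also have "\<dots> = ennreal (\<integral>w. c + q \<bullet> w + (norm (p + B *v w))\<^sup>2 \<partial>N)"
  proof (intro nn_integral_eq_integral AE_I2)
    show "0 \<le> c + q \<bullet> w + (norm (p + B *v w))\<^sup>2" for w using assms[of w] by linarith
  qed (use * in \<open>auto simp: has_bochner_integral_iff\<close>)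
  finally show ?thesis using * by (simp add: has_bochner_integral_iff)
qed

text \<open>
  Expanding the square, the term linear in the noise has mean zero, and the drift contributes a further
  \<open>\<delta>\<^sup>2\<close> times its squared norm.
\<close>

lemma second_moment_one_step:
  fixes d B :: "real ^ 'n::finite" and S :: "real ^ 'm ^ 'n"
  assumes \<delta>: "0 < \<delta>" "\<delta> \<le> 1" and V: "0 \<le> V" and \<kappa>: "0 \<le> \<kappa>"
    and 1: "2 * (d \<bullet> B) + (norm S)\<^sup>2 \<le> \<alpha> * (norm d)\<^sup>2 + \<beta> * V + \<kappa>"
    and 2: "(norm B)\<^sup>2 \<le> L * ((norm d)\<^sup>2 + V) + \<kappa>"
  shows "(\<integral>\<^sup>+w. ennreal ((norm (d + \<delta> *\<^sub>R B + S *v w))\<^sup>2) \<partial>N)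
    \<le> ennreal ((1 + \<alpha> * \<delta> + L * \<delta>\<^sup>2) * (norm d)\<^sup>2 + (\<beta> * \<delta> + L * \<delta>\<^sup>2) * V + (4 * \<kappa>) * \<delta>)"
proof -
  have "(\<integral>\<^sup>+w. ennreal ((norm (d + \<delta> *\<^sub>R B + S *v w))\<^sup>2) \<partial>N) \<le> ennreal (0 + (norm (d + \<delta> *\<^sub>R B))\<^sup>2 + \<delta> * (norm S)\<^sup>2)"
    by (rule nn_integral_le_affine_square[where q=0]) auto
  also have "0 + (norm (d + \<delta> *\<^sub>R B))\<^sup>2 + \<delta> * (norm S)\<^sup>2
    = (norm d)\<^sup>2 + \<delta> * (2 * (d \<bullet> B) + (norm S)\<^sup>2) + \<delta>\<^sup>2 * (norm B)\<^sup>2"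
    unfolding power2_norm_eq_inner by (simp add: inner_simps inner_commute power2_eq_square algebra_simps)
  also have "\<dots> \<le> (norm d)\<^sup>2 + \<delta> * (\<alpha> * (norm d)\<^sup>2 + \<beta> * V + \<kappa>) + \<delta>\<^sup>2 * (L * ((norm d)\<^sup>2 + V) + \<kappa>)"
    using \<delta> by (intro add_mono mult_left_mono 1 2) auto
  also have "\<dots> = (1 + \<alpha> * \<delta> + L * \<delta>\<^sup>2) * (norm d)\<^sup>2 + (\<beta> * \<delta> + L * \<delta>\<^sup>2) * V + (\<kappa> * \<delta> + \<kappa> * \<delta>\<^sup>2)"
    by (simp add: algebra_simps)
  also have "\<kappa> * \<delta> + \<kappa> * \<delta>\<^sup>2 \<le> (4 * \<kappa>) * \<delta>"
  proof -
    have "\<kappa> * \<delta>\<^sup>2 \<le> \<kappa> * \<delta>" using \<delta> \<kappa> by (intro mult_left_mono) (auto simp: power2_eq_square mult_left_le)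
    moreover have "0 \<le> \<kappa> * \<delta>" using \<delta> \<kappa> by simp
    moreover have "(4 * \<kappa>) * \<delta> = 4 * (\<kappa> * \<delta>)" by simp
    ultimately show ?thesis by linarith
  qed
  finally show ?thesis by (simp add: ennreal_leI)
qed

text \<open>
  The new norm is at least its component in the direction of \<open>d\<close>, an affine function of the noise whose
  mean differs from \<open>norm d\<close> by at most \<open>\<delta> * norm B\<close>. Expanding the square and using this
  lower bound in the mixed term \<open>- 2 * m * norm\<close>, with \<open>m \<ge> 0\<close>, gives the estimate.
\<close>

lemma deviation_one_step:
  fixes d B :: "real ^ 'n::finite" and S :: "real ^ 'm ^ 'n"
  assumes \<delta>: "0 < \<delta>" "\<delta> \<le> 1" and V: "0 \<le> V" and \<kappa>: "0 \<le> \<kappa>" and m: "0 \<le> m"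
    and 2: "(norm B)\<^sup>2 \<le> L * ((norm d)\<^sup>2 + V) + \<kappa>"
    and 3: "(norm S)\<^sup>2 \<le> L * ((norm d)\<^sup>2 + V) + \<kappa>"
  shows "(\<integral>\<^sup>+w. ennreal ((m - norm (d + \<delta> *\<^sub>R B + S *v w))\<^sup>2) \<partial>N)
    \<le> ennreal ((m - norm d)\<^sup>2 + \<delta> * (m\<^sup>2 + (1 + 4 * L) * ((norm d)\<^sup>2 + V) + 4 * \<kappa>))"
proof -
  \<comment> \<open>The direction of \<open>d\<close>, or zero if \<open>d\<close> is zero.\<close>
  define e where "e = sgn d"
  have e: "norm e \<le> 1" unfolding e_def by (simp add: norm_sgn)
  have ed: "e \<bullet> d = norm d"
    unfolding e_def by (cases "d = 0") (simp_all add: sgn_div_norm dot_square_norm power2_eq_square field_simps)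
  have lower: "norm d + \<delta> * (e \<bullet> B) + e \<bullet> (S *v w) \<le> norm (d + \<delta> *\<^sub>R B + S *v w)" for w
  proof -
    have "norm d + \<delta> * (e \<bullet> B) + e \<bullet> (S *v w) = e \<bullet> (d + \<delta> *\<^sub>R B + S *v w)"
      by (simp add: inner_simps ed)
    also have "\<dots> \<le> norm e * norm (d + \<delta> *\<^sub>R B + S *v w)" by (rule norm_cauchy_schwarz)
    also have "\<dots> \<le> 1 * norm (d + \<delta> *\<^sub>R B + S *v w)" by (intro mult_right_mono e) auto
    finally show ?thesis by simp
  qed
  have "(\<integral>\<^sup>+w. ennreal ((m - norm (d + \<delta> *\<^sub>R B + S *v w))\<^sup>2) \<partial>N)
     \<le> ennreal (m\<^sup>2 - 2 * m * (norm d + \<delta> * (e \<bullet> B)) + (norm (d + \<delta> *\<^sub>R B))\<^sup>2 + \<delta> * (norm S)\<^sup>2)"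
  proof (rule nn_integral_le_affine_square)
    fix w
    have "m * (norm d + \<delta> * (e \<bullet> B) + e \<bullet> (S *v w)) \<le> m * norm (d + \<delta> *\<^sub>R B + S *v w)"
      by (intro mult_left_mono lower m)
    moreover have "e \<bullet> (S *v w) = (e v* S) \<bullet> w" by (rule dot_lmul_matrix[symmetric])
    ultimately show "(m - norm (d + \<delta> *\<^sub>R B + S *v w))\<^sup>2
      \<le> m\<^sup>2 - 2 * m * (norm d + \<delta> * (e \<bullet> B)) + (- (2 * m) *\<^sub>R (e v* S)) \<bullet> w + (norm (d + \<delta> *\<^sub>R B + S *v w))\<^sup>2"
      by (simp add: power2_diff algebra_simps)
  qed simp
  also have "m\<^sup>2 - 2 * m * (norm d + \<delta> * (e \<bullet> B)) + (norm (d + \<delta> *\<^sub>R B))\<^sup>2 + \<delta> * (norm S)\<^sup>2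
    \<le> (m - norm d)\<^sup>2 + \<delta> * (m\<^sup>2 + (1 + 4 * L) * ((norm d)\<^sup>2 + V) + 4 * \<kappa>)"
  proof -
    have "- (e \<bullet> B) \<le> norm B"
      using norm_cauchy_schwarz[of "-e" B] mult_right_mono[OF e norm_ge_zero[of B]] by simp
    then have "m * (- (e \<bullet> B)) \<le> m * norm B" using m by (rule mult_left_mono)
    also have "\<dots> \<le> (m\<^sup>2 + (norm B)\<^sup>2) / 2" using sum_squares_bound[of m "norm B"] by simp
    finally have a1: "- 2 * (m * (e \<bullet> B)) \<le> m\<^sup>2 + (norm B)\<^sup>2" by simp
    have "d \<bullet> B \<le> norm d * norm B" by (rule norm_cauchy_schwarz)
    also have "\<dots> \<le> ((norm d)\<^sup>2 + (norm B)\<^sup>2) / 2" using sum_squares_bound[of "norm d" "norm B"] by simp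
    finally have a2: "2 * (d \<bullet> B) \<le> (norm d)\<^sup>2 + (norm B)\<^sup>2" by simp
    have a3: "\<delta> * (norm B)\<^sup>2 \<le> 1 * (norm B)\<^sup>2" using \<delta> by (intro mult_right_mono) auto
    have "- 2 * (m * (e \<bullet> B)) + 2 * (d \<bullet> B) + \<delta> * (norm B)\<^sup>2 + (norm S)\<^sup>2
       \<le> m\<^sup>2 + (1 + 4 * L) * ((norm d)\<^sup>2 + V) + 4 * \<kappa>"
      using a1 a2 a3 2 3 V by (simp add: algebra_simps)
    then have "\<delta> * (- 2 * (m * (e \<bullet> B)) + 2 * (d \<bullet> B) + \<delta> * (norm B)\<^sup>2 + (norm S)\<^sup>2)
       \<le> \<delta> * (m\<^sup>2 + (1 + 4 * L) * ((norm d)\<^sup>2 + V) + 4 * \<kappa>)"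
      using \<delta> by (intro mult_left_mono) auto
    moreover have "m\<^sup>2 - 2 * m * (norm d + \<delta> * (e \<bullet> B)) + (norm (d + \<delta> *\<^sub>R B))\<^sup>2 + \<delta> * (norm S)\<^sup>2
      = (m - norm d)\<^sup>2 + \<delta> * (- 2 * (m * (e \<bullet> B)) + 2 * (d \<bullet> B) + \<delta> * (norm B)\<^sup>2 + (norm S)\<^sup>2)"
    proof -
      have "(norm (d + \<delta> *\<^sub>R B))\<^sup>2 = (norm d)\<^sup>2 + 2 * \<delta> * (d \<bullet> B) + \<delta>\<^sup>2 * (norm B)\<^sup>2"
        unfolding power2_norm_eq_inner by (simp add: inner_simps inner_commute power2_eq_square algebra_simps)
      then show ?thesis by (simp add: power2_diff power2_eq_square algebra_simps)
    qed
    ultimately show ?thesis by linarith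
  qed
  finally show ?thesis by (simp add: ennreal_leI)
qed

end

text \<open>
  The tent function of the grid point \<open>- l * \<delta>\<close>. Linear interpolation is a combination of tents, which form
  a partition of unity on \<open>[-\<tau>,0]\<close>.
\<close>

definition hat :: "real \<Rightarrow> nat \<Rightarrow> real \<Rightarrow> real" where
  "hat \<delta> l \<theta> = max 0 (1 - \<bar>\<theta> / \<delta> + real l\<bar>)"

locale time_grid =
  fixes \<tau> \<delta> :: real and M :: nat and v :: "real measure"
  assumes tau: "0 < \<tau>" and M_pos: "0 < M" and delta: "\<delta> = \<tau> / real M"
    and v_prob: "prob_space v" and v_sets: "sets v = sets (restrict_space borel {-\<tau>..0})"
begin

sublocale v: prob_space v by (rule v_prob)

lemma delta_pos: "0 < \<delta>" using tau M_pos delta by simp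

lemma M_delta: "real M * \<delta> = \<tau>" using M_pos delta by simp

lemma space_v: "space v = {-\<tau>..0}" using sets_eq_imp_space_eq[OF v_sets] by (simp add: space_restrict_space)

text \<open>
  Histories are indexed backwards in time: \<open>z l\<close> is the value at \<open>- l * \<delta>\<close>.
\<close>

definition seg :: "(nat \<Rightarrow> real ^ 'n::finite) \<Rightarrow> real \<Rightarrow> real ^ 'n" where
  "seg z = (\<lambda>\<theta>\<in>{-\<tau>..0}. \<Sum>l\<le>M. hat \<delta> l \<theta> *\<^sub>R z l)"

definition wt :: "nat \<Rightarrow> real" where "wt l = (\<integral>\<theta>. hat \<delta> l \<theta> \<partial>v)"

lemma hat_nonneg: "0 \<le> hat \<delta> l \<theta>" unfolding hat_def by simp

lemma hat_le_1: "hat \<delta> l \<theta> \<le> 1" unfolding hat_def by simp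

lemma hat_sum_two:
  fixes z :: "nat \<Rightarrow> 'b::real_vector"
  assumes "\<theta> \<in> {-\<tau>..0}"
  defines "k \<equiv> min (-1) \<lfloor>\<theta> / \<delta>\<rfloor>"
  shows "(\<Sum>l\<le>M. hat \<delta> l \<theta> *\<^sub>R z l)
    = z (nat (- k)) + ((\<theta> - of_int k * \<delta>) / \<delta>) *\<^sub>R (z (nat (- k - 1)) - z (nat (- k)))"
    and "- int M \<le> k" "k \<le> -1"
proof -
  define x where "x = \<theta> / \<delta>"
  have x: "- real M \<le> x" "x \<le> 0" using assms delta_pos M_delta unfolding x_def by (auto simp: field_simps)
  then have "- int M \<le> \<lfloor>x\<rfloor>" by (simp add: le_floor_iff)
  then show k: "- int M \<le> k" "k \<le> -1" using M_pos unfolding k_def x_def[symmetric] by auto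
  define m where "m = nat (- k)"
  have m: "1 \<le> m" "m \<le> M" "int m = - k" using k unfolding m_def by auto
  have km: "real_of_int k = - real m" using m(3) by linarith
  have xm: "- real m \<le> x" "x \<le> - real m + 1"
  proof -
    show "- real m \<le> x" unfolding km[symmetric] k_def x_def[symmetric] by linarith
    show "x \<le> - real m + 1" 
    proof (cases "\<lfloor>x\<rfloor> \<le> -1")
      case True
      then have "k = \<lfloor>x\<rfloor>" unfolding k_def x_def[symmetric] by simp
      then show ?thesis unfolding km[symmetric] by linarith
    next
      case False
      then have "k = -1" unfolding k_def x_def[symmetric] by simp
      then show ?thesis unfolding km[symmetric] using x by simp
    qed
  qed
  have h1: "hat \<delta> m \<theta> = 1 - (x + real m)" "hat \<delta> (m - 1) \<theta> = x + real m"
    unfolding hat_def x_def[symmetric] using xm m by (auto simp: of_nat_diff)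
  have h0: "hat \<delta> l \<theta> = 0" if "l \<noteq> m" "l \<noteq> m - 1" for l
  proof -
    have "l \<ge> m + 1 \<or> l + 2 \<le> m" using that by auto
    then show ?thesis unfolding hat_def x_def[symmetric] using xm by auto
  qed
  have "(\<Sum>l\<le>M. hat \<delta> l \<theta> *\<^sub>R z l) = (\<Sum>l\<in>{m - 1, m}. hat \<delta> l \<theta> *\<^sub>R z l)"
  proof (rule sum.mono_neutral_right)
    show "\<forall>i\<in>{..M} - {m - 1, m}. hat \<delta> i \<theta> *\<^sub>R z i = 0"
    proof
      fix i assume "i \<in> {..M} - {m - 1, m}"
      then have "hat \<delta> i \<theta> = 0" by (intro h0) auto
      then show "hat \<delta> i \<theta> *\<^sub>R z i = 0" by simp
    qed
  qed (use m in auto)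
  also have "\<dots> = (x + real m) *\<^sub>R z (m - 1) + (1 - (x + real m)) *\<^sub>R z m"
    using m h1 by (subst sum.insert) auto
  also have "\<dots> = z m + (x + real m) *\<^sub>R (z (m - 1) - z m)" by (simp add: scaleR_left_diff_distrib scaleR_right_diff_distrib)
  also have "x + real m = (\<theta> - of_int k * \<delta>) / \<delta>" unfolding km x_def using delta_pos by (simp add: field_simps)
  also have "m - 1 = nat (- k - 1)" unfolding m_def by auto
  finally show "(\<Sum>l\<le>M. hat \<delta> l \<theta> *\<^sub>R z l)
    = z (nat (- k)) + ((\<theta> - of_int k * \<delta>) / \<delta>) *\<^sub>R (z (nat (- k - 1)) - z (nat (- k)))"
    unfolding m_def .
qed

lemma hat_sum: "\<theta> \<in> {-\<tau>..0} \<Longrightarrow> (\<Sum>l\<le>M. hat \<delta> l \<theta>) = 1"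
  using hat_sum_two(1)[of \<theta> "\<lambda>_. 1 :: real"] by simp

lemma segment_eq_seg:
  fixes y :: "real \<Rightarrow> real ^ 'n::finite"
  shows "segment \<tau> \<delta> y k = seg (\<lambda>l. y (of_int (k - int l) * \<delta>))"
proof (rule ext)
  fix \<theta>
  show "segment \<tau> \<delta> y k \<theta> = seg (\<lambda>l. y (of_int (k - int l) * \<delta>)) \<theta>"
  proof (cases "\<theta> \<in> {-\<tau>..0}")
    case True
    let ?k = "min (-1) \<lfloor>\<theta> / \<delta>\<rfloor>"
    have 1: "k - int (nat (- ?k)) = k + ?k" "k - int (nat (- ?k - 1)) = k + ?k + 1" by auto
    show ?thesis unfolding segment_def seg_def using True
      by (simp add: hat_sum_two(1)[OF True] 1 Let_def del: of_int_add of_int_diff of_int_min of_nat_nat int_nat_eq)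
  qed (auto simp: segment_def seg_def)
qed

lemma seg_0: "seg z 0 = z 0"
proof -
  have "0 \<in> {-\<tau>..0}" using tau by simp
  from hat_sum_two(1)[OF this, of z] show ?thesis unfolding seg_def using tau delta_pos by (simp add: min_def)
qed

lemma seg_grid: "l \<le> M \<Longrightarrow> seg z (- real l * \<delta>) = z l"
proof -
  assume l: "l \<le> M"
  have in_range: "- real l * \<delta> \<in> {-\<tau>..0}" using l delta_pos M_delta mult_right_mono[of "real l" "real M" \<delta>] by auto
  have "hat \<delta> l' (- real l * \<delta>) = (if l' = l then 1 else 0)" for l'
  proof -
    have "- real l * \<delta> / \<delta> + real l' = real l' - real l" using delta_pos by simp
    moreover have "l' \<noteq> l \<Longrightarrow> \<bar>real l' - real l\<bar> \<ge> 1" by linarith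
    ultimately show ?thesis unfolding hat_def by auto
  qed
  then have "(\<Sum>l'\<le>M. hat \<delta> l' (- real l * \<delta>) *\<^sub>R z l') = (\<Sum>l'\<le>M. if l' = l then z l' else 0)"
    by (intro sum.cong) auto
  then show ?thesis using in_range l unfolding seg_def by simp
qed

lemma hat_continuous: "continuous_on S (hat \<delta> l)"
  unfolding hat_def[abs_def] using delta_pos by (intro continuous_intros) auto

lemma seg_path: "seg z \<in> mspace (path_space \<tau>)"
proof -
  have "continuous_on {-\<tau>..0} (\<lambda>\<theta>. \<Sum>l\<le>M. hat \<delta> l \<theta> *\<^sub>R z l)"
    by (intro continuous_intros hat_continuous)
  then have "continuous_on {-\<tau>..0} (seg z)"
    by (rule continuous_on_eq) (simp add: seg_def)
  then show ?thesis unfolding mspace_path_space by (auto simp: seg_def)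
qed

lemma seg_diff: "\<theta> \<in> {-\<tau>..0} \<Longrightarrow> seg z \<theta> - seg z' \<theta> = seg (\<lambda>l. z l - z' l) \<theta>"
  unfolding seg_def by (simp add: sum_subtractf scaleR_diff_right)

lemma seg_zero: "seg (\<lambda>_. 0) = (\<lambda>\<theta>\<in>{-\<tau>..0}. 0)"
  unfolding seg_def by (auto simp: restrict_def)

lemma norm_seg_le: "\<theta> \<in> {-\<tau>..0} \<Longrightarrow> norm (seg z \<theta>) \<le> (\<Sum>l\<le>M. hat \<delta> l \<theta> * norm (z l))"
  unfolding seg_def by (auto intro!: order.trans[OF norm_sum] sum_mono simp: hat_nonneg)

lemma norm_seg_bound:
  assumes "\<theta> \<in> {-\<tau>..0}" "\<And>l. l \<le> M \<Longrightarrow> norm (z l) \<le> R"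
  shows "norm (seg z \<theta>) \<le> R"
proof -
  have "norm (seg z \<theta>) \<le> (\<Sum>l\<le>M. hat \<delta> l \<theta> * R)"
    using assms by (intro order.trans[OF norm_seg_le] sum_mono mult_left_mono hat_nonneg) auto
  then show ?thesis using hat_sum[OF assms(1)] by (simp add: sum_distrib_right[symmetric])
qed

lemma norm_seg_square: 
  assumes "\<theta> \<in> {-\<tau>..0}"
  shows "(norm (seg z \<theta>))\<^sup>2 \<le> (\<Sum>l\<le>M. hat \<delta> l \<theta> * (norm (z l))\<^sup>2)"
proof -
  have "(norm (seg z \<theta>))\<^sup>2 \<le> (\<Sum>l\<le>M. hat \<delta> l \<theta> * norm (z l))\<^sup>2"
    using assms by (intro power_mono norm_seg_le) auto
  also have "\<dots> \<le> (\<Sum>l\<le>M. hat \<delta> l \<theta> * (norm (z l))\<^sup>2)"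
  proof -
    have "convex_on UNIV (\<lambda>x::real. x\<^sup>2)" by (rule convex_power2)
    from convex_on_sum[OF _ _ this, of "{..M}" "\<lambda>l. hat \<delta> l \<theta>" "\<lambda>l. norm (z l)"]
    show ?thesis using hat_sum[OF assms] hat_nonneg by simp
  qed
  finally show ?thesis .
qed

lemma hat_integrable: "integrable v (hat \<delta> l)"
proof (rule v.integrable_const_bound[of _ 1])
  have "hat \<delta> l \<in> borel_measurable (restrict_space borel {-\<tau>..0})"
    by (intro borel_measurable_continuous_on_restrict hat_continuous)
  then show "hat \<delta> l \<in> borel_measurable v"
    using measurable_cong_sets[OF v_sets refl] by auto
qed (use hat_nonneg hat_le_1 in auto)

lemma wt_nonneg: "0 \<le> wt l" unfolding wt_def by (intro integral_nonneg_AE) (simp add: hat_nonneg)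

lemma wt_sum: "(\<Sum>l\<le>M. wt l) = 1"
proof -
  have "(\<Sum>l\<le>M. wt l) = (\<integral>\<theta>. (\<Sum>l\<le>M. hat \<delta> l \<theta>) \<partial>v)" unfolding wt_def using hat_integrable by simp
  also have "\<dots> = (\<integral>\<theta>. 1 \<partial>v)" by (intro Bochner_Integration.integral_cong refl hat_sum) (simp add: space_v)
  finally show ?thesis by (simp add: v.prob_space)
qed

text \<open>
  Convexity of the square replaces the delay integral of an interpolated path by a weighted mean over grid
  points, with weights of total mass one.
\<close>

lemma seg_integral_le: "(\<integral>\<theta>. (norm (seg z \<theta> - seg z' \<theta>))\<^sup>2 \<partial>v) \<le> (\<Sum>l\<le>M. wt l * (norm (z l - z' l))\<^sup>2)"
proof -
  have "(\<integral>\<theta>. (norm (seg z \<theta> - seg z' \<theta>))\<^sup>2 \<partial>v) \<le> (\<integral>\<theta>. (\<Sum>l\<le>M. hat \<delta> l \<theta> * (norm (z l - z' l))\<^sup>2) \<partial>v)"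
  proof (rule integral_mono_AE')
    show "integrable v (\<lambda>\<theta>. \<Sum>l\<le>M. hat \<delta> l \<theta> * (norm (z l - z' l))\<^sup>2)" using hat_integrable by auto
    show "AE \<theta> in v. (norm (seg z \<theta> - seg z' \<theta>))\<^sup>2 \<le> (\<Sum>l\<le>M. hat \<delta> l \<theta> * (norm (z l - z' l))\<^sup>2)"
      by (intro AE_I2) (auto simp: space_v seg_diff intro!: norm_seg_square)
  qed (auto intro!: AE_I2 sum_nonneg mult_nonneg_nonneg hat_nonneg)
  also have "\<dots> = (\<Sum>l\<le>M. wt l * (norm (z l - z' l))\<^sup>2)" unfolding wt_def using hat_integrable by simp
  finally show ?thesis .
qed

end

locale em_maps = time_grid \<tau> \<delta> M v + gaussian_increment N \<delta>
  for \<tau> \<delta> :: real and M :: nat and v :: "real measure" and N :: "(real ^ 'm::finite) measure" +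
  fixes b :: "(real \<Rightarrow> real ^ 'n::finite) \<Rightarrow> 's::finite \<Rightarrow> real ^ 'n"
    and \<sigma> :: "(real \<Rightarrow> real ^ 'n) \<Rightarrow> 's \<Rightarrow> real ^ 'm ^ 'n"
    and \<alpha> \<beta> :: "'s \<Rightarrow> real" and L L1 :: real
  assumes beta_nonneg: "\<And>i. \<beta> i \<ge> 0"
    and cond_i: "\<And>i \<xi> \<eta>. \<xi> \<in> mspace (path_space \<tau>) \<Longrightarrow> \<eta> \<in> mspace (path_space \<tau>) \<Longrightarrow>
           2 * ((\<xi> 0 - \<eta> 0) \<bullet> (b \<xi> i - b \<eta> i)) + (hs_norm (\<sigma> \<xi> i - \<sigma> \<eta> i))\<^sup>2
             \<le> \<alpha> i * (norm (\<xi> 0 - \<eta> 0))\<^sup>2 + \<beta> i * (\<integral>\<theta>. (norm (\<xi> \<theta> - \<eta> \<theta>))\<^sup>2 \<partial>v)"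
    and L_pos: "L > 0"
    and cond_ii: "\<And>i \<xi> \<eta>. \<xi> \<in> mspace (path_space \<tau>) \<Longrightarrow> \<eta> \<in> mspace (path_space \<tau>) \<Longrightarrow>
           (hs_norm (\<sigma> \<xi> i - \<sigma> \<eta> i))\<^sup>2
             \<le> L * ((norm (\<xi> 0 - \<eta> 0))\<^sup>2 + (\<integral>\<theta>. (norm (\<xi> \<theta> - \<eta> \<theta>))\<^sup>2 \<partial>v))"
    and L1_pos: "L1 > 0"
    and cond_iii: "\<And>i \<xi> \<eta>. \<xi> \<in> mspace (path_space \<tau>) \<Longrightarrow> \<eta> \<in> mspace (path_space \<tau>) \<Longrightarrow>
           (norm (b \<xi> i - b \<eta> i))\<^sup>2
             \<le> L1 * ((norm (\<xi> 0 - \<eta> 0))\<^sup>2 + (\<integral>\<theta>. (norm (\<xi> \<theta> - \<eta> \<theta>))\<^sup>2 \<partial>v))"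
begin

definition avg_sq :: "(nat \<Rightarrow> real ^ 'n) \<Rightarrow> real" where "avg_sq d = (\<Sum>l\<le>M. wt l * (norm (d l))\<^sup>2)"

lemma avg_sq_nonneg: "0 \<le> avg_sq d"
  unfolding avg_sq_def by (intro sum_nonneg mult_nonneg_nonneg wt_nonneg) auto

abbreviation "bb z i \<equiv> b (seg z) i"
abbreviation "ss z i \<equiv> \<sigma> (seg z) i"

lemma grid_i: "2 * ((z 0 - z' 0) \<bullet> (bb z i - bb z' i)) + (norm (ss z i - ss z' i))\<^sup>2
    \<le> \<alpha> i * (norm (z 0 - z' 0))\<^sup>2 + \<beta> i * avg_sq (\<lambda>l. z l - z' l)"
  using cond_i[OF seg_path seg_path, of z z' i] mult_left_mono[OF seg_integral_le[of z z'] beta_nonneg[of i]]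
  unfolding hs_norm_eq_norm seg_0 avg_sq_def by linarith

lemma grid_ii: "(norm (ss z i - ss z' i))\<^sup>2 \<le> L * ((norm (z 0 - z' 0))\<^sup>2 + avg_sq (\<lambda>l. z l - z' l))"
proof -
  have "L * ((norm (z 0 - z' 0))\<^sup>2 + (\<integral>\<theta>. (norm (seg z \<theta> - seg z' \<theta>))\<^sup>2 \<partial>v)) \<le> L * ((norm (z 0 - z' 0))\<^sup>2 + avg_sq (\<lambda>l. z l - z' l))"
    unfolding avg_sq_def using L_pos by (intro mult_left_mono add_left_mono seg_integral_le) auto
  then show ?thesis using cond_ii[OF seg_path seg_path, of z i z'] unfolding hs_norm_eq_norm seg_0 by linarith
qed

lemma grid_iii: "(norm (bb z i - bb z' i))\<^sup>2 \<le> L1 * ((norm (z 0 - z' 0))\<^sup>2 + avg_sq (\<lambda>l. z l - z' l))"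
proof -
  have "L1 * ((norm (z 0 - z' 0))\<^sup>2 + (\<integral>\<theta>. (norm (seg z \<theta> - seg z' \<theta>))\<^sup>2 \<partial>v)) \<le> L1 * ((norm (z 0 - z' 0))\<^sup>2 + avg_sq (\<lambda>l. z l - z' l))"
    unfolding avg_sq_def using L1_pos by (intro mult_left_mono add_left_mono seg_integral_le) auto
  then show ?thesis using cond_iii[OF seg_path seg_path, of z i z'] unfolding seg_0 by linarith
qed

lemma grid_modulus_continuous:
  fixes f :: "(nat \<Rightarrow> real ^ 'n) \<Rightarrow> 'b::real_normed_vector"
  assumes "\<And>z z'. (norm (f z - f z'))\<^sup>2 \<le> c * ((norm (z 0 - z' 0))\<^sup>2 + avg_sq (\<lambda>l. z l - z' l))"
  shows "continuous_on UNIV f"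
proof -
  have "(f \<longlongrightarrow> f z) (at z)" for z
  proof -
    define g where "g y = sqrt (c * ((norm (y 0 - z 0))\<^sup>2 + avg_sq (\<lambda>l. y l - z l)))" for y
    have "continuous_on UNIV g" unfolding g_def avg_sq_def
      by (intro continuous_intros continuous_on_product_coordinates)
    then have "(g \<longlongrightarrow> g z) (at z)" by (simp add: continuous_on_def)
    moreover have "g z = 0" unfolding g_def avg_sq_def by simp
    moreover have "norm (f y - f z) \<le> g y" for y
      unfolding g_def using assms[of y z] by (rule real_le_rsqrt)
    ultimately have "((\<lambda>y. f y - f z) \<longlongrightarrow> 0) (at z)"
      by (intro Lim_null_comparison[of "\<lambda>y. f y - f z" g]) auto
    then show ?thesis by (simp add: LIM_zero_iff)
  qed
  then show ?thesis by (simp add: continuous_on_def)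
qed

lemma bb_continuous: "continuous_on UNIV (\<lambda>z. bb z i)"
  by (rule grid_modulus_continuous[OF grid_iii])

lemma ss_continuous: "continuous_on UNIV (\<lambda>z. ss z i)"
  by (rule grid_modulus_continuous[OF grid_ii])

text \<open>
  Histories are sequences, of which the coordinates up to \<open>M\<close> carry information; the others are reset to
  zero.
\<close>

definition em_step :: "(nat \<Rightarrow> real ^ 'n) \<Rightarrow> 's \<Rightarrow> real ^ 'm \<Rightarrow> nat \<Rightarrow> real ^ 'n" where
  "em_step z i w = (\<lambda>l. if l = 0 then z 0 + \<delta> *\<^sub>R bb z i + ss z i *v w else if l \<le> M then z (l - 1) else 0)"

lemma em_step_continuous: "continuous_on UNIV (\<lambda>z. em_step z i w)"
proof (rule continuous_on_coordinatewise_then_product)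
  fix l
  have "continuous_on UNIV (\<lambda>z. ss z i *v w)"
  proof -
    have "continuous_on UNIV (\<lambda>z. (ss z i, w))" by (intro continuous_intros ss_continuous)
    from continuous_on_compose2[OF continuous_matrix_vector_mult this] show ?thesis by simp
  qed
  then show "continuous_on UNIV (\<lambda>z. em_step z i w l)"
    unfolding em_step_def
    by (cases "l = 0"; cases "l \<le> M") (auto intro!: continuous_intros bb_continuous continuous_on_product_coordinates)
qed

lemma coord_measurable [measurable]: "(\<lambda>z :: nat \<Rightarrow> real ^ 'n. z l) \<in> borel_measurable borel"
  by (intro borel_measurable_continuous_onI continuous_on_product_coordinates)

lemma em_step_measurable: "(\<lambda>z. em_step (fst z) i (snd z)) \<in> measurable (borel \<Otimes>\<^sub>M N) borel"
proof (rule measurable_coordinatewise_then_product)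
  fix l
  have [measurable]: "(\<lambda>z. bb z i) \<in> borel_measurable borel" "(\<lambda>z. ss z i) \<in> borel_measurable borel"
    by (intro borel_measurable_continuous_onI bb_continuous ss_continuous)+
  have [measurable]: "(\<lambda>z. ss (fst z) i *v snd z) \<in> borel_measurable (borel \<Otimes>\<^sub>M N)"
    by (rule borel_measurable_continuous_Pair[OF _ _ continuous_matrix_vector_mult]) measurable
  show "(\<lambda>z. em_step (fst z) i (snd z) l) \<in> borel_measurable (borel \<Otimes>\<^sub>M N)"
    unfolding em_step_def by (cases "l = 0"; cases "l \<le> M") simp_all
qed

end

section \<open>Contraction of the coupled scheme\<close>

text \<open>
  Jensen's inequality for the square root, through \<open>f \<le> R / 2 + f\<^sup>2 / (2 * R)\<close> with \<open>R\<close> just above \<open>B\<close>.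
\<close>

lemma (in random_maps) avg_pow_le_of_square:
  assumes [measurable]: "f \<in> borel_measurable X" and x: "x \<in> space X" and B: "0 \<le> B"
    and f: "\<And>y. 0 \<le> f y" and sq: "(avg \<Theta> F ^^ k) (\<lambda>y. ennreal ((f y)\<^sup>2)) x \<le> ennreal (B\<^sup>2)"
  shows "(avg \<Theta> F ^^ k) (\<lambda>y. ennreal (f y)) x \<le> ennreal B"
proof (rule ennreal_le_epsilon)
  fix e :: real assume e: "0 < e"
  define R where "R = B + e"
  have R: "0 < R" unfolding R_def using B e by simp
  have "(avg \<Theta> F ^^ k) (\<lambda>y. ennreal (f y)) x \<le> (avg \<Theta> F ^^ k) (\<lambda>y. ennreal (R / 2) + ennreal (1 / (2 * R)) * ennreal ((f y)\<^sup>2)) x"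
  proof (rule avg_pow_mono[OF _ x])
    fix y
    have "2 * R * f y \<le> R\<^sup>2 + (f y)\<^sup>2" using sum_squares_bound[of R "f y"] by simp
    then have "f y \<le> R / 2 + 1 / (2 * R) * (f y)\<^sup>2" using R by (simp add: field_simps power2_eq_square)
    then show "ennreal (f y) \<le> ennreal (R / 2) + ennreal (1 / (2 * R)) * ennreal ((f y)\<^sup>2)"
      using R by (simp add: ennreal_mult[symmetric] ennreal_plus[symmetric] ennreal_leI del: ennreal_plus)
  qed
  also have "\<dots> = ennreal (R / 2) + ennreal (1 / (2 * R)) * (avg \<Theta> F ^^ k) (\<lambda>y. ennreal ((f y)\<^sup>2)) x"
    using x by (simp add: avg_pow_add avg_pow_cmult avg_pow_const)
  also have "\<dots> \<le> ennreal (R / 2) + ennreal (1 / (2 * R)) * ennreal (R\<^sup>2)"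
  proof (intro add_left_mono mult_left_mono order.trans[OF sq] ennreal_leI)
    show "B\<^sup>2 \<le> R\<^sup>2" using B e unfolding R_def by (intro power_mono) auto
  qed auto
  also have "\<dots> = ennreal R"
    using R by (simp add: ennreal_mult[symmetric] ennreal_plus[symmetric] power2_eq_square del: ennreal_plus)
  also have "\<dots> = ennreal B + ennreal e" unfolding R_def using B e by simp
  finally show "(avg \<Theta> F ^^ k) (\<lambda>y. ennreal (f y)) x \<le> ennreal B + ennreal e" .
qed

text \<open>
  The constant of the contraction estimate. \<open>Bq\<close> bounds second moments and \<open>hm\<close> is the least value of the
  meeting function at distinct states, neither of which depends on the step size.
\<close>

definition coupling_const :: "real \<Rightarrow> real \<Rightarrow> real \<Rightarrow> real" where
  "coupling_const Bq hm a = exp (a / 4) * (2 * Bq + sqrt Bq * (3 / 2 * (4 + 2 * Bq) + 1 / (2 * hm)) + 1 / hm)"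

text \<open>
  Inequalities that hold for small step sizes and imply the contraction. The slack \<open>\<epsilon>\<close> absorbs the products with the coefficients
  at the zero path, whose size is measured by \<open>\<kappa>\<close>; \<open>u\<close> is the Lyapunov vector for moments and
  \<open>h\<close> the function that controls the meeting of the chains.
\<close>

locale em_contraction = em_maps \<tau> \<delta> M v N b \<sigma> \<alpha> \<beta> L L1
  for \<tau> \<delta> :: real and M :: nat and v :: "real measure" and N :: "(real ^ 'm::finite) measure"
    and b :: "(real \<Rightarrow> real ^ 'n::finite) \<Rightarrow> 's::finite \<Rightarrow> real ^ 'n"
    and \<sigma> :: "(real \<Rightarrow> real ^ 'n) \<Rightarrow> 's \<Rightarrow> real ^ 'm ^ 'n"
    and \<alpha> \<beta> :: "'s \<Rightarrow> real" and L L1 :: real +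
  fixes \<Phi> :: "('s \<Rightarrow> 's) pmf" and u :: "'s \<Rightarrow> real" and um U a D r \<epsilon> \<kappa> :: real
    and h :: "'s \<Rightarrow> 's \<Rightarrow> real" and hm :: real
    and c1 c2 :: "'s \<Rightarrow> real" and K :: real
  assumes delta_le: "\<delta> \<le> 1" and eps: "0 < \<epsilon>"
    and c1_def: "\<And>i. c1 i = 1 + (\<alpha> i + 2 * \<epsilon>) * \<delta> + 2 * (L + L1) * \<delta>\<^sup>2"
    and c2_def: "\<And>i. c2 i = (\<beta> i + 2 * \<epsilon>) * \<delta> + 2 * (L + L1) * \<delta>\<^sup>2"
    and K_def: "K = 1 + 4 * (2 * (L + L1))"
    and c1_nonneg: "\<And>i. 0 \<le> c1 i"
    and r: "0 < r" "r \<le> 1" "1 \<le> D * r ^ M" "r \<le> 1 - a * \<delta>" "\<And>i. r \<le> c1 i + c2 i * D"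
    and lyapunov: "\<And>i. (c1 i + c2 i * D) * (\<Sum>j\<in>UNIV. pmf (map_pmf (\<lambda>f. f i) \<Phi>) j * u j) \<le> (1 - a * \<delta>) * u i"
    and u: "\<And>i. um \<le> u i" "\<And>i. u i \<le> U" "0 < um" and a: "0 < a"
    and \<kappa>: "0 \<le> \<kappa>"
      "\<And>i. (2 + 1 / \<epsilon> + L / \<epsilon>) * ((norm (b (\<lambda>\<theta>\<in>{-\<tau>..0}. 0) i))\<^sup>2 + (norm (\<sigma> (\<lambda>\<theta>\<in>{-\<tau>..0}. 0) i))\<^sup>2) \<le> \<kappa>"
    and h: "\<And>i. h i i = 0" "\<And>i j. i \<noteq> j \<Longrightarrow> hm \<le> h i j" "\<And>i j. 0 \<le> h i j" "\<And>i j. h i j \<le> 1" "0 < hm"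
    and h_step: "\<And>i j. (\<integral>\<^sup>+f. ennreal (h (f i) (f j)) \<partial>measure_pmf \<Phi>) \<le> ennreal ((1 - a * \<delta>) * h i j)"
begin

lemma c2_nonneg: "0 \<le> c2 i"
  unfolding c2_def using beta_nonneg[of i] eps delta_pos L_pos L1_pos by simp

lemma K_nonneg: "0 \<le> K" unfolding K_def using L_pos L1_pos by simp

lemma coefficients_difference:
  fixes z z' :: "nat \<Rightarrow> real ^ 'n"
  defines "d \<equiv> \<lambda>l. z l - z' l"
  shows "2 * (d 0 \<bullet> (bb z i - bb z' i)) + (norm (ss z i - ss z' i))\<^sup>2 \<le> (\<alpha> i + 2 * \<epsilon>) * (norm (d 0))\<^sup>2 + (\<beta> i + 2 * \<epsilon>) * avg_sq d + 0"
    and "(norm (bb z i - bb z' i))\<^sup>2 \<le> 2 * (L + L1) * ((norm (d 0))\<^sup>2 + avg_sq d) + 0"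
    and "(norm (ss z i - ss z' i))\<^sup>2 \<le> 2 * (L + L1) * ((norm (d 0))\<^sup>2 + avg_sq d) + 0"
proof -
  have n: "0 \<le> (norm (d 0))\<^sup>2 + avg_sq d" using avg_sq_nonneg by simp
  have "0 \<le> 2 * \<epsilon> * (norm (d 0))\<^sup>2 + 2 * \<epsilon> * avg_sq d" using eps avg_sq_nonneg by simp
  then show "2 * (d 0 \<bullet> (bb z i - bb z' i)) + (norm (ss z i - ss z' i))\<^sup>2 \<le> (\<alpha> i + 2 * \<epsilon>) * (norm (d 0))\<^sup>2 + (\<beta> i + 2 * \<epsilon>) * avg_sq d + 0"
    using grid_i[of z z' i] unfolding d_def by (simp add: algebra_simps)
  have "L1 * ((norm (d 0))\<^sup>2 + avg_sq d) \<le> 2 * (L + L1) * ((norm (d 0))\<^sup>2 + avg_sq d)"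
    "L * ((norm (d 0))\<^sup>2 + avg_sq d) \<le> 2 * (L + L1) * ((norm (d 0))\<^sup>2 + avg_sq d)"
    using L_pos L1_pos n by (auto intro!: mult_right_mono)
  then show "(norm (bb z i - bb z' i))\<^sup>2 \<le> 2 * (L + L1) * ((norm (d 0))\<^sup>2 + avg_sq d) + 0"
    "(norm (ss z i - ss z' i))\<^sup>2 \<le> 2 * (L + L1) * ((norm (d 0))\<^sup>2 + avg_sq d) + 0"
    using grid_ii[of z i z'] grid_iii[of z i z'] unfolding d_def by auto
qed

text \<open>
  Comparison with the zero path, the mixed terms being absorbed by Young's inequality.
\<close>

lemma coefficients_growth:
  fixes z :: "nat \<Rightarrow> real ^ 'n"
  shows "2 * (z 0 \<bullet> bb z i) + (norm (ss z i))\<^sup>2 \<le> (\<alpha> i + 2 * \<epsilon>) * (norm (z 0))\<^sup>2 + (\<beta> i + 2 * \<epsilon>) * avg_sq z + \<kappa>"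
    and "(norm (bb z i))\<^sup>2 \<le> 2 * (L + L1) * ((norm (z 0))\<^sup>2 + avg_sq z) + \<kappa>"
    and "(norm (ss z i))\<^sup>2 \<le> 2 * (L + L1) * ((norm (z 0))\<^sup>2 + avg_sq z) + \<kappa>"
proof -
  define b0 where "b0 = b (\<lambda>\<theta>\<in>{-\<tau>..0}. 0) i"
  define s0 where "s0 = \<sigma> (\<lambda>\<theta>\<in>{-\<tau>..0}. 0) i"
  define n0 where "n0 = (norm (z 0))\<^sup>2"
  define V where "V = avg_sq z"
  have V: "0 \<le> V" "0 \<le> n0" unfolding V_def n0_def using avg_sq_nonneg by auto
  have g1: "2 * (z 0 \<bullet> (bb z i - b0)) + (norm (ss z i - s0))\<^sup>2 \<le> \<alpha> i * n0 + \<beta> i * V"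
    and g2: "(norm (ss z i - s0))\<^sup>2 \<le> L * (n0 + V)" and g3: "(norm (bb z i - b0))\<^sup>2 \<le> L1 * (n0 + V)"
    using grid_i[of z "\<lambda>_. 0" i] grid_ii[of z i "\<lambda>_. 0"] grid_iii[of z i "\<lambda>_. 0"]
    unfolding seg_zero b0_def s0_def n0_def V_def by simp_all
  have k0: "(2 + 1 / \<epsilon> + L / \<epsilon>) * ((norm b0)\<^sup>2 + (norm s0)\<^sup>2) \<le> \<kappa>"
    unfolding b0_def s0_def by (rule \<kappa>(2))
  have ei: "0 < 1 / \<epsilon>" "0 < L / \<epsilon>" using eps L_pos by auto
  have k1: "2 * (norm b0)\<^sup>2 \<le> \<kappa>" "2 * (norm s0)\<^sup>2 \<le> \<kappa>"
    and k2: "1 / \<epsilon> * (norm b0)\<^sup>2 + L / \<epsilon> * (norm s0)\<^sup>2 + (norm s0)\<^sup>2 \<le> \<kappa>"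
  proof -
    have nn: "0 \<le> 1 / \<epsilon> * (norm b0)\<^sup>2" "0 \<le> 1 / \<epsilon> * (norm s0)\<^sup>2" "0 \<le> L / \<epsilon> * (norm b0)\<^sup>2" "0 \<le> L / \<epsilon> * (norm s0)\<^sup>2"
      "0 \<le> (norm b0)\<^sup>2" "0 \<le> (norm s0)\<^sup>2" using eps L_pos by auto
    have "2 * (norm b0)\<^sup>2 + 2 * (norm s0)\<^sup>2 + 1 / \<epsilon> * (norm b0)\<^sup>2 + 1 / \<epsilon> * (norm s0)\<^sup>2 + L / \<epsilon> * (norm b0)\<^sup>2 + L / \<epsilon> * (norm s0)\<^sup>2 \<le> \<kappa>"
      using k0 by (simp add: distrib_left distrib_right)
    with nn show "2 * (norm b0)\<^sup>2 \<le> \<kappa>" "2 * (norm s0)\<^sup>2 \<le> \<kappa>" "1 / \<epsilon> * (norm b0)\<^sup>2 + L / \<epsilon> * (norm s0)\<^sup>2 + (norm s0)\<^sup>2 \<le> \<kappa>"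
      by linarith+
  qed
  have split: "(norm x)\<^sup>2 \<le> (1 + e) * (norm (x - y))\<^sup>2 + (1 / e + 1) * (norm y)\<^sup>2" if "0 < e" for x y :: "'c::real_inner" and e :: real
  proof -
    have "0 \<le> (norm (e *\<^sub>R (x - y) - y))\<^sup>2 / e" using that by simp
    also have "(norm (e *\<^sub>R (x - y) - y))\<^sup>2 = e\<^sup>2 * (norm (x - y))\<^sup>2 - 2 * e * ((x - y) \<bullet> y) + (norm y)\<^sup>2"
      unfolding power2_norm_eq_inner by (simp add: inner_simps inner_commute power2_eq_square algebra_simps)
    also have "\<dots> / e = e * (norm (x - y))\<^sup>2 - 2 * ((x - y) \<bullet> y) + 1 / e * (norm y)\<^sup>2"
      using that by (simp add: field_simps power2_eq_square)
    finally have "2 * ((x - y) \<bullet> y) \<le> e * (norm (x - y))\<^sup>2 + 1 / e * (norm y)\<^sup>2" by simp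
    moreover have "(norm x)\<^sup>2 = (norm (x - y))\<^sup>2 + 2 * ((x - y) \<bullet> y) + (norm y)\<^sup>2"
      unfolding power2_norm_eq_inner by (simp add: inner_simps inner_commute algebra_simps)
    ultimately show ?thesis by (simp add: algebra_simps)
  qed
  have "(norm (bb z i))\<^sup>2 \<le> 2 * (norm (bb z i - b0))\<^sup>2 + 2 * (norm b0)\<^sup>2"
    using split[of 1 "bb z i" b0] by simp
  also have "\<dots> \<le> 2 * (L1 * (n0 + V)) + \<kappa>" using g3 k1 by simp
  also have "\<dots> \<le> 2 * (L + L1) * (n0 + V) + \<kappa>" using L_pos V by (simp add: algebra_simps)
  finally show "(norm (bb z i))\<^sup>2 \<le> 2 * (L + L1) * ((norm (z 0))\<^sup>2 + avg_sq z) + \<kappa>" unfolding n0_def V_def .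
  have "(norm (ss z i))\<^sup>2 \<le> 2 * (norm (ss z i - s0))\<^sup>2 + 2 * (norm s0)\<^sup>2"
    using split[of 1 "ss z i" s0] by simp
  also have "\<dots> \<le> 2 * (L * (n0 + V)) + \<kappa>" using g2 k1 by simp
  also have "\<dots> \<le> 2 * (L + L1) * (n0 + V) + \<kappa>" using L1_pos V by (simp add: algebra_simps)
  finally show "(norm (ss z i))\<^sup>2 \<le> 2 * (L + L1) * ((norm (z 0))\<^sup>2 + avg_sq z) + \<kappa>" unfolding n0_def V_def .
  have 1: "2 * (z 0 \<bullet> b0) \<le> \<epsilon> * n0 + 1 / \<epsilon> * (norm b0)\<^sup>2"
  proof -
    have "0 \<le> (norm (\<epsilon> *\<^sub>R z 0 - b0))\<^sup>2 / \<epsilon>" using eps by simp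
    also have "(norm (\<epsilon> *\<^sub>R z 0 - b0))\<^sup>2 = \<epsilon>\<^sup>2 * n0 - 2 * \<epsilon> * (z 0 \<bullet> b0) + (norm b0)\<^sup>2"
      unfolding n0_def power2_norm_eq_inner by (simp add: inner_simps inner_commute power2_eq_square algebra_simps)
    also have "\<dots> / \<epsilon> = \<epsilon> * n0 - 2 * (z 0 \<bullet> b0) + 1 / \<epsilon> * (norm b0)\<^sup>2"
      using eps by (simp add: field_simps power2_eq_square)
    finally show ?thesis by simp
  qed
  have 2: "(norm (ss z i))\<^sup>2 \<le> (norm (ss z i - s0))\<^sup>2 + \<epsilon> * (n0 + V) + (L / \<epsilon> * (norm s0)\<^sup>2 + (norm s0)\<^sup>2)"
  proof -
    have "(norm (ss z i))\<^sup>2 \<le> (1 + \<epsilon> / L) * (norm (ss z i - s0))\<^sup>2 + (1 / (\<epsilon> / L) + 1) * (norm s0)\<^sup>2"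
      using eps L_pos by (intro split) auto
    moreover have "\<epsilon> / L * (norm (ss z i - s0))\<^sup>2 \<le> \<epsilon> / L * (L * (n0 + V))"
      using eps L_pos g2 by (intro mult_left_mono) auto
    ultimately show ?thesis using L_pos by (simp add: algebra_simps)
  qed
  have "2 * (z 0 \<bullet> bb z i) = 2 * (z 0 \<bullet> (bb z i - b0)) + 2 * (z 0 \<bullet> b0)" by (simp add: inner_simps)
  with 1 2 g1 have "2 * (z 0 \<bullet> bb z i) + (norm (ss z i))\<^sup>2
     \<le> \<alpha> i * n0 + \<beta> i * V + \<epsilon> * n0 + \<epsilon> * (n0 + V) + (1 / \<epsilon> * (norm b0)\<^sup>2 + L / \<epsilon> * (norm s0)\<^sup>2 + (norm s0)\<^sup>2)" by linarith
  also have "\<dots> \<le> \<alpha> i * n0 + \<beta> i * V + \<epsilon> * n0 + \<epsilon> * (n0 + V) + \<kappa> + \<epsilon> * V"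
    using k2 mult_nonneg_nonneg[of \<epsilon> V] eps V by linarith
  also have "\<dots> = (\<alpha> i + 2 * \<epsilon>) * n0 + (\<beta> i + 2 * \<epsilon>) * V + \<kappa>" by (simp add: algebra_simps)
  finally show "2 * (z 0 \<bullet> bb z i) + (norm (ss z i))\<^sup>2 \<le> (\<alpha> i + 2 * \<epsilon>) * (norm (z 0))\<^sup>2 + (\<beta> i + 2 * \<epsilon>) * avg_sq z + \<kappa>"
    unfolding n0_def V_def .
qed

lemma shift_em_step: "l < M \<Longrightarrow> em_step z i w (Suc l) = z l"
  unfolding em_step_def by simp

sublocale single: delay_recursion N borel em_step \<Phi> "\<lambda>l z. norm (z l)" wt c1 c2 u M \<delta> r a D K U um "4 * \<kappa>"
proof
  show "(\<lambda>z. em_step (fst z) i (snd z)) \<in> borel \<Otimes>\<^sub>M N \<rightarrow>\<^sub>M borel" for i by (rule em_step_measurable)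
  show "(\<integral>\<^sup>+w. ennreal ((norm (em_step x i w 0))\<^sup>2) \<partial>N)
      \<le> ennreal (c1 i * (norm (x 0))\<^sup>2 + c2 i * (\<Sum>l\<le>M. wt l * (norm (x l))\<^sup>2) + 4 * \<kappa> * \<delta>)" for x i
    using second_moment_one_step[OF delta_pos delta_le avg_sq_nonneg \<kappa>(1) coefficients_growth(1,2), of x i]
    unfolding em_step_def c1_def c2_def avg_sq_def by simp
  show "(\<integral>\<^sup>+w. ennreal ((m - norm (em_step x i w 0))\<^sup>2) \<partial>N)
        \<le> ennreal ((m - norm (x 0))\<^sup>2 + \<delta> * (m\<^sup>2 + K * ((norm (x 0))\<^sup>2 + (\<Sum>l\<le>M. wt l * (norm (x l))\<^sup>2)) + 4 * \<kappa>))"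
    if "0 \<le> m" for x i m
    using deviation_one_step[OF delta_pos delta_le avg_sq_nonneg \<kappa>(1) that coefficients_growth(2,3), of x i]
    unfolding em_step_def K_def avg_sq_def by simp
  show "r \<le> c1 i + c2 i * D" for i by (rule r(5))
  show "(c1 i + c2 i * D) * (\<Sum>j\<in>UNIV. pmf (map_pmf (\<lambda>f. f i) \<Phi>) j * u j) \<le> (1 - a * \<delta>) * u i" for i
    by (rule lyapunov)
qed (use r u a \<kappa>(1) delta_pos K_nonneg c1_nonneg c2_nonneg wt_nonneg wt_sum shift_em_step in auto)

definition pair_step :: "(nat \<Rightarrow> real ^ 'n) \<times> (nat \<Rightarrow> real ^ 'n) \<Rightarrow> 's \<Rightarrow> real ^ 'm \<Rightarrow> (nat \<Rightarrow> real ^ 'n) \<times> (nat \<Rightarrow> real ^ 'n)" where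
  "pair_step z i w = (em_step (fst z) i w, em_step (snd z) i w)"

sublocale double: delay_recursion N "borel \<Otimes>\<^sub>M borel" pair_step \<Phi> "\<lambda>l z. norm (fst z l - snd z l)" wt c1 c2 u M \<delta> r a D K U um 0
proof
  show "(\<lambda>z. pair_step (fst z) i (snd z)) \<in> (borel \<Otimes>\<^sub>M borel) \<Otimes>\<^sub>M N \<rightarrow>\<^sub>M borel \<Otimes>\<^sub>M borel" for i
    unfolding pair_step_def by measurable
  have one: "em_step x i w 0 - em_step y i w 0
    = (x 0 - y 0) + \<delta> *\<^sub>R (bb x i - bb y i) + (ss x i - ss y i) *v w" for x y i w
    unfolding em_step_def by (simp add: scaleR_diff_right matrix_vector_mult_diff_rdistrib)
  show "(\<integral>\<^sup>+w. ennreal ((norm (fst (pair_step x i w) 0 - snd (pair_step x i w) 0))\<^sup>2) \<partial>N)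
      \<le> ennreal (c1 i * (norm (fst x 0 - snd x 0))\<^sup>2 + c2 i * (\<Sum>l\<le>M. wt l * (norm (fst x l - snd x l))\<^sup>2) + 0 * \<delta>)" for x i
    using second_moment_one_step[OF delta_pos delta_le avg_sq_nonneg order_refl coefficients_difference(1,2), of "fst x" "snd x" i]
    unfolding pair_step_def fst_conv snd_conv one c1_def c2_def avg_sq_def by simp
  show "(\<integral>\<^sup>+w. ennreal ((m - norm (fst (pair_step x i w) 0 - snd (pair_step x i w) 0))\<^sup>2) \<partial>N)
        \<le> ennreal ((m - norm (fst x 0 - snd x 0))\<^sup>2 + \<delta> * (m\<^sup>2 + K * ((norm (fst x 0 - snd x 0))\<^sup>2 + (\<Sum>l\<le>M. wt l * (norm (fst x l - snd x l))\<^sup>2)) + 0))"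
    if "0 \<le> m" for x i m
    using deviation_one_step[OF delta_pos delta_le avg_sq_nonneg order_refl that coefficients_difference(2,3), of "fst x" "snd x" i]
    unfolding pair_step_def fst_conv snd_conv one K_def avg_sq_def by simp
  show "r \<le> c1 i + c2 i * D" for i by (rule r(5))
  show "(c1 i + c2 i * D) * (\<Sum>j\<in>UNIV. pmf (map_pmf (\<lambda>f. f i) \<Phi>) j * u j) \<le> (1 - a * \<delta>) * u i" for i
    by (rule lyapunov)
qed (use r u a delta_pos K_nonneg c1_nonneg c2_nonneg wt_nonneg wt_sum shift_em_step in \<open>auto simp: pair_step_def\<close>)

definition size :: "(nat \<Rightarrow> real ^ 'n) \<Rightarrow> real" where "size z = Max ((\<lambda>l. norm (z l)) ` {..M})"

lemma size_ge: "l \<le> M \<Longrightarrow> norm (z l) \<le> size z" unfolding size_def by (intro Max_ge) auto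

lemma size_le: "(\<And>l. l \<le> M \<Longrightarrow> norm (z l) \<le> R) \<Longrightarrow> size z \<le> R"
  unfolding size_def by (intro Max.boundedI) auto

lemma size_nonneg: "0 \<le> size z" using size_ge[of 0 z] norm_ge_zero[of "z 0"] by linarith

lemma size_diff_le: "size (\<lambda>l. z l - z' l) \<le> size z + size z'"
  by (intro size_le order.trans[OF norm_triangle_ineq4] add_mono size_ge)

lemma single_top: "single.top M z = size z" unfolding single.top_def size_def ..
lemma double_top: "double.top M z = size (\<lambda>l. fst z l - snd z l)" unfolding double.top_def size_def ..

lemma size_measurable [measurable]: "size \<in> borel_measurable borel"
  using single.top_measurable[of M] unfolding single_top[abs_def] .

lemma size_diff_measurable [measurable]: "(\<lambda>z. size (\<lambda>l. fst z l - snd z l)) \<in> borel_measurable (borel \<Otimes>\<^sub>M borel)"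
  using double.top_measurable[of M] unfolding double_top[abs_def] .

abbreviation "\<Theta> \<equiv> env_noise \<Phi> N"
abbreviation "F \<equiv> env_step em_step"
abbreviation "SX \<equiv> (borel \<Otimes>\<^sub>M count_space UNIV) :: ((nat \<Rightarrow> real ^ 'n) \<times> 's) measure"

text \<open>
  The constant of \<open>top_second_moment\<close> for both instances of the delay recursion.
\<close>

definition M1 where "M1 = moment_const D (D * U / um) a K \<tau>"

lemma M1_nonneg: "0 \<le> M1"
  unfolding M1_def moment_const_def using single.D_ge_1 single.U_pos u(3) a K_nonneg tau
  by (intro add_nonneg_nonneg mult_nonneg_nonneg divide_nonneg_nonneg) auto

lemma in_SX [simp]: "x \<in> space SX" by (simp add: space_pair_measure)

lemma size_second_moment:
  "(avg \<Theta> F ^^ k) (\<lambda>y. ennreal ((size (fst y))\<^sup>2)) (z, i) \<le> ennreal (M1 * ((1 - a * \<delta>) ^ k * (size z)\<^sup>2 + 4 * \<kappa>))"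
  using single.top_second_moment[where x=z and R="size z" and k=k and i=i, OF _ size_nonneg size_ge M_delta]
  unfolding single_top single.C0_def M1_def by simp

text \<open>
  Two copies that start from the same state of the chain share the environment forever, so the pair is
  itself a process in one environment, to which the delay recursion applies.
\<close>

lemma same_environment:
  "(avg \<Theta> (pair_map F) ^^ k) g ((z, i), (z', i)) = (avg \<Theta> (env_step pair_step) ^^ k) (\<lambda>y. g ((fst (fst y), snd y), (snd (fst y), snd y))) ((z, z'), i)"
proof (induction k arbitrary: z z' i)
  case (Suc k)
  have "pair_map F \<theta> ((z, i), (z', i)) = ((em_step z i (snd \<theta>), fst \<theta> i), (em_step z' i (snd \<theta>), fst \<theta> i))"
    "env_step pair_step \<theta> ((z, z'), i) = ((em_step z i (snd \<theta>), em_step z' i (snd \<theta>)), fst \<theta> i)" for \<theta>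
    by (simp_all add: pair_map_def env_step_def pair_step_def)
  then show ?case unfolding avg_pow_Suc by (simp only: Suc)
qed simp

lemma size_diff_second_moment:
  "(avg \<Theta> (pair_map F) ^^ k) (\<lambda>y. ennreal ((size (\<lambda>l. fst (fst y) l - fst (snd y) l))\<^sup>2)) ((z, i), (z', i))
    \<le> ennreal (M1 * (1 - a * \<delta>) ^ k * (size (\<lambda>l. z l - z' l))\<^sup>2)"
proof -
  have "norm (fst (z, z') l - snd (z, z') l) \<le> size (\<lambda>l. z l - z' l)" if "l \<le> M" for l
    using size_ge[OF that, of "\<lambda>l. z l - z' l"] by simp
  from double.top_second_moment[where k=k and i=i, OF _ size_nonneg this M_delta]
  show ?thesis unfolding same_environment double_top double.C0_def M1_def
    by (simp add: space_pair_measure mult.assoc)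
qed

sublocale P2: random_maps \<Theta> "SX \<Otimes>\<^sub>M SX" "pair_map F" by (rule single.random_maps_pair)

text \<open>
  \<open>Bq * (1 + size z)\<^sup>2\<close> bounds the second moment of the size of the history at all times.
\<close>

definition Bq where "Bq = M1 * (1 + 4 * \<kappa>)"

lemma Bq_nonneg: "0 \<le> Bq" unfolding Bq_def using M1_nonneg \<kappa>(1) by simp

lemma decay_factor_bounds: "0 < 1 - a * \<delta>" "1 - a * \<delta> < 1"
  using single.one_minus by auto

lemma decay_power_bounds: "(1 - a * \<delta>) ^ k \<le> 1" "0 \<le> (1 - a * \<delta>) ^ k"
  using decay_factor_bounds by (auto intro: power_le_one)

lemma decay_power_le_exp: "(1 - a * \<delta>) ^ k \<le> exp (- (a * \<delta> * real k))"
proof -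
  have "(1 - a * \<delta>) ^ k \<le> exp (- (a * \<delta>)) ^ k"
    using exp_ge_add_one_self[of "- (a * \<delta>)"] decay_factor_bounds by (intro power_mono) auto
  then show ?thesis by (simp add: exp_of_nat_mult[symmetric] mult.commute)
qed

lemmas decay_bounds = decay_factor_bounds decay_power_bounds decay_power_le_exp

lemma M1_le_Bq: "M1 \<le> Bq"
  unfolding Bq_def using M1_nonneg \<kappa>(1) mult_left_mono[of 1 "1 + 4 * \<kappa>" M1] by simp

lemma size_second_moment': "(avg \<Theta> F ^^ k) (\<lambda>y. ennreal ((size (fst y))\<^sup>2)) (z, i) \<le> ennreal (Bq * (1 + size z)\<^sup>2)"
proof (rule order.trans[OF size_second_moment ennreal_leI])
  have "(1 - a * \<delta>) ^ k * (size z)\<^sup>2 + 4 * \<kappa> \<le> 1 * (1 + size z)\<^sup>2 + 4 * \<kappa> * (1 + size z)\<^sup>2"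
  proof (rule add_mono)
    show "(1 - a * \<delta>) ^ k * (size z)\<^sup>2 \<le> 1 * (1 + size z)\<^sup>2"
      using size_nonneg[of z] by (intro mult_mono decay_bounds power_mono) auto
    have "1 * 1 \<le> (1 + size z)\<^sup>2" using size_nonneg[of z] by simp
    then show "4 * \<kappa> \<le> 4 * \<kappa> * (1 + size z)\<^sup>2" using \<kappa>(1) mult_left_mono[of 1 "(1 + size z)\<^sup>2" "4 * \<kappa>"] by simp
  qed
  then have "M1 * ((1 - a * \<delta>) ^ k * (size z)\<^sup>2 + 4 * \<kappa>) \<le> M1 * (1 * (1 + size z)\<^sup>2 + 4 * \<kappa> * (1 + size z)\<^sup>2)"
    using M1_nonneg by (rule mult_left_mono)
  then show "M1 * ((1 - a * \<delta>) ^ k * (size z)\<^sup>2 + 4 * \<kappa>) \<le> Bq * (1 + size z)\<^sup>2"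
    unfolding Bq_def by (simp add: algebra_simps)
qed

lemma size_first_moment: "(avg \<Theta> F ^^ k) (\<lambda>y. ennreal (size (fst y))) (z, i) \<le> ennreal (sqrt Bq * (1 + size z))"
proof (rule single.avg_pow_le_of_square)
  show "(avg \<Theta> F ^^ k) (\<lambda>y. ennreal ((size (fst y))\<^sup>2)) (z, i) \<le> ennreal ((sqrt Bq * (1 + size z))\<^sup>2)"
    using size_second_moment'[of k z i] Bq_nonneg by (simp add: power_mult_distrib)
qed (use Bq_nonneg size_nonneg in auto)

lemma size_diff_first_moment:
  "(avg \<Theta> (pair_map F) ^^ k) (\<lambda>y. ennreal (size (\<lambda>l. fst (fst y) l - fst (snd y) l))) ((z, i), (z', i))
    \<le> ennreal (sqrt Bq * exp (- (a / 2 * \<delta> * real k)) * (size z + size z'))"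
proof (rule P2.avg_pow_le_of_square)
  have "(1 - a * \<delta>) ^ k \<le> exp (- (a * \<delta> * real k))" by (rule decay_bounds)
  also have "\<dots> = (exp (- (a / 2 * \<delta> * real k)))\<^sup>2" by (simp add: exp_double[symmetric])
  finally have "M1 * (1 - a * \<delta>) ^ k * (size (\<lambda>l. z l - z' l))\<^sup>2 \<le> Bq * (exp (- (a / 2 * \<delta> * real k)))\<^sup>2 * (size z + size z')\<^sup>2"
    using size_diff_le[of z z'] size_nonneg M1_nonneg decay_power_bounds Bq_nonneg M1_le_Bq
    by (intro mult_mono power_mono) auto
  then show "(avg \<Theta> (pair_map F) ^^ k) (\<lambda>y. ennreal ((size (\<lambda>l. fst (fst y) l - fst (snd y) l))\<^sup>2)) ((z, i), (z', i))
     \<le> ennreal ((sqrt Bq * exp (- (a / 2 * \<delta> * real k)) * (size z + size z'))\<^sup>2)"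
    using size_diff_second_moment[of k z i z'] Bq_nonneg
    by (auto simp: power_mult_distrib intro: order.trans ennreal_leI)
  show "(\<lambda>y. size (\<lambda>l. fst (fst y) l - fst (snd y) l)) \<in> borel_measurable (SX \<Otimes>\<^sub>M SX)"
    using measurable_compose[OF _ size_diff_measurable, of "\<lambda>y. (fst (fst y), fst (snd y))" "SX \<Otimes>\<^sub>M SX"] by simp
qed (use Bq_nonneg size_nonneg in \<open>auto simp: space_pair_measure intro!: mult_nonneg_nonneg add_nonneg_nonneg\<close>)

text \<open>
  Comparable with the indicator of distinct chain states, but decreasing on average in every step.
\<close>

definition apart :: "((nat \<Rightarrow> real ^ 'n) \<times> 's) \<times> ((nat \<Rightarrow> real ^ 'n) \<times> 's) \<Rightarrow> real" where
  "apart y = h (snd (fst y)) (snd (snd y))"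

lemma pair_discrete_measurable [measurable (raw)]:
  fixes g :: "'s \<Rightarrow> 's \<Rightarrow> real"
  shows "(\<lambda>y. g (snd (fst y)) (snd (snd y))) \<in> borel_measurable (SX \<Otimes>\<^sub>M SX)"
proof -
  have "(\<lambda>y. (snd (fst y), snd (snd y))) \<in> measurable (SX \<Otimes>\<^sub>M SX) (count_space UNIV \<Otimes>\<^sub>M count_space UNIV)"
    by measurable
  then have "(\<lambda>y. (snd (fst y), snd (snd y))) \<in> measurable (SX \<Otimes>\<^sub>M SX) (count_space (UNIV :: ('s \<times> 's) set))"
    by (simp add: pair_measure_countable)
  from measurable_compose[OF this, of "\<lambda>p. g (fst p) (snd p)" borel] show ?thesis by simp
qed

lemma apart_decay: "(avg \<Theta> (pair_map F) ^^ k) (\<lambda>y. ennreal (apart y)) x \<le> ennreal ((1 - a * \<delta>) ^ k * apart x)"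
proof (induction k)
  case (Suc k)
  interpret pp: pair_prob_space "measure_pmf \<Phi>" N ..
  have step: "avg \<Theta> (pair_map F) (\<lambda>y. ennreal (apart y)) y \<le> ennreal (1 - a * \<delta>) * ennreal (apart y)" for y
  proof -
    have "avg \<Theta> (pair_map F) (\<lambda>y. ennreal (apart y)) y
       = (\<integral>\<^sup>+f. \<integral>\<^sup>+w. ennreal (h (f (snd (fst y))) (f (snd (snd y)))) \<partial>N \<partial>measure_pmf \<Phi>)"
      unfolding avg_def env_noise_def apart_def pair_map_def env_step_def
      by (subst nn_integral_fst[symmetric]) (auto intro!: measurable_compose[OF measurable_fst])
    also have "\<dots> = (\<integral>\<^sup>+f. ennreal (h (f (snd (fst y))) (f (snd (snd y)))) \<partial>measure_pmf \<Phi>)"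
      using emeasure_space_1 by simp
    also have "\<dots> \<le> ennreal ((1 - a * \<delta>) * apart y)" unfolding apart_def by (rule h_step)
    finally show ?thesis using decay_bounds(1) h(3) unfolding apart_def by (simp add: ennreal_mult)
  qed
  have [measurable]: "apart \<in> borel_measurable (SX \<Otimes>\<^sub>M SX)"
    unfolding apart_def[abs_def] by (rule pair_discrete_measurable)
  have x: "x \<in> space (SX \<Otimes>\<^sub>M SX)" by (simp add: space_pair_measure)
  have "(avg \<Theta> (pair_map F) ^^ Suc k) (\<lambda>y. ennreal (apart y)) x = (avg \<Theta> (pair_map F) ^^ k) (avg \<Theta> (pair_map F) (\<lambda>y. ennreal (apart y))) x"
    by (simp add: funpow_swap1)
  also have "\<dots> \<le> (avg \<Theta> (pair_map F) ^^ k) (\<lambda>y. ennreal (1 - a * \<delta>) * ennreal (apart y)) x"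
    by (rule P2.avg_pow_mono[OF step x])
  also have "\<dots> = ennreal (1 - a * \<delta>) * (avg \<Theta> (pair_map F) ^^ k) (\<lambda>y. ennreal (apart y)) x"
    using x by (intro P2.avg_pow_cmult) auto
  also have "\<dots> \<le> ennreal (1 - a * \<delta>) * ennreal ((1 - a * \<delta>) ^ k * apart x)"
    by (intro mult_left_mono Suc) auto
  also have "\<dots> = ennreal ((1 - a * \<delta>) ^ Suc k * apart x)"
    using decay_bounds h(3) by (subst ennreal_mult[symmetric]) (auto simp: apart_def mult.assoc)
  finally show ?case .
qed simp

text \<open>
  The distance of histories that dominates the distance of the interpolated paths.
\<close>

definition gap :: "((nat \<Rightarrow> real ^ 'n) \<times> 's) \<times> ((nat \<Rightarrow> real ^ 'n) \<times> 's) \<Rightarrow> real" where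
  "gap y = size (\<lambda>l. fst (fst y) l - fst (snd y) l) + (if snd (fst y) \<noteq> snd (snd y) then 1 else 0)"

lemma pos_diff_measurable [measurable]: "(\<lambda>y. size (\<lambda>l. fst (fst y) l - fst (snd y) l)) \<in> borel_measurable (SX \<Otimes>\<^sub>M SX)"
  using measurable_compose[OF _ size_diff_measurable, of "\<lambda>y. (fst (fst y), fst (snd y))" "SX \<Otimes>\<^sub>M SX"] by simp

lemma gap_measurable [measurable]: "gap \<in> borel_measurable (SX \<Otimes>\<^sub>M SX)"
  unfolding gap_def[abs_def] by (intro borel_measurable_add pos_diff_measurable pair_discrete_measurable)

text \<open>
  The first half of the steps is given to the chains for meeting, the second half to the histories for
  contracting. Where the chains have not met, the moments after the second half are bounded, and
  Young's inequality with a small parameter \<open>lam\<close> separates them from the indicator of not having met.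
  Passing from second to first moments halves the exponent \<open>a\<close>, and so does using half of the steps.
\<close>

theorem contraction:
  "(avg \<Theta> (pair_map F) ^^ k) (\<lambda>y. ennreal (gap y)) (x, y)
    \<le> ennreal (coupling_const Bq hm a * (1 + size (fst x) + size (fst y)) * exp (- (a / 4 * real k * \<delta>)))"
proof -
  obtain z i z' j where xy: "x = (z, i)" "y = (z', j)" by fastforce
  define m where "m = k div 2"
  define n where "n = k - m"
  have mn: "k = m + n" "real k / 2 \<le> real n" "real k \<le> 2 * real m + 1" unfolding n_def m_def by linarith+
  define S where "S = 1 + size z + size z'"
  have S: "1 \<le> S" unfolding S_def using size_nonneg by simp
  define B where "B = sqrt Bq"
  have B: "0 \<le> B" "B * B = Bq" unfolding B_def using Bq_nonneg by auto
  let ?P = "avg \<Theta> (pair_map F)"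
  let ?q = "1 - a * \<delta>"
  let ?X = "SX \<Otimes>\<^sub>M SX"
  have sp[simp]: "y \<in> space ?X" for y by (simp add: space_pair_measure)
  define dd :: "((nat \<Rightarrow> real ^ 'n) \<times> 's) \<times> ((nat \<Rightarrow> real ^ 'n) \<times> 's) \<Rightarrow> real"
    where "dd y = size (\<lambda>l. fst (fst y) l - fst (snd y) l)" for y
  define ne :: "((nat \<Rightarrow> real ^ 'n) \<times> 's) \<times> ((nat \<Rightarrow> real ^ 'n) \<times> 's) \<Rightarrow> real"
    where "ne y = (if snd (fst y) \<noteq> snd (snd y) then 1 else 0)" for y
  have [measurable]: "dd \<in> borel_measurable ?X" unfolding dd_def[abs_def] by measurable
  have [measurable]: "ne \<in> borel_measurable ?X" unfolding ne_def[abs_def] by (rule pair_discrete_measurable)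
  have [measurable]: "apart \<in> borel_measurable ?X" unfolding apart_def[abs_def] by (rule pair_discrete_measurable)
  have dd0: "0 \<le> dd y" for y unfolding dd_def by (rule size_nonneg)
  have fst_mom: "(?P ^^ k) (\<lambda>y. g (fst (fst y))) ((z, i), (z', j)) = (avg \<Theta> F ^^ k) (\<lambda>y. g (fst y)) (z, i)" for g k z i z' j
    using avg_pow_pair_fst[where \<Theta>=\<Theta> and F=F and k=k and g="\<lambda>y. g (fst y)" and z="((z, i), (z', j))"] by simp
  have snd_mom: "(?P ^^ k) (\<lambda>y. g (fst (snd y))) ((z, i), (z', j)) = (avg \<Theta> F ^^ k) (\<lambda>y. g (fst y)) (z', j)" for g k z i z' j
    using avg_pow_pair_snd[where \<Theta>=\<Theta> and F=F and k=k and g="\<lambda>y. g (fst y)" and z="((z, i), (z', j))"] by simp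
  have ne_le: "ne y \<le> 1 / hm * apart y" for y
    using h(2)[of "snd (fst y)" "snd (snd y)"] h(3)[of "snd (fst y)" "snd (snd y)"] h(5)
    unfolding ne_def apart_def by (auto simp: field_simps)
  have apart_mom: "(?P ^^ k) (\<lambda>y. ennreal (apart y)) x \<le> ennreal (?q ^ k)" for k x
  proof (rule order.trans[OF apart_decay ennreal_leI])
    show "?q ^ k * apart x \<le> ?q ^ k" using decay_bounds h(4) by (simp add: apart_def mult_left_le)
  qed
  have ne_mom: "(?P ^^ k) (\<lambda>y. ennreal (ne y)) x \<le> ennreal (?q ^ k / hm)" for k x
  proof -
    have "(?P ^^ k) (\<lambda>y. ennreal (ne y)) x \<le> (?P ^^ k) (\<lambda>y. ennreal (1 / hm) * ennreal (apart y)) x"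
    proof (rule P2.avg_pow_mono)
      show "ennreal (ne y) \<le> ennreal (1 / hm) * ennreal (apart y)" for y
        using ne_le[of y] h(3,5) by (subst ennreal_mult[symmetric]) (auto simp: apart_def intro!: ennreal_leI)
    qed simp
    also have "\<dots> = ennreal (1 / hm) * (?P ^^ k) (\<lambda>y. ennreal (apart y)) x" by (rule P2.avg_pow_cmult) auto
    also have "\<dots> \<le> ennreal (1 / hm) * ennreal (?q ^ k)" by (intro mult_left_mono apart_mom) auto
    also have "\<dots> = ennreal (?q ^ k / hm)" using h(5) decay_bounds by (simp add: ennreal_mult[symmetric])
    finally show ?thesis .
  qed
  define En where "En = exp (- (a / 2 * \<delta> * real n))"
  define sq where "sq = sqrt (?q ^ m)"
  have sq: "0 < sq" "sq * sq = ?q ^ m" unfolding sq_def using decay_bounds by auto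
  \<comment> \<open>With this parameter both terms of Young's inequality decay like \<open>sq\<close>.\<close>
  define lam where "lam = sq / S"
  have lam: "0 < lam" unfolding lam_def using sq S by simp
  \<comment> \<open>The second half of the steps, from an arbitrary pair of states at the middle.\<close>
  have point: "(?P ^^ n) (\<lambda>y. ennreal (dd y)) y
     \<le> ennreal (B * En) * (ennreal (size (fst (fst y))) + ennreal (size (fst (snd y))))
      + ennreal B * (ennreal (3 / 2 * lam) * (4 + ennreal ((size (fst (fst y)))\<^sup>2) + ennreal ((size (fst (snd y)))\<^sup>2))
          + ennreal (1 / (2 * lam)) * ennreal (ne y))" (is "_ \<le> ?T1 + ?T2") for y
  proof -
    obtain z1 i1 z2 i2 where y: "y = ((z1, i1), (z2, i2))" by (metis prod.collapse)
    define s1 s2 where "s1 = size z1" and "s2 = size z2"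
    have s: "0 \<le> s1" "0 \<le> s2" unfolding s1_def s2_def by (rule size_nonneg)+
    show ?thesis
    proof (cases "i1 = i2")
      case True
      have "(?P ^^ n) (\<lambda>y. ennreal (dd y)) y \<le> ennreal (B * En * (s1 + s2))"
        using size_diff_first_moment[of n z1 i1 z2] True unfolding y dd_def B_def En_def s1_def s2_def by simp
      also have "\<dots> = ?T1"
        using B s unfolding y En_def by (simp add: ennreal_mult s1_def[symmetric] s2_def[symmetric])
      also have "\<dots> \<le> ?T1 + ?T2" by simp
      finally show ?thesis .
    next
      case False
      have "(?P ^^ n) (\<lambda>y. ennreal (dd y)) y \<le> (?P ^^ n) (\<lambda>y. ennreal (size (fst (fst y))) + ennreal (size (fst (snd y)))) y"
        unfolding dd_def by (intro P2.avg_pow_mono) (auto simp: ennreal_plus[symmetric] size_nonneg size_diff_le simp del: ennreal_plus intro!: ennreal_leI)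
      also have "\<dots> = (?P ^^ n) (\<lambda>y. ennreal (size (fst (fst y)))) y + (?P ^^ n) (\<lambda>y. ennreal (size (fst (snd y)))) y"
        by (rule P2.avg_pow_add) auto
      also have "\<dots> \<le> ennreal (B * (1 + s1)) + ennreal (B * (1 + s2))"
        unfolding y fst_mom[of n "\<lambda>u. ennreal (size u)"] snd_mom[of n "\<lambda>u. ennreal (size u)"] B_def s1_def s2_def by (intro add_mono size_first_moment)
      also have "\<dots> = ennreal (B * (2 + s1 + s2))"
        using B s by (subst ennreal_plus[symmetric]) (auto simp: algebra_simps)
      also have "\<dots> \<le> ennreal (B * (3 / 2 * lam * (4 + s1\<^sup>2 + s2\<^sup>2) + 1 / (2 * lam)))"
      proof (intro ennreal_leI mult_left_mono B)
        let ?t = "2 + s1 + s2"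
        have "2 * (lam * ?t) \<le> (lam * ?t)\<^sup>2 + 1" using sum_squares_bound[of "lam * ?t" 1] by simp
        then have "?t \<le> lam / 2 * ?t\<^sup>2 + 1 / (2 * lam)"
          using lam by (simp add: field_simps power2_eq_square)
        moreover have "?t\<^sup>2 \<le> 3 * (4 + s1\<^sup>2 + s2\<^sup>2)"
          using sum_squares_bound[of 2 s1] sum_squares_bound[of 2 s2] sum_squares_bound[of s1 s2]
          by (simp add: power2_eq_square algebra_simps)
        then have "lam / 2 * ?t\<^sup>2 \<le> lam / 2 * (3 * (4 + s1\<^sup>2 + s2\<^sup>2))" using lam by (intro mult_left_mono) auto
        moreover have "lam / 2 * (3 * (4 + s1\<^sup>2 + s2\<^sup>2)) = 3 / 2 * lam * (4 + s1\<^sup>2 + s2\<^sup>2)" by simp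
        ultimately show "?t \<le> 3 / 2 * lam * (4 + s1\<^sup>2 + s2\<^sup>2) + 1 / (2 * lam)" by linarith
      qed
      also have "\<dots> = ?T2"
      proof -
        have four: "(4::ennreal) = ennreal 4" by simp
        have "ne ((z1, i1), (z2, i2)) = 1" using False unfolding ne_def by simp
        then show ?thesis unfolding y fst_conv snd_conv four s1_def[symmetric] s2_def[symmetric]
          using B(1) s lam[THEN less_imp_le]
          by (simp only: ennreal_plus[symmetric] ennreal_mult[symmetric] mult_nonneg_nonneg add_nonneg_nonneg
            zero_le_power divide_nonneg_nonneg zero_le_numeral zero_le_one mult_1_right)
      qed
      also have "\<dots> \<le> ?T1 + ?T2" by simp
      finally show ?thesis .
    qed
  qed
  have e1: "En \<le> exp (- (a / 4 * real k * \<delta>))"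
  proof -
    have "a / 2 * \<delta> * (real k / 2) \<le> a / 2 * \<delta> * real n" using mn a delta_pos by (intro mult_left_mono) auto
    then show ?thesis unfolding En_def by (simp add: mult_ac)
  qed
  have e2: "sq \<le> exp (a / 4) * exp (- (a / 4 * real k * \<delta>))"
  proof -
    have "sq \<le> sqrt (exp (- (a * \<delta> * real m)))" unfolding sq_def by (intro real_sqrt_le_mono decay_bounds)
    also have "\<dots> = exp (- (a * \<delta> * real m) / 2)"
      by (rule real_sqrt_unique) (simp_all add: exp_double[symmetric])
    also have "\<dots> \<le> exp (a / 4 + - (a / 4 * real k * \<delta>))"
    proof -
      have "a * \<delta> / 4 * real k \<le> a * \<delta> / 4 * (2 * real m + 1)" using mn a delta_pos by (intro mult_left_mono) auto
      moreover have "a * \<delta> / 4 \<le> a / 4" using a delta_le by simp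
      ultimately show ?thesis by (simp add: algebra_simps)
    qed
    finally show ?thesis unfolding exp_add .
  qed
  have e3: "?q ^ k \<le> exp (- (a / 4 * real k * \<delta>))"
  proof -
    have "a / 4 * real k * \<delta> \<le> a * \<delta> * real k" using a delta_pos by (simp add: mult_ac)
    then show ?thesis using decay_power_le_exp[of k] by (meson exp_le_cancel_iff neg_le_iff_le order.trans)
  qed
  let ?E = "exp (- (a / 4 * real k * \<delta>))"
  \<comment> \<open>Averaging the previous estimate over the first half of the steps.\<close>
  have dd_mom: "(?P ^^ k) (\<lambda>y. ennreal (dd y)) (x, y)
      \<le> ennreal (B * En * (2 * B * S) + B * (3 / 2 * lam * ((4 + 2 * Bq) * S\<^sup>2) + 1 / (2 * lam) * (?q ^ m / hm)))"
  proof -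
    have "(?P ^^ k) (\<lambda>y. ennreal (dd y)) (x, y) = (?P ^^ m) ((?P ^^ n) (\<lambda>y. ennreal (dd y))) (x, y)"
      unfolding mn(1) funpow_add by simp
    also have "\<dots> \<le> (?P ^^ m) (\<lambda>y. ennreal (B * En) * (ennreal (size (fst (fst y))) + ennreal (size (fst (snd y))))
      + ennreal B * (ennreal (3 / 2 * lam) * (4 + ennreal ((size (fst (fst y)))\<^sup>2) + ennreal ((size (fst (snd y)))\<^sup>2))
          + ennreal (1 / (2 * lam)) * ennreal (ne y))) (x, y)"
      by (intro P2.avg_pow_mono point) auto
    also have "\<dots> = ennreal (B * En) * ((?P ^^ m) (\<lambda>y. ennreal (size (fst (fst y)))) (x, y) + (?P ^^ m) (\<lambda>y. ennreal (size (fst (snd y)))) (x, y))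
      + ennreal B * (ennreal (3 / 2 * lam) * (4 + (?P ^^ m) (\<lambda>y. ennreal ((size (fst (fst y)))\<^sup>2)) (x, y) + (?P ^^ m) (\<lambda>y. ennreal ((size (fst (snd y)))\<^sup>2)) (x, y))
          + ennreal (1 / (2 * lam)) * (?P ^^ m) (\<lambda>y. ennreal (ne y)) (x, y))"
      by (simp add: P2.avg_pow_add P2.avg_pow_cmult P2.avg_pow_const)
    also have "\<dots> \<le> ennreal (B * En) * (ennreal (B * (1 + size z)) + ennreal (B * (1 + size z')))
      + ennreal B * (ennreal (3 / 2 * lam) * (4 + ennreal (Bq * (1 + size z)\<^sup>2) + ennreal (Bq * (1 + size z')\<^sup>2))
          + ennreal (1 / (2 * lam)) * ennreal (?q ^ m / hm))"
    proof -
      have 1: "(?P ^^ m) (\<lambda>y. ennreal (size (fst (fst y)))) (x, y) \<le> ennreal (B * (1 + size z))"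
        unfolding xy B_def fst_mom[of m "\<lambda>u. ennreal (size u)"] by (rule size_first_moment)
      have 2: "(?P ^^ m) (\<lambda>y. ennreal (size (fst (snd y)))) (x, y) \<le> ennreal (B * (1 + size z'))"
        unfolding xy B_def snd_mom[of m "\<lambda>u. ennreal (size u)"] by (rule size_first_moment)
      have 3: "(?P ^^ m) (\<lambda>y. ennreal ((size (fst (fst y)))\<^sup>2)) (x, y) \<le> ennreal (Bq * (1 + size z)\<^sup>2)"
        unfolding xy fst_mom[of m "\<lambda>u. ennreal ((size u)\<^sup>2)"] by (rule size_second_moment')
      have 4: "(?P ^^ m) (\<lambda>y. ennreal ((size (fst (snd y)))\<^sup>2)) (x, y) \<le> ennreal (Bq * (1 + size z')\<^sup>2)"
        unfolding xy snd_mom[of m "\<lambda>u. ennreal ((size u)\<^sup>2)"] by (rule size_second_moment')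
      show ?thesis by (intro add_mono mult_left_mono 1 2 3 4 ne_mom order_refl) auto
    qed
    also have "\<dots> = ennreal (B * En * (B * (1 + size z) + B * (1 + size z'))
        + B * (3 / 2 * lam * (4 + Bq * (1 + size z)\<^sup>2 + Bq * (1 + size z')\<^sup>2) + 1 / (2 * lam) * (?q ^ m / hm)))"
    proof -
      have En: "0 \<le> En" unfolding En_def by simp
      have qh: "0 \<le> ?q ^ m / hm" using decay_power_bounds(2) h(5) by (intro divide_nonneg_nonneg) auto
      have sz: "0 \<le> 1 + size z" "0 \<le> 1 + size z'" using size_nonneg by (auto intro: add_nonneg_nonneg)
      note nn = B(1) En qh sz lam[THEN less_imp_le] Bq_nonneg
      have four: "(4::ennreal) = ennreal 4" by simp
      show ?thesis unfolding four using nn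
        by (simp only: ennreal_plus[symmetric] ennreal_mult[symmetric] mult_nonneg_nonneg add_nonneg_nonneg
            zero_le_power divide_nonneg_nonneg zero_le_numeral zero_le_one)
    qed
    also have "\<dots> \<le> ennreal (B * En * (2 * B * S) + B * (3 / 2 * lam * ((4 + 2 * Bq) * S\<^sup>2) + 1 / (2 * lam) * (?q ^ m / hm)))"
    proof (intro ennreal_leI add_mono mult_left_mono order_refl)
      show "B * (1 + size z) + B * (1 + size z') \<le> 2 * B * S"
        using B size_nonneg[of z] size_nonneg[of z'] mult_nonneg_nonneg[OF B(1) size_nonneg[of z]] mult_nonneg_nonneg[OF B(1) size_nonneg[of z']]
        unfolding S_def by (simp add: algebra_simps)
      have "(1 + size z)\<^sup>2 \<le> S\<^sup>2" "(1 + size z')\<^sup>2 \<le> S\<^sup>2"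
        using size_nonneg[of z] size_nonneg[of z'] unfolding S_def by (auto intro!: power_mono)
      then have "Bq * (1 + size z)\<^sup>2 \<le> Bq * S\<^sup>2" "Bq * (1 + size z')\<^sup>2 \<le> Bq * S\<^sup>2"
        using Bq_nonneg by (auto intro: mult_left_mono)
      moreover have "4 \<le> 4 * S\<^sup>2" using S by simp
      ultimately show "4 + Bq * (1 + size z)\<^sup>2 + Bq * (1 + size z')\<^sup>2 \<le> (4 + 2 * Bq) * S\<^sup>2" by (simp add: algebra_simps)
    qed (use B lam in \<open>auto simp: En_def\<close>)
    finally show ?thesis .
  qed
  have "B * En * (2 * B * S) + B * (3 / 2 * lam * ((4 + 2 * Bq) * S\<^sup>2) + 1 / (2 * lam) * (?q ^ m / hm))
     = 2 * Bq * S * En + B * (3 / 2 * (4 + 2 * Bq) + 1 / (2 * hm)) * S * sq"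
  proof -
    have l1: "lam * S\<^sup>2 = S * sq" unfolding lam_def using S by (simp add: power2_eq_square field_simps)
    have l2: "1 / (2 * lam) * (?q ^ m / hm) = 1 / (2 * hm) * (S * sq)"
      unfolding sq(2)[symmetric] lam_def using S sq h(5) by (simp add: field_simps)
    have "B * En * (2 * B * S) = 2 * (B * B) * S * En" by simp
    moreover have "B * (3 / 2 * lam * ((4 + 2 * Bq) * S\<^sup>2) + 1 / (2 * lam) * (?q ^ m / hm)) = B * (3 / 2 * (4 + 2 * Bq) * (lam * S\<^sup>2) + 1 / (2 * lam) * (?q ^ m / hm))"
      by (simp only: mult_ac)
    ultimately show ?thesis unfolding l1 l2 B(2) by (simp only: distrib_left distrib_right mult_ac)
  qed
  also have "\<dots> \<le> 2 * Bq * S * (exp (a / 4) * ?E) + B * (3 / 2 * (4 + 2 * Bq) + 1 / (2 * hm)) * S * (exp (a / 4) * ?E)"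
  proof -
    have "1 * ?E \<le> exp (a / 4) * ?E" using a by (intro mult_right_mono) auto
    then have "En \<le> exp (a / 4) * ?E" using e1 by linarith
    then show ?thesis using e2 Bq_nonneg B S h(5) by (intro add_mono mult_left_mono) auto
  qed
  finally have dd_mom': "(?P ^^ k) (\<lambda>y. ennreal (dd y)) (x, y)
    \<le> ennreal (2 * Bq * S * (exp (a / 4) * ?E) + B * (3 / 2 * (4 + 2 * Bq) + 1 / (2 * hm)) * S * (exp (a / 4) * ?E))"
    using dd_mom by (meson ennreal_leI order.trans)
  have "(?P ^^ k) (\<lambda>y. ennreal (gap y)) (x, y) = (?P ^^ k) (\<lambda>y. ennreal (dd y) + ennreal (ne y)) (x, y)"
    unfolding gap_def dd_def[symmetric] ne_def[symmetric] using dd0 by (simp add: ne_def)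
  also have "\<dots> = (?P ^^ k) (\<lambda>y. ennreal (dd y)) (x, y) + (?P ^^ k) (\<lambda>y. ennreal (ne y)) (x, y)"
    by (rule P2.avg_pow_add) auto
  also have "\<dots> \<le> ennreal (2 * Bq * S * (exp (a / 4) * ?E) + B * (3 / 2 * (4 + 2 * Bq) + 1 / (2 * hm)) * S * (exp (a / 4) * ?E))
      + ennreal (?q ^ k / hm)"
    by (intro add_mono dd_mom' ne_mom)
  also have "\<dots> = ennreal (2 * Bq * S * (exp (a / 4) * ?E) + B * (3 / 2 * (4 + 2 * Bq) + 1 / (2 * hm)) * S * (exp (a / 4) * ?E) + ?q ^ k / hm)"
    using Bq_nonneg B S h(5) decay_bounds by (subst ennreal_plus[symmetric]) (auto intro!: add_nonneg_nonneg mult_nonneg_nonneg)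
  also have "\<dots> \<le> ennreal (coupling_const Bq hm a * S * ?E)"
  proof (rule ennreal_leI)
    have "?q ^ k / hm \<le> 1 / hm * S * (exp (a / 4) * ?E)"
    proof -
      have "?q ^ k * 1 \<le> (exp (a / 4) * ?E) * S"
      proof (rule mult_mono)
        have "1 * ?E \<le> exp (a / 4) * ?E" using a by (intro mult_right_mono) auto
        then show "?q ^ k \<le> exp (a / 4) * ?E" using e3 by linarith
      qed (use S in auto)
      then show ?thesis using h(5) by (simp add: field_simps)
    qed
    moreover have "coupling_const Bq hm a * S * ?E = 2 * Bq * S * (exp (a / 4) * ?E) + B * (3 / 2 * (4 + 2 * Bq) + 1 / (2 * hm)) * S * (exp (a / 4) * ?E) + 1 / hm * S * (exp (a / 4) * ?E)"
      unfolding coupling_const_def B_def[symmetric] by (simp only: distrib_left distrib_right mult_ac)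
    ultimately show "2 * Bq * S * (exp (a / 4) * ?E) + B * (3 / 2 * (4 + 2 * Bq) + 1 / (2 * hm)) * S * (exp (a / 4) * ?E) + ?q ^ k / hm \<le> coupling_const Bq hm a * S * ?E"
      by linarith
  qed
  finally show ?thesis unfolding S_def xy by simp
qed

end

section \<open>The invariant measure of the history process\<close>

lemma tendsto_coordinatewise:
  fixes f :: "'b \<Rightarrow> nat \<Rightarrow> 'a::topological_space"
  assumes "\<And>i. ((\<lambda>n. f n i) \<longlongrightarrow> l i) F"
  shows "(f \<longlongrightarrow> l) F"
proof -
  have "limitin (product_topology (\<lambda>_::nat. euclidean) UNIV) f l F"
    using assms by (subst limitin_componentwise) (auto simp: limitin_canonical_iff)
  then show ?thesis by (simp add: euclidean_product_topology limitin_canonical_iff)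
qed

lemma tendsto_coordinate:
  fixes f :: "'b \<Rightarrow> nat \<Rightarrow> 'a::topological_space"
  assumes "(f \<longlongrightarrow> l) F"
  shows "((\<lambda>n. f n i) \<longlongrightarrow> l i) F"
  using continuous_on_tendsto_compose[OF continuous_on_product_coordinates[of i] assms] by simp

text \<open>
  The indicator of the product of a closed set and a set of states is a limit of functions that are
  continuous in the first argument, and these products generate the sigma-algebra.
\<close>

lemma measure_eq_if_continuous_integrals:
  fixes \<mu> \<nu> :: "('a::metric_space \<times> 's::finite) measure"
  assumes sets: "sets \<mu> = sets (borel \<Otimes>\<^sub>M count_space UNIV)" "sets \<nu> = sets (borel \<Otimes>\<^sub>M count_space UNIV)"
    and prob: "prob_space \<mu>" "prob_space \<nu>"
    and eq: "\<And>g :: 'a \<times> 's \<Rightarrow> real. (\<And>j. continuous_on UNIV (\<lambda>z. g (z, j))) \<Longrightarrow> (\<And>y. 0 \<le> g y) \<Longrightarrow> (\<And>y. g y \<le> 1) \<Longrightarrow>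
        g \<in> borel_measurable (borel \<Otimes>\<^sub>M count_space UNIV) \<Longrightarrow> (\<integral>\<^sup>+y. ennreal (g y) \<partial>\<mu>) = (\<integral>\<^sup>+y. ennreal (g y) \<partial>\<nu>)"
  shows "\<mu> = \<nu>"
proof -
  interpret \<mu>: prob_space \<mu> by fact
  interpret \<nu>: prob_space \<nu> by fact
  note [measurable_cong] = sets
  define E where "E = {C \<times> J |C J. closed (C :: 'a set) \<and> (J :: 's set) \<in> Pow UNIV}"
  have gen: "sets (borel \<Otimes>\<^sub>M count_space UNIV) = sigma_sets UNIV E"
  proof -
    have "sets (sigma UNIV (Collect closed) \<Otimes>\<^sub>M sigma UNIV (Pow UNIV) :: ('a \<times> 's) measure)
        = sets (sigma (UNIV \<times> UNIV) {C \<times> J |C J. C \<in> Collect closed \<and> J \<in> Pow UNIV})"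
      by (intro arg_cong[where f=sets] sigma_prod exI[of _ "{UNIV}"]) auto
    then have "sets (sigma UNIV (Collect closed) \<Otimes>\<^sub>M sigma UNIV (Pow UNIV) :: ('a \<times> 's) measure) = sigma_sets UNIV E"
      unfolding E_def by simp
    moreover have "sets (borel \<Otimes>\<^sub>M count_space UNIV) = sets (sigma UNIV (Collect closed) \<Otimes>\<^sub>M sigma UNIV (Pow UNIV) :: ('a \<times> 's) measure)"
    proof (rule sets_pair_measure_cong)
      show "sets (count_space UNIV) = sets (sigma UNIV (Pow (UNIV :: 's set)))"
        using sigma_algebra.sigma_sets_eq[OF sigma_algebra_Pow, of "UNIV :: 's set"] by simp
    qed (simp add: borel_eq_closed)
    ultimately show ?thesis by simp
  qed
  have closed_eq: "emeasure \<mu> (C \<times> J) = emeasure \<nu> (C \<times> J)" if C: "closed C" for C :: "'a set" and J :: "'s set"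
  proof (cases "C = {}")
    case False
    define g where "g n y = max 0 (1 - real n * infdist (fst y) C) * indicator J (snd y)" for n and y :: "'a \<times> 's"
    have [measurable]: "(\<lambda>y. indicator J (snd y) :: real) \<in> borel_measurable (borel \<Otimes>\<^sub>M count_space UNIV)"
      by (rule measurable_compose[OF measurable_snd]) simp
    have [measurable]: "(\<lambda>y. infdist y C) \<in> borel_measurable borel"
      by (intro borel_measurable_continuous_onI continuous_intros)
    have g_meas[measurable]: "g n \<in> borel_measurable (borel \<Otimes>\<^sub>M count_space UNIV)" for n
      unfolding g_def[abs_def] by measurable
    have g0: "0 \<le> g n y" "g n y \<le> 1" for n y
      unfolding g_def using infdist_nonneg[of "fst y" C] by (auto simp: indicator_def mult_nonneg_nonneg)
    have lim: "(\<lambda>n. ennreal (g n y)) \<longlonglongrightarrow> indicator (C \<times> J) y" for y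
    proof (cases "fst y \<in> C")
      case True
      then have "ennreal (g n y) = indicator (C \<times> J) y" for n
        unfolding g_def by (cases y) (auto simp: infdist_zero indicator_def)
      then show ?thesis by simp
    next
      case F: False
      then have "0 < infdist (fst y) C"
        using in_closed_iff_infdist_zero[OF C False, of "fst y"] infdist_nonneg[of "fst y" C] by linarith
      then obtain n0 where n0: "1 / infdist (fst y) C < real n0" using reals_Archimedean2 by blast
      have "eventually (\<lambda>n. ennreal (g n y) = indicator (C \<times> J) y) sequentially"
        using eventually_ge_at_top[of n0]
      proof eventually_elim
        case (elim n)
        have "1 < real n0 * infdist (fst y) C" using n0 \<open>0 < infdist (fst y) C\<close> by (simp add: field_simps)
        also have "\<dots> \<le> real n * infdist (fst y) C" using elim infdist_nonneg by (intro mult_right_mono) auto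
        finally have "g n y = 0" unfolding g_def by simp
        then show ?case using F by (cases y) (auto simp: indicator_def)
      qed
      then show ?thesis by (rule tendsto_eventually)
    qed
    have int: "(\<lambda>n. \<integral>\<^sup>+y. ennreal (g n y) \<partial>m) \<longlonglongrightarrow> emeasure m (C \<times> J)"
      if "prob_space m" and [measurable_cong]: "sets m = sets (borel \<Otimes>\<^sub>M count_space UNIV)" for m :: "('a \<times> 's) measure"
    proof -
      interpret m: prob_space m by fact
      have CJ[measurable]: "C \<times> J \<in> sets m" using C unfolding that(2) by (intro pair_measureI) auto
      have "(\<lambda>n. \<integral>\<^sup>+y. ennreal (g n y) \<partial>m) \<longlonglongrightarrow> (\<integral>\<^sup>+y. indicator (C \<times> J) y \<partial>m)"
        by (rule nn_integral_dominated_convergence[where w="\<lambda>_. 1"])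
          (auto simp: m.emeasure_space_1 g0 lim intro!: AE_I2)
      then show ?thesis by simp
    qed
    have "(\<integral>\<^sup>+y. ennreal (g n y) \<partial>\<mu>) = (\<integral>\<^sup>+y. ennreal (g n y) \<partial>\<nu>)" for n
    proof (rule eq)
      show "continuous_on UNIV (\<lambda>z. g n (z, j))" for j
        unfolding g_def by (auto intro!: continuous_intros)
    qed (use g0 in auto)
    then show ?thesis using int[OF prob(1) sets(1)] int[OF prob(2) sets(2)] LIMSEQ_unique by auto
  qed simp
  show ?thesis
  proof (rule measure_eqI_generator_eq[where E=E and \<Omega>=UNIV and A="\<lambda>_. UNIV"])
    show "Int_stable E"
    proof (rule Int_stableI)
      fix A B assume "A \<in> E" "B \<in> E"
      then obtain C J C' J' where "A = C \<times> J" "B = C' \<times> J'" "closed C" "closed C'" unfolding E_def by auto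
      then have "A \<inter> B = (C \<inter> C') \<times> (J \<inter> J')" "closed (C \<inter> C')" by auto
      then show "A \<inter> B \<in> E" unfolding E_def by blast
    qed
    show "range (\<lambda>_. UNIV) \<subseteq> E" unfolding E_def using closed_UNIV UNIV_Times_UNIV by blast
  qed (use gen sets closed_eq \<mu>.emeasure_space_1 in \<open>auto simp: E_def\<close>)
qed

context em_contraction begin

abbreviation "S \<equiv> stream_space \<Theta>"
abbreviation "orbit \<equiv> back_iter F"

definition cc where "cc = coupling_const Bq hm a"
definition rate where "rate = a / 4"

lemma cc_pos: "0 < cc"
  unfolding cc_def coupling_const_def using Bq_nonneg h(5)
  by (intro mult_pos_pos add_nonneg_pos add_nonneg_nonneg mult_nonneg_nonneg) auto

lemma rate_pos: "0 < rate" unfolding rate_def using a by simp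

lemma F_coord: "l \<noteq> 0 \<Longrightarrow> M < l \<Longrightarrow> fst (F \<theta> x) l = 0"
  unfolding env_step_def em_step_def by simp

lemma gap_nonneg: "0 \<le> gap y" unfolding gap_def using size_nonneg by simp

lemma orbit_gap: "(\<integral>\<^sup>+s. ennreal (gap (orbit k s x, orbit k s y)) \<partial>S)
    \<le> ennreal (cc * (1 + size (fst x) + size (fst y)) * exp (- (rate * real k * \<delta>)))"
  using contraction[of k x y] P2.nn_integral_back[of "\<lambda>y. ennreal (gap y)" "(x, y)" k]
  unfolding back_pair_map cc_def rate_def by (simp add: space_pair_measure)

lemma orbit_measurable' [measurable]: "(\<lambda>s. orbit k s x) \<in> measurable S SX"
  by (rule single.back_measurable') auto

text \<open>
  The additional map first moves \<open>x\<close> by one step, which costs only a first moment.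
\<close>

lemma orbit_increment: "(\<integral>\<^sup>+s. ennreal (gap (orbit k s x, orbit (Suc k) s x)) \<partial>S)
    \<le> ennreal (cc * (1 + size (fst x) + sqrt Bq * (1 + size (fst x))) * exp (- (rate * real k * \<delta>)))"
proof -
  let ?E = "exp (- (rate * real k * \<delta>))"
  have "(\<integral>\<^sup>+s. ennreal (gap (orbit k s x, orbit (Suc k) s x)) \<partial>S)
      = (\<integral>\<^sup>+\<theta>. (avg \<Theta> (pair_map F) ^^ k) (\<lambda>y. ennreal (gap y)) (x, F \<theta> x) \<partial>\<Theta>)"
    by (rule single.nn_integral_back_increment) auto
  also have "\<dots> \<le> (\<integral>\<^sup>+\<theta>. ennreal (cc * (1 + size (fst x)) * ?E) + ennreal (cc * ?E) * ennreal (size (fst (F \<theta> x))) \<partial>\<Theta>)"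
  proof (intro nn_integral_mono order.trans[OF contraction])
    fix \<theta>
    have "coupling_const Bq hm a * (1 + size (fst x) + size (fst (F \<theta> x))) * exp (- (a / 4 * real k * \<delta>))
       = cc * (1 + size (fst x)) * ?E + cc * ?E * size (fst (F \<theta> x))"
      unfolding cc_def rate_def by (simp add: algebra_simps)
    then show "ennreal (coupling_const Bq hm a * (1 + size (fst x) + size (fst (F \<theta> x))) * exp (- (a / 4 * real k * \<delta>)))
       \<le> ennreal (cc * (1 + size (fst x)) * ?E) + ennreal (cc * ?E) * ennreal (size (fst (F \<theta> x)))"
      using cc_pos size_nonneg by (simp add: ennreal_mult[symmetric] ennreal_plus[symmetric] del: ennreal_plus)
  qed
  also have "\<dots> = ennreal (cc * (1 + size (fst x)) * ?E) + ennreal (cc * ?E) * (avg \<Theta> F ^^ 1) (\<lambda>y. ennreal (size (fst y))) x"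
    unfolding avg_def by (simp add: nn_integral_add nn_integral_cmult single.emeasure_space_1)
  also have "(avg \<Theta> F ^^ 1) (\<lambda>y. ennreal (size (fst y))) x \<le> ennreal (sqrt Bq * (1 + size (fst x)))"
    using size_first_moment[of 1 "fst x" "snd x"] by simp
  also have "ennreal (cc * (1 + size (fst x)) * ?E) + ennreal (cc * ?E) * ennreal (sqrt Bq * (1 + size (fst x)))
    = ennreal (cc * (1 + size (fst x) + sqrt Bq * (1 + size (fst x))) * ?E)"
  proof -
    define A1 A2 A3 where "A1 = cc * (1 + size (fst x)) * ?E" and "A2 = cc * ?E" and "A3 = sqrt Bq * (1 + size (fst x))"
    have "0 \<le> A1" "0 \<le> A2" "0 \<le> A3"
      unfolding A1_def A2_def A3_def
      using cc_pos size_nonneg Bq_nonneg by (auto intro!: mult_nonneg_nonneg add_nonneg_nonneg)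
    then have "ennreal A1 + ennreal A2 * ennreal A3 = ennreal (A1 + A2 * A3)"
      by (simp add: ennreal_mult ennreal_plus)
    also have "A1 + A2 * A3 = cc * (1 + size (fst x) + sqrt Bq * (1 + size (fst x))) * ?E"
      unfolding A1_def A2_def A3_def by (simp add: algebra_simps)
    finally show ?thesis unfolding A1_def A2_def A3_def .
  qed
  finally show ?thesis by (simp add: add_mono mult_left_mono)
qed

lemma AE_summable_geometric:
  assumes [measurable]: "\<And>k. f k \<in> borel_measurable S" and f0: "\<And>k s. 0 \<le> f k s" and "0 \<le> C"
    and le: "\<And>k. (\<integral>\<^sup>+s. ennreal (f k s) \<partial>S) \<le> ennreal (C * exp (- (rate * real k * \<delta>)))"
  shows "AE s in S. summable (\<lambda>k. f k s)"
proof -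
  define q where "q = exp (- (rate * \<delta>))"
  have q: "0 < q" "q < 1" unfolding q_def using rate_pos delta_pos by auto
  have eq: "exp (- (rate * real k * \<delta>)) = q ^ k" for k
    unfolding q_def by (simp add: exp_of_nat_mult[symmetric] mult_ac)
  have summ: "summable (\<lambda>k. C * q ^ k)" using q by (intro summable_mult summable_geometric) auto
  have "(\<integral>\<^sup>+s. (\<Sum>k. ennreal (f k s)) \<partial>S) = (\<Sum>k. \<integral>\<^sup>+s. ennreal (f k s) \<partial>S)"
    by (rule nn_integral_suminf) simp
  also have "\<dots> \<le> (\<Sum>k. ennreal (C * q ^ k))"
    using le unfolding eq by (intro suminf_le) auto
  also have "\<dots> < \<infinity>"
    using summ q \<open>0 \<le> C\<close> by (subst suminf_ennreal2) auto
  finally have "(\<integral>\<^sup>+s. (\<Sum>k. ennreal (f k s)) \<partial>S) \<noteq> \<infinity>" by simp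
  then have "AE s in S. (\<Sum>k. ennreal (f k s)) \<noteq> \<infinity>"
    by (intro nn_integral_noteq_infinite) auto
  then show ?thesis
  proof eventually_elim
    case (elim s)
    then show ?case using summable_suminf_not_top[of "\<lambda>k. f k s"] f0 by simp
  qed
qed

definition "origin = ((\<lambda>_. 0, undefined) :: (nat \<Rightarrow> real ^ 'n) \<times> 's)"

text \<open>
  Convergence in the product topology, the chain component being discrete.
\<close>

definition converges_to :: "(nat \<Rightarrow> (nat \<Rightarrow> real ^ 'n) \<times> 's) \<Rightarrow> (nat \<Rightarrow> real ^ 'n) \<times> 's \<Rightarrow> bool" where
  "converges_to X y \<longleftrightarrow> (\<forall>l. (\<lambda>n. fst (X n) l) \<longlonglongrightarrow> fst y l) \<and> (\<forall>\<^sub>F n in sequentially. snd (X n) = snd y)"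

text \<open>
  Where the orbit does not converge, a set of probability zero, the value is arbitrary.
\<close>

definition limit_state :: "(('s \<Rightarrow> 's) \<times> (real ^ 'm)) stream \<Rightarrow> (nat \<Rightarrow> real ^ 'n) \<times> 's" where
  "limit_state s = (\<lambda>l. lim (\<lambda>n. fst (orbit n s origin) l), SOME j. \<forall>\<^sub>F n in sequentially. snd (orbit n s origin) = j)"

lemma limit_state_measurable [measurable]: "limit_state \<in> measurable S SX"
proof -
  have m1[measurable]: "(\<lambda>s. fst (orbit n s origin) l) \<in> borel_measurable S" for n l
    using measurable_compose[OF measurable_compose[OF orbit_measurable' measurable_fst] coord_measurable] by simp
  have m2[measurable]: "(\<lambda>s. snd (orbit n s origin)) \<in> measurable S (count_space UNIV)" for n
    by (rule measurable_compose[OF orbit_measurable' measurable_snd])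
  have "(\<lambda>s l. lim (\<lambda>n. fst (orbit n s origin) l)) \<in> measurable S borel"
    by (intro measurable_coordinatewise_then_product borel_measurable_lim_metric m1)
  moreover have "(\<lambda>s. SOME j. \<forall>\<^sub>F n in sequentially. snd (orbit n s origin) = j) \<in> measurable S (count_space UNIV)"
  proof -
    define J where "J s = {j. \<forall>\<^sub>F n in sequentially. snd (orbit n s origin) = j}" for s
    have [measurable]: "Measurable.pred S (\<lambda>s. j \<in> J s)" for j
      unfolding J_def mem_Collect_eq eventually_sequentially by measurable
    have "J \<in> measurable S (count_space UNIV)"
    proof (rule measurableI)
      fix A :: "'s set set"
      have "J -` A \<inter> space S = (\<Union>K\<in>A. {s\<in>space S. \<forall>j\<in>UNIV. (j \<in> J s) = (j \<in> K)})" by auto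
      also have "\<dots> \<in> sets S" by (intro sets.finite_UN) measurable
      finally show "J -` A \<inter> space S \<in> sets S" .
    qed simp
    then have "(\<lambda>s. SOME j. j \<in> J s) \<in> measurable S (count_space UNIV)"
      by (rule measurable_compose) simp
    then show ?thesis unfolding J_def by simp
  qed
  ultimately show ?thesis unfolding limit_state_def[abs_def] by (rule measurable_Pair)
qed

text \<open>
  The expected increments are summable, so almost surely the increments are.
\<close>

lemma orbit_converges_origin: "AE s in S. converges_to (\<lambda>n. orbit n s origin) (limit_state s)"
proof -
  define C where "C = cc * (1 + size (fst origin) + sqrt Bq * (1 + size (fst origin)))"
  have "AE s in S. summable (\<lambda>k. gap (orbit k s origin, orbit (Suc k) s origin))"
  proof (rule AE_summable_geometric)
    show "0 \<le> C" unfolding C_def using cc_pos size_nonneg Bq_nonneg by (auto intro!: mult_nonneg_nonneg add_nonneg_nonneg)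
    show "(\<integral>\<^sup>+s. ennreal (gap (orbit k s origin, orbit (Suc k) s origin)) \<partial>S) \<le> ennreal (C * exp (- (rate * real k * \<delta>)))" for k
      unfolding C_def by (rule orbit_increment)
    show "(\<lambda>s. gap (orbit k s origin, orbit (Suc k) s origin)) \<in> borel_measurable S" for k
      by (rule measurable_compose[OF measurable_Pair[OF orbit_measurable' orbit_measurable'] gap_measurable])
  qed (rule gap_nonneg)
  then show ?thesis
  proof eventually_elim
    case (elim s)
    define X where "X k = orbit k s origin" for k
    have summ: "summable (\<lambda>k. gap (X k, X (Suc k)))" using elim unfolding X_def .
    have conv: "convergent (\<lambda>n. fst (X n) l)" for l
    proof (cases "l \<le> M")
      case True
      have "norm (fst (X (Suc k)) l - fst (X k) l) \<le> gap (X k, X (Suc k))" for k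
        using size_ge[OF True, of "\<lambda>l. fst (X k) l - fst (X (Suc k)) l"]
        unfolding gap_def by (simp add: norm_minus_commute)
      then have "summable (\<lambda>k. fst (X (Suc k)) l - fst (X k) l)"
        by (intro summable_comparison_test'[OF summ, of 0]) auto
      then have "convergent (\<lambda>n. \<Sum>k<n. fst (X (Suc k)) l - fst (X k) l)"
        by (simp add: summable_iff_convergent)
      then have "convergent (\<lambda>n. (fst (X n) l - fst (X 0) l) + fst (X 0) l)"
        unfolding sum_lessThan_telescope[of "\<lambda>k. fst (X k) l"] by (intro convergent_add convergent_const)
      then show ?thesis by simp
    next
      case False
      then have "fst (X (Suc n)) l = 0" for n unfolding X_def by (simp add: F_coord)
      then have "convergent (\<lambda>n. fst (X (Suc n)) l)" by (simp add: convergent_const)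
      then show ?thesis using convergent_Suc_iff[of "\<lambda>n. fst (X n) l"] by simp
    qed
    have "(\<lambda>k. gap (X k, X (Suc k))) \<longlonglongrightarrow> 0" by (rule summable_LIMSEQ_zero[OF summ])
    then have "\<forall>\<^sub>F k in sequentially. gap (X k, X (Suc k)) < 1" by (rule order_tendstoD) simp
    then obtain n0 where n0: "\<And>k. n0 \<le> k \<Longrightarrow> gap (X k, X (Suc k)) < 1" unfolding eventually_sequentially by auto
    have eqS: "snd (X k) = snd (X (Suc k))" if "n0 \<le> k" for k
      using n0[OF that] size_nonneg[of "\<lambda>l. fst (X k) l - fst (X (Suc k)) l"] unfolding gap_def by (auto split: if_splits)
    have "snd (X k) = snd (X n0)" if "n0 \<le> k" for k
      using that by (induction k rule: dec_induct) (auto simp: eqS[symmetric])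
    then have "\<forall>\<^sub>F k in sequentially. snd (X k) = snd (X n0)"
      by (rule eventually_sequentiallyI)
    then have "\<forall>\<^sub>F k in sequentially. snd (X k) = (SOME j. \<forall>\<^sub>F n in sequentially. snd (X n) = j)"
      by (rule someI)
    then show ?case using conv unfolding converges_to_def limit_state_def X_def[symmetric]
      by (auto simp: convergent_LIMSEQ_iff)
  qed
qed

text \<open>
  The distance to the orbit of the origin is almost surely summable, hence tends to zero.
\<close>

lemma orbit_converges: "AE s in S. converges_to (\<lambda>n. orbit n s x) (limit_state s)"
proof -
  define C where "C = cc * (1 + size (fst x) + size (fst origin))"
  have "AE s in S. summable (\<lambda>k. gap (orbit k s x, orbit k s origin))"
  proof (rule AE_summable_geometric)
    show "0 \<le> C" unfolding C_def using cc_pos size_nonneg by (auto intro!: mult_nonneg_nonneg add_nonneg_nonneg)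
    show "(\<integral>\<^sup>+s. ennreal (gap (orbit k s x, orbit k s origin)) \<partial>S) \<le> ennreal (C * exp (- (rate * real k * \<delta>)))" for k
      unfolding C_def by (rule orbit_gap)
    show "(\<lambda>s. gap (orbit k s x, orbit k s origin)) \<in> borel_measurable S" for k
      by (rule measurable_compose[OF measurable_Pair[OF orbit_measurable' orbit_measurable'] gap_measurable])
  qed (rule gap_nonneg)
  with orbit_converges_origin show ?thesis
  proof eventually_elim
    case (elim s)
    define X where "X k = orbit k s x" for k
    define X0 where "X0 k = orbit k s origin" for k
    have gap0: "(\<lambda>k. gap (X k, X0 k)) \<longlonglongrightarrow> 0"
      using summable_LIMSEQ_zero[OF elim(2)] unfolding X_def X0_def .
    have conv0: "converges_to X0 (limit_state s)" using elim(1) unfolding X0_def .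
    have "(\<lambda>n. fst (X n) l) \<longlonglongrightarrow> fst (limit_state s) l" for l
    proof (cases "l \<le> M")
      case True
      have "norm (fst (X k) l - fst (X0 k) l) \<le> gap (X k, X0 k)" for k
        using size_ge[OF True, of "\<lambda>l. fst (X k) l - fst (X0 k) l"] unfolding gap_def by simp
      then have "(\<lambda>k. fst (X k) l - fst (X0 k) l) \<longlonglongrightarrow> 0"
        by (intro Lim_null_comparison[OF _ gap0]) auto
      then have "(\<lambda>k. (fst (X k) l - fst (X0 k) l) + fst (X0 k) l) \<longlonglongrightarrow> 0 + fst (limit_state s) l"
        using conv0 unfolding converges_to_def by (intro tendsto_add) auto
      then show ?thesis by simp
    next
      case False
      have "\<forall>\<^sub>F k in sequentially. fst (X0 k) l = fst (X k) l"
        using eventually_ge_at_top[of 1]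
      proof eventually_elim
        case (elim k)
        then show ?case using False by (cases k) (auto simp: X_def X0_def F_coord)
      qed
      moreover have "(\<lambda>k. fst (X0 k) l) \<longlonglongrightarrow> fst (limit_state s) l" using conv0 unfolding converges_to_def by auto
      ultimately show ?thesis by (rule Lim_transform_eventually[rotated])
    qed
    moreover have "\<forall>\<^sub>F k in sequentially. snd (X k) = snd (limit_state s)"
    proof -
      have "\<forall>\<^sub>F k in sequentially. gap (X k, X0 k) < 1" using gap0 by (rule order_tendstoD) simp
      moreover have "\<forall>\<^sub>F k in sequentially. snd (X0 k) = snd (limit_state s)" using conv0 unfolding converges_to_def by auto
      ultimately show ?thesis
      proof eventually_elim
        case (elim k)
        then show ?case using size_nonneg[of "\<lambda>l. fst (X k) l - fst (X0 k) l"] unfolding gap_def by (auto split: if_splits)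
      qed
    qed
    ultimately show ?case unfolding converges_to_def X_def by auto
  qed
qed

lemma converges_to_continuous:
  fixes g :: "(nat \<Rightarrow> real ^ 'n) \<times> 's \<Rightarrow> 'b::topological_space"
  assumes "converges_to X y" "\<And>j. continuous_on UNIV (\<lambda>z. g (z, j))"
  shows "(\<lambda>n. g (X n)) \<longlonglongrightarrow> g y"
proof -
  have "(\<lambda>n. fst (X n)) \<longlonglongrightarrow> fst y"
    using assms(1) unfolding converges_to_def by (intro tendsto_coordinatewise) auto
  then have "(\<lambda>n. g (fst (X n), snd y)) \<longlonglongrightarrow> g (fst y, snd y)"
    by (rule continuous_on_tendsto_compose[OF assms(2)]) auto
  then have "(\<lambda>n. g (fst (X n), snd y)) \<longlonglongrightarrow> g y" by simp
  moreover have "\<forall>\<^sub>F n in sequentially. g (fst (X n), snd y) = g (X n)"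
    using assms(1) unfolding converges_to_def by (auto elim!: eventually_mono) (metis prod.collapse)
  ultimately show ?thesis using Lim_transform_eventually by fastforce
qed

lemma converges_to_unique:
  assumes "converges_to X y" "converges_to X y'"
  shows "y = y'"
proof (rule prod_eqI)
  show "fst y = fst y'"
    using assms LIMSEQ_unique unfolding converges_to_def by (intro ext) blast
  have "\<forall>\<^sub>F n in sequentially. snd y = snd y'"
    using eventually_conj[OF conjunct2[OF assms(1)[unfolded converges_to_def]] conjunct2[OF assms(2)[unfolded converges_to_def]]]
    by (rule eventually_mono) auto
  then show "snd y = snd y'" by simp
qed

definition limit_law :: "((nat \<Rightarrow> real ^ 'n) \<times> 's) measure" where "limit_law = distr S SX limit_state"

lemma sets_limit_law [measurable_cong, simp]: "sets limit_law = sets SX" unfolding limit_law_def by simp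

lemma prob_limit_law: "prob_space limit_law"
  unfolding limit_law_def by (rule single.stream.prob_space_distr) simp

text \<open>
  The expectation after \<open>n\<close> steps is that of the \<open>n\<close>-th backward iterate, which converges almost surely.
\<close>

lemma ergodic:
  fixes g :: "(nat \<Rightarrow> real ^ 'n) \<times> 's \<Rightarrow> real"
  assumes "\<And>j. continuous_on UNIV (\<lambda>z. g (z, j))" and [measurable]: "g \<in> borel_measurable SX"
    and "\<And>y. 0 \<le> g y" "\<And>y. g y \<le> 1"
  shows "(\<lambda>n. (avg \<Theta> F ^^ n) (\<lambda>y. ennreal (g y)) x) \<longlonglongrightarrow> (\<integral>\<^sup>+y. ennreal (g y) \<partial>limit_law)"
proof -
  have "(\<lambda>n. \<integral>\<^sup>+s. ennreal (g (orbit n s x)) \<partial>S) \<longlonglongrightarrow> (\<integral>\<^sup>+s. ennreal (g (limit_state s)) \<partial>S)"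
  proof (rule nn_integral_dominated_convergence[where w="\<lambda>_. 1"])
    show "AE s in S. (\<lambda>n. ennreal (g (orbit n s x))) \<longlonglongrightarrow> ennreal (g (limit_state s))"
      using orbit_converges[of x]
    proof eventually_elim
      case (elim s)
      from converges_to_continuous[OF elim assms(1)] show ?case by (rule tendsto_ennrealI)
    qed
  qed (auto simp: assms single.stream.emeasure_space_1)
  then show ?thesis unfolding limit_law_def
    using single.nn_integral_back[of "\<lambda>y. ennreal (g y)" x] by (simp add: nn_integral_distr)
qed

text \<open>
  The outermost map can be pulled out of the limit because every map is continuous in the history.
\<close>

lemma limit_state_shift: "AE s in S. limit_state s = F (shd s) (limit_state (stl s))"
proof -
  let ?conv = "\<lambda>s. converges_to (\<lambda>n. orbit n s origin) (limit_state s)"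
  have [measurable]: "(\<lambda>s. fst (orbit n s origin) l) \<in> borel_measurable S" for n l
    using measurable_compose[OF measurable_compose[OF orbit_measurable' measurable_fst] coord_measurable] by simp
  have [measurable]: "(\<lambda>s. snd (orbit n s origin)) \<in> measurable S (count_space UNIV)" for n
    by (rule measurable_compose[OF orbit_measurable' measurable_snd])
  have [measurable]: "(\<lambda>s. fst (limit_state s) l) \<in> borel_measurable S" for l
    using measurable_compose[OF measurable_compose[OF limit_state_measurable measurable_fst] coord_measurable] by simp
  have [measurable]: "(\<lambda>s. snd (limit_state s)) \<in> measurable S (count_space UNIV)"
    by (rule measurable_compose[OF limit_state_measurable measurable_snd])
  have [measurable]: "Measurable.pred S ?conv"
  proof -
    have lim_iff: "(\<lambda>n. X n) \<longlonglongrightarrow> L \<longleftrightarrow> (\<forall>m::nat. \<exists>no. \<forall>n\<ge>no. dist (X n) L < inverse (real (Suc m)))"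
      for X :: "nat \<Rightarrow> real ^ 'n" and L
    proof
      assume R: "\<forall>m::nat. \<exists>no. \<forall>n\<ge>no. dist (X n) L < inverse (real (Suc m))"
      show "X \<longlonglongrightarrow> L"
      proof (rule metric_LIMSEQ_I)
        fix r :: real assume "0 < r"
        then obtain m where "inverse (real (Suc m)) < r" using reals_Archimedean by blast
        moreover obtain no where "\<forall>n\<ge>no. dist (X n) L < inverse (real (Suc m))" using R by blast
        ultimately show "\<exists>no. \<forall>n\<ge>no. dist (X n) L < r" by (intro exI[of _ no]) (auto intro: less_trans)
      qed
    qed (auto simp: LIMSEQ_def)
    have eq_iff: "(i = j) = (\<forall>k. (i = k) = (j = k))" for i j :: 's by auto
    show ?thesis
      unfolding converges_to_def eventually_sequentially lim_iff by (subst eq_iff) measurable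
  qed
  have "AE \<theta> in \<Theta>. AE s in S. ?conv (\<theta> ## s)"
    using orbit_converges_origin by (subst (asm) single.AE_stream_space) auto
  then have main: "AE \<theta> in \<Theta>. AE s in S. ?conv (\<theta> ## s) \<and> ?conv s"
  proof eventually_elim
    case (elim \<theta>)
    from this orbit_converges_origin show ?case by eventually_elim auto
  qed
  have "AE s in S. ?conv s \<and> ?conv (stl s)"
    using main by (subst single.AE_stream_space) auto
  then show ?thesis
  proof eventually_elim
    case (elim s)
    have "converges_to (\<lambda>n. orbit (Suc n) s origin) (limit_state s)"
    proof -
      have "(\<lambda>n. fst (orbit (Suc n) s origin) l) \<longlonglongrightarrow> fst (limit_state s) l" for l
        using elim unfolding converges_to_def by (intro LIMSEQ_Suc) auto
      moreover have "\<forall>\<^sub>F n in sequentially. snd (orbit (Suc n) s origin) = snd (limit_state s)"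
        using elim unfolding converges_to_def by (subst eventually_sequentially_Suc) auto
      ultimately show ?thesis unfolding converges_to_def by auto
    qed
    moreover have "converges_to (\<lambda>n. orbit (Suc n) s origin) (F (shd s) (limit_state (stl s)))"
    proof -
      have 1: "(\<lambda>n. fst (F (shd s) (orbit n (stl s) origin)) l) \<longlonglongrightarrow> fst (F (shd s) (limit_state (stl s))) l" for l
      proof (rule converges_to_continuous[where g="\<lambda>y. fst (F (shd s) y) l"])
        show "continuous_on UNIV (\<lambda>z. fst (F (shd s) (z, j)) l)" for j
          unfolding env_step_def using continuous_on_product_then_coordinatewise[OF em_step_continuous] by simp
      qed (use elim in auto)
      have "\<forall>\<^sub>F n in sequentially. snd (orbit n (stl s) origin) = snd (limit_state (stl s))"
        using elim unfolding converges_to_def by auto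
      then have 2: "\<forall>\<^sub>F n in sequentially. snd (F (shd s) (orbit n (stl s) origin)) = snd (F (shd s) (limit_state (stl s)))"
        by eventually_elim (simp add: env_step_def)
      show ?thesis using 1 2 unfolding converges_to_def by simp
    qed
    ultimately show ?case by (rule converges_to_unique)
  qed
qed

text \<open>
  Formulated through integrals, the form in which invariance is transported between histories and paths.
\<close>

definition invariant :: "((nat \<Rightarrow> real ^ 'n) \<times> 's) measure \<Rightarrow> bool" where
  "invariant \<nu> \<longleftrightarrow> sets \<nu> = sets SX \<and> prob_space \<nu> \<and>
     (\<forall>k. \<forall>g\<in>borel_measurable SX. (\<integral>\<^sup>+y. (avg \<Theta> F ^^ k) g y \<partial>\<nu>) = (\<integral>\<^sup>+y. g y \<partial>\<nu>))"

lemma invariant_limit_law: "invariant limit_law"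
proof -
  have step: "(\<integral>\<^sup>+y. avg \<Theta> F g y \<partial>limit_law) = (\<integral>\<^sup>+y. g y \<partial>limit_law)" if [measurable]: "g \<in> borel_measurable SX" for g
  proof -
    have [measurable]: "(\<lambda>\<theta>. g (F \<theta> y)) \<in> borel_measurable \<Theta>" for y
      by (rule measurable_compose[OF single.F_measurable'[OF measurable_ident_sets[OF refl]] that]) simp
    interpret p: pair_sigma_finite \<Theta> S ..
    have m[measurable]: "(\<lambda>z. g (F (fst z) (limit_state (snd z)))) \<in> borel_measurable (\<Theta> \<Otimes>\<^sub>M S)" by measurable
    have "(\<integral>\<^sup>+y. g y \<partial>limit_law) = (\<integral>\<^sup>+s. g (limit_state s) \<partial>S)"
      unfolding limit_law_def by (simp add: nn_integral_distr)
    also have "\<dots> = (\<integral>\<^sup>+s. g (F (shd s) (limit_state (stl s))) \<partial>S)"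
      using limit_state_shift by (intro nn_integral_cong_AE) auto
    also have "\<dots> = (\<integral>\<^sup>+\<theta>. \<integral>\<^sup>+s. g (F \<theta> (limit_state s)) \<partial>S \<partial>\<Theta>)"
      by (subst single.nn_integral_stream_space) auto
    also have "\<dots> = (\<integral>\<^sup>+s. \<integral>\<^sup>+\<theta>. g (F \<theta> (limit_state s)) \<partial>\<Theta> \<partial>S)"
      by (rule p.Fubini'[symmetric]) (use m in \<open>simp add: case_prod_beta'\<close>)
    also have "\<dots> = (\<integral>\<^sup>+y. avg \<Theta> F g y \<partial>limit_law)"
      unfolding limit_law_def avg_def[symmetric] by (simp add: nn_integral_distr)
    finally show ?thesis by simp
  qed
  have "(\<integral>\<^sup>+y. (avg \<Theta> F ^^ k) g y \<partial>limit_law) = (\<integral>\<^sup>+y. g y \<partial>limit_law)" if [measurable]: "g \<in> borel_measurable SX" for g k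
    by (induction k) (simp_all add: step)
  then show ?thesis unfolding invariant_def using prob_limit_law by auto
qed

text \<open>
  Integrating the convergence of \<open>ergodic\<close> over the starting point shows that an invariant law gives
  bounded continuous functions the same integrals as \<open>limit_law\<close>.
\<close>

lemma invariant_unique:
  assumes "invariant \<nu>"
  shows "\<nu> = limit_law"
proof (rule measure_eq_if_continuous_integrals)
  interpret \<nu>: prob_space \<nu> using assms unfolding invariant_def by auto
  have sets[measurable_cong]: "sets \<nu> = sets SX" using assms unfolding invariant_def by auto
  fix g :: "(nat \<Rightarrow> real ^ 'n) \<times> 's \<Rightarrow> real"
  assume g: "\<And>j. continuous_on UNIV (\<lambda>z. g (z, j))" "\<And>y. 0 \<le> g y" "\<And>y. g y \<le> 1" and [measurable]: "g \<in> borel_measurable SX"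
  have "(\<lambda>n. \<integral>\<^sup>+y. (avg \<Theta> F ^^ n) (\<lambda>y. ennreal (g y)) y \<partial>\<nu>) \<longlonglongrightarrow> (\<integral>\<^sup>+y. (\<integral>\<^sup>+y. ennreal (g y) \<partial>limit_law) \<partial>\<nu>)"
  proof (rule nn_integral_dominated_convergence[where w="\<lambda>_. 1"])
    show "AE y in \<nu>. (avg \<Theta> F ^^ n) (\<lambda>y. ennreal (g y)) y \<le> 1" for n
    proof (rule AE_I2)
      fix y
      have "(avg \<Theta> F ^^ n) (\<lambda>y. ennreal (g y)) y \<le> (avg \<Theta> F ^^ n) (\<lambda>y. 1) y"
        using g by (intro single.avg_pow_mono) auto
      then show "(avg \<Theta> F ^^ n) (\<lambda>y. ennreal (g y)) y \<le> 1" by (simp add: single.avg_pow_const)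
    qed
  qed (auto simp: \<nu>.emeasure_space_1 intro!: AE_I2 ergodic g)
  moreover have "(\<integral>\<^sup>+y. (avg \<Theta> F ^^ n) (\<lambda>y. ennreal (g y)) y \<partial>\<nu>) = (\<integral>\<^sup>+y. ennreal (g y) \<partial>\<nu>)" for n
    using assms unfolding invariant_def by auto
  ultimately show "(\<integral>\<^sup>+y. ennreal (g y) \<partial>\<nu>) = (\<integral>\<^sup>+y. ennreal (g y) \<partial>limit_law)"
    by (simp add: \<nu>.emeasure_space_1 LIMSEQ_const_iff)
qed (use assms prob_limit_law in \<open>auto simp: invariant_def\<close>)

text \<open>
  Fatou's lemma along the orbit of the origin, whose first moments are bounded.
\<close>

lemma limit_law_first_moment: "(\<integral>\<^sup>+y. ennreal (size (fst y)) \<partial>limit_law) \<le> ennreal (sqrt Bq * (1 + size (fst origin)))"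
proof -
  have cont: "continuous_on UNIV size"
  proof (rule continuous_on_sequentiallyI)
    fix u :: "nat \<Rightarrow> nat \<Rightarrow> real ^ 'n" and a assume u: "u \<longlonglongrightarrow> a"
    have "(\<lambda>n. \<Sum>l\<le>M. norm (u n l - a l)) \<longlonglongrightarrow> (\<Sum>l\<le>M. norm (a l - a l))"
      by (intro tendsto_sum tendsto_norm tendsto_diff tendsto_const tendsto_coordinate[OF u])
    then have lim: "(\<lambda>n. \<Sum>l\<le>M. norm (u n l - a l)) \<longlonglongrightarrow> 0" by simp
    have le: "size x \<le> size y + (\<Sum>l\<le>M. norm (x l - y l))" for x y :: "nat \<Rightarrow> real ^ 'n"
    proof (rule size_le)
      fix l assume l: "l \<le> M"
      have "norm (x l) \<le> norm (y l) + norm (x l - y l)" by (rule norm_triangle_sub)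
      also have "norm (x l - y l) \<le> (\<Sum>l\<le>M. norm (x l - y l))" using l by (intro member_le_sum) auto
      finally show "norm (x l) \<le> size y + (\<Sum>l\<le>M. norm (x l - y l))" using size_ge[OF l, of y] by linarith
    qed
    have "norm (size (u n) - size a) \<le> (\<Sum>l\<le>M. norm (u n l - a l))" for n
      using le[of "u n" a] le[of a "u n"] by (simp add: norm_minus_commute)
    then have "(\<lambda>n. size (u n) - size a) \<longlonglongrightarrow> 0" by (intro Lim_null_comparison[OF _ lim]) auto
    then show "(\<lambda>n. size (u n)) \<longlonglongrightarrow> size a" by (rule LIM_zero_cancel)
  qed
  have "(\<integral>\<^sup>+y. ennreal (size (fst y)) \<partial>limit_law) = (\<integral>\<^sup>+s. ennreal (size (fst (limit_state s))) \<partial>S)"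
    unfolding limit_law_def by (simp add: nn_integral_distr)
  also have "\<dots> = (\<integral>\<^sup>+s. liminf (\<lambda>n. ennreal (size (fst (orbit n s origin)))) \<partial>S)"
  proof (rule nn_integral_cong_AE)
    show "AE s in S. ennreal (size (fst (limit_state s))) = liminf (\<lambda>n. ennreal (size (fst (orbit n s origin))))"
      using orbit_converges_origin
    proof eventually_elim
      case (elim s)
      from converges_to_continuous[OF elim, of "\<lambda>y. size (fst y)"] cont
      have "(\<lambda>n. ennreal (size (fst (orbit n s origin)))) \<longlonglongrightarrow> ennreal (size (fst (limit_state s)))"
        by (intro tendsto_ennrealI) simp
      then show ?case using lim_imp_Liminf[OF sequentially_bot] by metis
    qed
  qed
  also have "\<dots> \<le> liminf (\<lambda>n. \<integral>\<^sup>+s. ennreal (size (fst (orbit n s origin))) \<partial>S)"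
    by (rule nn_integral_liminf) measurable
  also have "\<dots> = liminf (\<lambda>n. (avg \<Theta> F ^^ n) (\<lambda>y. ennreal (size (fst y))) origin)"
    using single.nn_integral_back[of "\<lambda>y. ennreal (size (fst y))" origin] by simp
  also have "\<dots> \<le> liminf (\<lambda>n. ennreal (sqrt Bq * (1 + size (fst origin))))"
    using size_first_moment[of _ "fst origin" "snd origin"] by (intro Liminf_mono) auto
  finally show ?thesis by (simp add: Liminf_const)
qed

end

section \<open>Path space and grid values\<close>

text \<open>
  The function \<open>f\<close> is arbitrary. For nonmeasurable \<open>f\<close> this direction of the change of variables
  survives, and it is the direction that bounds a transport cost from above.
\<close>

lemma nn_integral_distr_le:
  assumes T: "T \<in> measurable M N"
  shows "(\<integral>\<^sup>+y. f y \<partial>distr M N T) \<le> (\<integral>\<^sup>+x. f (T x) \<partial>M)"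
  unfolding nn_integral_def[of "distr M N T"]
proof (rule SUP_least)
  fix g assume "g \<in> {g. simple_function (distr M N T) g \<and> g \<le> f}"
  then have g: "simple_function (distr M N T) g" "\<And>y. g y \<le> f y" by (auto simp: le_fun_def)
  have m: "g \<in> borel_measurable N" using borel_measurable_simple_function[OF g(1)] by simp
  have "integral\<^sup>S (distr M N T) g = (\<integral>\<^sup>+y. g y \<partial>distr M N T)"
    by (rule nn_integral_eq_simple_integral[OF g(1), symmetric])
  also have "\<dots> = (\<integral>\<^sup>+x. g (T x) \<partial>M)" by (rule nn_integral_distr[OF T]) (use m in simp)
  also have "\<dots> \<le> (\<integral>\<^sup>+x. f (T x) \<partial>M)" by (intro nn_integral_mono g)
  finally show "integral\<^sup>S (distr M N T) g \<le> (\<integral>\<^sup>+x. f (T x) \<partial>M)" .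
qed

lemma measure_eqI_nn_integral:
  assumes "sets M = sets N" "\<And>f. f \<in> borel_measurable M \<Longrightarrow> (\<integral>\<^sup>+x. f x \<partial>M) = (\<integral>\<^sup>+x. f x \<partial>N)"
  shows "M = N"
proof (rule measure_eqI[OF assms(1)])
  fix A assume A: "A \<in> sets M"
  then show "emeasure M A = emeasure N A"
    using assms(2)[of "indicator A"] assms(1) by simp
qed

lemma open_paths_subset: "{U. openin (mtopology_of (path_space \<tau>)) U} \<subseteq> Pow (mspace (path_space \<tau>))"
  using openin_subset topspace_mtopology_of by fastforce

lemma space_path_borel: "space (path_borel \<tau>) = mspace (path_space \<tau>)"
  unfolding path_borel_def by (rule space_measure_of[OF open_paths_subset])

lemma sets_path_borel: "sets (path_borel \<tau>) = sigma_sets (mspace (path_space \<tau>)) {U. openin (mtopology_of (path_space \<tau>)) U}"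
  unfolding path_borel_def by (rule sets_measure_of[OF open_paths_subset])

lemma openin_path_space:
  "openin (mtopology_of (path_space \<tau>)) U \<longleftrightarrow> U \<subseteq> mspace (path_space \<tau>) \<and>
    (\<forall>x\<in>U. \<exists>e>0. \<forall>y\<in>mspace (path_space \<tau>). mdist (path_space \<tau>) x y < e \<longrightarrow> y \<in> U)"
proof -
  have "Metric_space.mball (mspace (path_space \<tau>)) (mdist (path_space \<tau>)) x r \<subseteq> U \<longleftrightarrow>
      (\<forall>y\<in>mspace (path_space \<tau>). mdist (path_space \<tau>) x y < r \<longrightarrow> y \<in> U)" if "x \<in> mspace (path_space \<tau>)" for x r
    using that by (auto simp: subset_iff Metric_space.in_mball[OF Metric_space_mspace_mdist])
  then show ?thesis
    unfolding mtopology_of_def Metric_space.openin_mtopology[OF Metric_space_mspace_mdist]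
    by (intro conj_cong refl) (simp add: Ball_def subset_iff[of U "mspace (path_space \<tau>)"])
qed

text \<open>
  Preimages of open sets under a nonexpansive map are open in the supremum metric. This applies to
  evaluations at grid points and to the norm.
\<close>

lemma lipschitz_measurable_path:
  fixes f :: "(real \<Rightarrow> real ^ 'n::finite) \<Rightarrow> 'b::metric_space"
  assumes "\<And>x y. x \<in> mspace (path_space \<tau>) \<Longrightarrow> y \<in> mspace (path_space \<tau>) \<Longrightarrow> dist (f x) (f y) \<le> mdist (path_space \<tau>) x y"
  shows "f \<in> borel_measurable (path_borel \<tau>)"
proof (rule borel_measurableI)
  fix U :: "'b set" assume "open U"
  have "openin (mtopology_of (path_space \<tau>)) (f -` U \<inter> mspace (path_space \<tau>))"
    unfolding openin_path_space
  proof (intro conjI ballI)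
    fix x assume x: "x \<in> f -` U \<inter> mspace (path_space \<tau>)"
    then obtain e where e: "e > 0" "\<And>y. dist y (f x) < e \<Longrightarrow> y \<in> U" using \<open>open U\<close> unfolding open_dist by auto
    have "y \<in> f -` U \<inter> mspace (path_space \<tau>)" if "y \<in> mspace (path_space \<tau>)" "mdist (path_space \<tau>) x y < e" for y
      using assms[of x y] x that e(2)[of "f y"] by (auto simp: dist_commute)
    then show "\<exists>e>0. \<forall>y\<in>mspace (path_space \<tau>). mdist (path_space \<tau>) x y < e \<longrightarrow> y \<in> f -` U \<inter> mspace (path_space \<tau>)"
      using e(1) by blast
  qed auto
  then show "f -` U \<inter> space (path_borel \<tau>) \<in> sets (path_borel \<tau>)"
    unfolding space_path_borel sets_path_borel by (intro sigma_sets.Basic) simp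
qed

lemma sup_norm_ge:
  assumes "continuous_on {-\<tau>..0} f" "\<theta> \<in> {-\<tau>..0}"
  shows "norm (f \<theta>) \<le> sup_norm \<tau> f"
  unfolding sup_norm_def
proof (rule cSUP_upper[OF assms(2)])
  have "bounded (f ` {-\<tau>..0})" by (rule bounded_path[OF assms(1)])
  then show "bdd_above ((\<lambda>\<theta>. norm (f \<theta>)) ` {-\<tau>..0})"
    unfolding bounded_iff bdd_above_def by auto
qed

lemma sup_norm_le: "0 \<le> \<tau> \<Longrightarrow> (\<And>\<theta>. \<theta> \<in> {-\<tau>..0} \<Longrightarrow> norm (f \<theta>) \<le> R) \<Longrightarrow> sup_norm \<tau> f \<le> R"
  unfolding sup_norm_def by (rule cSUP_least) auto

lemma path_continuous: "f \<in> mspace (path_space \<tau>) \<Longrightarrow> continuous_on {-\<tau>..0} f"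
  unfolding mspace_path_space by simp

lemma sup_norm_measurable:
  assumes "0 \<le> \<tau>"
  shows "sup_norm \<tau> \<in> borel_measurable (path_borel \<tau> :: (real \<Rightarrow> real ^ 'n::finite) measure)"
proof (rule lipschitz_measurable_path)
  fix x y :: "real \<Rightarrow> real ^ 'n" assume xy: "x \<in> mspace (path_space \<tau>)" "y \<in> mspace (path_space \<tau>)"
  have le: "sup_norm \<tau> x \<le> sup_norm \<tau> y + sup_norm \<tau> (\<lambda>\<theta>. x \<theta> - y \<theta>)"
    if "x \<in> mspace (path_space \<tau>)" "y \<in> mspace (path_space \<tau>)" for x y :: "real \<Rightarrow> real ^ 'n"
  proof (rule sup_norm_le[OF assms])
    fix \<theta> assume "\<theta> \<in> {-\<tau>..0}"
    then have "norm (y \<theta>) \<le> sup_norm \<tau> y" "norm (x \<theta> - y \<theta>) \<le> sup_norm \<tau> (\<lambda>\<theta>. x \<theta> - y \<theta>)"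
      using that path_continuous by (auto intro!: sup_norm_ge[of \<tau> y] sup_norm_ge[of \<tau> "\<lambda>\<theta>. x \<theta> - y \<theta>"] continuous_intros)
    moreover have "norm (x \<theta>) \<le> norm (y \<theta>) + norm (x \<theta> - y \<theta>)" by (rule norm_triangle_sub)
    ultimately show "norm (x \<theta>) \<le> sup_norm \<tau> y + sup_norm \<tau> (\<lambda>\<theta>. x \<theta> - y \<theta>)" by linarith
  qed
  have "sup_norm \<tau> (\<lambda>\<theta>. y \<theta> - x \<theta>) = sup_norm \<tau> (\<lambda>\<theta>. x \<theta> - y \<theta>)" unfolding sup_norm_def by (simp add: norm_minus_commute)
  then show "dist (sup_norm \<tau> x) (sup_norm \<tau> y) \<le> mdist (path_space \<tau>) x y"
    using le[OF xy] le[OF xy(2,1)] unfolding mdist_path_space[OF assms xy] dist_real_def by linarith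
qed

lemma sup_norm_nonneg: "0 \<le> \<tau> \<Longrightarrow> x \<in> mspace (path_space \<tau>) \<Longrightarrow> 0 \<le> sup_norm \<tau> x"
proof -
  assume "0 \<le> \<tau>" "x \<in> mspace (path_space \<tau>)"
  then have "norm (x 0) \<le> sup_norm \<tau> x" by (intro sup_norm_ge path_continuous) auto
  then show ?thesis using norm_ge_zero[of "x 0"] by linarith
qed

lemma space_state_space: "space (state_space \<tau>) = mspace (path_space \<tau>) \<times> UNIV"
  unfolding state_space_def by (simp add: space_pair_measure space_path_borel)

lemma first_moment_eq:
  fixes \<nu> :: "((real \<Rightarrow> real ^ 'n::finite) \<times> 's::finite) measure"
  assumes "0 \<le> \<tau>" and [measurable_cong]: "sets \<nu> = sets (state_space \<tau>)"
  shows "first_moment \<tau> \<nu> = (\<integral>\<^sup>+x. ennreal (sup_norm \<tau> (fst x)) \<partial>\<nu>)"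
proof -
  note [measurable] = sup_norm_measurable[OF assms(1)]
  have [measurable]: "(\<lambda>x. ennreal (sup_norm \<tau> (fst x))) \<in> borel_measurable (state_space \<tau>)"
    unfolding state_space_def by measurable
  have [measurable]: "(\<lambda>x. indicator {i} (snd x) :: ennreal) \<in> borel_measurable (state_space \<tau>)" for i :: 's
    unfolding state_space_def by (rule measurable_compose[OF measurable_snd]) simp
  have "first_moment \<tau> \<nu> = (\<integral>\<^sup>+x. (\<Sum>i\<in>UNIV. ennreal (sup_norm \<tau> (fst x)) * indicator {i} (snd x)) \<partial>\<nu>)"
    unfolding first_moment_def by (rule nn_integral_sum[symmetric]) measurable
  also have "\<dots> = (\<integral>\<^sup>+x. ennreal (sup_norm \<tau> (fst x)) \<partial>\<nu>)"
  proof (intro nn_integral_cong)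
    fix x :: "(real \<Rightarrow> real ^ 'n) \<times> 's"
    have "(\<Sum>i\<in>UNIV. indicator {i} (snd x) :: ennreal) = 1"
      by (subst sum.remove[of _ "snd x"]) (auto simp: indicator_def)
    then show "(\<Sum>i\<in>UNIV. ennreal (sup_norm \<tau> (fst x)) * indicator {i} (snd x)) = ennreal (sup_norm \<tau> (fst x))"
      by (simp add: sum_distrib_left[symmetric])
  qed
  finally show ?thesis .
qed

context em_contraction begin

abbreviation "SS \<equiv> (state_space \<tau> :: ((real \<Rightarrow> real ^ 'n) \<times> 's) measure)"

definition grid :: "(real \<Rightarrow> real ^ 'n) \<Rightarrow> nat \<Rightarrow> real ^ 'n" where
  "grid \<xi> = (\<lambda>l. if l \<le> M then \<xi> (- real l * \<delta>) else 0)"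

text \<open>
  Passing to paths and back erases the coordinates beyond \<open>M\<close>, which no step of the scheme reads.
\<close>

definition truncate :: "(nat \<Rightarrow> real ^ 'n) \<times> 's \<Rightarrow> (nat \<Rightarrow> real ^ 'n) \<times> 's" where
  "truncate y = ((\<lambda>l. if l \<le> M then fst y l else 0), snd y)"

definition to_path :: "(nat \<Rightarrow> real ^ 'n) \<times> 's \<Rightarrow> (real \<Rightarrow> real ^ 'n) \<times> 's" where
  "to_path y = (seg (fst y), snd y)"

definition to_grid :: "(real \<Rightarrow> real ^ 'n) \<times> 's \<Rightarrow> (nat \<Rightarrow> real ^ 'n) \<times> 's" where
  "to_grid x = (grid (fst x), snd x)"

lemma grid_point: "l \<le> M \<Longrightarrow> - real l * \<delta> \<in> {-\<tau>..0}"
  using delta_pos M_delta mult_right_mono[of "real l" "real M" \<delta>] by auto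

lemma to_grid_to_path: "to_grid (to_path y) = truncate y"
  unfolding to_grid_def to_path_def truncate_def grid_def
  using seg_grid[of _ "fst y"] by (auto simp: fun_eq_iff)

lemma seg_truncate: "seg (\<lambda>l. if l \<le> M then z l else 0) = seg z"
  unfolding seg_def by (intro restrict_ext sum.cong) auto

lemma to_path_truncate: "to_path (truncate y) = to_path y"
  unfolding to_path_def truncate_def by (simp add: seg_truncate)

lemma truncate_to_grid: "truncate (to_grid x) = to_grid x"
  unfolding to_grid_def truncate_def grid_def by auto

lemma truncate_F: "truncate (F \<theta> y) = F \<theta> y"
  unfolding truncate_def env_step_def em_step_def by auto

lemma F_truncate: "F \<theta> (truncate y) = F \<theta> y"
  unfolding truncate_def env_step_def em_step_def by (auto simp: seg_truncate fun_eq_iff)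

lemma truncate_orbit: "truncate (orbit k s y) = orbit k s (truncate y)"
  by (induction k arbitrary: s) (simp_all add: truncate_F, metis F_truncate)

text \<open>
  Interpolation is continuous from the product topology to the supremum metric, since finitely many
  coordinates determine the path.
\<close>

lemma seg_measurable: "seg \<in> measurable borel (path_borel \<tau> :: (real \<Rightarrow> real ^ 'n) measure)"
  unfolding path_borel_def
proof (rule measurable_measure_of)
  show "{U. openin (mtopology_of (path_space \<tau> :: (real \<Rightarrow> real ^ 'n) metric)) U} \<subseteq> Pow (mspace (path_space \<tau>))"
    using openin_subset topspace_mtopology_of by fastforce
  show "seg \<in> space borel \<rightarrow> mspace (path_space \<tau>)" using seg_path by auto
  fix U assume "U \<in> {U. openin (mtopology_of (path_space \<tau> :: (real \<Rightarrow> real ^ 'n) metric)) U}"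
  then have U: "openin (mtopology_of (path_space \<tau>)) U" by simp
  have "open (seg -` U)"
  proof (subst open_subopen, intro ballI)
    fix z0 assume "z0 \<in> seg -` U"
    then obtain e where e: "e > 0" "\<And>y. y \<in> mspace (path_space \<tau>) \<Longrightarrow> mdist (path_space \<tau>) (seg z0) y < e \<Longrightarrow> y \<in> U"
      using U unfolding openin_path_space by auto
    define V where "V = (\<Inter>l\<in>{..M}. {z :: nat \<Rightarrow> real ^ 'n. norm (z0 l - z l) < e / 2})"
    have "open V" unfolding V_def
      by (intro open_INT ballI open_Collect_less continuous_intros continuous_on_product_coordinates) auto
    moreover have "z0 \<in> V" unfolding V_def using e by simp
    moreover have "V \<subseteq> seg -` U"
    proof
      fix z assume z: "z \<in> V"
      have "sup_norm \<tau> (\<lambda>\<theta>. seg z0 \<theta> - seg z \<theta>) \<le> e / 2"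
      proof (rule sup_norm_le)
        fix \<theta> assume \<theta>: "\<theta> \<in> {-\<tau>..0}"
        show "norm (seg z0 \<theta> - seg z \<theta>) \<le> e / 2"
          unfolding seg_diff[OF \<theta>] using z by (intro norm_seg_bound[OF \<theta>]) (auto simp: V_def intro: less_imp_le)
      qed (use tau in simp)
      then have "mdist (path_space \<tau>) (seg z0) (seg z) < e"
        using e(1) tau by (subst mdist_path_space) (auto simp: seg_path)
      then show "z \<in> seg -` U" using e(2)[OF seg_path] by simp
    qed
    ultimately show "\<exists>V. open V \<and> z0 \<in> V \<and> V \<subseteq> seg -` U" by blast
  qed
  then show "seg -` U \<inter> space borel \<in> sets borel" by simp
qed

lemma grid_measurable: "grid \<in> measurable (path_borel \<tau>) borel"
proof (rule measurable_coordinatewise_then_product)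
  fix l
  have "(\<lambda>\<xi> :: real \<Rightarrow> real ^ 'n. \<xi> (- real l * \<delta>)) \<in> borel_measurable (path_borel \<tau>)" if l: "l \<le> M"
  proof (rule lipschitz_measurable_path)
    fix x y :: "real \<Rightarrow> real ^ 'n" assume xy: "x \<in> mspace (path_space \<tau>)" "y \<in> mspace (path_space \<tau>)"
    then have "norm (x (- real l * \<delta>) - y (- real l * \<delta>)) \<le> sup_norm \<tau> (\<lambda>\<theta>. x \<theta> - y \<theta>)"
      using path_continuous by (intro sup_norm_ge[of \<tau> "\<lambda>\<theta>. x \<theta> - y \<theta>"] grid_point l continuous_intros) auto
    then show "dist (x (- real l * \<delta>)) (y (- real l * \<delta>)) \<le> mdist (path_space \<tau>) x y"
      using tau xy by (simp add: mdist_path_space dist_norm)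
  qed
  then show "(\<lambda>\<xi>. grid \<xi> l) \<in> borel_measurable (path_borel \<tau>)"
    unfolding grid_def by (cases "l \<le> M") simp_all
qed

lemma to_path_measurable [measurable]: "to_path \<in> measurable SX SS"
  unfolding to_path_def[abs_def] state_space_def
  by (intro measurable_Pair measurable_compose[OF measurable_fst seg_measurable] measurable_snd)

lemma to_grid_measurable [measurable]: "to_grid \<in> measurable SS SX"
  unfolding to_grid_def[abs_def] state_space_def
  by (intro measurable_Pair measurable_compose[OF measurable_fst grid_measurable] measurable_snd)

text \<open>
  The law of the interpolated history after \<open>k\<close> steps from the grid values of a path. Backward
  composition gives the same law as running the scheme forward.
\<close>

definition path_kernel :: "nat \<Rightarrow> (real \<Rightarrow> real ^ 'n) \<times> 's \<Rightarrow> ((real \<Rightarrow> real ^ 'n) \<times> 's) measure" where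
  "path_kernel k x = distr S SS (\<lambda>s. to_path (orbit k s (to_grid x)))"

lemma orbit_path_measurable [measurable (raw)]:
  "f \<in> measurable A S \<Longrightarrow> g \<in> measurable A SS \<Longrightarrow> (\<lambda>x. to_path (orbit k (f x) (to_grid (g x)))) \<in> measurable A SS"
  by (rule measurable_compose[OF single.back_measurable'[OF _ measurable_compose[OF _ to_grid_measurable]] to_path_measurable])

lemma path_kernel_measurable: "path_kernel k \<in> measurable SS (subprob_algebra SS)"
  unfolding path_kernel_def[abs_def]
proof (rule measurable_distr2)
  show "(\<lambda>x. S) \<in> measurable SS (subprob_algebra S)"
    by (intro measurable_const) (simp add: space_subprob_algebra single.stream.subprob_space_axioms)
qed measurable

lemma nn_integral_path_kernel:
  assumes [measurable]: "f \<in> borel_measurable SS" and x: "x \<in> space SS"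
  shows "(\<integral>\<^sup>+y. f y \<partial>path_kernel k x) = (avg \<Theta> F ^^ k) (\<lambda>y. f (to_path y)) (to_grid x)"
proof -
  have "(\<integral>\<^sup>+y. f y \<partial>path_kernel k x) = (\<integral>\<^sup>+s. f (to_path (orbit k s (to_grid x))) \<partial>S)"
    unfolding path_kernel_def by (rule nn_integral_distr) measurable
  also have "\<dots> = (avg \<Theta> F ^^ k) (\<lambda>y. f (to_path y)) (to_grid x)"
    by (rule single.nn_integral_back) auto
  finally show ?thesis .
qed

lemma bind_path_kernel:
  assumes \<nu>: "\<nu> \<in> prob_measures \<tau>"
  shows "sets (\<nu> \<bind> path_kernel k) = sets SS"
    and "prob_space (\<nu> \<bind> path_kernel k)"
    and "f \<in> borel_measurable SS \<Longrightarrow> (\<integral>\<^sup>+y. f y \<partial>(\<nu> \<bind> path_kernel k)) = (\<integral>\<^sup>+x. (avg \<Theta> F ^^ k) (\<lambda>y. f (to_path y)) (to_grid x) \<partial>\<nu>)"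
proof -
  interpret \<nu>: prob_space \<nu> using \<nu> unfolding prob_measures_def by auto
  have sets[measurable_cong]: "sets \<nu> = sets SS" using \<nu> unfolding prob_measures_def by auto
  have space: "space \<nu> = space SS" by (rule sets_eq_imp_space_eq[OF sets])
  have m: "path_kernel k \<in> measurable \<nu> (subprob_algebra SS)"
    by (subst measurable_cong_sets[OF sets refl]) (rule path_kernel_measurable)
  show "sets (\<nu> \<bind> path_kernel k) = sets SS"
    by (rule sets_bind[where N=SS]) (auto simp: path_kernel_def \<nu>.not_empty)
  show "prob_space (\<nu> \<bind> path_kernel k)"
  proof (rule \<nu>.prob_space_bind[OF _ m])
    show "AE x in \<nu>. prob_space (path_kernel k x)"
    proof (rule AE_I2)
      fix x assume "x \<in> space \<nu>"
      then have "x \<in> space SS" by (simp add: space)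
      then show "prob_space (path_kernel k x)"
        unfolding path_kernel_def by (intro single.stream.prob_space_distr) measurable
    qed
  qed
  show "(\<integral>\<^sup>+y. f y \<partial>(\<nu> \<bind> path_kernel k)) = (\<integral>\<^sup>+x. (avg \<Theta> F ^^ k) (\<lambda>y. f (to_path y)) (to_grid x) \<partial>\<nu>)"
    if f: "f \<in> borel_measurable SS"
  proof -
    have "(\<integral>\<^sup>+y. f y \<partial>(\<nu> \<bind> path_kernel k)) = (\<integral>\<^sup>+x. \<integral>\<^sup>+y. f y \<partial>path_kernel k x \<partial>\<nu>)"
      by (rule nn_integral_bind[OF f m])
    also have "\<dots> = (\<integral>\<^sup>+x. (avg \<Theta> F ^^ k) (\<lambda>y. f (to_path y)) (to_grid x) \<partial>\<nu>)"
      by (intro nn_integral_cong nn_integral_path_kernel f) (simp add: space)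
    finally show ?thesis .
  qed
qed

lemma rho_to_path_le: "rho \<tau> (to_path y) (to_path y') \<le> gap (y, y')"
proof -
  have "sup_norm \<tau> (\<lambda>\<theta>. seg (fst y) \<theta> - seg (fst y') \<theta>) \<le> size (\<lambda>l. fst y l - fst y' l)"
  proof (rule sup_norm_le)
    fix \<theta> assume \<theta>: "\<theta> \<in> {-\<tau>..0}"
    show "norm (seg (fst y) \<theta> - seg (fst y') \<theta>) \<le> size (\<lambda>l. fst y l - fst y' l)"
      unfolding seg_diff[OF \<theta>] using size_ge[of _ "\<lambda>l. fst y l - fst y' l"] by (intro norm_seg_bound[OF \<theta>]) auto
  qed (use tau in simp)
  then show ?thesis unfolding rho_def to_path_def gap_def by simp
qed

lemma size_grid_le: "x \<in> space SS \<Longrightarrow> size (fst (to_grid x)) \<le> sup_norm \<tau> (fst x)"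
proof (rule size_le)
  fix l assume x: "x \<in> space SS" and l: "l \<le> M"
  have "norm (fst x (- real l * \<delta>)) \<le> sup_norm \<tau> (fst x)"
    using x by (intro sup_norm_ge path_continuous grid_point l) (auto simp: space_state_space)
  then show "norm (fst (to_grid x) l) \<le> sup_norm \<tau> (fst x)"
    using l unfolding to_grid_def grid_def by simp
qed

lemma sup_norm_seg_le: "sup_norm \<tau> (seg z) \<le> size z"
  using tau size_ge by (intro sup_norm_le norm_seg_bound) auto

text \<open>
  The transport plan draws the two initial conditions independently and then applies the same random maps
  to both.
\<close>

theorem wasserstein_path_kernel:
  fixes \<nu>1 \<nu>2 :: "((real \<Rightarrow> real ^ 'n) \<times> 's) measure"
  assumes \<nu>1: "\<nu>1 \<in> prob_measures \<tau>" and \<nu>2: "\<nu>2 \<in> prob_measures \<tau>"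
  shows "wasserstein \<tau> (\<nu>1 \<bind> path_kernel k) (\<nu>2 \<bind> path_kernel k)
    \<le> ennreal cc * (1 + first_moment \<tau> \<nu>1 + first_moment \<tau> \<nu>2) * ennreal (exp (- rate * real k * \<delta>))"
proof -
  interpret \<nu>1: prob_space \<nu>1 using \<nu>1 unfolding prob_measures_def by auto
  interpret \<nu>2: prob_space \<nu>2 using \<nu>2 unfolding prob_measures_def by auto
  have sets1[measurable_cong]: "sets \<nu>1 = sets SS" and sets2[measurable_cong]: "sets \<nu>2 = sets SS"
    using \<nu>1 \<nu>2 unfolding prob_measures_def by auto
  have space1: "space \<nu>1 = space SS" and space2: "space \<nu>2 = space SS"
    using sets_eq_imp_space_eq[OF sets1] sets_eq_imp_space_eq[OF sets2] by auto
  interpret p12: pair_prob_space \<nu>1 \<nu>2 ..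
  interpret p12S: pair_prob_space "\<nu>1 \<Otimes>\<^sub>M \<nu>2" S ..
  define T1 where "T1 w = to_path (orbit k (snd w) (to_grid (fst (fst w))))" for w :: "(((real \<Rightarrow> real ^ 'n) \<times> 's) \<times> ((real \<Rightarrow> real ^ 'n) \<times> 's)) \<times> (('s \<Rightarrow> 's) \<times> (real ^ 'm)) stream"
  define T2 where "T2 w = to_path (orbit k (snd w) (to_grid (snd (fst w))))" for w :: "(((real \<Rightarrow> real ^ 'n) \<times> 's) \<times> ((real \<Rightarrow> real ^ 'n) \<times> 's)) \<times> (('s \<Rightarrow> 's) \<times> (real ^ 'm)) stream"
  let ?N = "(\<nu>1 \<Otimes>\<^sub>M \<nu>2) \<Otimes>\<^sub>M S"
  have T1[measurable]: "T1 \<in> measurable ?N SS" unfolding T1_def[abs_def] by measurable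
  have T2[measurable]: "T2 \<in> measurable ?N SS" unfolding T2_def[abs_def] by measurable
  define \<pi> where "\<pi> = distr ?N (SS \<Otimes>\<^sub>M SS) (\<lambda>w. (T1 w, T2 w))"
  have marg1: "distr \<pi> SS fst = \<nu>1 \<bind> path_kernel k"
  proof (rule measure_eqI_nn_integral)
    show "sets (distr \<pi> SS fst) = sets (\<nu>1 \<bind> path_kernel k)" using bind_path_kernel(1)[OF \<nu>1] by simp
    fix f :: "(real \<Rightarrow> real ^ 'n) \<times> 's \<Rightarrow> ennreal" assume "f \<in> borel_measurable (distr \<pi> SS fst)"
    then have f[measurable]: "f \<in> borel_measurable SS" by simp
    have "(\<integral>\<^sup>+y. f y \<partial>distr \<pi> SS fst) = (\<integral>\<^sup>+w. f (T1 w) \<partial>?N)"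
      unfolding \<pi>_def by (simp add: nn_integral_distr distr_distr comp_def)
    also have "\<dots> = (\<integral>\<^sup>+x. \<integral>\<^sup>+y. \<integral>\<^sup>+s. f (to_path (orbit k s (to_grid x))) \<partial>S \<partial>\<nu>2 \<partial>\<nu>1)"
      unfolding T1_def by (simp add: single.stream.nn_integral_fst[symmetric] \<nu>2.nn_integral_fst[symmetric])
    also have "\<dots> = (\<integral>\<^sup>+x. (avg \<Theta> F ^^ k) (\<lambda>y. f (to_path y)) (to_grid x) \<partial>\<nu>1)"
      using single.nn_integral_back[of "\<lambda>y. f (to_path y)"] by (simp add: \<nu>2.emeasure_space_1)
    finally show "(\<integral>\<^sup>+y. f y \<partial>distr \<pi> SS fst) = (\<integral>\<^sup>+y. f y \<partial>(\<nu>1 \<bind> path_kernel k))"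
      using bind_path_kernel(3)[OF \<nu>1 f] by simp
  qed
  have marg2: "distr \<pi> SS snd = \<nu>2 \<bind> path_kernel k"
  proof (rule measure_eqI_nn_integral)
    show "sets (distr \<pi> SS snd) = sets (\<nu>2 \<bind> path_kernel k)" using bind_path_kernel(1)[OF \<nu>2] by simp
    fix f :: "(real \<Rightarrow> real ^ 'n) \<times> 's \<Rightarrow> ennreal" assume "f \<in> borel_measurable (distr \<pi> SS snd)"
    then have f[measurable]: "f \<in> borel_measurable SS" by simp
    have "(\<integral>\<^sup>+y. f y \<partial>distr \<pi> SS snd) = (\<integral>\<^sup>+w. f (T2 w) \<partial>?N)"
      unfolding \<pi>_def by (simp add: nn_integral_distr distr_distr comp_def)
    also have "\<dots> = (\<integral>\<^sup>+x. \<integral>\<^sup>+y. \<integral>\<^sup>+s. f (to_path (orbit k s (to_grid y))) \<partial>S \<partial>\<nu>2 \<partial>\<nu>1)"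
      unfolding T2_def by (simp add: single.stream.nn_integral_fst[symmetric] \<nu>2.nn_integral_fst[symmetric])
    also have "\<dots> = (\<integral>\<^sup>+y. (avg \<Theta> F ^^ k) (\<lambda>y. f (to_path y)) (to_grid y) \<partial>\<nu>2)"
      using single.nn_integral_back[of "\<lambda>y. f (to_path y)"] by (simp add: \<nu>1.emeasure_space_1)
    finally show "(\<integral>\<^sup>+y. f y \<partial>distr \<pi> SS snd) = (\<integral>\<^sup>+y. f y \<partial>(\<nu>2 \<bind> path_kernel k))"
      using bind_path_kernel(3)[OF \<nu>2 f] by simp
  qed
  have "\<pi> \<in> couplings \<tau> (\<nu>1 \<bind> path_kernel k) (\<nu>2 \<bind> path_kernel k)"
    unfolding couplings_def using marg1 marg2
    by (auto simp: \<pi>_def intro!: p12S.prob_space_distr)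
  then have "wasserstein \<tau> (\<nu>1 \<bind> path_kernel k) (\<nu>2 \<bind> path_kernel k) \<le> (\<integral>\<^sup>+z. ennreal (rho \<tau> (fst z) (snd z)) \<partial>\<pi>)"
    unfolding wasserstein_def by (rule INF_lower)
  also have "\<dots> \<le> (\<integral>\<^sup>+w. ennreal (rho \<tau> (T1 w) (T2 w)) \<partial>?N)"
    unfolding \<pi>_def by (rule order.trans[OF nn_integral_distr_le]) auto
  also have "\<dots> \<le> (\<integral>\<^sup>+w. ennreal (gap (orbit k (snd w) (to_grid (fst (fst w))), orbit k (snd w) (to_grid (snd (fst w))))) \<partial>?N)"
    unfolding T1_def T2_def by (intro nn_integral_mono ennreal_leI rho_to_path_le)
  also have "\<dots> = (\<integral>\<^sup>+x. \<integral>\<^sup>+y. \<integral>\<^sup>+s. ennreal (gap (orbit k s (to_grid x), orbit k s (to_grid y))) \<partial>S \<partial>\<nu>2 \<partial>\<nu>1)"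
    by (simp add: single.stream.nn_integral_fst[symmetric] \<nu>2.nn_integral_fst[symmetric])
  also have "\<dots> \<le> (\<integral>\<^sup>+x. \<integral>\<^sup>+y. ennreal (cc * exp (- (rate * real k * \<delta>))) * (1 + ennreal (sup_norm \<tau> (fst x)) + ennreal (sup_norm \<tau> (fst y))) \<partial>\<nu>2 \<partial>\<nu>1)"
  proof (intro nn_integral_mono order.trans[OF orbit_gap])
    fix x y assume xy: "x \<in> space \<nu>1" "y \<in> space \<nu>2"
    then have xs: "x \<in> space SS" "y \<in> space SS" using space1 space2 by auto
    let ?E = "exp (- (rate * real k * \<delta>))"
    have nn: "0 \<le> sup_norm \<tau> (fst x)" "0 \<le> sup_norm \<tau> (fst y)"
      using xs tau by (auto simp: space_state_space intro!: sup_norm_nonneg)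
    have "cc * (1 + size (fst (to_grid x)) + size (fst (to_grid y))) * ?E \<le> cc * (1 + sup_norm \<tau> (fst x) + sup_norm \<tau> (fst y)) * ?E"
      using cc_pos size_grid_le[OF xs(1)] size_grid_le[OF xs(2)] by (intro mult_right_mono mult_left_mono) auto
    then have "ennreal (cc * (1 + size (fst (to_grid x)) + size (fst (to_grid y))) * ?E) \<le> ennreal (cc * ?E * (1 + sup_norm \<tau> (fst x) + sup_norm \<tau> (fst y)))"
      by (intro ennreal_leI) (simp add: mult_ac)
    also have "\<dots> = ennreal (cc * ?E) * (1 + ennreal (sup_norm \<tau> (fst x)) + ennreal (sup_norm \<tau> (fst y)))"
      using nn cc_pos by (simp add: ennreal_mult ennreal_plus)
    finally show "ennreal (cc * (1 + size (fst (to_grid x)) + size (fst (to_grid y))) * ?E) \<le> ennreal (cc * ?E) * (1 + ennreal (sup_norm \<tau> (fst x)) + ennreal (sup_norm \<tau> (fst y)))" .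
  qed
  also have "\<dots> = ennreal (cc * exp (- (rate * real k * \<delta>))) * (1 + first_moment \<tau> \<nu>1 + first_moment \<tau> \<nu>2)"
  proof -
    have tau0: "0 \<le> \<tau>" using tau by simp
    have [measurable]: "(\<lambda>x. ennreal (sup_norm \<tau> (fst x))) \<in> borel_measurable SS"
      unfolding state_space_def using sup_norm_measurable[OF tau0] by measurable
    show ?thesis unfolding first_moment_eq[OF tau0 sets1] first_moment_eq[OF tau0 sets2]
      by (simp add: nn_integral_cmult nn_integral_add \<nu>1.emeasure_space_1 \<nu>2.emeasure_space_1)
  qed
  also have "\<dots> = ennreal cc * (1 + first_moment \<tau> \<nu>1 + first_moment \<tau> \<nu>2) * ennreal (exp (- rate * real k * \<delta>))"
    using cc_pos by (simp add: ennreal_mult mult_ac)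
  finally show ?thesis .
qed

definition path_law :: "((real \<Rightarrow> real ^ 'n) \<times> 's) measure" where "path_law = distr limit_law SS to_path"

lemma path_law_prob: "path_law \<in> prob_measures \<tau>"
proof -
  interpret l: prob_space limit_law by (rule prob_limit_law)
  show ?thesis unfolding prob_measures_def path_law_def by (auto intro!: l.prob_space_distr)
qed

lemma path_law_prob0: "path_law \<in> prob_measures0 \<tau>"
proof -
  have tau0: "0 \<le> \<tau>" using tau by simp
  have [measurable]: "(\<lambda>x. ennreal (sup_norm \<tau> (fst x))) \<in> borel_measurable SS"
    unfolding state_space_def using sup_norm_measurable[OF tau0] by measurable
  have "first_moment \<tau> path_law = (\<integral>\<^sup>+x. ennreal (sup_norm \<tau> (fst x)) \<partial>path_law)"
    by (rule first_moment_eq[OF tau0]) (simp add: path_law_def)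
  also have "\<dots> = (\<integral>\<^sup>+y. ennreal (sup_norm \<tau> (seg (fst y))) \<partial>limit_law)"
    unfolding path_law_def by (subst nn_integral_distr) (auto simp: to_path_def)
  also have "\<dots> \<le> (\<integral>\<^sup>+y. ennreal (size (fst y)) \<partial>limit_law)"
    by (intro nn_integral_mono ennreal_leI sup_norm_seg_le)
  also have "\<dots> \<le> ennreal (sqrt Bq * (1 + size (fst origin)))" by (rule limit_law_first_moment)
  finally have "first_moment \<tau> path_law < \<infinity>" using ennreal_less_top order.strict_trans1 by (metis infinity_ennreal_def)
  then show ?thesis unfolding prob_measures0_def using path_law_prob by simp
qed

lemma avg_to_path_truncate:
  assumes [measurable]: "f \<in> borel_measurable SS"
  shows "(avg \<Theta> F ^^ k) (\<lambda>y. f (to_path y)) (truncate y) = (avg \<Theta> F ^^ k) (\<lambda>y. f (to_path y)) y"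
proof -
  have "(avg \<Theta> F ^^ k) (\<lambda>y. f (to_path y)) (truncate y) = (\<integral>\<^sup>+s. f (to_path (orbit k s (truncate y))) \<partial>S)"
    using single.nn_integral_back[of "\<lambda>y. f (to_path y)" "truncate y" k] by simp
  also have "\<dots> = (\<integral>\<^sup>+s. f (to_path (orbit k s y)) \<partial>S)"
    unfolding truncate_orbit[symmetric] to_path_truncate ..
  also have "\<dots> = (avg \<Theta> F ^^ k) (\<lambda>y. f (to_path y)) y"
    using single.nn_integral_back[of "\<lambda>y. f (to_path y)" y k] by simp
  finally show ?thesis .
qed

lemma path_law_invariant: "path_law \<bind> path_kernel k = path_law"
proof (rule measure_eqI_nn_integral)
  show "sets (path_law \<bind> path_kernel k) = sets path_law"
    using bind_path_kernel(1)[OF path_law_prob] by (simp add: path_law_def)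
  fix f :: "(real \<Rightarrow> real ^ 'n) \<times> 's \<Rightarrow> ennreal" assume "f \<in> borel_measurable (path_law \<bind> path_kernel k)"
  then have f[measurable]: "f \<in> borel_measurable SS"
    using measurable_cong_sets[OF bind_path_kernel(1)[OF path_law_prob] refl] by auto
  have "(\<integral>\<^sup>+y. f y \<partial>(path_law \<bind> path_kernel k)) = (\<integral>\<^sup>+x. (avg \<Theta> F ^^ k) (\<lambda>y. f (to_path y)) (to_grid x) \<partial>path_law)"
    by (rule bind_path_kernel(3)[OF path_law_prob f])
  also have "\<dots> = (\<integral>\<^sup>+y. (avg \<Theta> F ^^ k) (\<lambda>y. f (to_path y)) (truncate y) \<partial>limit_law)"
  proof -
    have [measurable]: "(avg \<Theta> F ^^ k) (\<lambda>y. f (to_path y)) \<in> borel_measurable SX"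
      by (rule single.avg_pow_measurable) measurable
    show ?thesis unfolding path_law_def to_grid_to_path[symmetric] by (rule nn_integral_distr) measurable
  qed
  also have "\<dots> = (\<integral>\<^sup>+y. (avg \<Theta> F ^^ k) (\<lambda>y. f (to_path y)) y \<partial>limit_law)"
    by (simp add: avg_to_path_truncate)
  also have "\<dots> = (\<integral>\<^sup>+y. f (to_path y) \<partial>limit_law)"
  proof -
    have "(\<lambda>y. f (to_path y)) \<in> borel_measurable SX" by measurable
    then show ?thesis using invariant_limit_law unfolding invariant_def by blast
  qed
  also have "\<dots> = (\<integral>\<^sup>+y. f y \<partial>path_law)"
    unfolding path_law_def by (rule nn_integral_distr[symmetric]) measurable
  finally show "(\<integral>\<^sup>+y. f y \<partial>(path_law \<bind> path_kernel k)) = (\<integral>\<^sup>+y. f y \<partial>path_law)" .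
qed

text \<open>
  An invariant law on paths restricts to an invariant law on grid values, which is unique; and it is
  recovered from its grid values, because after zero steps the kernel already replaces a path by its
  interpolation.
\<close>

lemma path_law_unique:
  assumes \<mu>: "\<mu> \<in> prob_measures \<tau>" and inv: "\<And>k. \<mu> \<bind> path_kernel k = \<mu>"
  shows "\<mu> = path_law"
proof -
  interpret \<mu>: prob_space \<mu> using \<mu> unfolding prob_measures_def by auto
  have sets[measurable_cong]: "sets \<mu> = sets SS" using \<mu> unfolding prob_measures_def by auto
  have int: "(\<integral>\<^sup>+x. f x \<partial>\<mu>) = (\<integral>\<^sup>+x. (avg \<Theta> F ^^ k) (\<lambda>y. f (to_path y)) (to_grid x) \<partial>\<mu>)"
    if "f \<in> borel_measurable SS" for f :: "(real \<Rightarrow> real ^ 'n) \<times> 's \<Rightarrow> ennreal" and k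
    using bind_path_kernel(3)[OF \<mu> that, of k] unfolding inv .
  define \<nu> where "\<nu> = distr \<mu> SX to_grid"
  have "invariant \<nu>"
    unfolding invariant_def
  proof (intro conjI allI ballI)
    show "sets \<nu> = sets SX" unfolding \<nu>_def by simp
    show "prob_space \<nu>" unfolding \<nu>_def by (rule \<mu>.prob_space_distr) measurable
    fix k and g :: "(nat \<Rightarrow> real ^ 'n) \<times> 's \<Rightarrow> ennreal" assume g[measurable]: "g \<in> borel_measurable SX"
    have m[measurable]: "(avg \<Theta> F ^^ k) g \<in> borel_measurable SX"
      by (rule single.avg_pow_measurable) measurable
    have "(\<integral>\<^sup>+y. g y \<partial>\<nu>) = (\<integral>\<^sup>+x. g (to_grid x) \<partial>\<mu>)" unfolding \<nu>_def by (rule nn_integral_distr) measurable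
    also have "\<dots> = (\<integral>\<^sup>+x. (avg \<Theta> F ^^ k) (\<lambda>y. g (to_grid (to_path y))) (to_grid x) \<partial>\<mu>)"
      by (rule int) measurable
    also have "\<dots> = (\<integral>\<^sup>+x. (avg \<Theta> F ^^ k) g (to_grid x) \<partial>\<mu>)"
    proof (intro nn_integral_cong)
      fix x
      have "(avg \<Theta> F ^^ k) (\<lambda>y. g (to_grid (to_path y))) (to_grid x) = (\<integral>\<^sup>+s. g (to_grid (to_path (orbit k s (to_grid x)))) \<partial>S)"
        using single.nn_integral_back[of "\<lambda>y. g (to_grid (to_path y))" "to_grid x" k] by simp
      also have "\<dots> = (\<integral>\<^sup>+s. g (orbit k s (to_grid x)) \<partial>S)"
        by (simp add: to_grid_to_path truncate_orbit truncate_to_grid)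
      also have "\<dots> = (avg \<Theta> F ^^ k) g (to_grid x)" using single.nn_integral_back[of g "to_grid x" k] by simp
      finally show "(avg \<Theta> F ^^ k) (\<lambda>y. g (to_grid (to_path y))) (to_grid x) = (avg \<Theta> F ^^ k) g (to_grid x)" .
    qed
    also have "\<dots> = (\<integral>\<^sup>+y. (avg \<Theta> F ^^ k) g y \<partial>\<nu>)" unfolding \<nu>_def by (rule nn_integral_distr[symmetric]) measurable
    finally show "(\<integral>\<^sup>+y. (avg \<Theta> F ^^ k) g y \<partial>\<nu>) = (\<integral>\<^sup>+y. g y \<partial>\<nu>)" by simp
  qed
  then have \<nu>: "\<nu> = limit_law" by (rule invariant_unique)
  show ?thesis
  proof (rule measure_eqI_nn_integral)
    show "sets \<mu> = sets path_law" using sets by (simp add: path_law_def)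
    fix f :: "(real \<Rightarrow> real ^ 'n) \<times> 's \<Rightarrow> ennreal" assume "f \<in> borel_measurable \<mu>"
    then have f[measurable]: "f \<in> borel_measurable SS" using measurable_cong_sets[OF sets refl] by auto
    have "(\<integral>\<^sup>+x. f x \<partial>\<mu>) = (\<integral>\<^sup>+x. f (to_path (to_grid x)) \<partial>\<mu>)" using int[OF f, of 0] by simp
    also have "\<dots> = (\<integral>\<^sup>+y. f (to_path y) \<partial>\<nu>)" unfolding \<nu>_def by (rule nn_integral_distr[symmetric]) measurable
    also have "\<dots> = (\<integral>\<^sup>+y. f y \<partial>path_law)" unfolding \<nu> path_law_def by (rule nn_integral_distr[symmetric]) measurable
    finally show "(\<integral>\<^sup>+x. f x \<partial>\<mu>) = (\<integral>\<^sup>+x. f x \<partial>path_law)" .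
  qed
qed

end

section \<open>Brownian increments\<close>

definition increment_law :: "'w measure \<Rightarrow> (real \<Rightarrow> 'w \<Rightarrow> real ^ 'm::finite) \<Rightarrow> real \<Rightarrow> (real ^ 'm) measure" where
  "increment_law \<Omega> W \<delta> = distr \<Omega> borel (\<lambda>\<omega>. W \<delta> \<omega> - W 0 \<omega>)"

locale brownian = prob_space \<Omega> for \<Omega> :: "'w measure" +
  fixes W :: "real \<Rightarrow> 'w \<Rightarrow> real ^ 'm::finite"
  assumes bm: "brownian_motion \<Omega> W"
begin

lemma W_measurable: "t \<ge> 0 \<Longrightarrow> W t \<in> borel_measurable \<Omega>"
  using bm unfolding brownian_motion_def by blast

lemma increments_indep:
  "0 \<le> t 0 \<Longrightarrow> (\<And>k. k < n \<Longrightarrow> t k < t (Suc k)) \<Longrightarrow> indep_vars (\<lambda>_. borel) (\<lambda>k \<omega>. W (t (Suc k)) \<omega> - W (t k) \<omega>) {..<n}"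
  using bm unfolding brownian_motion_def by blast

lemma components_indep:
  "0 \<le> s \<Longrightarrow> s < t \<Longrightarrow> indep_vars (\<lambda>_. borel) (\<lambda>j \<omega>. (W t \<omega> - W s \<omega>) $ j) UNIV"
  using bm unfolding brownian_motion_def by blast

lemma components_normal:
  "0 \<le> s \<Longrightarrow> s < t \<Longrightarrow> distributed \<Omega> lborel (\<lambda>\<omega>. (W t \<omega> - W s \<omega>) $ j) (normal_density 0 (sqrt (t - s)))"
  using bm unfolding brownian_motion_def by blast

lemma increment_measurable: "0 \<le> s \<Longrightarrow> 0 \<le> t \<Longrightarrow> (\<lambda>\<omega>. W t \<omega> - W s \<omega>) \<in> borel_measurable \<Omega>"
  by (intro borel_measurable_diff W_measurable)

lemma component_measurable: "0 \<le> s \<Longrightarrow> 0 \<le> t \<Longrightarrow> (\<lambda>\<omega>. (W t \<omega> - W s \<omega>) $ j) \<in> borel_measurable \<Omega>"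
  by (rule measurable_compose[OF increment_measurable]) auto

text \<open>
  Independent normal components determine the law, which depends on the times only through \<open>t - s\<close>.
\<close>

lemma increment_distr:
  assumes "0 \<le> s" "s < t"
  shows "distr \<Omega> borel (\<lambda>\<omega>. W t \<omega> - W s \<omega>) =
    distr (PiM UNIV (\<lambda>_. density lborel (\<lambda>x. ennreal (normal_density 0 (sqrt (t - s)) x)))) borel (\<lambda>f. \<chi> j. f j)"
proof -
  have m: "(\<lambda>\<omega>. (W t \<omega> - W s \<omega>) $ j) \<in> borel_measurable \<Omega>" for j
    using assms by (intro component_measurable) auto
  have vec: "(\<lambda>f. \<chi> j. f j) \<in> measurable (PiM UNIV (\<lambda>_. borel :: real measure)) (borel :: (real ^ 'm) measure)"
  proof (rule borel_measurable_euclidean_space[THEN iffD2], rule ballI)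
    fix b :: "real ^ 'm" assume "b \<in> Basis"
    then obtain j where "b = axis j 1" by (auto simp: Basis_vec_def)
    then have "(\<lambda>f. (\<chi> j. f j) \<bullet> b) = (\<lambda>f. f j)" by (simp add: inner_axis fun_eq_iff)
    then show "(\<lambda>f. (\<chi> j. f j) \<bullet> b) \<in> borel_measurable (PiM UNIV (\<lambda>_. borel))" by simp
  qed
  have "distr \<Omega> (PiM UNIV (\<lambda>_. borel)) (\<lambda>\<omega>. \<lambda>j\<in>UNIV. (W t \<omega> - W s \<omega>) $ j)
      = PiM UNIV (\<lambda>j. distr \<Omega> borel (\<lambda>\<omega>. (W t \<omega> - W s \<omega>) $ j))"
    using indep_vars_iff_distr_eq_PiM[where I=UNIV and M'="\<lambda>_. borel" and X="\<lambda>j \<omega>. (W t \<omega> - W s \<omega>) $ j"] m components_indep[OF assms] by simp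
  also have "(\<lambda>j. distr \<Omega> borel (\<lambda>\<omega>. (W t \<omega> - W s \<omega>) $ j)) = (\<lambda>_. density lborel (\<lambda>x. ennreal (normal_density 0 (sqrt (t - s)) x)))"
  proof
    fix j
    have "distr \<Omega> borel (\<lambda>\<omega>. (W t \<omega> - W s \<omega>) $ j) = distr \<Omega> lborel (\<lambda>\<omega>. (W t \<omega> - W s \<omega>) $ j)"
      by (rule distr_cong) auto
    then show "distr \<Omega> borel (\<lambda>\<omega>. (W t \<omega> - W s \<omega>) $ j) = density lborel (\<lambda>x. ennreal (normal_density 0 (sqrt (t - s)) x))"
      using distributed_distr_eq_density[OF components_normal[OF assms]] by simp
  qed
  finally have eq: "distr \<Omega> (PiM UNIV (\<lambda>_. borel)) (\<lambda>\<omega>. \<lambda>j\<in>UNIV. (W t \<omega> - W s \<omega>) $ j)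
     = PiM UNIV (\<lambda>_. density lborel (\<lambda>x. ennreal (normal_density 0 (sqrt (t - s)) x)))" .
  have mm: "(\<lambda>\<omega>. \<lambda>j\<in>UNIV. (W t \<omega> - W s \<omega>) $ j) \<in> measurable \<Omega> (PiM UNIV (\<lambda>_. borel))"
    by (rule measurable_restrict) (rule m)
  have "distr \<Omega> borel (\<lambda>\<omega>. W t \<omega> - W s \<omega>) = distr (distr \<Omega> (PiM UNIV (\<lambda>_. borel)) (\<lambda>\<omega>. \<lambda>j\<in>UNIV. (W t \<omega> - W s \<omega>) $ j)) borel (\<lambda>f. \<chi> j. f j)"
    by (subst distr_distr[OF vec mm]) (simp add: comp_def restrict_UNIV vec_nth_inverse)
  then show ?thesis unfolding eq .
qed

lemma increment_law_eq:
  assumes "0 \<le> s" "0 < \<delta>"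
  shows "distr \<Omega> borel (\<lambda>\<omega>. W (s + \<delta>) \<omega> - W s \<omega>) = increment_law \<Omega> W \<delta>"
  using increment_distr[of s "s + \<delta>"] increment_distr[of 0 \<delta>] assms unfolding increment_law_def by simp

lemma gaussian_increment_law:
  assumes "0 < \<delta>"
  shows "gaussian_increment (increment_law \<Omega> W \<delta>) \<delta>"
proof -
  define Z where "Z j \<omega> = (W \<delta> \<omega> - W 0 \<omega>) $ j" for j \<omega>
  have m: "(\<lambda>\<omega>. W \<delta> \<omega> - W 0 \<omega>) \<in> borel_measurable \<Omega>" using assms by (intro increment_measurable) auto
  have Zm: "Z j \<in> borel_measurable \<Omega>" for j unfolding Z_def using assms by (intro component_measurable) auto
  have normal: "distributed \<Omega> lborel (Z j) (normal_density 0 (sqrt \<delta>))" for j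
    using components_normal[of 0 \<delta> j] assms unfolding Z_def by simp
  have sp: "0 < sqrt \<delta>" using assms by simp
  have int1: "integrable \<Omega> (Z j)" for j
    using distributed_integrable[OF normal, of "\<lambda>x. x" j] integrable_normal_moment_nz_1[OF sp, of 0] by simp
  have exp1: "(\<integral>\<omega>. Z j \<omega> \<partial>\<Omega>) = 0" for j
    using distributed_integral[OF normal, of "\<lambda>x. x" j] integral_normal_moment_nz_1[OF sp, of 0] by simp
  have int2: "integrable \<Omega> (\<lambda>\<omega>. Z j \<omega> * Z j \<omega>)" for j
    using distributed_integrable[OF normal, of "\<lambda>x. x\<^sup>2" j] integrable_normal_moment[OF sp, of 0 2] by (simp add: power2_eq_square)
  have exp2: "(\<integral>\<omega>. Z j \<omega> * Z j \<omega> \<partial>\<Omega>) = \<delta>" for j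
    using distributed_integral[OF normal, of "\<lambda>x. x\<^sup>2" j] integral_normal_moment_even[OF sp, of 0 1] assms
    by (simp add: power2_eq_square fact_numeral)
  have cross: "integrable \<Omega> (\<lambda>\<omega>. Z i \<omega> * Z j \<omega>) \<and> (\<integral>\<omega>. Z i \<omega> * Z j \<omega> \<partial>\<Omega>) = 0" if "i \<noteq> j" for i j
  proof -
    have "indep_vars (\<lambda>_. borel) Z UNIV" unfolding Z_def using assms by (intro components_indep) auto
    then have ind: "indep_vars (\<lambda>_. borel) Z {i, j}" by (rule indep_vars_subset) auto
    have "(\<integral>\<omega>. (\<Prod>k\<in>{i, j}. Z k \<omega>) \<partial>\<Omega>) = (\<Prod>k\<in>{i, j}. \<integral>\<omega>. Z k \<omega> \<partial>\<Omega>)"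
      by (rule indep_vars_lebesgue_integral[OF _ ind int1]) auto
    moreover have "integrable \<Omega> (\<lambda>\<omega>. \<Prod>k\<in>{i, j}. Z k \<omega>)"
      by (rule indep_vars_integrable[OF _ ind int1]) auto
    ultimately show ?thesis using that exp1 by simp
  qed
  show ?thesis
  proof (rule gaussian_increment.intro)
    show "prob_space (increment_law \<Omega> W \<delta>)" unfolding increment_law_def by (rule prob_space_distr[OF m])
    show "gaussian_increment_axioms (increment_law \<Omega> W \<delta>) \<delta>"
    proof
      show "sets (increment_law \<Omega> W \<delta>) = sets borel" unfolding increment_law_def by simp
      show "has_bochner_integral (increment_law \<Omega> W \<delta>) (\<lambda>w. w $ i) 0" for i
        unfolding increment_law_def has_bochner_integral_iff using m int1[of i] exp1[of i]
        by (auto simp: integrable_distr_eq integral_distr Z_def[abs_def])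
      show "has_bochner_integral (increment_law \<Omega> W \<delta>) (\<lambda>w. w $ i * w $ j) (if i = j then \<delta> else 0)" for i j
        unfolding increment_law_def has_bochner_integral_iff using m int2[of i] exp2[of i] cross[of i j]
        by (auto simp: integrable_distr_eq integral_distr Z_def[abs_def])
    qed
  qed
qed

end

section \<open>The law of the scheme\<close>

text \<open>
  The history obtained by applying the steps forward along given environment states and noise values.
\<close>

primrec driven_history :: "('h \<Rightarrow> 's \<Rightarrow> 'w \<Rightarrow> 'h) \<Rightarrow> 'h \<Rightarrow> (nat \<Rightarrow> 's) \<Rightarrow> (nat \<Rightarrow> 'w) \<Rightarrow> nat \<Rightarrow> 'h" where
  "driven_history step z0 x w 0 = z0"
| "driven_history step z0 x w (Suc k) = step (driven_history step z0 x w k) (x k) (w k)"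

lemma driven_history_cong:
  "(\<And>j. j < k \<Longrightarrow> x j = x' j) \<Longrightarrow> (\<And>j. j < k \<Longrightarrow> w j = w' j) \<Longrightarrow>
    driven_history step z0 x w k = driven_history step z0 x' w' k"
  by (induction k) auto

text \<open>
  An environment \<open>C\<close> and noises \<open>V\<close> on one probability space, known through their finite-dimensional
  laws and their independence of each other.
\<close>

locale driven_maps = environment_maps N "X :: 'h measure" step \<Phi> + O: prob_space \<Omega>
  for N :: "'w measure" and X step and \<Phi> :: "('s::finite \<Rightarrow> 's) pmf" and \<Omega> :: "'o measure" +
  fixes C :: "nat \<Rightarrow> 'o \<Rightarrow> 's" and V :: "nat \<Rightarrow> 'o \<Rightarrow> 'w"
  assumes C_meas: "\<And>k. C k \<in> measurable \<Omega> (count_space UNIV)"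
    and V_meas: "\<And>k. V k \<in> measurable \<Omega> N"
    and chain_step: "\<And>k x. O.prob {\<omega>\<in>space \<Omega>. \<forall>l\<le>Suc k. C l \<omega> = x l} =
        O.prob {\<omega>\<in>space \<Omega>. \<forall>l\<le>k. C l \<omega> = x l} * pmf (map_pmf (\<lambda>f. f (x k)) \<Phi>) (x (Suc k))"
    and noise_law: "\<And>n. distr \<Omega> (PiM {..<n} (\<lambda>_. N)) (\<lambda>\<omega>. \<lambda>k\<in>{..<n}. V k \<omega>) = PiM {..<n} (\<lambda>_. N)"
    and independent: "\<And>n k x B. B \<in> sets (PiM {..<n} (\<lambda>_. N)) \<Longrightarrow>
        O.prob ({\<omega>\<in>space \<Omega>. \<forall>l\<le>k. C l \<omega> = x l} \<inter> {\<omega>\<in>space \<Omega>. (\<lambda>k\<in>{..<n}. V k \<omega>) \<in> B}) =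
        O.prob {\<omega>\<in>space \<Omega>. \<forall>l\<le>k. C l \<omega> = x l} * O.prob {\<omega>\<in>space \<Omega>. (\<lambda>k\<in>{..<n}. V k \<omega>) \<in> B}"
begin

abbreviation "path_event k x \<equiv> {\<omega>\<in>space \<Omega>. \<forall>l\<le>k. C l \<omega> = x l}"

lemma path_event_sets: "path_event k x \<in> sets \<Omega>"
proof -
  have "path_event k x = (\<Inter>l\<in>{..k}. {\<omega>\<in>space \<Omega>. C l \<omega> = x l})" by auto
  also have "\<dots> \<in> sets \<Omega>" using C_meas by (intro sets.finite_INT) auto
  finally show ?thesis .
qed

lemma noise_meas: "(\<lambda>\<omega>. \<lambda>k\<in>{..<n}. V k \<omega>) \<in> measurable \<Omega> (PiM {..<n} (\<lambda>_. N))"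
  by (rule measurable_restrict) (rule V_meas)

text \<open>
  Given the environment path, the noises still have their product law.
\<close>

lemma nn_integral_path_event:
  assumes f: "f \<in> borel_measurable (PiM {..<n} (\<lambda>_. N))"
  shows "(\<integral>\<^sup>+\<omega>. indicator (path_event k x) \<omega> * f (\<lambda>j\<in>{..<n}. V j \<omega>) \<partial>\<Omega>)
    = ennreal (O.prob (path_event k x)) * (\<integral>\<^sup>+w. f w \<partial>PiM {..<n} (\<lambda>_. N))"
proof -
  let ?PM = "PiM {..<n} (\<lambda>_. N)"
  define A where "A = path_event k x"
  define G where "G \<omega> = (\<lambda>k\<in>{..<n}. V k \<omega>)" for \<omega>
  have A[measurable]: "A \<in> sets \<Omega>" unfolding A_def by (rule path_event_sets)
  have ind: "O.prob (A \<inter> {\<omega>\<in>space \<Omega>. G \<omega> \<in> B}) = O.prob A * O.prob {\<omega>\<in>space \<Omega>. G \<omega> \<in> B}" if "B \<in> sets ?PM" for B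
    unfolding A_def G_def by (rule independent[OF that])
  have law: "distr \<Omega> ?PM G = ?PM" unfolding G_def by (rule noise_law)
  have G: "G \<in> measurable \<Omega> ?PM" unfolding G_def by (rule noise_meas)
  have G': "G \<in> measurable (density \<Omega> (indicator A)) ?PM" using G by simp
  have eq: "distr (density \<Omega> (indicator A)) ?PM G = density ?PM (\<lambda>_. ennreal (O.prob A))"
  proof (rule measure_eqI)
    fix B assume "B \<in> sets (distr (density \<Omega> (indicator A)) ?PM G)"
    then have B: "B \<in> sets ?PM" by simp
    have GB: "G -` B \<inter> space \<Omega> \<in> sets \<Omega>" by (rule measurable_sets[OF G B])
    have "emeasure (distr (density \<Omega> (indicator A)) ?PM G) B = emeasure (density \<Omega> (indicator A)) (G -` B \<inter> space \<Omega>)"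
      using emeasure_distr[OF G' B] by simp
    also have "\<dots> = (\<integral>\<^sup>+\<omega>. indicator A \<omega> * indicator (G -` B \<inter> space \<Omega>) \<omega> \<partial>\<Omega>)"
      by (rule emeasure_density) (use GB in auto)
    also have "\<dots> = (\<integral>\<^sup>+\<omega>. indicator (A \<inter> (G -` B \<inter> space \<Omega>)) \<omega> \<partial>\<Omega>)"
      by (intro nn_integral_cong) (simp add: indicator_inter_arith)
    also have "\<dots> = emeasure \<Omega> (A \<inter> (G -` B \<inter> space \<Omega>))" using GB by (intro nn_integral_indicator) auto
    also have "G -` B \<inter> space \<Omega> = {\<omega>\<in>space \<Omega>. G \<omega> \<in> B}" by auto
    also have "emeasure \<Omega> (A \<inter> {\<omega>\<in>space \<Omega>. G \<omega> \<in> B}) = ennreal (O.prob A) * emeasure \<Omega> {\<omega>\<in>space \<Omega>. G \<omega> \<in> B}"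
      unfolding O.emeasure_eq_measure ind[OF B] by (simp add: ennreal_mult)
    also have "emeasure \<Omega> {\<omega>\<in>space \<Omega>. G \<omega> \<in> B} = emeasure (distr \<Omega> ?PM G) B"
      using emeasure_distr[OF G B] by (simp add: vimage_def Int_def conj_commute)
    also have "ennreal (O.prob A) * emeasure (distr \<Omega> ?PM G) B = emeasure (density ?PM (\<lambda>_. ennreal (O.prob A))) B"
      unfolding law using B by (simp add: emeasure_density nn_integral_cmult_indicator)
    finally show "emeasure (distr (density \<Omega> (indicator A)) ?PM G) B = emeasure (density ?PM (\<lambda>_. ennreal (O.prob A))) B" .
  qed simp
  have "(\<integral>\<^sup>+\<omega>. indicator A \<omega> * f (G \<omega>) \<partial>\<Omega>) = (\<integral>\<^sup>+\<omega>. f (G \<omega>) \<partial>density \<Omega> (indicator A))"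
    using measurable_compose[OF G f] by (subst nn_integral_density) auto
  also have "\<dots> = (\<integral>\<^sup>+w. f w \<partial>distr (density \<Omega> (indicator A)) ?PM G)"
    by (rule nn_integral_distr[OF G', symmetric]) (use f in simp)
  also have "\<dots> = ennreal (O.prob A) * (\<integral>\<^sup>+w. f w \<partial>?PM)"
    unfolding eq using f by (simp add: nn_integral_density nn_integral_cmult)
  finally show ?thesis unfolding A_def G_def .
qed

lemma driven_history_measurable:
  assumes z0: "z0 \<in> space X" and "k \<le> n"
  shows "(\<lambda>w. driven_history step z0 x w k) \<in> measurable (PiM {..<n} (\<lambda>_. N)) X"
  using \<open>k \<le> n\<close>
proof (induction k)
  case (Suc k)
  have "(\<lambda>w. w k) \<in> measurable (PiM {..<n} (\<lambda>_. N)) N" using Suc by (intro measurable_component_singleton) auto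
  then show ?case using Suc by (simp add: step_measurable')
qed (use z0 in simp)

lemma sum_over_paths:
  fixes f :: "(nat \<Rightarrow> 's) \<Rightarrow> ennreal"
  assumes "\<And>x x'. (\<And>l. l \<le> k \<Longrightarrow> x l = x' l) \<Longrightarrow> f x = f x'" and \<omega>: "\<omega> \<in> space \<Omega>"
  shows "(\<Sum>x\<in>PiE {..k} (\<lambda>_. UNIV). indicator (path_event k x) \<omega> * f x) = f (\<lambda>l. C l \<omega>)"
proof -
  define y where "y = (\<lambda>l\<in>{..k}. C l \<omega>)"
  have y: "y \<in> PiE {..k} (\<lambda>_. UNIV)" unfolding y_def by auto
  have "indicator (path_event k x) \<omega> * f x = 0" if "x \<in> PiE {..k} (\<lambda>_. UNIV)" "x \<noteq> y" for x
  proof -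
    have "\<not> (\<forall>l\<le>k. C l \<omega> = x l)"
    proof
      assume "\<forall>l\<le>k. C l \<omega> = x l"
      then have "x = y" using that(1) unfolding y_def by (auto simp: PiE_def extensional_def fun_eq_iff restrict_def)
      then show False using that by simp
    qed
    then show ?thesis by (auto simp: indicator_def)
  qed
  then have "(\<Sum>x\<in>PiE {..k} (\<lambda>_. UNIV) - {y}. indicator (path_event k x) \<omega> * f x) = 0"
    by (intro sum.neutral ballI) blast
  then have "(\<Sum>x\<in>PiE {..k} (\<lambda>_. UNIV). indicator (path_event k x) \<omega> * f x) = indicator (path_event k y) \<omega> * f y"
    by (subst sum.remove[OF _ y]) (auto simp: finite_PiE)
  also have "\<dots> = f y" using \<omega> unfolding y_def by (simp add: indicator_def)
  also have "\<dots> = f (\<lambda>l. C l \<omega>)" unfolding y_def by (intro assms(1)) simp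
  finally show ?thesis .
qed

lemma path_cylinder:
  "indicator (path_event k x) \<omega> * (if C (Suc k) \<omega> = j then c else 0) = (indicator (path_event (Suc k) (x(Suc k := j))) \<omega> * c :: ennreal)"
proof -
  have "\<omega> \<in> path_event (Suc k) (x(Suc k := j)) \<longleftrightarrow> \<omega> \<in> path_event k x \<and> C (Suc k) \<omega> = j"
    by (auto simp: le_Suc_eq)
  then show ?thesis by (auto simp: indicator_def)
qed

text \<open>
  The environment has finitely many paths up to step \<open>k\<close>. On each of them the history is a function of
  the independent noises, so integrating the last noise and summing over the last environment state
  produces one application of the transition operator.
\<close>

theorem nn_integral_driven_history:
  assumes z0: "z0 \<in> space X" and start: "AE \<omega> in \<Omega>. C 0 \<omega> = i"
    and "g \<in> borel_measurable (X \<Otimes>\<^sub>M count_space UNIV)"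
  shows "(\<integral>\<^sup>+\<omega>. g (driven_history step z0 (\<lambda>l. C l \<omega>) (\<lambda>l. V l \<omega>) k, C k \<omega>) \<partial>\<Omega>)
    = (avg (env_noise \<Phi> N) (env_step step) ^^ k) g (z0, i)"
  using assms(3)
proof (induction k arbitrary: g)
  case 0
  have "(\<integral>\<^sup>+\<omega>. g (z0, C 0 \<omega>) \<partial>\<Omega>) = (\<integral>\<^sup>+\<omega>. g (z0, i) \<partial>\<Omega>)"
    using start by (intro nn_integral_cong_AE) auto
  then show ?case by (simp add: O.emeasure_space_1)
next
  case (Suc k)
  note g[measurable] = Suc.prems
  let ?A = "avg (env_noise \<Phi> N) (env_step step) g"
  let ?PM = "\<lambda>n. PiM {..<n::nat} (\<lambda>_. N)"
  have Ag[measurable]: "?A \<in> borel_measurable (X \<Otimes>\<^sub>M count_space UNIV)" by (rule avg_measurable[OF g])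
  interpret PN: product_sigma_finite "\<lambda>_. N" ..
  let ?paths = "PiE {..k} (\<lambda>_. UNIV :: 's set)"
  let ?H = "\<lambda>x w k. driven_history step z0 x w k"
  have gj: "(\<lambda>h. g (h, j)) \<in> borel_measurable X" for j by measurable
  have Agj: "(\<lambda>h. ?A (h, j)) \<in> borel_measurable X" for j by measurable
  have restr: "?H x (\<lambda>l. V l \<omega>) k = ?H x (\<lambda>l\<in>{..<n}. V l \<omega>) k" if "k \<le> n" for x \<omega> k n
    by (rule driven_history_cong) (use that in auto)
  have inner: "(\<integral>\<^sup>+w. ?A (?H x w k, x k) \<partial>?PM k)
      = (\<Sum>j\<in>UNIV. ennreal (pmf (map_pmf (\<lambda>f. f (x k)) \<Phi>) j) * (\<integral>\<^sup>+w. g (?H x w (Suc k), j) \<partial>?PM (Suc k)))" for x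
  proof -
    have m: "(\<lambda>w. ?H x w k) \<in> measurable (?PM k) X" by (rule driven_history_measurable[OF z0]) simp
    have "(\<integral>\<^sup>+w. ?A (?H x w k, x k) \<partial>?PM k) = (\<integral>\<^sup>+w. (\<Sum>j\<in>UNIV. ennreal (pmf (map_pmf (\<lambda>f. f (x k)) \<Phi>) j) * (\<integral>\<^sup>+v. g (step (?H x w k) (x k) v, j) \<partial>N)) \<partial>?PM k)"
      by (intro nn_integral_cong avg_env g measurable_space[OF m])
    also have "\<dots> = (\<Sum>j\<in>UNIV. ennreal (pmf (map_pmf (\<lambda>f. f (x k)) \<Phi>) j) * (\<integral>\<^sup>+w. \<integral>\<^sup>+v. g (step (?H x w k) (x k) v, j) \<partial>N \<partial>?PM k))"
    proof -
      have [measurable]: "(\<lambda>w. \<integral>\<^sup>+v. g (step (?H x w k) (x k) v, j) \<partial>N) \<in> borel_measurable (?PM k)" for j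
      proof (rule noise.borel_measurable_nn_integral)
        have "(\<lambda>p. g (step (?H x (fst p) k) (x k) (snd p), j)) \<in> borel_measurable (?PM k \<Otimes>\<^sub>M N)"
          by (rule measurable_compose[OF step_measurable'[OF measurable_compose[OF measurable_fst m] measurable_snd] gj])
        then show "(\<lambda>(w, v). g (step (?H x w k) (x k) v, j)) \<in> borel_measurable (?PM k \<Otimes>\<^sub>M N)"
          by (simp add: case_prod_beta')
      qed
      show ?thesis by (simp add: nn_integral_sum nn_integral_cmult)
    qed
    finally have expand: "(\<integral>\<^sup>+w. ?A (?H x w k, x k) \<partial>?PM k) = (\<Sum>j\<in>UNIV. ennreal (pmf (map_pmf (\<lambda>f. f (x k)) \<Phi>) j) * (\<integral>\<^sup>+w. \<integral>\<^sup>+v. g (step (?H x w k) (x k) v, j) \<partial>N \<partial>?PM k))" .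
    have "(\<integral>\<^sup>+w. \<integral>\<^sup>+v. g (step (?H x w k) (x k) v, j) \<partial>N \<partial>?PM k) = (\<integral>\<^sup>+w. g (?H x w (Suc k), j) \<partial>?PM (Suc k))" for j
    proof -
      have m': "(\<lambda>w. g (?H x w (Suc k), j)) \<in> borel_measurable (?PM (Suc k))"
        by (rule measurable_compose[OF driven_history_measurable[OF z0] gj]) simp
      have ins: "{..<Suc k} = insert k {..<k}" by auto
      have "(\<integral>\<^sup>+w. g (?H x w (Suc k), j) \<partial>?PM (Suc k)) = (\<integral>\<^sup>+w. \<integral>\<^sup>+v. g (?H x (w(k := v)) (Suc k), j) \<partial>N \<partial>?PM k)"
        using m' unfolding ins by (subst PN.product_nn_integral_insert) auto
      moreover have "?H x (w(k := v)) k = ?H x w k" for w v by (rule driven_history_cong) auto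
      ultimately show ?thesis by simp
    qed
    then show ?thesis unfolding expand by simp
  qed
  have "(\<integral>\<^sup>+\<omega>. g (?H (\<lambda>l. C l \<omega>) (\<lambda>l. V l \<omega>) (Suc k), C (Suc k) \<omega>) \<partial>\<Omega>)
     = (\<integral>\<^sup>+\<omega>. (\<Sum>x\<in>?paths. \<Sum>j\<in>UNIV. indicator (path_event (Suc k) (x(Suc k := j))) \<omega> * g (?H x (\<lambda>l\<in>{..<Suc k}. V l \<omega>) (Suc k), j)) \<partial>\<Omega>)"
  proof (rule nn_integral_cong)
    fix \<omega> assume \<omega>: "\<omega> \<in> space \<Omega>"
    define f where "f x = (\<Sum>j\<in>UNIV. if C (Suc k) \<omega> = j then g (?H x (\<lambda>l\<in>{..<Suc k}. V l \<omega>) (Suc k), j) else 0)" for x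
    have "(\<Sum>x\<in>?paths. indicator (path_event k x) \<omega> * f x) = f (\<lambda>l. C l \<omega>)"
    proof (rule sum_over_paths[OF _ \<omega>])
      fix x x' :: "nat \<Rightarrow> 's" assume "\<And>l. l \<le> k \<Longrightarrow> x l = x' l"
      then have "?H x w (Suc k) = ?H x' w (Suc k)" for w by (intro driven_history_cong) auto
      then show "f x = f x'" unfolding f_def by (simp del: driven_history.simps)
    qed
    moreover have "f (\<lambda>l. C l \<omega>) = g (?H (\<lambda>l. C l \<omega>) (\<lambda>l. V l \<omega>) (Suc k), C (Suc k) \<omega>)"
      unfolding f_def restr[of "Suc k" "Suc k", OF order_refl] by simp
    ultimately show "g (?H (\<lambda>l. C l \<omega>) (\<lambda>l. V l \<omega>) (Suc k), C (Suc k) \<omega>) =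
        (\<Sum>x\<in>?paths. \<Sum>j\<in>UNIV. indicator (path_event (Suc k) (x(Suc k := j))) \<omega> * g (?H x (\<lambda>l\<in>{..<Suc k}. V l \<omega>) (Suc k), j))"
      unfolding f_def sum_distrib_left path_cylinder by simp
  qed
  also have "\<dots> = (\<Sum>x\<in>?paths. \<Sum>j\<in>UNIV. \<integral>\<^sup>+\<omega>. indicator (path_event (Suc k) (x(Suc k := j))) \<omega> * g (?H x (\<lambda>l\<in>{..<Suc k}. V l \<omega>) (Suc k), j) \<partial>\<Omega>)"
  proof -
    define T where "T x j \<omega> = indicator (path_event (Suc k) (x(Suc k := j))) \<omega> * g (?H x (\<lambda>l\<in>{..<Suc k}. V l \<omega>) (Suc k), j)" for x j \<omega>
    have "T x j \<in> borel_measurable \<Omega>" for x j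
      unfolding T_def
    proof (rule borel_measurable_times_ennreal)
      show "indicator (path_event (Suc k) (x(Suc k := j))) \<in> borel_measurable \<Omega>"
        by (rule borel_measurable_indicator[OF path_event_sets])
      show "(\<lambda>\<omega>. g (?H x (\<lambda>l\<in>{..<Suc k}. V l \<omega>) (Suc k), j)) \<in> borel_measurable \<Omega>"
        by (rule measurable_compose[OF noise_meas measurable_compose[OF driven_history_measurable[OF z0 order_refl] gj]])
    qed
    then show ?thesis unfolding T_def[symmetric] by (simp add: nn_integral_sum)
  qed
  also have "\<dots> = (\<Sum>x\<in>?paths. \<Sum>j\<in>UNIV. ennreal (O.prob (path_event (Suc k) (x(Suc k := j)))) * (\<integral>\<^sup>+w. g (?H x w (Suc k), j) \<partial>?PM (Suc k)))"
    by (intro sum.cong refl nn_integral_path_event measurable_compose[OF driven_history_measurable[OF z0] gj]) simp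
  also have "\<dots> = (\<Sum>x\<in>?paths. ennreal (O.prob (path_event k x)) * (\<integral>\<^sup>+w. ?A (?H x w k, x k) \<partial>?PM k))"
  proof (rule sum.cong[OF refl])
    fix x assume "x \<in> ?paths"
    have "O.prob (path_event (Suc k) (x(Suc k := j))) = O.prob (path_event k x) * pmf (map_pmf (\<lambda>f. f (x k)) \<Phi>) j" for j
    proof -
      have "path_event k (x(Suc k := j)) = path_event k x" by auto
      then show ?thesis using chain_step[of k "x(Suc k := j)"] by simp
    qed
    then show "(\<Sum>j\<in>UNIV. ennreal (O.prob (path_event (Suc k) (x(Suc k := j)))) * (\<integral>\<^sup>+w. g (?H x w (Suc k), j) \<partial>?PM (Suc k)))
      = ennreal (O.prob (path_event k x)) * (\<integral>\<^sup>+w. ?A (?H x w k, x k) \<partial>?PM k)"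
      unfolding inner sum_distrib_left by (intro sum.cong refl) (simp add: ennreal_mult mult.assoc)
  qed
  also have "\<dots> = (\<Sum>x\<in>?paths. \<integral>\<^sup>+\<omega>. indicator (path_event k x) \<omega> * ?A (?H x (\<lambda>l\<in>{..<k}. V l \<omega>) k, x k) \<partial>\<Omega>)"
    by (intro sum.cong refl nn_integral_path_event[symmetric] measurable_compose[OF driven_history_measurable[OF z0] Agj]) simp
  also have "\<dots> = (\<integral>\<^sup>+\<omega>. (\<Sum>x\<in>?paths. indicator (path_event k x) \<omega> * ?A (?H x (\<lambda>l\<in>{..<k}. V l \<omega>) k, x k)) \<partial>\<Omega>)"
  proof -
    define T where "T x \<omega> = indicator (path_event k x) \<omega> * ?A (?H x (\<lambda>l\<in>{..<k}. V l \<omega>) k, x k)" for x \<omega>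
    have "T x \<in> borel_measurable \<Omega>" for x
      unfolding T_def
    proof (rule borel_measurable_times_ennreal)
      show "indicator (path_event k x) \<in> borel_measurable \<Omega>"
        by (rule borel_measurable_indicator[OF path_event_sets])
      show "(\<lambda>\<omega>. ?A (?H x (\<lambda>l\<in>{..<k}. V l \<omega>) k, x k)) \<in> borel_measurable \<Omega>"
        by (rule measurable_compose[OF noise_meas measurable_compose[OF driven_history_measurable[OF z0 order_refl] Agj]])
    qed
    then show ?thesis unfolding T_def[symmetric] by (simp add: nn_integral_sum)
  qed
  also have "\<dots> = (\<integral>\<^sup>+\<omega>. ?A (?H (\<lambda>l. C l \<omega>) (\<lambda>l. V l \<omega>) k, C k \<omega>) \<partial>\<Omega>)"
  proof (rule nn_integral_cong)
    fix \<omega> assume \<omega>: "\<omega> \<in> space \<Omega>"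
    have "(\<Sum>x\<in>?paths. indicator (path_event k x) \<omega> * ?A (?H x (\<lambda>l\<in>{..<k}. V l \<omega>) k, x k)) = ?A (?H (\<lambda>l. C l \<omega>) (\<lambda>l\<in>{..<k}. V l \<omega>) k, C k \<omega>)"
    proof (rule sum_over_paths[OF _ \<omega>])
      fix x x' :: "nat \<Rightarrow> 's" assume eq: "\<And>l. l \<le> k \<Longrightarrow> x l = x' l"
      then have "?H x w k = ?H x' w k" for w by (intro driven_history_cong) auto
      then show "?A (?H x (\<lambda>l\<in>{..<k}. V l \<omega>) k, x k) = ?A (?H x' (\<lambda>l\<in>{..<k}. V l \<omega>) k, x' k)" using eq by simp
    qed
    then show "(\<Sum>x\<in>?paths. indicator (path_event k x) \<omega> * ?A (?H x (\<lambda>l\<in>{..<k}. V l \<omega>) k, x k)) = ?A (?H (\<lambda>l. C l \<omega>) (\<lambda>l. V l \<omega>) k, C k \<omega>)"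
      unfolding restr[of k k, OF order_refl] .
  qed
  also have "\<dots> = (avg (env_noise \<Phi> N) (env_step step) ^^ k) ?A (z0, i)"
    by (rule Suc.IH[OF Ag])
  finally show ?case by (simp add: funpow_swap1)
qed

end

section \<open>Small-step asymptotics of the chain\<close>

lemma finite_positive_lower_bound:
  fixes f :: "'x::finite \<Rightarrow> real"
  assumes "\<And>x. 0 < f x"
  obtains c where "0 < c" "\<And>x. c \<le> f x"
proof
  show "0 < Min (range f)" using assms by (subst Min_gr_iff) auto
  show "Min (range f) \<le> f x" for x by (intro Min_le) auto
qed

lemma transition_mean_deriv:
  fixes Q :: "real ^ 's::finite ^ 's"
  assumes p: "transition_semigroup Q p"
  shows "((\<lambda>h. ((\<Sum>j\<in>UNIV. p h i j * f j) - f i) / h) \<longlongrightarrow> (\<Sum>j\<in>UNIV. Q $ i $ j * f j)) (at_right 0)"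
proof -
  have "((\<lambda>h. \<Sum>j\<in>UNIV. (p h i j - (if i = j then 1 else 0)) / h * f j) \<longlongrightarrow> (\<Sum>j\<in>UNIV. Q $ i $ j * f j)) (at_right 0)"
    by (intro tendsto_sum tendsto_mult_right transition_deriv[OF p])
  moreover have "(\<Sum>j\<in>UNIV. (p h i j - (if i = j then 1 else 0)) / h * f j) = ((\<Sum>j\<in>UNIV. p h i j * f j) - f i) / h" for h
  proof -
    have "(\<Sum>j\<in>UNIV. (p h i j - (if i = j then 1 else 0)) / h * f j) = (\<Sum>j\<in>UNIV. p h i j * f j - (if i = j then f j else 0)) / h"
      unfolding sum_divide_distrib by (intro sum.cong) (auto simp: left_diff_distrib)
    then show ?thesis by (simp add: sum_subtractf)
  qed
  ultimately show ?thesis by simp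
qed

lemma transition_tendsto:
  fixes Q :: "real ^ 's::finite ^ 's"
  assumes p: "transition_semigroup Q p"
  shows "((\<lambda>h. p h i j) \<longlongrightarrow> (if i = j then 1 else 0)) (at_right 0)"
proof -
  have "((\<lambda>h. (p h i j - (if i = j then 1 else 0)) / h * h + (if i = j then 1 else 0)) \<longlongrightarrow> Q $ i $ j * 0 + (if i = j then 1 else 0)) (at_right 0)"
    by (intro tendsto_intros transition_deriv[OF p])
  moreover have "eventually (\<lambda>h. (p h i j - (if i = j then 1 else 0)) / h * h + (if i = j then 1 else 0) = p h i j) (at_right 0)"
    using eventually_at_right_less[of "0::real"] by eventually_elim simp
  ultimately show ?thesis using Lim_transform_eventually by fastforce
qed

text \<open>
  The generator of two independent copies is the sum of the generators acting on each coordinate.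
\<close>

lemma transition_pair_mean_deriv:
  fixes Q :: "real ^ 's::finite ^ 's"
  assumes p: "transition_semigroup Q p"
  shows "((\<lambda>t. ((\<Sum>i'\<in>UNIV. \<Sum>j'\<in>UNIV. p t i i' * p t j j' * h i' j') - h i j) / t)
    \<longlongrightarrow> (\<Sum>j'\<in>UNIV. Q $ j $ j' * h i j') + (\<Sum>i'\<in>UNIV. Q $ i $ i' * h i' j)) (at_right 0)"
proof -
  define g where "g t i' = (\<Sum>j'\<in>UNIV. p t j j' * h i' j')" for t i'
  have "((\<lambda>t. (\<Sum>i'\<in>UNIV. p t i i' * ((g t i' - h i' j) / t)) + ((\<Sum>i'\<in>UNIV. p t i i' * h i' j) - h i j) / t)
     \<longlongrightarrow> (\<Sum>i'\<in>UNIV. (if i = i' then 1 else 0) * (\<Sum>j'\<in>UNIV. Q $ j $ j' * h i' j')) + (\<Sum>i'\<in>UNIV. Q $ i $ i' * h i' j)) (at_right 0)"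
    unfolding g_def
    by (intro tendsto_add tendsto_sum tendsto_mult transition_tendsto[OF p] transition_mean_deriv[OF p])
  moreover have "(\<Sum>i'\<in>UNIV. (if i = i' then 1 else 0) * (\<Sum>j'\<in>UNIV. Q $ j $ j' * h i' j')) = (\<Sum>j'\<in>UNIV. Q $ j $ j' * h i j')"
    by (subst sum.remove[of _ i]) auto
  moreover have "(\<Sum>i'\<in>UNIV. p t i i' * ((g t i' - h i' j) / t)) + ((\<Sum>i'\<in>UNIV. p t i i' * h i' j) - h i j) / t
     = ((\<Sum>i'\<in>UNIV. \<Sum>j'\<in>UNIV. p t i i' * p t j j' * h i' j') - h i j) / t" for t
  proof -
    have "(\<Sum>i'\<in>UNIV. p t i i' * ((g t i' - h i' j) / t)) = ((\<Sum>i'\<in>UNIV. p t i i' * g t i') - (\<Sum>i'\<in>UNIV. p t i i' * h i' j)) / t"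
      unfolding sum_subtractf[symmetric] sum_divide_distrib by (intro sum.cong) (auto simp: right_diff_distrib)
    moreover have "(\<Sum>i'\<in>UNIV. p t i i' * g t i') = (\<Sum>i'\<in>UNIV. \<Sum>j'\<in>UNIV. p t i i' * p t j j' * h i' j')"
      unfolding g_def sum_distrib_left by (simp add: mult.assoc)
    ultimately show ?thesis by (simp add: add_divide_distrib[symmetric])
  qed
  ultimately show ?thesis by simp
qed

text \<open>
  Take \<open>h i j = 1 - lam ^ d i j\<close> with \<open>d i j\<close> the graph distance from \<open>i\<close> to \<open>j\<close> along positive rates. From
  distance \<open>n + 1\<close> the function can rise by at most \<open>lam ^ (n + 1)\<close>, whatever happens, while the
  first copy has a positive rate of moving one step closer, which lowers it by \<open>lam ^ n - lam ^ (n + 1)\<close>.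
  For small \<open>lam\<close> the loss outweighs the gain.
\<close>

lemma meeting_function:
  fixes Q :: "real ^ 's::finite ^ 's"
  assumes p: "transition_semigroup Q p"
    and conn: "\<And>i j. (i, j) \<in> {(i, j). i \<noteq> j \<and> 0 < Q $ i $ j}\<^sup>*"
  obtains h :: "'s \<Rightarrow> 's \<Rightarrow> real" and hm k0 where
    "\<And>i. h i i = 0" "\<And>i j. i \<noteq> j \<Longrightarrow> hm \<le> h i j" "\<And>i j. 0 \<le> h i j" "\<And>i j. h i j \<le> 1" "0 < hm" "0 < k0"
    "\<And>i j. i \<noteq> j \<Longrightarrow> (\<Sum>j'\<in>UNIV. Q $ j $ j' * h i j') + (\<Sum>i'\<in>UNIV. Q $ i $ i' * h i' j) \<le> - k0"
proof -
  define R where "R = {(i, j). i \<noteq> j \<and> 0 < Q $ i $ j}"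
  define d where "d i j = (LEAST n. (i, j) \<in> R ^^ n)" for i j
  have d: "(i, j) \<in> R ^^ d i j" for i j
  proof -
    obtain n where "(i, j) \<in> R ^^ n" using conn[of i j] unfolding R_def[symmetric] rtrancl_power by blast
    then show ?thesis unfolding d_def by (rule LeastI[of "\<lambda>n. (i, j) \<in> R ^^ n"])
  qed
  have d_le: "d i j \<le> n" if "(i, j) \<in> R ^^ n" for i j n unfolding d_def using that by (rule Least_le[of "\<lambda>n. (i, j) \<in> R ^^ n"])
  have d0: "d i i = 0" for i using d_le[of i i 0] by simp
  have d_pos: "0 < d i j" if "i \<noteq> j" for i j using d[of i j] that by (cases "d i j") auto
  have next_step: "\<exists>k. (i, k) \<in> R \<and> d k j < d i j" if ij: "i \<noteq> j" for i j
  proof -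
    obtain n where n: "d i j = Suc n" using d_pos[OF ij] by (cases "d i j") auto
    then have "(i, j) \<in> R ^^ Suc n" using d[of i j] by simp
    from relpow_Suc_D2[OF this] obtain k where "(i, k) \<in> R" "(k, j) \<in> R ^^ n" by blast
    then show ?thesis using d_le[of k j n] n by auto
  qed
  obtain q0 where q0: "0 < q0" "\<And>x. q0 \<le> (if Q $ fst x $ snd x > 0 then Q $ fst x $ snd x else 1)"
    by (rule finite_positive_lower_bound[of "\<lambda>x. if Q $ fst x $ snd x > 0 then Q $ fst x $ snd x else 1"]) auto
  have q0: "0 < q0" "\<And>i j. 0 < Q $ i $ j \<Longrightarrow> q0 \<le> Q $ i $ j"
  proof -
    show "q0 \<le> Q $ i $ j" if "0 < Q $ i $ j" for i j using q0(2)[of "(i, j)"] that by simp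
  qed (rule q0(1))
  define qb where "qb = (\<Sum>i\<in>UNIV. \<Sum>j\<in>UNIV. \<bar>Q $ i $ j\<bar>)"
  have qb: "0 \<le> qb" unfolding qb_def by (intro sum_nonneg) auto
  have qb_row: "(\<Sum>j\<in>UNIV - {i}. Q $ i $ j) \<le> qb" for i
  proof -
    have "(\<Sum>j\<in>UNIV - {i}. Q $ i $ j) \<le> (\<Sum>j\<in>UNIV - {i}. \<bar>Q $ i $ j\<bar>)" by (intro sum_mono) auto
    also have "\<dots> \<le> (\<Sum>j\<in>UNIV. \<bar>Q $ i $ j\<bar>)" by (intro sum_mono2) auto
    also have "\<dots> \<le> qb" unfolding qb_def
      by (intro member_le_sum[where f="\<lambda>i. \<Sum>j\<in>UNIV. \<bar>Q $ i $ j\<bar>"] sum_nonneg) auto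
    finally show ?thesis .
  qed
  \<comment> \<open>Small enough for \<open>2 * lam * qb < q0 * (1 - lam)\<close>, where \<open>q0\<close> is the least positive rate and \<open>qb\<close> bounds the row sums.\<close>
  define lam where "lam = q0 / (4 * (qb + q0))"
  have lam: "0 < lam" "lam < 1" unfolding lam_def using q0 qb by (auto simp: field_simps)
  have lamq: "2 * lam * qb < q0"
  proof -
    have "lam * (4 * (qb + q0)) = q0" unfolding lam_def using q0 qb by simp
    then have "4 * (lam * qb) + 4 * (lam * q0) = q0" by (simp add: algebra_simps)
    moreover have "0 < lam * q0" "0 \<le> lam * qb" using lam q0 qb by auto
    ultimately show ?thesis by linarith
  qed
  define h where "h i j = 1 - lam ^ d i j" for i j
  have row: "(\<Sum>i'\<in>UNIV. Q $ i $ i' * f i') \<le> c * qb" if f: "\<And>i'. f i' - f i \<le> c" "0 \<le> c" for i f and c :: real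
  proof -
    have "(\<Sum>i'\<in>UNIV. Q $ i $ i' * f i') = (\<Sum>i'\<in>UNIV. Q $ i $ i' * (f i' - f i))" by (rule generator_mult_diff[OF p])
    also have "\<dots> = (\<Sum>i'\<in>UNIV - {i}. Q $ i $ i' * (f i' - f i))" by (subst sum.remove[of _ i]) auto
    also have "\<dots> \<le> (\<Sum>i'\<in>UNIV - {i}. Q $ i $ i' * c)"
      using f generator_nonneg[OF p] by (intro sum_mono mult_left_mono) auto
    also have "\<dots> = c * (\<Sum>i'\<in>UNIV - {i}. Q $ i $ i')" by (simp add: sum_distrib_left mult.commute)
    also have "\<dots> \<le> c * qb" using qb_row[of i] f(2) by (rule mult_left_mono)
    finally show ?thesis .
  qed
  have row_strict: "(\<Sum>i'\<in>UNIV. Q $ i $ i' * f i') \<le> c * qb - q0 * e"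
    if f: "\<And>i'. f i' - f i \<le> c" "0 \<le> c" and k: "(i, k) \<in> R" "f k - f i \<le> - e" "0 \<le> e" for i k f and c e :: real
  proof -
    have ik: "i \<noteq> k" "0 < Q $ i $ k" using k unfolding R_def by auto
    have "(\<Sum>i'\<in>UNIV. Q $ i $ i' * f i') = (\<Sum>i'\<in>UNIV. Q $ i $ i' * (f i' - f i))" by (rule generator_mult_diff[OF p])
    also have "\<dots> = (\<Sum>i'\<in>UNIV - {i}. Q $ i $ i' * (f i' - f i))" by (subst sum.remove[of _ i]) auto
    also have "\<dots> = Q $ i $ k * (f k - f i) + (\<Sum>i'\<in>UNIV - {i} - {k}. Q $ i $ i' * (f i' - f i))"
      using ik by (subst sum.remove[of _ k]) auto
    also have "\<dots> \<le> - (q0 * e) + (\<Sum>i'\<in>UNIV - {i}. Q $ i $ i' * c)"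
    proof (rule add_mono)
      have "q0 * e \<le> Q $ i $ k * e" using q0(2)[OF ik(2)] k(3) by (rule mult_right_mono)
      moreover have "Q $ i $ k * (f k - f i) \<le> Q $ i $ k * (- e)" using k(2) ik(2) by (intro mult_left_mono) auto
      ultimately show "Q $ i $ k * (f k - f i) \<le> - (q0 * e)" by simp
      have "(\<Sum>i'\<in>UNIV - {i} - {k}. Q $ i $ i' * (f i' - f i)) \<le> (\<Sum>i'\<in>UNIV - {i} - {k}. Q $ i $ i' * c)"
        using f generator_nonneg[OF p] by (intro sum_mono mult_left_mono) auto
      also have "\<dots> \<le> (\<Sum>i'\<in>UNIV - {i}. Q $ i $ i' * c)"
        using f generator_nonneg[OF p] by (intro sum_mono2) auto
      finally show "(\<Sum>i'\<in>UNIV - {i} - {k}. Q $ i $ i' * (f i' - f i)) \<le> (\<Sum>i'\<in>UNIV - {i}. Q $ i $ i' * c)" .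
    qed
    also have "(\<Sum>i'\<in>UNIV - {i}. Q $ i $ i' * c) = c * (\<Sum>i'\<in>UNIV - {i}. Q $ i $ i')" by (simp add: sum_distrib_left mult.commute)
    also have "- (q0 * e) + \<dots> \<le> c * qb - q0 * e" using mult_left_mono[OF qb_row[of i] f(2)] by simp
    finally show ?thesis .
  qed
  have neg: "(\<Sum>j'\<in>UNIV. Q $ j $ j' * h i j') + (\<Sum>i'\<in>UNIV. Q $ i $ i' * h i' j) < 0" if ij: "i \<noteq> j" for i j
  proof -
    obtain k where k: "(i, k) \<in> R" "d k j < d i j" using next_step[OF ij] by auto
    obtain n where n: "d i j = Suc n" using d_pos[OF ij] by (cases "d i j") auto
    have up: "h x y - h i j \<le> lam ^ Suc n" for x y unfolding h_def n using lam by simp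
    have "(\<Sum>j'\<in>UNIV. Q $ j $ j' * h i j') \<le> lam ^ Suc n * qb"
      by (rule row[of "\<lambda>j'. h i j'"]) (use up lam in auto)
    moreover have "(\<Sum>i'\<in>UNIV. Q $ i $ i' * h i' j) \<le> lam ^ Suc n * qb - q0 * (lam ^ n - lam ^ Suc n)"
    proof (rule row_strict[of "\<lambda>i'. h i' j", OF up _ k(1)])
      have "lam ^ n \<le> lam ^ d k j" using lam k n by (intro power_decreasing) auto
      then show "h k j - h i j \<le> - (lam ^ n - lam ^ Suc n)" unfolding h_def n by simp
      show "0 \<le> lam ^ n - lam ^ Suc n" using lam by (simp add: mult_left_le_one_le)
    qed (use lam in auto)
    moreover have "lam ^ Suc n * qb + (lam ^ Suc n * qb - q0 * (lam ^ n - lam ^ Suc n)) = lam ^ n * (2 * lam * qb - q0 * (1 - lam))"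
      by (simp add: algebra_simps)
    moreover have "2 * lam * qb - q0 * (1 - lam) < 0"
    proof -
      have "lam * (4 * (qb + q0)) = q0" unfolding lam_def using q0 qb by simp
      then have "4 * (lam * qb) + 4 * (lam * q0) = q0" by (simp add: algebra_simps)
      moreover have "0 < lam * q0" "0 \<le> lam * qb" using lam q0 qb by auto
      ultimately show ?thesis by (simp add: algebra_simps)
    qed
    then have "lam ^ n * (2 * lam * qb - q0 * (1 - lam)) < 0" using lam by (simp add: mult_pos_neg)
    ultimately show ?thesis by linarith
  qed
  obtain k0 where k0: "0 < k0" "\<And>x. k0 \<le> (if fst x = snd x then 1 else - ((\<Sum>j'\<in>UNIV. Q $ snd x $ j' * h (fst x) j') + (\<Sum>i'\<in>UNIV. Q $ fst x $ i' * h i' (snd x))))"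
    by (rule finite_positive_lower_bound[of "\<lambda>x. if fst x = snd x then 1 else - ((\<Sum>j'\<in>UNIV. Q $ snd x $ j' * h (fst x) j') + (\<Sum>i'\<in>UNIV. Q $ fst x $ i' * h i' (snd x)))"])
      (use neg in force)+
  show ?thesis
  proof (rule that[of h "1 - lam" k0])
    show "1 - lam \<le> h i j" if "i \<noteq> j" for i j
      using d_pos[OF that] lam power_decreasing[of 1 "d i j" lam] unfolding h_def by simp
    show "(\<Sum>j'\<in>UNIV. Q $ j $ j' * h i j') + (\<Sum>i'\<in>UNIV. Q $ i $ i' * h i' j) \<le> - k0" if "i \<noteq> j" for i j
      using k0(2)[of "(i, j)"] that by simp
  qed (use lam k0 in \<open>auto simp: h_def d0 power_le_one\<close>)
qed

text \<open>
  A quantitative form of \<open>(1 - x) ^ M \<approx> exp (- M * x)\<close>, with the correction of order \<open>M * x\<^sup>2\<close>.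
\<close>

lemma one_minus_power_lower:
  fixes x :: real
  assumes "0 \<le> x" "x \<le> 1 / 2"
  shows "exp (- (real M * x) - 2 * real M * x\<^sup>2) \<le> (1 - x) ^ M"
proof -
  have "exp (- x - 2 * x\<^sup>2) \<le> exp (ln (1 - x))"
    using ln_one_minus_pos_lower_bound[OF assms] by simp
  also have "\<dots> = 1 - x" using assms by simp
  finally have "exp (- x - 2 * x\<^sup>2) ^ M \<le> (1 - x) ^ M" by (intro power_mono) auto
  then show ?thesis by (simp add: exp_of_nat_mult[symmetric] algebra_simps)
qed

section \<open>The kernel of the scheme\<close>

context em_contraction begin

lemma step_ito_integral_grid:
  "step_ito_integral \<delta> H w (real k * \<delta>) = (\<Sum>j<k. H (int j) *v (w (real (Suc j) * \<delta>) - w (real j * \<delta>)))"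
proof -
  have fl: "\<lfloor>real k * \<delta> / \<delta>\<rfloor> = int k" using delta_pos by simp
  have im: "{0..int k} = int ` {..k}" using image_int_atLeastAtMost[of 0 k] by (simp add: atLeast0AtMost)
  have "step_ito_integral \<delta> H w (real k * \<delta>)
     = (\<Sum>j\<le>k. H (int j) *v (w (min (real k * \<delta>) (of_int (int j + 1) * \<delta>)) - w (of_int (int j) * \<delta>)))"
    unfolding step_ito_integral_def fl im by (subst sum.reindex) (auto simp: o_def)
  also have "\<dots> = (\<Sum>j<k. H (int j) *v (w (min (real k * \<delta>) (of_int (int j + 1) * \<delta>)) - w (of_int (int j) * \<delta>)))"
    using delta_pos by (simp add: lessThan_Suc_atMost[symmetric] min_absorb1)
  also have "\<dots> = (\<Sum>j<k. H (int j) *v (w (real (Suc j) * \<delta>) - w (real j * \<delta>)))"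
  proof (intro sum.cong refl)
    fix j assume "j \<in> {..<k}"
    then have "real (Suc j) * \<delta> \<le> real k * \<delta>" using delta_pos by (intro mult_right_mono) auto
    then have "min (real k * \<delta>) (of_int (int j + 1) * \<delta>) = real (Suc j) * \<delta>" by (simp add: min_def add.commute)
    then show "H (int j) *v (w (min (real k * \<delta>) (of_int (int j + 1) * \<delta>)) - w (of_int (int j) * \<delta>)) = H (int j) *v (w (real (Suc j) * \<delta>) - w (real j * \<delta>))"
      by simp
  qed
  finally show ?thesis .
qed

lemma step_function_has_integral:
  fixes c :: "int \<Rightarrow> real ^ 'n"
  shows "((\<lambda>s. c \<lfloor>s / \<delta>\<rfloor>) has_integral (\<Sum>j<k. \<delta> *\<^sub>R c (int j))) {0..real k * \<delta>}"
proof (induction k)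
  case 0
  show ?case using has_integral_refl(1)[of "\<lambda>s. c \<lfloor>s / \<delta>\<rfloor>" "0 :: real"] by simp
next
  case (Suc k)
  have "((\<lambda>s. c (int k)) has_integral (\<delta> *\<^sub>R c (int k))) {real k * \<delta>..real (Suc k) * \<delta>}"
    using has_integral_const_real[of "c (int k)" "real k * \<delta>" "real (Suc k) * \<delta>"] delta_pos by (simp add: algebra_simps)
  then have "((\<lambda>s. c \<lfloor>s / \<delta>\<rfloor>) has_integral (\<delta> *\<^sub>R c (int k))) {real k * \<delta>..real (Suc k) * \<delta>}"
  proof (rule has_integral_spike_finite[rotated 2])
    fix s assume "s \<in> {real k * \<delta>..real (Suc k) * \<delta>} - {real (Suc k) * \<delta>}"
    then have "real k \<le> s / \<delta>" "s / \<delta> < real k + 1" using delta_pos by (auto simp: field_simps)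
    then have "\<lfloor>s / \<delta>\<rfloor> = int k" by (simp add: floor_eq_iff)
    then show "c \<lfloor>s / \<delta>\<rfloor> = c (int k)" by simp
  qed simp
  from has_integral_combine[OF _ _ Suc this] show ?case using delta_pos by (simp add: algebra_simps)
qed

text \<open>
  Between grid times the integrands are constant, so the integral equation telescopes into the recursion of
  \<open>em_step\<close>, pathwise.
\<close>

lemma em_history:
  assumes init: "\<And>\<theta>. \<theta> \<in> {-\<tau>..0} \<Longrightarrow> y \<theta> = \<xi> \<theta>"
    and eq: "\<And>t. 0 \<le> t \<Longrightarrow> y t = \<xi> 0
           + integral {0..t} (\<lambda>s. b (segment \<tau> \<delta> y \<lfloor>s / \<delta>\<rfloor>) (x (of_int \<lfloor>s / \<delta>\<rfloor> * \<delta>)))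
           + step_ito_integral \<delta> (\<lambda>k. \<sigma> (segment \<tau> \<delta> y k) (x (of_int k * \<delta>))) w t"
  shows "(\<lambda>l. if l \<le> M then y (of_int (int k - int l) * \<delta>) else 0) =
    driven_history em_step (grid \<xi>) (\<lambda>l. x (real l * \<delta>)) (\<lambda>l. w (real (Suc l) * \<delta>) - w (real l * \<delta>)) k"
proof (induction k)
  case 0
  have "y (- (real l * \<delta>)) = \<xi> (- (real l * \<delta>))" if "l \<le> M" for l
    using init[OF grid_point[OF that]] by simp
  then show ?case by (auto simp: grid_def fun_eq_iff)
next
  case (Suc k)
  define H where "H = (\<lambda>l. if l \<le> M then y (of_int (int k - int l) * \<delta>) else 0)"
  have segH: "segment \<tau> \<delta> y (int k) = seg H"
    unfolding segment_eq_seg H_def seg_truncate ..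
  define c where "c j = b (segment \<tau> \<delta> y j) (x (of_int j * \<delta>))" for j :: int
  define s where "s j = \<sigma> (segment \<tau> \<delta> y j) (x (of_int j * \<delta>))" for j :: int
  have yk: "y (real k * \<delta>) = \<xi> 0 + (\<Sum>j<k. \<delta> *\<^sub>R c (int j)) + (\<Sum>j<k. s (int j) *v (w (real (Suc j) * \<delta>) - w (real j * \<delta>)))" for k
    using eq[of "real k * \<delta>"] delta_pos integral_unique[OF step_function_has_integral[of c k]]
    unfolding c_def[symmetric] s_def[symmetric] step_ito_integral_grid by simp
  have step: "y (real (Suc k) * \<delta>) = y (real k * \<delta>) + \<delta> *\<^sub>R bb H (x (real k * \<delta>)) + ss H (x (real k * \<delta>)) *v (w (real (Suc k) * \<delta>) - w (real k * \<delta>))"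
    unfolding yk[of "Suc k"] yk[of k] by (simp add: c_def s_def segH)
  have "(\<lambda>l. if l \<le> M then y (of_int (int (Suc k) - int l) * \<delta>) else 0) = em_step H (x (real k * \<delta>)) (w (real (Suc k) * \<delta>) - w (real k * \<delta>))"
  proof
    fix l
    show "(if l \<le> M then y (of_int (int (Suc k) - int l) * \<delta>) else 0) = em_step H (x (real k * \<delta>)) (w (real (Suc k) * \<delta>) - w (real k * \<delta>)) l"
    proof (cases l)
      case 0
      have "H 0 = y (real k * \<delta>)" unfolding H_def by simp
      then show ?thesis using step unfolding em_step_def 0 by (simp add: add.commute)
    next
      case (Suc l')
      then show ?thesis unfolding em_step_def H_def by auto
    qed
  qed
  then show ?case using Suc unfolding H_def[symmetric] by simp
qed

text \<open>
  The grid values of the chain and the Brownian increments satisfy the assumptions of \<open>driven_maps\<close>, so the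
  law of the forward recursion is given by the transition operator.
\<close>

lemma em_kernel_eq_path_kernel:
  fixes \<Omega> :: "'w measure" and W :: "real \<Rightarrow> 'w \<Rightarrow> real ^ 'm"
  assumes bm: "brownian \<Omega> W" and N: "N = increment_law \<Omega> W \<delta>"
    and mc: "chain_process \<Omega> Q X" and start: "AE \<omega> in \<Omega>. X 0 \<omega> = i"
    and \<Phi>: "\<And>a c. pmf (map_pmf (\<lambda>f. f a) \<Phi>) c = chain_process.trans \<Omega> X \<delta> a c"
    and ind: "independent_processes \<Omega> W X"
    and em: "euler_maruyama \<Omega> \<tau> \<delta> b \<sigma> W X \<xi> Y" and \<xi>: "\<xi> \<in> mspace (path_space \<tau>)"
  shows "distr \<Omega> SS (\<lambda>\<omega>. (segment \<tau> \<delta> (\<lambda>r. Y r \<omega>) (int k), X (real k * \<delta>) \<omega>)) = path_kernel k (\<xi>, i)"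
proof -
  interpret B: brownian \<Omega> W by fact
  interpret C: chain_process \<Omega> Q X by fact
  define V where "V k \<omega> = W (real (Suc k) * \<delta>) \<omega> - W (real k * \<delta>) \<omega>" for k \<omega>
  have t0: "0 \<le> real k * \<delta>" for k using delta_pos by simp
  have Vm: "V k \<in> measurable \<Omega> N" for k
    unfolding measurable_cong_sets[OF refl sets_N] V_def using t0[of k] t0[of "Suc k"] by (intro B.increment_measurable)
  have Vm': "V k \<in> borel_measurable \<Omega>" for k using Vm[of k] measurable_cong_sets[OF refl sets_N, of \<Omega>] by auto
  have Vlaw: "distr \<Omega> borel (V k) = N" for k
    using B.increment_law_eq[OF t0[of k] delta_pos] unfolding V_def N by (simp add: algebra_simps)
  interpret D: driven_maps N borel em_step \<Phi> \<Omega> "\<lambda>k. X (real k * \<delta>)" V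
  proof
    show "X (real k * \<delta>) \<in> measurable \<Omega> (count_space UNIV)" for k by (rule C.X_meas[OF t0])
    show "V k \<in> measurable \<Omega> N" for k by (rule Vm)
    show "B.prob {\<omega> \<in> space \<Omega>. \<forall>l\<le>Suc k. X (real l * \<delta>) \<omega> = x l} =
       B.prob {\<omega> \<in> space \<Omega>. \<forall>l\<le>k. X (real l * \<delta>) \<omega> = x l} * pmf (map_pmf (\<lambda>f. f (x k)) \<Phi>) (x (Suc k))" for k x
    proof -
      have "B.prob {\<omega> \<in> space \<Omega>. X (real (Suc k) * \<delta>) \<omega> = x (Suc k) \<and> (\<forall>l\<le>k. X (real l * \<delta>) \<omega> = x l)}
         = B.prob {\<omega> \<in> space \<Omega>. \<forall>l\<le>k. X (real l * \<delta>) \<omega> = x l} * C.trans (real (Suc k) * \<delta> - real k * \<delta>) (x k) (x (Suc k))"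
        by (rule C.markov_step[where t="\<lambda>l. real l * \<delta>"]) (use delta_pos in auto)
      moreover have "real (Suc k) * \<delta> - real k * \<delta> = \<delta>" by (simp add: algebra_simps)
      moreover have "(\<forall>l\<le>Suc k. X (real l * \<delta>) \<omega> = x l) \<longleftrightarrow> X (real (Suc k) * \<delta>) \<omega> = x (Suc k) \<and> (\<forall>l\<le>k. X (real l * \<delta>) \<omega> = x l)" for \<omega>
        by (auto simp: le_Suc_eq)
      ultimately show ?thesis unfolding \<Phi> by simp
    qed
    show "distr \<Omega> (PiM {..<n} (\<lambda>_. N)) (\<lambda>\<omega>. \<lambda>k\<in>{..<n}. V k \<omega>) = PiM {..<n} (\<lambda>_. N)" for n
    proof (cases "n = 0")
      case True
      have "distr \<Omega> (PiM {} (\<lambda>_. N)) (\<lambda>\<omega>. \<lambda>k\<in>{}. V k \<omega>) = PiM {} (\<lambda>_. N)"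
      proof (rule measure_eqI)
        have m: "(\<lambda>\<omega>. \<lambda>k\<in>{}. V k \<omega>) \<in> measurable \<Omega> (PiM {} (\<lambda>_. N))" by (rule measurable_restrict) simp
        fix A assume "A \<in> sets (distr \<Omega> (PiM {} (\<lambda>_. N)) (\<lambda>\<omega>. \<lambda>k\<in>{}. V k \<omega>))"
        then have "A = {} \<or> A = {\<lambda>_. undefined}" by (simp add: sets_PiM_empty)
        then show "emeasure (distr \<Omega> (PiM {} (\<lambda>_. N)) (\<lambda>\<omega>. \<lambda>k\<in>{}. V k \<omega>)) A = emeasure (PiM {} (\<lambda>_. N)) A"
          using B.emeasure_space_1 m by (auto simp: emeasure_distr sets_PiM_empty restrict_def vimage_def)
      qed simp
      then show ?thesis using True by simp
    next
      case False
      have "B.indep_vars (\<lambda>_. borel) V {..<n}"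
        unfolding V_def using delta_pos by (intro B.increments_indep[where t="\<lambda>l. real l * \<delta>"]) auto
      then have "distr \<Omega> (PiM {..<n} (\<lambda>_. borel)) (\<lambda>\<omega>. \<lambda>k\<in>{..<n}. V k \<omega>) = PiM {..<n} (\<lambda>k. distr \<Omega> borel (V k))"
        using B.indep_vars_iff_distr_eq_PiM[where I="{..<n}" and M'="\<lambda>_. borel" and X=V] Vm' False by auto
      moreover have "distr \<Omega> (PiM {..<n} (\<lambda>_. N)) (\<lambda>\<omega>. \<lambda>k\<in>{..<n}. V k \<omega>) = distr \<Omega> (PiM {..<n} (\<lambda>_. borel)) (\<lambda>\<omega>. \<lambda>k\<in>{..<n}. V k \<omega>)"
        by (intro distr_cong sets_PiM_cong refl) simp
      ultimately show ?thesis by (simp add: Vlaw)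
    qed
    show "B.prob ({\<omega>\<in>space \<Omega>. \<forall>l\<le>k. X (real l * \<delta>) \<omega> = x l} \<inter> {\<omega>\<in>space \<Omega>. (\<lambda>k\<in>{..<n}. V k \<omega>) \<in> A}) =
        B.prob {\<omega>\<in>space \<Omega>. \<forall>l\<le>k. X (real l * \<delta>) \<omega> = x l} * B.prob {\<omega>\<in>space \<Omega>. (\<lambda>k\<in>{..<n}. V k \<omega>) \<in> A}"
      if A: "A \<in> sets (PiM {..<n} (\<lambda>_. N))" for n k x A
    proof -
      let ?PW = "PiM {0::real..} (\<lambda>_. borel :: (real ^ 'm) measure)" and ?PX = "PiM {0::real..} (\<lambda>_. count_space (UNIV :: 's set))"
      let ?VW = "vimage_algebra (space \<Omega>) (\<lambda>\<omega>. \<lambda>t\<in>{0..}. W t \<omega>) ?PW"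
      let ?VX = "vimage_algebra (space \<Omega>) (\<lambda>\<omega>. \<lambda>t\<in>{0..}. X t \<omega>) ?PX"
      have 1: "{\<omega>\<in>space \<Omega>. \<forall>l\<le>k. X (real l * \<delta>) \<omega> = x l} \<in> sets ?VX"
      proof -
        have m: "(\<lambda>\<omega>. \<lambda>t\<in>{0..}. X t \<omega>) \<in> measurable ?VX ?PX"
          by (rule measurable_vimage_algebra1) (auto simp: space_PiM)
        have Xm: "(\<lambda>\<omega>. X (real l * \<delta>) \<omega>) \<in> measurable ?VX (count_space UNIV)" for l
        proof -
          have "(\<lambda>f. f (real l * \<delta>)) \<in> measurable ?PX (count_space UNIV)"
            by (rule measurable_component_singleton) (use t0 in simp)
          from measurable_compose[OF m this] show ?thesis using t0[of l] by simp
        qed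
        have "{\<omega>\<in>space \<Omega>. \<forall>l\<le>k. X (real l * \<delta>) \<omega> = x l} = (\<Inter>l\<in>{..k}. (\<lambda>\<omega>. X (real l * \<delta>) \<omega>) -` {x l} \<inter> space ?VX)" by auto
        also have "\<dots> \<in> sets ?VX" by (intro sets.finite_INT measurable_sets[OF Xm]) auto
        finally show ?thesis .
      qed
      have 2: "{\<omega>\<in>space \<Omega>. (\<lambda>k\<in>{..<n}. V k \<omega>) \<in> A} \<in> sets ?VW"
      proof -
        have m: "(\<lambda>\<omega>. \<lambda>t\<in>{0..}. W t \<omega>) \<in> measurable ?VW ?PW"
          by (rule measurable_vimage_algebra1) (auto simp: space_PiM)
        have Wm: "(\<lambda>\<omega>. W t \<omega>) \<in> borel_measurable ?VW" if "0 \<le> t" for t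
        proof -
          have "(\<lambda>f. f t) \<in> borel_measurable ?PW"
            by (rule measurable_component_singleton) (use that in simp)
          from measurable_compose[OF m this] show ?thesis using that by simp
        qed
        have "(\<lambda>\<omega>. \<lambda>k\<in>{..<n}. V k \<omega>) \<in> measurable ?VW (PiM {..<n} (\<lambda>_. N))"
          unfolding V_def
          by (intro measurable_restrict) (auto simp: measurable_cong_sets[OF refl sets_N] intro!: borel_measurable_diff Wm mult_nonneg_nonneg less_imp_le[OF delta_pos])
        from measurable_sets[OF this A] show ?thesis by (simp add: vimage_def Int_def conj_commute)
      qed
      have "B.prob ({\<omega>\<in>space \<Omega>. (\<lambda>k\<in>{..<n}. V k \<omega>) \<in> A} \<inter> {\<omega>\<in>space \<Omega>. \<forall>l\<le>k. X (real l * \<delta>) \<omega> = x l})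
         = B.prob {\<omega>\<in>space \<Omega>. (\<lambda>k\<in>{..<n}. V k \<omega>) \<in> A} * B.prob {\<omega>\<in>space \<Omega>. \<forall>l\<le>k. X (real l * \<delta>) \<omega> = x l}"
        using ind unfolding independent_processes_def by (rule B.indep_setD[OF _ 2 1])
      then show ?thesis by (simp add: Int_commute mult.commute)
    qed
  qed
  define H where "H \<omega> = (\<lambda>l. if l \<le> M then Y (of_int (int k - int l) * \<delta>) \<omega> else 0)" for \<omega>
  have segH: "segment \<tau> \<delta> (\<lambda>r. Y r \<omega>) (int k) = seg (H \<omega>)" for \<omega>
    unfolding segment_eq_seg H_def seg_truncate ..
  have Hm: "H \<in> measurable \<Omega> borel"
  proof (rule measurable_coordinatewise_then_product)
    fix l
    have "Y (of_int (int k - int l) * \<delta>) \<in> borel_measurable \<Omega>" if "l \<le> M"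
    proof -
      have "- \<tau> \<le> - (real l * \<delta>)" using grid_point[OF that] by simp
      also have "\<dots> \<le> of_int (int k - int l) * \<delta>" using delta_pos by (simp add: algebra_simps)
      finally show ?thesis using em unfolding euler_maruyama_def by blast
    qed
    then show "(\<lambda>\<omega>. H \<omega> l) \<in> borel_measurable \<Omega>" unfolding H_def by (cases "l \<le> M") simp_all
  qed
  have pm: "(\<lambda>\<omega>. (H \<omega>, X (real k * \<delta>) \<omega>)) \<in> measurable \<Omega> SX"
    by (intro measurable_Pair Hm C.X_meas t0)
  have ae: "AE \<omega> in \<Omega>. H \<omega> = driven_history em_step (grid \<xi>) (\<lambda>l. X (real l * \<delta>) \<omega>) (\<lambda>l. V l \<omega>) k"
  proof -
    have "AE \<omega> in \<Omega>. (\<forall>\<theta>\<in>{-\<tau>..0}. Y \<theta> \<omega> = \<xi> \<theta>) \<and>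
        (\<forall>t\<ge>0. Y t \<omega> = \<xi> 0
           + integral {0..t} (\<lambda>s. b (segment \<tau> \<delta> (\<lambda>r. Y r \<omega>) \<lfloor>s / \<delta>\<rfloor>) (X (of_int \<lfloor>s / \<delta>\<rfloor> * \<delta>) \<omega>))
           + step_ito_integral \<delta>
               (\<lambda>k. \<sigma> (segment \<tau> \<delta> (\<lambda>r. Y r \<omega>) k) (X (of_int k * \<delta>) \<omega>)) (\<lambda>r. W r \<omega>) t)"
      using em unfolding euler_maruyama_def by blast
    then show ?thesis
    proof eventually_elim
      case (elim \<omega>)
      show ?case unfolding H_def V_def
        by (rule em_history[where y="\<lambda>r. Y r \<omega>" and x="\<lambda>t. X t \<omega>" and w="\<lambda>r. W r \<omega>"]) (use elim in auto)
    qed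
  qed
  show ?thesis
  proof (rule measure_eqI_nn_integral)
    show "sets (distr \<Omega> SS (\<lambda>\<omega>. (segment \<tau> \<delta> (\<lambda>r. Y r \<omega>) (int k), X (real k * \<delta>) \<omega>))) = sets (path_kernel k (\<xi>, i))"
      unfolding path_kernel_def by simp
    fix f :: "(real \<Rightarrow> real ^ 'n) \<times> 's \<Rightarrow> ennreal"
    assume "f \<in> borel_measurable (distr \<Omega> SS (\<lambda>\<omega>. (segment \<tau> \<delta> (\<lambda>r. Y r \<omega>) (int k), X (real k * \<delta>) \<omega>)))"
    then have f[measurable]: "f \<in> borel_measurable SS" by simp
    have eq: "(\<lambda>\<omega>. (segment \<tau> \<delta> (\<lambda>r. Y r \<omega>) (int k), X (real k * \<delta>) \<omega>)) = (\<lambda>\<omega>. to_path (H \<omega>, X (real k * \<delta>) \<omega>))"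
      unfolding to_path_def segH by simp
    have "(\<integral>\<^sup>+y. f y \<partial>distr \<Omega> SS (\<lambda>\<omega>. to_path (H \<omega>, X (real k * \<delta>) \<omega>))) = (\<integral>\<^sup>+\<omega>. f (to_path (H \<omega>, X (real k * \<delta>) \<omega>)) \<partial>\<Omega>)"
      by (rule nn_integral_distr[OF measurable_compose[OF pm to_path_measurable]]) simp
    also have "\<dots> = (\<integral>\<^sup>+\<omega>. f (to_path (driven_history em_step (grid \<xi>) (\<lambda>l. X (real l * \<delta>) \<omega>) (\<lambda>l. V l \<omega>) k, X (real k * \<delta>) \<omega>)) \<partial>\<Omega>)"
      using ae by (intro nn_integral_cong_AE) auto
    also have "\<dots> = (avg \<Theta> F ^^ k) (\<lambda>y. f (to_path y)) (grid \<xi>, i)"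
      using D.nn_integral_driven_history[of "grid \<xi>" i "\<lambda>y. f (to_path y)" k] start by simp
    also have "\<dots> = (\<integral>\<^sup>+y. f y \<partial>path_kernel k (\<xi>, i))"
      using nn_integral_path_kernel[OF f, of "(\<xi>, i)" k] \<xi> by (simp add: space_state_space to_grid_def)
    finally show "(\<integral>\<^sup>+y. f y \<partial>distr \<Omega> SS (\<lambda>\<omega>. (segment \<tau> \<delta> (\<lambda>r. Y r \<omega>) (int k), X (real k * \<delta>) \<omega>))) = (\<integral>\<^sup>+y. f y \<partial>path_kernel k (\<xi>, i))"
      unfolding eq .
  qed
qed

end

section \<open>Exponential ergodicity of the scheme\<close>

text \<open>
  The states that can be reached from \<open>i\<close> along positive rates form a closed set, which the chain started
  from \<open>i\<close> cannot leave; since it reaches every state, this set is everything.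
\<close>

lemma irreducible_generator:
  assumes cp: "chain_process \<Omega> Q X" and start: "AE \<omega> in \<Omega>. X 0 \<omega> = i"
    and hits: "\<And>j. \<exists>t\<ge>0. \<P>(\<omega> in \<Omega>. X t \<omega> = j) > 0"
  shows "(i, j) \<in> {(i, j). i \<noteq> j \<and> 0 < Q $ i $ j}\<^sup>*"
proof (rule ccontr)
  interpret chain_process \<Omega> Q X by (rule cp)
  define R where "R = {(i, j). i \<noteq> j \<and> 0 < Q $ i $ j}"
  define A where "A = {k. (i, k) \<in> R\<^sup>*}"
  assume "(i, j) \<notin> {(i, j). i \<noteq> j \<and> 0 < Q $ i $ j}\<^sup>*"
  then have j: "j \<notin> A" unfolding A_def R_def by simp
  have i: "i \<in> A" unfolding A_def by simp
  have closed: "Q $ a $ c = 0" if "a \<in> A" "c \<notin> A" for a c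
  proof -
    have "a \<noteq> c" using that by auto
    moreover have "(a, c) \<notin> R" using that unfolding A_def by (auto intro: rtrancl_into_rtrancl)
    ultimately show ?thesis
      using generator_nonneg[OF transition_semigroup_trans, of a c] unfolding R_def by auto
  qed
  obtain t where t: "0 \<le> t" "\<P>(\<omega> in \<Omega>. X t \<omega> = j) > 0" using hits[of j] by auto
  have "\<P>(\<omega> in \<Omega>. X t \<omega> = j) = \<P>(\<omega> in \<Omega>. X (0 + t) \<omega> = j \<and> X 0 \<omega> = i)"
    using start t by (intro prob_eq_AE) auto
  also have "\<dots> = \<P>(\<omega> in \<Omega>. X 0 \<omega> = i) * trans t i j" using t by (intro prob_two) auto
  finally have "0 < \<P>(\<omega> in \<Omega>. X 0 \<omega> = i) * trans t i j" using t by simp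
  then have pos: "trans t i j \<noteq> 0" by auto
  have "t \<noteq> 0"
  proof
    assume "t = 0"
    then have "\<P>(\<omega> in \<Omega>. X t \<omega> = j) = \<P>(\<omega> in \<Omega>. False)"
      using start i j by (intro prob_eq_AE) (auto elim!: eventually_mono)
    then show False using t by simp
  qed
  then show False
    using closed_set_transition[OF transition_semigroup_trans closed _ i j, of t] t(1) pos by simp
qed

text \<open>
  This is the independence of the two coupled chains up to the time when they meet.
\<close>

lemma map_pmf_Pi_pmf_two:
  fixes pm :: "'s::finite \<Rightarrow> 'b pmf"
  assumes "i \<noteq> j"
  shows "map_pmf (\<lambda>f. (f i, f j)) (Pi_pmf UNIV d pm) = pair_pmf (pm i) (pm j)"
proof -
  have "Pi_pmf UNIV d pm = Pi_pmf (insert i (UNIV - {i})) d pm" by (simp add: insert_absorb)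
  also have "\<dots> = map_pmf (\<lambda>(y, f). f(i := y)) (pair_pmf (pm i) (Pi_pmf (UNIV - {i}) d pm))"
    by (rule Pi_pmf_insert) auto
  finally have "map_pmf (\<lambda>f. (f i, f j)) (Pi_pmf UNIV d pm)
      = map_pmf (\<lambda>(y, f). (y, f j)) (pair_pmf (pm i) (Pi_pmf (UNIV - {i}) d pm))"
    using assms by (simp add: map_pmf_comp case_prod_beta')
  also have "\<dots> = pair_pmf (pm i) (map_pmf (\<lambda>f. f j) (Pi_pmf (UNIV - {i}) d pm))"
    by (simp add: pair_map_pmf2 case_prod_beta' apsnd_def map_prod_def)
  also have "map_pmf (\<lambda>f. f j) (Pi_pmf (UNIV - {i}) d pm) = pm j"
    using assms by (simp add: Pi_pmf_component)
  finally show ?thesis .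
qed

theorem theorem1p5:
  fixes \<tau> :: real
    and \<Omega> :: "'w measure"
    and Q :: "real ^ 's::finite ^ 's"
    and \<Lambda> :: "'s \<Rightarrow> real \<Rightarrow> 'w \<Rightarrow> 's"
    and W :: "real \<Rightarrow> 'w \<Rightarrow> real ^ 'm::finite"
    and b :: "(real \<Rightarrow> real ^ 'n::finite) \<Rightarrow> 's \<Rightarrow> real ^ 'n"
    and \<sigma> :: "(real \<Rightarrow> real ^ 'n) \<Rightarrow> 's \<Rightarrow> real ^ 'm ^ 'n"
    and Y :: "real \<Rightarrow> (real \<Rightarrow> real ^ 'n) \<Rightarrow> 's \<Rightarrow> real \<Rightarrow> 'w \<Rightarrow> real ^ 'n"
    and v :: "real measure"
    and \<alpha> \<beta> :: "'s \<Rightarrow> real"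
    and L L1 :: real
  assumes tau: "\<tau> > 0"
    and card_states: "2 \<le> CARD('s)"
    and prob: "prob_space \<Omega>"
    and chain: "irreducible_chain_family \<Omega> Q \<Lambda>"
    and brownian: "brownian_motion \<Omega> W"
    and indep: "\<And>i. independent_processes \<Omega> W (\<Lambda> i)"
    and scheme: "\<And>M \<xi> i. real M > \<tau> \<Longrightarrow> \<xi> \<in> mspace (path_space \<tau>) \<Longrightarrow>
           euler_maruyama \<Omega> \<tau> (\<tau> / real M) b \<sigma> W (\<Lambda> i) \<xi> (Y (\<tau> / real M) \<xi> i)"
    and v_prob: "prob_space v"
    and v_sets: "sets v = sets (restrict_space borel {-\<tau>..0})"
    and beta_nonneg: "\<And>i. \<beta> i \<ge> 0"
    and cond_i: "\<And>i \<xi> \<eta>. \<xi> \<in> mspace (path_space \<tau>) \<Longrightarrow> \<eta> \<in> mspace (path_space \<tau>) \<Longrightarrow>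
           2 * ((\<xi> 0 - \<eta> 0) \<bullet> (b \<xi> i - b \<eta> i)) + (hs_norm (\<sigma> \<xi> i - \<sigma> \<eta> i))\<^sup>2
             \<le> \<alpha> i * (norm (\<xi> 0 - \<eta> 0))\<^sup>2 + \<beta> i * (\<integral>\<theta>. (norm (\<xi> \<theta> - \<eta> \<theta>))\<^sup>2 \<partial>v)"
    and L_pos: "L > 0"
    and cond_ii: "\<And>i \<xi> \<eta>. \<xi> \<in> mspace (path_space \<tau>) \<Longrightarrow> \<eta> \<in> mspace (path_space \<tau>) \<Longrightarrow>
           (hs_norm (\<sigma> \<xi> i - \<sigma> \<eta> i))\<^sup>2
             \<le> L * ((norm (\<xi> 0 - \<eta> 0))\<^sup>2 + (\<integral>\<theta>. (norm (\<xi> \<theta> - \<eta> \<theta>))\<^sup>2 \<partial>v))"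
    and L1_pos: "L1 > 0"
    and cond_iii: "\<And>i \<xi> \<eta>. \<xi> \<in> mspace (path_space \<tau>) \<Longrightarrow> \<eta> \<in> mspace (path_space \<tau>) \<Longrightarrow>
           (norm (b \<xi> i - b \<eta> i))\<^sup>2
             \<le> L1 * ((norm (\<xi> 0 - \<eta> 0))\<^sup>2 + (\<integral>\<theta>. (norm (\<xi> \<theta> - \<eta> \<theta>))\<^sup>2 \<partial>v))"
    and eta3_pos: "eta3 \<tau> Q \<alpha> \<beta> > 0"
  shows "\<exists>\<delta>\<^sub>0 a c. 0 < \<delta>\<^sub>0 \<and> \<delta>\<^sub>0 < 1 \<and> a > 0 \<and> c > 0 \<and>
    (\<forall>(M::nat) \<delta>. real M > \<tau> \<longrightarrow> \<delta> = \<tau> / real M \<longrightarrow> \<delta> < \<delta>\<^sub>0 \<longrightarrow>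
      (\<forall>k. \<forall>\<nu>\<^sub>1\<in>prob_measures0 \<tau>. \<forall>\<nu>\<^sub>2\<in>prob_measures0 \<tau>.
         wasserstein \<tau> (\<nu>\<^sub>1 \<bind> em_kernel \<Omega> \<tau> \<delta> (Y \<delta>) \<Lambda> k) (\<nu>\<^sub>2 \<bind> em_kernel \<Omega> \<tau> \<delta> (Y \<delta>) \<Lambda> k)
           \<le> ennreal c * (1 + first_moment \<tau> \<nu>\<^sub>1 + first_moment \<tau> \<nu>\<^sub>2) * ennreal (exp (- a * real k * \<delta>))) \<and>
      (\<exists>\<mu>\<in>prob_measures0 \<tau>.
         em_invariant \<Omega> \<tau> \<delta> (Y \<delta>) \<Lambda> \<mu> \<and>
         (\<forall>\<mu>'. em_invariant \<Omega> \<tau> \<delta> (Y \<delta>) \<Lambda> \<mu>' \<longrightarrow> \<mu>' = \<mu>) \<and>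
         (\<forall>\<xi>\<in>mspace (path_space \<tau>). \<forall>i k.
            wasserstein \<tau> (return (state_space \<tau>) (\<xi>, i) \<bind> em_kernel \<Omega> \<tau> \<delta> (Y \<delta>) \<Lambda> k)
                (\<mu> \<bind> em_kernel \<Omega> \<tau> \<delta> (Y \<delta>) \<Lambda> k)
              \<le> ennreal c * (1 + ennreal (sup_norm \<tau> \<xi>) + first_moment \<tau> \<mu>)
                  * ennreal (exp (- a * real k * \<delta>)))))"
proof -
  interpret Om: prob_space \<Omega> by (rule prob)
  have fam: "markov_chain \<Omega> Q (\<Lambda> i)" "AE \<omega> in \<Omega>. \<Lambda> i 0 \<omega> = i" "\<exists>t\<ge>0. \<P>(\<omega> in \<Omega>. \<Lambda> i t \<omega> = j) > 0" for i j
    using chain unfolding irreducible_chain_family_def by auto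
  have cp: "chain_process \<Omega> Q (\<Lambda> i)" for i
    by (intro chain_process.intro chain_process_axioms.intro prob fam)
  \<comment> \<open>By uniqueness of the semigroup, the starting state chosen here is immaterial.\<close>
  define p where "p = chain_process.trans \<Omega> (\<Lambda> undefined)"
  have p: "transition_semigroup Q p"
    unfolding p_def by (rule chain_process.transition_semigroup_trans[OF cp])
  have trans_eq: "chain_process.trans \<Omega> (\<Lambda> i) h a b = p h a b" if "0 < h" for i h a b
    by (rule transition_semigroup_unique[OF chain_process.transition_semigroup_trans[OF cp] p that])
  have conn: "(i, j) \<in> {(i, j). i \<noteq> j \<and> 0 < Q $ i $ j}\<^sup>*" for i j
    by (rule irreducible_generator[OF cp fam(2) fam(3)])
  have bm: "brownian \<Omega> W" by (intro brownian.intro brownian_axioms.intro prob brownian)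
  obtain u :: "'s \<Rightarrow> real" where u_pos: "\<And>i. 0 < u i" and
    u_eq: "\<And>i. (\<Sum>j\<in>UNIV. Q $ i $ j * u j) + (\<alpha> i + 4 * exp (- Min (range \<alpha>) * \<tau>) * \<beta> i) * u i = - 1"
  proof (rule eta3_positive_vector[OF eta3_pos generator_nonneg[OF p]])
    fix u :: "'s \<Rightarrow> real" assume "\<And>i. 0 < u i"
      "\<And>i. (\<Sum>j\<in>UNIV. Q $ i $ j * u j) + (\<alpha> i + 4 * exp (- Min (range \<alpha>) * \<tau>) * \<beta> i) * u i = - 1"
    then show thesis by (rule that)
  qed
  define ah where "ah = Min (range \<alpha>)"
  have ah_le: "ah \<le> \<alpha> i" for i unfolding ah_def by (intro Min_le) auto
  define D where "D = 4 * exp (- ah * \<tau>)"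
  have D: "0 < D" unfolding D_def by simp
  define U um where "U = Max (range u)" and "um = Min (range u)"
  have uU: "u i \<le> U" "um \<le> u i" for i unfolding U_def um_def by auto
  have um: "0 < um" unfolding um_def using u_pos by (subst Min_gr_iff) auto
  have U: "0 < U" using u_pos[of undefined] uU(1)[of undefined] by linarith
  \<comment> \<open>Where \<open>u\<close> is minimal, \<open>Q u\<close> is nonnegative, so the equation of \<open>u\<close> forces \<open>\<alpha> i + D * \<beta> i < 0\<close>.\<close>
  have ah_neg: "ah < 0"
  proof -
    have "um \<in> range u" unfolding um_def by (intro Min_in) auto
    then obtain i where i: "um = u i" by auto
    have "0 \<le> (\<Sum>j\<in>UNIV. Q $ i $ j * (u j - u i))"
    proof (rule sum_nonneg)
      fix j show "0 \<le> Q $ i $ j * (u j - u i)"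
        using generator_nonneg[OF p, of i j] uU(2)[of j] i by (cases "i = j") auto
    qed
    then have "0 \<le> (\<Sum>j\<in>UNIV. Q $ i $ j * u j)" unfolding generator_mult_diff[OF p, symmetric] .
    then have "(\<alpha> i + D * \<beta> i) * u i < 0" using u_eq[of i] unfolding D_def ah_def by linarith
    then have "\<alpha> i + D * \<beta> i < 0" using u_pos[of i] by (simp add: mult_less_0_iff)
    moreover have "0 \<le> D * \<beta> i" using D beta_nonneg by simp
    ultimately show ?thesis using ah_le[of i] by linarith
  qed
  obtain h :: "'s \<Rightarrow> 's \<Rightarrow> real" and hm k0 where h: "\<And>i. h i i = 0" "\<And>i j. i \<noteq> j \<Longrightarrow> hm \<le> h i j" "\<And>i j. 0 \<le> h i j" "\<And>i j. h i j \<le> 1" "0 < hm"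
    and k0: "0 < k0" "\<And>i j. i \<noteq> j \<Longrightarrow> (\<Sum>j'\<in>UNIV. Q $ j $ j' * h i j') + (\<Sum>i'\<in>UNIV. Q $ i $ i' * h i' j) \<le> - k0"
    by (rule meeting_function[OF p conn]) blast
  \<comment> \<open>The slack costs \<open>2 * \<epsilon> * (1 + D) * u i \<le> 1 / 2\<close>, half of the margin \<open>-1\<close> in the equation of \<open>u\<close>.\<close>
  define \<epsilon> where "\<epsilon> = 1 / (4 * ((1 + D) * U))"
  have eps: "0 < \<epsilon>" unfolding \<epsilon>_def using D U by simp
  \<comment> \<open>The three bounds serve the Lyapunov inequality, \<open>r \<le> 1 - a * \<delta>\<close>, and the meeting of the chains.\<close>
  define a where "a = Min {1 / (4 * U), - ah, k0 / 2}"
  have a: "0 < a" "a \<le> 1 / (4 * U)" "a \<le> - ah" "a \<le> k0 / 2" unfolding a_def using U ah_neg k0(1) by auto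
  define LL where "LL = 2 * (L + L1)"
  define c1 where "c1 \<delta> i = 1 + (\<alpha> i + 2 * \<epsilon>) * \<delta> + LL * \<delta>\<^sup>2" for \<delta> i
  define c2 where "c2 \<delta> i = (\<beta> i + 2 * \<epsilon>) * \<delta> + LL * \<delta>\<^sup>2" for \<delta> i
  define K where "K = 1 + 4 * LL"
  have LL: "0 < LL" unfolding LL_def using L_pos L1_pos by simp
  define \<kappa> where "\<kappa> = (\<Sum>i\<in>UNIV. (2 + 1 / \<epsilon> + L / \<epsilon>) * ((norm (b (\<lambda>\<theta>\<in>{-\<tau>..0}. 0) i))\<^sup>2 + (norm (\<sigma> (\<lambda>\<theta>\<in>{-\<tau>..0}. 0) i))\<^sup>2))"
  have kap_nn: "0 \<le> (2 + 1 / \<epsilon> + L / \<epsilon>) * ((norm (b (\<lambda>\<theta>\<in>{-\<tau>..0}. 0) i))\<^sup>2 + (norm (\<sigma> (\<lambda>\<theta>\<in>{-\<tau>..0}. 0) i))\<^sup>2)" for i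
    using eps L_pos by (intro mult_nonneg_nonneg add_nonneg_nonneg) auto
  have kap: "0 \<le> \<kappa>" unfolding \<kappa>_def by (rule sum_nonneg) (rule kap_nn)
  have kap_le: "(2 + 1 / \<epsilon> + L / \<epsilon>) * ((norm (b (\<lambda>\<theta>\<in>{-\<tau>..0}. 0) i))\<^sup>2 + (norm (\<sigma> (\<lambda>\<theta>\<in>{-\<tau>..0}. 0) i))\<^sup>2) \<le> \<kappa>" for i
    unfolding \<kappa>_def
    by (rule member_le_sum[where f="\<lambda>i. (2 + 1 / \<epsilon> + L / \<epsilon>) * ((norm (b (\<lambda>\<theta>\<in>{-\<tau>..0}. 0) i))\<^sup>2 + (norm (\<sigma> (\<lambda>\<theta>\<in>{-\<tau>..0}. 0) i))\<^sup>2)"])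
      (simp, rule kap_nn, simp)
  \<comment> \<open>The sides agree at \<open>\<delta> = 0\<close>; there the left one has derivative at most \<open>-1/2\<close>, by the equation of \<open>u\<close>, and the right one at least \<open>-1/4\<close>.\<close>
  have lyap: "eventually (\<lambda>\<delta>. (c1 \<delta> i + c2 \<delta> i * D) * (\<Sum>j\<in>UNIV. p \<delta> i j * u j) \<le> (1 - a * \<delta>) * u i) (at_right 0)" for i
  proof -
    define s where "s \<delta> = (\<Sum>j\<in>UNIV. p \<delta> i j * u j)" for \<delta>
    define g where "g = \<alpha> i + 2 * \<epsilon> + (\<beta> i + 2 * \<epsilon>) * D"
    have c: "c1 \<delta> i + c2 \<delta> i * D = 1 + g * \<delta> + LL * (1 + D) * \<delta>\<^sup>2" for \<delta>
      unfolding c1_def c2_def g_def by (simp add: algebra_simps)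
    have "((\<lambda>\<delta>. (1 + g * \<delta> + LL * (1 + D) * \<delta>\<^sup>2) * ((s \<delta> - u i) / \<delta>) + (g + LL * (1 + D) * \<delta>) * u i)
       \<longlongrightarrow> (1 + g * 0 + LL * (1 + D) * 0\<^sup>2) * (\<Sum>j\<in>UNIV. Q $ i $ j * u j) + (g + LL * (1 + D) * 0) * u i) (at_right 0)"
      unfolding s_def by (intro tendsto_intros transition_mean_deriv[OF p])
    moreover have "(1 + g * 0 + LL * (1 + D) * 0\<^sup>2) * (\<Sum>j\<in>UNIV. Q $ i $ j * u j) + (g + LL * (1 + D) * 0) * u i < - a * u i"
    proof -
      have "(\<Sum>j\<in>UNIV. Q $ i $ j * u j) + g * u i = - 1 + 2 * \<epsilon> * (1 + D) * u i"
        using u_eq[of i] unfolding g_def D_def ah_def by (simp add: algebra_simps)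
      also have "2 * \<epsilon> * (1 + D) * u i \<le> 2 * \<epsilon> * (1 + D) * U" using eps D uU by (intro mult_left_mono) auto
      also have "\<dots> = 1 / 2" 
      proof -
        have "(1 + D) * U \<noteq> 0" using D U by simp
        then have "\<epsilon> * ((1 + D) * U) = 1 / 4" unfolding \<epsilon>_def by simp
        then show ?thesis by (simp add: mult_ac)
      qed
      finally have "(\<Sum>j\<in>UNIV. Q $ i $ j * u j) + g * u i \<le> - (1 / 2)" by simp
      moreover have "a * u i \<le> 1 / (4 * U) * U" using a uU(1)[of i] u_pos[of i] by (intro mult_mono) auto
      then have "a * u i \<le> 1 / 4" using U by simp
      ultimately show ?thesis by simp
    qed
    ultimately have "eventually (\<lambda>\<delta>. (1 + g * \<delta> + LL * (1 + D) * \<delta>\<^sup>2) * ((s \<delta> - u i) / \<delta>) + (g + LL * (1 + D) * \<delta>) * u i < - a * u i) (at_right 0)"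
      by (rule order_tendstoD(2))
    then show ?thesis using eventually_at_right_less[of "0 :: real"]
    proof eventually_elim
      case (elim \<delta>)
      have "\<delta> * ((1 + g * \<delta> + LL * (1 + D) * \<delta>\<^sup>2) * ((s \<delta> - u i) / \<delta>) + (g + LL * (1 + D) * \<delta>) * u i) \<le> \<delta> * (- a * u i)"
        using elim by (intro mult_left_mono) auto
      moreover have "\<delta> * ((1 + g * \<delta> + LL * (1 + D) * \<delta>\<^sup>2) * ((s \<delta> - u i) / \<delta>) + (g + LL * (1 + D) * \<delta>) * u i)
        = (1 + g * \<delta> + LL * (1 + D) * \<delta>\<^sup>2) * s \<delta> - u i"
        using elim by (simp add: field_simps power2_eq_square)
      ultimately show ?case unfolding c s_def[symmetric] by (simp add: algebra_simps)
    qed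
  qed
  \<comment> \<open>Again by comparing derivatives, at most \<open>- k0\<close> against at least \<open>- k0 / 2\<close>.\<close>
  have meet: "eventually (\<lambda>\<delta>. i \<noteq> j \<longrightarrow> (\<Sum>i'\<in>UNIV. \<Sum>j'\<in>UNIV. p \<delta> i i' * p \<delta> j j' * h i' j') \<le> (1 - a * \<delta>) * h i j) (at_right 0)" for i j
  proof (cases "i = j")
    case False
    define s where "s \<delta> = (\<Sum>i'\<in>UNIV. \<Sum>j'\<in>UNIV. p \<delta> i i' * p \<delta> j j' * h i' j')" for \<delta>
    have "(\<Sum>j'\<in>UNIV. Q $ j $ j' * h i j') + (\<Sum>i'\<in>UNIV. Q $ i $ i' * h i' j) < - a * h i j"
    proof -
      have "a * h i j \<le> k0 / 2 * 1" using a h(3,4) k0(1) by (intro mult_mono) auto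
      then show ?thesis using k0(2)[OF False] k0(1) by simp
    qed
    then have "eventually (\<lambda>\<delta>. (s \<delta> - h i j) / \<delta> < - a * h i j) (at_right 0)"
      using order_tendstoD(2)[OF transition_pair_mean_deriv[OF p, of i j h]] unfolding s_def by blast
    then show ?thesis using eventually_at_right_less[of "0 :: real"]
    proof eventually_elim
      case (elim \<delta>)
      then have "s \<delta> - h i j \<le> - a * h i j * \<delta>" by (simp add: field_simps)
      then show ?case unfolding s_def by (simp add: algebra_simps)
    qed
  qed simp
  have "eventually (\<lambda>\<delta>. (\<forall>i. (c1 \<delta> i + c2 \<delta> i * D) * (\<Sum>j\<in>UNIV. p \<delta> i j * u j) \<le> (1 - a * \<delta>) * u i) \<and>
      (\<forall>i j. i \<noteq> j \<longrightarrow> (\<Sum>i'\<in>UNIV. \<Sum>j'\<in>UNIV. p \<delta> i i' * p \<delta> j j' * h i' j') \<le> (1 - a * \<delta>) * h i j)) (at_right 0)"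
    by (intro eventually_conj eventually_all_finite lyap meet)
  then obtain d1 where d1: "0 < d1"
    "\<And>\<delta> i. 0 < \<delta> \<Longrightarrow> \<delta> < d1 \<Longrightarrow> (c1 \<delta> i + c2 \<delta> i * D) * (\<Sum>j\<in>UNIV. p \<delta> i j * u j) \<le> (1 - a * \<delta>) * u i"
    "\<And>\<delta> i j. 0 < \<delta> \<Longrightarrow> \<delta> < d1 \<Longrightarrow> i \<noteq> j \<Longrightarrow> (\<Sum>i'\<in>UNIV. \<Sum>j'\<in>UNIV. p \<delta> i i' * p \<delta> j j' * h i' j') \<le> (1 - a * \<delta>) * h i j"
    unfolding eventually_at_right_field by auto
  \<comment> \<open>The last two bounds give \<open>- ah * \<delta> \<le> 1 / 2\<close> and \<open>2 * ah\<^sup>2 * \<tau> * \<delta> \<le> 1\<close>, whence \<open>D * r ^ M \<ge> 4 * exp (-1) \<ge> 1\<close>.\<close>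
  define d0 where "d0 = Min {d1, 1 / 2, 1 / (2 * (- ah)), 1 / (2 * ah\<^sup>2 * \<tau>)}"
  have d0: "0 < d0" "d0 < 1" "d0 \<le> d1" "d0 \<le> 1 / (2 * (- ah))" "d0 \<le> 1 / (2 * ah\<^sup>2 * \<tau>)"
  proof -
    have "0 < 1 / (2 * (- ah))" "0 < 1 / (2 * ah\<^sup>2 * \<tau>)" using ah_neg tau by simp_all
    then show "0 < d0" unfolding d0_def using d1(1) by simp
    have "d0 \<le> 1 / 2" unfolding d0_def by (intro Min_le) auto
    then show "d0 < 1" by simp
  qed (auto simp: d0_def)
  define BB where "BB = moment_const D (D * U / um) a K \<tau> * (1 + 4 * \<kappa>)"
  define c where "c = coupling_const BB hm a"
  have BB: "0 \<le> BB"
    unfolding BB_def moment_const_def K_def using D U um a LL tau kap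
    by (intro mult_nonneg_nonneg add_nonneg_nonneg divide_nonneg_nonneg) auto
  have c: "0 < c"
    unfolding c_def coupling_const_def using BB h(5)
    by (intro mult_pos_pos add_nonneg_pos add_nonneg_nonneg mult_nonneg_nonneg) auto
  have main: "(\<forall>k. \<forall>\<nu>\<^sub>1\<in>prob_measures0 \<tau>. \<forall>\<nu>\<^sub>2\<in>prob_measures0 \<tau>.
         wasserstein \<tau> (\<nu>\<^sub>1 \<bind> em_kernel \<Omega> \<tau> \<delta> (Y \<delta>) \<Lambda> k) (\<nu>\<^sub>2 \<bind> em_kernel \<Omega> \<tau> \<delta> (Y \<delta>) \<Lambda> k)
           \<le> ennreal c * (1 + first_moment \<tau> \<nu>\<^sub>1 + first_moment \<tau> \<nu>\<^sub>2) * ennreal (exp (- (a / 4) * real k * \<delta>))) \<and>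
      (\<exists>\<mu>\<in>prob_measures0 \<tau>.
         em_invariant \<Omega> \<tau> \<delta> (Y \<delta>) \<Lambda> \<mu> \<and>
         (\<forall>\<mu>'. em_invariant \<Omega> \<tau> \<delta> (Y \<delta>) \<Lambda> \<mu>' \<longrightarrow> \<mu>' = \<mu>) \<and>
         (\<forall>\<xi>\<in>mspace (path_space \<tau>). \<forall>i k.
            wasserstein \<tau> (return (state_space \<tau>) (\<xi>, i) \<bind> em_kernel \<Omega> \<tau> \<delta> (Y \<delta>) \<Lambda> k)
                (\<mu> \<bind> em_kernel \<Omega> \<tau> \<delta> (Y \<delta>) \<Lambda> k)
              \<le> ennreal c * (1 + ennreal (sup_norm \<tau> \<xi>) + first_moment \<tau> \<mu>)
                  * ennreal (exp (- (a / 4) * real k * \<delta>))))"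
    if M: "real M > \<tau>" and delta: "\<delta> = \<tau> / real M" and small: "\<delta> < d0" for M :: nat and \<delta> :: real
  proof -
    have Mpos: "0 < M" using M tau by (metis less_trans of_nat_0_less_iff)
    have dpos: "0 < \<delta>" using delta tau Mpos by simp
    have Md: "real M * \<delta> = \<tau>" using delta Mpos by simp
    define pm where "pm i = embed_pmf (p \<delta> i)" for i
    have pm: "pmf (pm i) j = p \<delta> i j" for i j
      unfolding pm_def
    proof (rule pmf_embed_pmf)
      show "0 \<le> p \<delta> i j" for j by (rule transition_nonneg[OF p dpos])
      then show "(\<integral>\<^sup>+ j. ennreal (p \<delta> i j) \<partial>count_space UNIV) = 1"
        using transition_sum[OF p dpos, of i] by (simp add: nn_integral_count_space_finite sum_ennreal)
    qed
    define \<Phi> where "\<Phi> = Pi_pmf UNIV undefined pm"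
    have \<Phi>_one: "map_pmf (\<lambda>f. f i) \<Phi> = pm i" for i unfolding \<Phi>_def by (simp add: Pi_pmf_component)
    have \<Phi>_two: "map_pmf (\<lambda>f. (f i, f j)) \<Phi> = pair_pmf (pm i) (pm j)" if "i \<noteq> j" for i j
      unfolding \<Phi>_def by (rule map_pmf_Pi_pmf_two[OF that])
    define r where "r = 1 + ah * \<delta>"
    have x: "0 \<le> - ah * \<delta>" "- ah * \<delta> \<le> 1 / 2"
    proof -
      have "\<delta> < 1 / (2 * (- ah))" using small d0(4) by linarith
      then show "- ah * \<delta> \<le> 1 / 2" using ah_neg by (simp add: field_simps)
    qed (use ah_neg dpos in \<open>simp add: mult_nonpos_nonneg\<close>)
    have r: "0 < r" "r \<le> 1" using x unfolding r_def by auto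
    have rM: "1 \<le> D * r ^ M"
    proof -
      have "exp (- (real M * (- ah * \<delta>)) - 2 * real M * (- ah * \<delta>)\<^sup>2) \<le> (1 - (- ah * \<delta>)) ^ M"
        by (rule one_minus_power_lower[OF x])
      moreover have "- (real M * (- ah * \<delta>)) - 2 * real M * (- ah * \<delta>)\<^sup>2 = ah * (real M * \<delta>) - 2 * ah\<^sup>2 * (real M * \<delta>) * \<delta>"
        by (simp add: power2_eq_square)
      ultimately have "exp (ah * \<tau> - 2 * ah\<^sup>2 * \<tau> * \<delta>) \<le> r ^ M" unfolding Md r_def by simp
      then have "D * exp (ah * \<tau> - 2 * ah\<^sup>2 * \<tau> * \<delta>) \<le> D * r ^ M" using D by (intro mult_left_mono) auto
      moreover have "D * exp (ah * \<tau> - 2 * ah\<^sup>2 * \<tau> * \<delta>) = 4 * exp (- (2 * ah\<^sup>2 * \<tau> * \<delta>))"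
        unfolding D_def by (simp add: exp_diff exp_minus field_simps)
      moreover have "1 \<le> 4 * exp (- (2 * ah\<^sup>2 * \<tau> * \<delta>))"
      proof -
        have "\<delta> < 1 / (2 * ah\<^sup>2 * \<tau>)" using small d0(5) by linarith
        then have "2 * ah\<^sup>2 * \<tau> * \<delta> \<le> 1" using ah_neg tau by (simp add: field_simps)
        then have "exp (- 1) \<le> exp (- (2 * ah\<^sup>2 * \<tau> * \<delta>))" by simp
        moreover have "1 \<le> 4 * exp (- (1::real))" using exp_le by (simp add: exp_minus field_simps)
        ultimately show ?thesis by linarith
      qed
      ultimately show ?thesis by linarith
    qed
    have c1r: "r \<le> c1 \<delta> i" for i
    proof -
      have "ah * \<delta> \<le> (\<alpha> i + 2 * \<epsilon>) * \<delta>" using ah_le[of i] eps dpos by (intro mult_right_mono) auto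
      moreover have "0 \<le> LL * \<delta>\<^sup>2" using LL by simp
      ultimately show ?thesis unfolding r_def c1_def by linarith
    qed
    have c2n: "0 \<le> c2 \<delta> i" for i unfolding c2_def using beta_nonneg[of i] eps dpos LL by simp
    define N where "N = increment_law \<Omega> W \<delta>"
    interpret N: gaussian_increment N \<delta> unfolding N_def by (rule brownian.gaussian_increment_law[OF bm dpos])
    interpret em_contraction \<tau> \<delta> M v N b \<sigma> \<alpha> \<beta> L L1 \<Phi> u um U a D r \<epsilon> \<kappa> h hm "c1 \<delta>" "c2 \<delta>" K
    proof (intro em_contraction.intro em_maps.intro em_maps_axioms.intro em_contraction_axioms.intro)
      show "time_grid \<tau> \<delta> M v" by (intro time_grid.intro tau Mpos delta v_prob v_sets)
      show "gaussian_increment N \<delta>" by (rule N.gaussian_increment_axioms)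
      show "c1 \<delta> i = 1 + (\<alpha> i + 2 * \<epsilon>) * \<delta> + 2 * (L + L1) * \<delta>\<^sup>2" for i unfolding c1_def LL_def ..
      show "c2 \<delta> i = (\<beta> i + 2 * \<epsilon>) * \<delta> + 2 * (L + L1) * \<delta>\<^sup>2" for i unfolding c2_def LL_def ..
      show "K = 1 + 4 * (2 * (L + L1))" unfolding K_def LL_def ..
      show "0 \<le> c1 \<delta> i" for i using c1r[of i] r by linarith
      show "r \<le> c1 \<delta> i + c2 \<delta> i * D" for i using c1r[of i] mult_nonneg_nonneg[OF c2n[of i] less_imp_le[OF D]] by linarith
      show "r \<le> 1 - a * \<delta>"
      proof -
        have "a * \<delta> \<le> - ah * \<delta>" using a(3) dpos by (intro mult_right_mono) auto
        then show ?thesis unfolding r_def by simp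
      qed
      show "(c1 \<delta> i + c2 \<delta> i * D) * (\<Sum>j\<in>UNIV. pmf (map_pmf (\<lambda>f. f i) \<Phi>) j * u j) \<le> (1 - a * \<delta>) * u i" for i
        unfolding \<Phi>_one pm using dpos small d0(3) by (intro d1(2)) auto
      show "(\<integral>\<^sup>+f. ennreal (h (f i) (f j)) \<partial>measure_pmf \<Phi>) \<le> ennreal ((1 - a * \<delta>) * h i j)" for i j
      proof (cases "i = j")
        case False
        have "(\<integral>\<^sup>+f. ennreal (h (f i) (f j)) \<partial>measure_pmf \<Phi>) = (\<integral>\<^sup>+z. ennreal (h (fst z) (snd z)) \<partial>measure_pmf (map_pmf (\<lambda>f. (f i, f j)) \<Phi>))"
          by simp
        also have "\<dots> = (\<integral>\<^sup>+i'. \<integral>\<^sup>+j'. ennreal (h i' j') \<partial>measure_pmf (pm j) \<partial>measure_pmf (pm i))"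
          unfolding \<Phi>_two[OF False] by (simp add: nn_integral_pair_pmf')
        also have "\<dots> = (\<Sum>i'\<in>UNIV. (\<Sum>j'\<in>UNIV. ennreal (h i' j') * ennreal (p \<delta> j j')) * ennreal (p \<delta> i i'))"
        proof -
          have "(\<integral>\<^sup>+j'. ennreal (h i' j') \<partial>measure_pmf (pm j)) = (\<Sum>j'\<in>UNIV. ennreal (h i' j') * ennreal (p \<delta> j j'))" for i'
            by (subst nn_integral_measure_pmf_support[of UNIV]) (auto simp: pm)
          then show ?thesis by (subst nn_integral_measure_pmf_support[of UNIV]) (auto simp: pm)
        qed
        also have "\<dots> = ennreal (\<Sum>i'\<in>UNIV. \<Sum>j'\<in>UNIV. p \<delta> i i' * p \<delta> j j' * h i' j')"
        proof -
          have nn: "0 \<le> p \<delta> i i'" "0 \<le> h i' j'" for i i' j' using transition_nonneg[OF p dpos] h(3) by auto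
          have "(\<Sum>j'\<in>UNIV. ennreal (h i' j') * ennreal (p \<delta> j j')) * ennreal (p \<delta> i i') = ennreal (\<Sum>j'\<in>UNIV. p \<delta> i i' * p \<delta> j j' * h i' j')" for i'
          proof -
            have "(\<Sum>j'\<in>UNIV. ennreal (h i' j') * ennreal (p \<delta> j j')) * ennreal (p \<delta> i i') = (\<Sum>j'\<in>UNIV. ennreal (p \<delta> i i' * p \<delta> j j' * h i' j'))"
              unfolding sum_distrib_right by (intro sum.cong refl) (simp add: nn ennreal_mult mult_ac)
            then show ?thesis using nn by (simp add: sum_ennreal)
          qed
          then show ?thesis using nn by (simp add: sum_nonneg sum_ennreal)
        qed
        also have "\<dots> \<le> ennreal ((1 - a * \<delta>) * h i j)"
          using dpos small d0(3) False by (intro ennreal_leI d1(3)) auto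
        finally show ?thesis .
      qed (simp add: h)
      show "\<delta> \<le> 1" using small d0(2) by linarith
    qed (fact beta_nonneg cond_i L_pos cond_ii L1_pos cond_iii eps r rM uU um a(1) kap kap_le h)+
    have cc_eq: "cc = c" unfolding cc_def c_def BB_def Bq_def M1_def ..
    have kernel: "em_kernel \<Omega> \<tau> \<delta> (Y \<delta>) \<Lambda> k x = path_kernel k x" if x: "x \<in> space (state_space \<tau>)" for k x
    proof -
      have xi: "fst x \<in> mspace (path_space \<tau>)" using x by (auto simp: space_state_space)
      show ?thesis
        unfolding em_kernel_def
        using em_kernel_eq_path_kernel[OF bm N_def cp[of "snd x"] fam(2) _ indep _ xi, where Y="Y \<delta> (fst x) (snd x)" and k=k]
          scheme[OF M xi, of "snd x"] trans_eq[OF dpos] unfolding delta[symmetric] \<Phi>_one pm by simp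
    qed
    have bind_eq: "\<nu> \<bind> em_kernel \<Omega> \<tau> \<delta> (Y \<delta>) \<Lambda> k = \<nu> \<bind> path_kernel k" if "\<nu> \<in> prob_measures \<tau>" for \<nu> k
    proof (rule bind_cong[OF refl])
      fix x assume "x \<in> space \<nu>"
      moreover have "space \<nu> = space (state_space \<tau>)"
        using that sets_eq_imp_space_eq unfolding prob_measures_def by blast
      ultimately show "em_kernel \<Omega> \<tau> \<delta> (Y \<delta>) \<Lambda> k x = path_kernel k x" by (intro kernel) simp
    qed
    have sub: "\<nu> \<in> prob_measures \<tau>" if "\<nu> \<in> prob_measures0 \<tau>" for \<nu> :: "((real \<Rightarrow> real ^ 'n) \<times> 's) measure"
      using that unfolding prob_measures0_def by simp
    have wass: "wasserstein \<tau> (\<nu>\<^sub>1 \<bind> em_kernel \<Omega> \<tau> \<delta> (Y \<delta>) \<Lambda> k) (\<nu>\<^sub>2 \<bind> em_kernel \<Omega> \<tau> \<delta> (Y \<delta>) \<Lambda> k)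
           \<le> ennreal c * (1 + first_moment \<tau> \<nu>\<^sub>1 + first_moment \<tau> \<nu>\<^sub>2) * ennreal (exp (- (a / 4) * real k * \<delta>))"
      if "\<nu>\<^sub>1 \<in> prob_measures \<tau>" "\<nu>\<^sub>2 \<in> prob_measures \<tau>" for \<nu>\<^sub>1 \<nu>\<^sub>2 k
      using wasserstein_path_kernel[OF that, of k] unfolding bind_eq[OF that(1)] bind_eq[OF that(2)] cc_eq rate_def .
    have inv_iff: "em_invariant \<Omega> \<tau> \<delta> (Y \<delta>) \<Lambda> \<mu> \<longleftrightarrow> \<mu> \<in> prob_measures \<tau> \<and> (\<forall>k. \<mu> \<bind> path_kernel k = \<mu>)" for \<mu>
      unfolding em_invariant_def using bind_eq by auto
    show ?thesis
    proof (intro conjI allI ballI bexI[of _ path_law] impI)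
      show "em_invariant \<Omega> \<tau> \<delta> (Y \<delta>) \<Lambda> path_law"
        unfolding inv_iff using path_law_prob path_law_invariant by simp
      show "\<mu>' = path_law" if "em_invariant \<Omega> \<tau> \<delta> (Y \<delta>) \<Lambda> \<mu>'" for \<mu>'
        using that unfolding inv_iff by (intro path_law_unique) auto
      fix \<xi> :: "real \<Rightarrow> real ^ 'n" and i :: 's and k
      assume xi: "\<xi> \<in> mspace (path_space \<tau>)"
      let ?\<nu> = "return (state_space \<tau>) (\<xi>, i)"
      have sp: "(\<xi>, i) \<in> space (state_space \<tau>)" using xi by (simp add: space_state_space)
      have nu: "?\<nu> \<in> prob_measures \<tau>" unfolding prob_measures_def using prob_space_return[OF sp] by simp
      have "first_moment \<tau> ?\<nu> = ennreal (sup_norm \<tau> \<xi>)"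
      proof -
        have tau0: "0 \<le> \<tau>" using tau by simp
        have [measurable]: "(\<lambda>x. ennreal (sup_norm \<tau> (fst x))) \<in> borel_measurable (state_space \<tau> :: ((real \<Rightarrow> real ^ 'n) \<times> 's) measure)"
          unfolding state_space_def using sup_norm_measurable[OF tau0] by measurable
        show ?thesis using sp by (subst first_moment_eq[OF tau0]) (auto simp: nn_integral_return)
      qed
      then show "wasserstein \<tau> (?\<nu> \<bind> em_kernel \<Omega> \<tau> \<delta> (Y \<delta>) \<Lambda> k) (path_law \<bind> em_kernel \<Omega> \<tau> \<delta> (Y \<delta>) \<Lambda> k)
              \<le> ennreal c * (1 + ennreal (sup_norm \<tau> \<xi>) + first_moment \<tau> path_law) * ennreal (exp (- (a / 4) * real k * \<delta>))"
        using wass[OF nu path_law_prob, of k] by simp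
    next
      fix k and \<nu>\<^sub>1 \<nu>\<^sub>2 :: "((real \<Rightarrow> real ^ 'n) \<times> 's) measure"
      assume "\<nu>\<^sub>1 \<in> prob_measures0 \<tau>" "\<nu>\<^sub>2 \<in> prob_measures0 \<tau>"
      then show "wasserstein \<tau> (\<nu>\<^sub>1 \<bind> em_kernel \<Omega> \<tau> \<delta> (Y \<delta>) \<Lambda> k) (\<nu>\<^sub>2 \<bind> em_kernel \<Omega> \<tau> \<delta> (Y \<delta>) \<Lambda> k)
           \<le> ennreal c * (1 + first_moment \<tau> \<nu>\<^sub>1 + first_moment \<tau> \<nu>\<^sub>2) * ennreal (exp (- (a / 4) * real k * \<delta>))"
        by (intro wass sub)
    qed (rule path_law_prob0)
  qed
  show ?thesis
  proof (rule exI[of _ d0], rule exI[of _ "a / 4"], rule exI[of _ c], intro conjI)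
    show "0 < d0" "d0 < 1" "0 < c" by (fact d0(1) d0(2) c)+
    show "0 < a / 4" using a(1) by simp
  qed (intro allI impI, rule main)
qed

end
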